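(* Let $q\ge2$, $d\ge2$, $1\le z\le q-1$ be integers with $\gcd(q,z)=1$. Put $n=qd$ and $s=qd-z$, let $p\in\{1,\dots,q-1\}$ be the unique residue with $pz\equiv 1\pmod q$, and let $r=(ps+1)/q$ (an integer). Then every point of the open order-$n$ arc lies outside $\Theta_{n-1}$: $$K_n(\{q,s\})\subseteq\mathbb C\setminus\Theta_{n-1}.$$ Consequently, for every $0<\alpha<1$, the Karpelevich--Ito boundary root $\lambda_\alpha$ of $$(x^q-(1-\alpha))^d-\alpha^d x^z$$ on this open arc satisfies $\lambda_\alpha\in K_n(\{q,s\})\setminus\Theta_{n-1}$.
   Context: A stochastic matrix is a real nonnegative square matrix all of whose row sums equal $1$. $\Theta_N\subseteq\mathbb C$ denotes the set of all complex numbers that occur as eigenvalues of $N\times N$ stochastic matrices (the Karpelevich region). With $p,q,r,s,n$ as in the claim one has $rq-ps=1$, and $p/q<r/s$ are consecutive (neighbours) in the Farey sequences of both orders $n-1$ and $n$ (the Farey sequence of order $N$ being the increasing sequence of reduced fractions in $[0,1]$ with denominator at most $N$). For an order $N$ for which $p/q<r/s$ is a Farey-neighbour pair, $K_N(\{q,s\})$ denotes the open Karpelevich boundary arc of $\Theta_N$ attached to this pair, i.e. the part of the boundary of $\Theta_N$ in the open sector of arguments $\theta$ with $2\pi p/q<\theta<2\pi r/s$ (the endpoints $e^{2\pi i p/q}$ and $e^{2\pi i r/s}$ are excluded). By the Karpelevich--Ito theorem, the order-$n$ arc is parametrised by $\alpha\in(0,1)$ via nonzero solutions $t$ of $t^s(t^q-(1-\alpha))^d=\alpha^d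 t^{qd}$, equivalently (as $s=qd-z$) of $(t^q-(1-\alpha))^d-\alpha^d t^z=0$. For each $0<\alpha<1$, the Karpelevich--Ito boundary root $\lambda_\alpha$ is the nonzero root of this polynomial lying on the open arc $K_n(\{q,s\})$ furnished by this parametrisation. *)

theory Defs
  imports
    "HOL-Analysis.Complex_Transcendental"
    "HOL-Number_Theory.Cong"
    "Jordan_Normal_Form.Char_Poly"
begin

definition stochastic_mat :: "nat \<Rightarrow> real mat \<Rightarrow> bool" where
  "stochastic_mat N A \<longleftrightarrow>
     A \<in> carrier_mat N N \<and>
     (\<forall>i<N. \<forall>j<N. 0 \<le> A $$ (i, j)) \<and>
     (\<forall>i<N. (\<Sum>j<N. A $$ (i, j)) = 1)"

definition karpelevich_region :: "nat \<Rightarrow> complex set" where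
  "karpelevich_region N =
     {x. \<exists>A. stochastic_mat N A \<and> eigenvalue (map_mat complex_of_real A) x}"

text \<open>
  The open Karpelevich arc of order \<open>N\<close> attached to a pair \<open>p/q < r/s\<close> of neighbours in the
  Farey sequence of order \<open>N\<close>. The numerators are explicit arguments because the denominators
  \<open>{q, s}\<close> alone determine the pair only up to \<open>p/q \<mapsto> 1 - p/q\<close>, \<open>r/s \<mapsto> 1 - r/s\<close>. The function
  \<open>Arg2pi\<close> takes values in \<open>[0, 2\<pi>)\<close>, which is the right branch because \<open>0 \<le> p/q < r/s \<le> 1\<close>.
\<close>

definition karpelevich_arc :: "nat \<Rightarrow> nat \<Rightarrow> nat \<Rightarrow> nat \<Rightarrow> nat \<Rightarrow> complex set" where
  "karpelevich_arc N p q r s =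
     {x \<in> frontier (karpelevich_region N). x \<noteq> 0 \<and>
        2 * pi * real p / real q < Arg2pi x \<and> Arg2pi x < 2 * pi * real r / real s}"

text \<open>
  The boundary root \<open>\<lambda>\<^sub>\<alpha>\<close>, for the order \<open>n = q d\<close> and \<open>s = q d - z\<close>. Any claim about this
  description carries the content that exactly one nonzero root lies on the arc, which is part of
  the Karpelevich--Ito parametrisation.
\<close>

definition karpelevich_ito_root ::
    "nat \<Rightarrow> nat \<Rightarrow> nat \<Rightarrow> nat \<Rightarrow> nat \<Rightarrow> real \<Rightarrow> complex" where
  "karpelevich_ito_root p q r d z \<alpha> =
     (THE x. x \<noteq> 0 \<and>
        (x ^ q - (1 - complex_of_real \<alpha>)) ^ d - complex_of_real \<alpha> ^ d * x ^ z = 0 \<and>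
        x \<in> karpelevich_arc (q * d) p q r (q * d - z))"

end

theory Submission
  imports Defs
begin

text \<open>
  Put \<open>\<lambda> = exp (- L) cis \<theta>\<close>, \<open>x = q \<theta> - 2 \<pi> p\<close>, \<open>y = (2 \<pi> r - s \<theta>) / d\<close>, \<open>\<sigma> = d p\<close>.

  A point \<open>\<lambda>\<close> of \<open>\<Theta>\<^sub>M\<close> maps a convex polygon with \<open>M\<close> vertices into itself. For \<open>M = n\<close> the angles \<open>\<phi> j\<close> of the
  vertices can be moved until \<open>\<phi> (j + \<sigma>) \<le> \<phi> j + \<theta> \<le> \<phi> (j + \<sigma> + 1)\<close>, and a Perron argument then turns the gauge of
  the polygon into an eigenvector of a cyclic matrix with two nonzero diagonals. Along the index \<open>i + \<sigma> t\<close> the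
  vertices form levels on which log gauge plus \<open>T\<close> times angle climbs from level to level, on average over a
  random phase, by at most \<open>saw_H T N\<close>, where \<open>cos (N + x) = exp (- q L) cos N\<close>. A climb through \<open>d\<close> levels returns to the start up to a known shift, which
  gives \<open>T d y - s L \<le> d saw_H T N\<close>. For the best \<open>T\<close> this is the side \<open>karp_g \<le> 0\<close> of the Karpelevich--Ito
  curve; Ito's matrices attain the curve.

  If a point of the curve had a polygon with \<open>n - 1\<close> vertices, an \<open>n\<close>-th vertex could be inserted at an arbitrary
  angle. Equality in all estimates makes the gauge at this angle the value of a sinusoid with only countably many
  possibilities, attached to a vertex beyond the next old one. Two nearby angles share the sinusoid, so the gauge
  has no kink at that old vertex; hence it has no kink at all, is linear, and takes negative values.
\<close>

subsection \<open>Chains of slopes\<close>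

text \<open>Three constraints shape the argument. The comparison of chains is available only for
  slopes \<open>T \<le> sqrt 3\<close>; because \<open>s \<ge> 3\<close> forces
  \<open>x + y < 2 * pi / 3\<close>, the optimal slope stays in this range. The Perron argument
  needs two positive weights in every row, while moved marks satisfy only weak inequalities. They
  are therefore mixed with equally spaced marks, and the curve is reached as a limit. Equality
  information does not survive such a limit, so rigidity is proved at the unperturbed marks: the
  limit leaves the upper inequality strict, and a supersolution that is strict in one row would
  yield one strict in all rows, hence a polygon for a point beyond the curve. Finally,
  \<open>d \<ge> 2\<close> enters twice: the climb at one level involves the phases of two different
  levels, which must be independent, and the inserted mark and the old mark that determines its
  gauge must have indices in different classes modulo \<open>d\<close>.\<close>

lemma sum_periodic_int:
  fixes f :: "int \<Rightarrow> real" and q :: nat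
  assumes "\<And>e. f (e + int q) = f e"
  shows "(\<Sum>e\<in>{t..<t + int q}. f e) = (\<Sum>e\<in>{0..<int q}. f e)"
proof -
  have step: "(\<Sum>e\<in>{t..<t + int q}. f e) = (\<Sum>e\<in>{t+1..<t+1 + int q}. f e)" for t
  proof (cases "q = 0")
    case False
    have "{t..<t + int q} = insert t {t+1..<t + int q}" using False by auto
    moreover have "{t+1..<t+1 + int q} = insert (t + int q) {t+1..<t + int q}" using False by auto
    ultimately show ?thesis using assms[of t] by simp
  qed auto
  have up: "(\<Sum>e\<in>{t..<t + int q}. f e) = (\<Sum>e\<in>{t + int k..<t + int k + int q}. f e)" for t and k :: nat
  proof (induction k)
    case (Suc k)
    then show ?case using step[of "t + int k"] by (simp add: algebra_simps)
  qed auto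
  show ?thesis
  proof (cases "t \<ge> 0")
    case True
    then show ?thesis using up[of 0 "nat t"] by simp
  next
    case False
    then show ?thesis using up[of t "nat (- t)"] by simp
  qed
qed

lemma sum_int_window_nat:
  fixes f :: "int \<Rightarrow> real"
  shows "(\<Sum>e\<in>{t..<t + int q}. f e) = (\<Sum>e<q. f (t + int e))"
proof -
  have "{t..<t + int q} = (\<lambda>e. t + int e) ` {..<q}"
  proof -
    have "x \<in> (\<lambda>e. t + int e) ` {..<q}" if "x \<in> {t..<t + int q}" for x
      using that by (intro image_eqI[where x="nat (x - t)"]) auto
    then show ?thesis by auto
  qed
  then show ?thesis by (simp add: sum.reindex inj_on_def)
qed

text \<open>Up to \<open>k\<close> the sum telescopes once each \<open>F (u e)\<close> is replaced
  by the larger \<open>F (l (Suc e))\<close>; the terms beyond \<open>k\<close> are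
  nonpositive.\<close>

lemma saw_chain:
  fixes l u :: "nat \<Rightarrow> real"
  assumes lu: "\<And>e. e < q \<Longrightarrow> l e \<le> u e" and ul: "\<And>e. Suc e < q \<Longrightarrow> l (Suc e) \<le> u e"
    and mem: "\<And>e. e < q \<Longrightarrow> l e \<in> A \<and> u e \<in> A"
    and F: "\<And>v w. v \<in> A \<Longrightarrow> w \<in> A \<Longrightarrow> v \<le> w \<Longrightarrow> F w \<le> F v"
    and k: "k < q"
  shows "(\<Sum>e<q. F (u e) - F (l e)) \<le> (F (u k) - F (l 0) :: real)"
proof -
  have le: "F (u e) - F (l e) \<le> 0" if "e < q" for e using F[of "l e" "u e"] mem[OF that] lu[OF that] by simp
  have 1: "j < q \<Longrightarrow> (\<Sum>e<Suc j. F (u e) - F (l e)) \<le> F (u j) - F (l 0)" for j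
  proof (induction j)
    case (Suc j)
    then have "(\<Sum>e<Suc j. F (u e) - F (l e)) \<le> F (u j) - F (l 0)" by auto
    moreover have "F (u j) \<le> F (l (Suc j))" using F[of "l (Suc j)" "u j"] mem[of j] mem[of "Suc j"] ul[of j] Suc.prems by auto
    ultimately show ?case by simp
  qed auto
  have "(\<Sum>e<q. F (u e) - F (l e)) = (\<Sum>e<Suc k. F (u e) - F (l e)) + (\<Sum>e\<in>{Suc k..<q}. F (u e) - F (l e))"
    using k sum.atLeastLessThan_concat[of 0 "Suc k" q "\<lambda>e. F (u e) - F (l e)"] by (simp add: atLeast0LessThan)
  moreover have "(\<Sum>e\<in>{Suc k..<q}. F (u e) - F (l e)) \<le> 0" by (rule sum_nonpos) (use le in auto)
  ultimately show ?thesis using 1[OF k] by linarith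
qed

text \<open>The constant makes the minimum, attained at \<open>- arctan T\<close>, equal to \<open>0\<close>.\<close>

definition saw_H :: "real \<Rightarrow> real \<Rightarrow> real" where
  "saw_H T s = - ln (cos s) + T * s + (ln (cos (arctan T)) + T * arctan T)"

lemma saw_H_deriv:
  assumes "\<bar>s\<bar> < pi / 2"
  shows "(saw_H T has_real_derivative tan s + T) (at s)"
proof -
  have "cos s > 0" using assms by (intro cos_gt_zero_pi) auto
  then show ?thesis unfolding saw_H_def[abs_def]
    by (auto intro!: derivative_eq_intros simp: tan_def field_simps)
qed

lemma tan_mono_abs: "\<bar>s\<bar> < pi / 2 \<Longrightarrow> \<bar>t\<bar> < pi / 2 \<Longrightarrow> s < t \<Longrightarrow> tan s < tan t"
  by (rule tan_monotone) auto

lemma saw_H_tangent: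
  assumes "\<bar>s\<bar> < pi / 2" "\<bar>t\<bar> < pi / 2"
  shows "saw_H T t \<ge> saw_H T s + (tan s + T) * (t - s)"
proof (cases s t rule: linorder_cases)
  case less
  obtain w where w: "s < w" "w < t" "saw_H T t - saw_H T s = (t - s) * (tan w + T)"
    using MVT2[OF less, of "saw_H T" "\<lambda>s. tan s + T"] saw_H_deriv assms by (smt (verit))
  then have "tan s < tan w" using assms by (intro tan_mono_abs) auto
  then have "(t - s) * (tan s + T) \<le> (t - s) * (tan w + T)" using less by (intro mult_left_mono) auto
  then show ?thesis using w by (simp add: algebra_simps)
next
  case greater
  obtain w where w: "t < w" "w < s" "saw_H T s - saw_H T t = (s - t) * (tan w + T)"
    using MVT2[OF greater, of "saw_H T" "\<lambda>s. tan s + T"] saw_H_deriv assms by (smt (verit))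
  then have "tan w < tan s" using assms by (intro tan_mono_abs) auto
  then have "(s - t) * (tan w + T) \<le> (s - t) * (tan s + T)" using greater by (intro mult_left_mono) auto
  then show ?thesis using w by (simp add: algebra_simps)
qed auto

lemma saw_H_at_min: "saw_H T (- arctan T) = 0" by (simp add: saw_H_def)

lemma saw_H_nonneg:
  assumes "\<bar>w\<bar> < pi / 2"
  shows "0 \<le> saw_H T w"
proof -
  have "\<bar>- arctan T\<bar> < pi / 2" using arctan_bounded[of T] by linarith
  then show ?thesis using saw_H_tangent[of "- arctan T" w T] assms by (simp add: saw_H_at_min tan_arctan)
qed

lemma saw_H_zero:
  assumes "\<bar>w\<bar> < pi / 2" "saw_H T w = 0"
  shows "w = - arctan T"
proof (rule ccontr)
  assume ne: "w \<noteq> - arctan T"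
  have b: "\<bar>- arctan T\<bar> < pi / 2" using arctan_bounded[of T] by linarith
  define v where "v = (w - arctan T) / 2"
  have v2: "2 * v = w + - arctan T" by (simp add: v_def)
  have v: "\<bar>v\<bar> < pi / 2" using b assms(1) v2 by linarith
  have "saw_H T w \<ge> saw_H T v + (tan v + T) * (w - v)" by (rule saw_H_tangent[OF v assms(1)])
  moreover have "0 < (tan v + T) * (w - v)"
  proof (cases "w < - arctan T")
    case True
    then have "tan v < tan (- arctan T)" using v b by (intro tan_mono_abs) (auto simp: v_def field_simps)
    then have "tan v + T < 0" by (simp add: tan_arctan)
    moreover have "w - v < 0" using True by (simp add: v_def field_simps)
    ultimately show ?thesis by (rule mult_neg_neg)
  next
    case False
    then have "tan (- arctan T) < tan v" using v b ne by (intro tan_mono_abs) (auto simp: v_def field_simps)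
    then have "0 < tan v + T" by (simp add: tan_arctan)
    moreover have "0 < w - v" using False ne by (simp add: v_def field_simps)
    ultimately show ?thesis by simp
  qed
  ultimately show False using saw_H_nonneg[OF v, of T] assms(2) by linarith
qed

lemma saw_H_increment:
  assumes "\<bar>s\<bar> < pi / 2" "\<bar>t\<bar> < pi / 2" "s < t" "\<bar>s + x\<bar> < pi / 2" "\<bar>t + x\<bar> < pi / 2" "0 < x"
  shows "saw_H T (s + x) - saw_H T s < saw_H T (t + x) - saw_H T t"
proof -
  have "\<exists>w. s < w \<and> w < t \<and> (saw_H T (t + x) - saw_H T t) - (saw_H T (s + x) - saw_H T s)
     = (t - s) * ((tan (w + x) + T) - (tan w + T))"
  proof (rule MVT2[OF assms(3), of "\<lambda>w. saw_H T (w + x) - saw_H T w"])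
    fix w assume w: "s \<le> w" "w \<le> t"
    have 1: "\<bar>w + x\<bar> < pi / 2" "\<bar>w\<bar> < pi/2" using w assms by linarith+
    have "((\<lambda>w. saw_H T (w + x)) has_real_derivative (tan (w + x) + T)) (at w)"
      using saw_H_deriv[OF 1(1), of T] DERIV_shift by blast
    then show "((\<lambda>w. saw_H T (w + x) - saw_H T w) has_real_derivative (tan (w + x) + T) - (tan w + T)) (at w)"
      using saw_H_deriv[OF 1(2), of T] by (rule DERIV_diff)
  qed
  then obtain w where w: "s < w" "w < t" "(saw_H T (t + x) - saw_H T t) - (saw_H T (s + x) - saw_H T s)
     = (t - s) * (tan (w + x) - tan w)" by auto
  moreover have "tan w < tan (w + x)" by (intro tan_mono_abs) (use assms w in linarith)+
  ultimately show ?thesis using assms by (smt (verit, best) mult_pos_pos)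
qed

section \<open>Convexity and chords for the squared increments\<close>

definition saw_P :: "real \<Rightarrow> real \<Rightarrow> real" where
  "saw_P T \<tau> = \<tau> * (saw_H T (arctan (\<tau> - T)))"

lemma arctan_abs: "\<bar>arctan v\<bar> < pi / 2" using arctan_bounded[of v] by auto

text \<open>With \<open>D = \<tau> - T\<close> the second derivative has the sign of
  \<open>3 + D^2 - 2 D T = (D - T)^2 + 3 - T^2\<close>, whence the bound \<open>sqrt 3\<close>. For
  negative \<open>T\<close> the product \<open>D T\<close> is nonpositive already.\<close>

lemma saw_P_convex:
  assumes "T \<le> sqrt 3"
  shows "convex_on {0<..} (saw_P T)"
proof -
  let ?h = "\<lambda>\<tau>. saw_H T (arctan (\<tau> - T))"
  let ?h1 = "\<lambda>\<tau>. \<tau> / (1 + (\<tau> - T)^2)"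
  have pos: "1 + (\<tau> - T)^2 > 0" for \<tau> by (smt (verit) zero_le_power2)
  have dh: "(?h has_real_derivative ?h1 \<tau>) (at \<tau>)" for \<tau>
  proof -
    have "(?h has_real_derivative (tan (arctan (\<tau> - T)) + T) * (inverse (1 + (\<tau> - T)^2) * 1)) (at \<tau>)"
      by (rule DERIV_chain2[where f="saw_H T" and g="\<lambda>\<tau>. arctan (\<tau> - T)"], rule saw_H_deriv[OF arctan_abs])
         (auto intro!: derivative_eq_intros)
    then show ?thesis by (simp add: tan_arctan divide_inverse)
  qed
  have d1: "(saw_P T has_real_derivative ?h \<tau> + \<tau> * ?h1 \<tau>) (at \<tau>)" for \<tau>
    unfolding saw_P_def[abs_def] by (auto intro!: derivative_eq_intros dh)
  have d2: "((\<lambda>\<tau>. ?h \<tau> + \<tau> * ?h1 \<tau>) has_real_derivative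
     \<tau> * (3 + (\<tau> - T)^2 - 2 * (\<tau> - T) * T) / (1 + (\<tau> - T)^2)^2) (at \<tau>)" for \<tau>
  proof -
    define D K where "D = \<tau> - T" and "K = 1 + D^2"
    have K: "K > 0" using pos[of \<tau>] by (simp add: K_def D_def)
    have dd: "(?h1 has_real_derivative (1 * K - \<tau> * (2 * D)) / (K * K)) (at \<tau>)"
      using K unfolding K_def D_def by (auto intro!: derivative_eq_intros)
    have "((\<lambda>\<tau>. ?h \<tau> + \<tau> * ?h1 \<tau>) has_real_derivative
        ?h1 \<tau> + (1 * ?h1 \<tau> + (1 * K - \<tau> * (2 * D)) / (K * K) * \<tau>)) (at \<tau>)"
      by (rule DERIV_add[OF dh DERIV_mult[OF DERIV_ident dd]])
    moreover have "?h1 \<tau> + (1 * ?h1 \<tau> + (1 * K - \<tau> * (2 * D)) / (K * K) * \<tau>)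
       = \<tau> * (3 + (\<tau> - T)^2 - 2 * (\<tau> - T) * T) / (1 + (\<tau> - T)^2)^2"
    proof -
      have e: "3 + (\<tau> - T)^2 - 2 * (\<tau> - T) * T = 3 * K - 2 * D * \<tau>"
        by (simp add: K_def D_def power2_eq_square algebra_simps)
      show ?thesis using K unfolding e unfolding D_def[symmetric] K_def[symmetric]
        by (simp add: field_simps power2_eq_square)
    qed
    ultimately show ?thesis by simp
  qed
  have nn: "\<tau> * (3 + (\<tau> - T)^2 - 2 * (\<tau> - T) * T) / (1 + (\<tau> - T)^2)^2 \<ge> 0" if "\<tau> > 0" for \<tau>
  proof -
    have "3 + (\<tau> - T)^2 - 2 * (\<tau> - T) * T \<ge> 0"
    proof (cases "T \<ge> 0")
      case True
      have "T^2 \<le> 3" using assms True by (metis real_le_lsqrt real_sqrt_le_iff real_sqrt_unique sqrt_le_D abs_of_nonneg real_sqrt_abs)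
      moreover have "(\<tau> - T)^2 - 2 * (\<tau> - T) * T = (\<tau> - T - T)^2 - T^2" by (simp add: power2_eq_square algebra_simps)
      ultimately show ?thesis by (smt (verit) zero_le_power2)
    next
      case False
      then have 1: "(\<tau> - T) * T \<le> 0" using that by (intro mult_nonneg_nonpos) auto
      have "(\<tau> - T)^2 \<ge> 0" by simp
      then show ?thesis using 1 mult.assoc[of 2 "\<tau> - T" T] by linarith
    qed
    then show ?thesis using that by simp
  qed
  show "convex_on {0<..} (saw_P T)"
    by (rule f''_ge0_imp_convex[OF _ d1 d2 nn]) auto
qed

lemma saw_H_eq_P:
  assumes "\<bar>s\<bar> < pi / 2"
  shows "(tan s + T) * saw_H T s = saw_P T (tan s + T)"
proof -
  have "arctan (tan s) = s" using assms by (intro arctan_tan) auto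
  then show ?thesis by (simp add: saw_P_def)
qed

lemma chord_bounds:
  fixes P :: "real \<Rightarrow> real"
  assumes c: "convex_on {0<..} P" and pos: "0 < a" "a < b"
  defines "B \<equiv> (P b - P a) / (b - a)" and "A \<equiv> P a - (P b - P a) / (b - a) * a"
  shows "a \<le> v \<Longrightarrow> v \<le> b \<Longrightarrow> P v \<le> A + B * v"
    and "0 < v \<Longrightarrow> v \<le> a \<Longrightarrow> P v \<ge> A + B * v"
    and "b \<le> v \<Longrightarrow> P v \<ge> A + B * v"
proof -
  have sl: "(P y - P x) * (z - y) \<le> (P z - P y) * (y - x)" if "0 < x" "x < y" "y < z" for x y z
  proof -
    define h where "h = (y - x) / (z - x)"
    have h: "h * (z - x) = y - x" "0 \<le> h" "h \<le> 1" using that by (auto simp: h_def field_simps)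
    have "P ((1 - h) * x + h * z) \<le> (1 - h) * P x + h * P z"
      using convex_onD[OF c, of h x z] that h by auto
    moreover have "(1 - h) * x + h * z = y" using h(1) by (simp add: algebra_simps)
    ultimately have "P y \<le> (1 - h) * P x + h * P z" by simp
    then have "P y * (z - x) \<le> ((1 - h) * P x + h * P z) * (z - x)"
      using that by (intro mult_right_mono) auto
    also have "\<dots> = (z - x) * P x + (h * (z - x)) * (P z - P x)" by (simp add: algebra_simps)
    also have "\<dots> = (z - x) * P x + (y - x) * (P z - P x)" unfolding h(1) ..
    finally show ?thesis by (simp add: algebra_simps)
  qed
  have AB: "A + B * v = P a + (P b - P a) * (v - a) / (b - a)" for v
    by (simp add: A_def B_def algebra_simps add_divide_distrib diff_divide_distrib)
  show "P v \<le> A + B * v" if "a \<le> v" "v \<le> b"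
  proof (cases "v = a \<or> v = b")
    case False
    then have "(P v - P a) * (b - v) \<le> (P b - P v) * (v - a)" using sl[of a v b] that pos by auto
    then have "P v * (b - a) \<le> P a * (b - a) + (P b - P a) * (v - a)" by (simp add: algebra_simps)
    then show ?thesis unfolding AB using pos by (simp add: field_simps)
  qed (use pos AB in auto)
  show "P v \<ge> A + B * v" if "0 < v" "v \<le> a"
  proof (cases "v = a")
    case False
    then have "(P a - P v) * (b - a) \<le> (P b - P a) * (a - v)" using sl[of v a b] that pos by auto
    then have "P v * (b - a) \<ge> P a * (b - a) + (P b - P a) * (v - a)" by (simp add: algebra_simps)
    then show ?thesis unfolding AB using pos by (simp add: field_simps)
  qed (use pos AB in auto)
  show "P v \<ge> A + B * v" if "b \<le> v"
  proof (cases "v = b")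
    case False
    then have "(P b - P a) * (v - b) \<le> (P v - P b) * (b - a)" using sl[of a b v] that pos by auto
    then have "P v * (b - a) \<ge> P a * (b - a) + (P b - P a) * (v - a)" by (simp add: algebra_simps)
    then show ?thesis unfolding AB using pos by (simp add: field_simps)
  qed (use pos AB in auto)
qed

lemma antimono_from_deriv:
  fixes F F' :: "real \<Rightarrow> real"
  assumes "\<And>s. a \<le> s \<Longrightarrow> s \<le> b \<Longrightarrow> (F has_real_derivative F' s) (at s)"
    and "\<And>s. a \<le> s \<Longrightarrow> s \<le> b \<Longrightarrow> F' s \<le> 0"
    and "a \<le> v" "v \<le> w" "w \<le> b"
  shows "F w \<le> F v"
  by (rule DERIV_nonpos_imp_nonincreasing) (use assms in \<open>force+\<close>)

text \<open>A chain of slope intervals \<open>[l e, u e]\<close> in which no interval starts above the end of its predecessor, with the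
  same total increments of \<open>s\<close> and \<open>saw_H T s\<close> as the single interval \<open>[N, N + x]\<close>. The sum of the
  increments of \<open>(saw_H T s)\<^sup>2\<close> is then largest for the single interval: as a function of
  \<open>\<tau> = tan s + T\<close>, half the derivative of \<open>(saw_H T s)\<^sup>2\<close> is \<open>saw_P T\<close>, which is convex for \<open>T \<le> sqrt 3\<close>,
  and its chord supplies the multipliers.\<close>

lemma saw_nat:
  fixes l u :: "nat \<Rightarrow> real"
  assumes lu: "\<And>e. e < q \<Longrightarrow> l e \<le> u e" and ul: "\<And>e. Suc e < q \<Longrightarrow> l (Suc e) \<le> u e"
    and q: "q > 0" and lmin: "\<And>e. e < q \<Longrightarrow> l 0 \<le> l e"
    and lb: "\<And>e. e < q \<Longrightarrow> \<bar>l e\<bar> < pi / 2" and ub: "\<And>e. e < q \<Longrightarrow> \<bar>u e\<bar> < pi / 2"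
    and N: "- (pi / 2) < N" "0 < x" "N + x < pi / 2" and T: "0 < tan N + T" "T \<le> sqrt 3"
    and sx: "(\<Sum>e<q. u e - l e) = x"
    and sH: "(\<Sum>e<q. saw_H T (u e) - saw_H T (l e)) = saw_H T (N + x) - saw_H T N"
  shows "\<And>e. e < q \<Longrightarrow> N \<le> l e \<and> u e \<le> N + x"
    and "(\<Sum>e<q. (saw_H T (u e))\<^sup>2 - (saw_H T (l e))\<^sup>2) \<le> (saw_H T (N + x))\<^sup>2 - (saw_H T N)\<^sup>2"
proof -
  let ?H = "saw_H T"
  have "\<exists>k<q. \<forall>e<q. u e \<le> u k"
  proof -
    have "finite (u ` {..<q})" "u ` {..<q} \<noteq> {}" using q by auto
    then have "Max (u ` {..<q}) \<in> u ` {..<q}" by (rule Max_in)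
    then obtain k where "k < q" "u k = Max (u ` {..<q})" by auto
    then show ?thesis by (metis Max_ge \<open>finite (u ` {..<q})\<close> imageI lessThan_iff)
  qed
  then obtain k where k: "k < q" "\<And>e. e < q \<Longrightarrow> u e \<le> u k" by auto
  define m M where "m = l 0" and "M = u k"
  have mem: "l e \<in> {m..M} \<and> u e \<in> {m..M}" if "e < q" for e
    using lmin[OF that] k(2)[OF that] lu[OF that] by (auto simp: m_def M_def)
  have mM: "\<bar>m\<bar> < pi/2" "\<bar>M\<bar> < pi/2" "m \<le> M" using lb[of 0] ub[of k] q k mem[of 0] by (auto simp: m_def M_def)
  have Nb: "\<bar>N\<bar> < pi/2" "\<bar>N + x\<bar> < pi/2" using N by linarith+
  have inr: "\<bar>s\<bar> < pi/2" if "m \<le> s" "s \<le> M" for s using that mM by linarith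
  have chain: "(\<Sum>e<q. F (u e) - F (l e)) \<le> F M - F m"
    if that': "\<And>v w. v \<in> {m..M} \<Longrightarrow> w \<in> {m..M} \<Longrightarrow> v \<le> w \<Longrightarrow> F w \<le> F v" for F :: "real \<Rightarrow> real"
    unfolding m_def M_def
  proof (rule saw_chain[where A="{m..M}" and F=F and l=l and u=u])
    show "F w \<le> F v" if "v \<in> {m..M}" "w \<in> {m..M}" "v \<le> w" for v w using that by (rule that')
  qed (use lu ul mem k in auto)
  have lin: "(\<Sum>e<q. (c * ?H (u e) + b * u e) - (c * ?H (l e) + b * l e)) = c * (?H (N + x) - ?H N) + b * x" for c b
  proof -
    have "(\<Sum>e<q. (c * ?H (u e) + b * u e) - (c * ?H (l e) + b * l e))
        = c * (\<Sum>e<q. ?H (u e) - ?H (l e)) + b * (\<Sum>e<q. u e - l e)"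
      unfolding sum_distrib_left sum.distrib[symmetric] by (rule sum.cong) (auto simp: algebra_simps)
    then show ?thesis using sx sH by simp
  qed
  have mN: "N \<le> m"
  proof (rule ccontr)
    assume "\<not> N \<le> m"
    then have mlt: "m < N" by simp
    \<comment> \<open>\<open>D\<close> is the largest slope of \<open>?H\<close> on
      \<open>[m, M]\<close>, so \<open>?H s - D * s\<close> decreases there and the chain bound
      applies. With the tangent at \<open>M\<close>, the increment of \<open>?H\<close> over
      \<open>[N, N + x]\<close> is at most the one over \<open>[m, m + x]\<close>, against strict
      convexity and \<open>m < N\<close>.\<close>
    define D where "D = tan M + T"
    have "(\<Sum>e<q. (1 * ?H (u e) + (- D) * u e) - (1 * ?H (l e) + (- D) * l e)) \<le> (1 * ?H M + (- D) * M) - (1 * ?H m + (- D) * m)"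
    proof (rule chain)
      fix v w assume vw: "v \<in> {m..M}" "w \<in> {m..M}" "v \<le> w"
      show "1 * ?H w + - D * w \<le> 1 * ?H v + - D * v"
      proof (rule antimono_from_deriv[of m M "\<lambda>s. 1 * ?H s + - D * s" "\<lambda>s. (tan s + T) - D"])
        fix s assume s: "m \<le> s" "s \<le> M"
        show "((\<lambda>a. 1 * ?H a + - D * a) has_real_derivative tan s + T - D) (at s)"
          using saw_H_deriv[OF inr[OF s], of T] by (auto intro!: derivative_eq_intros)
        show "tan s + T - D \<le> 0" using tan_mono_abs[OF inr[OF s] mM(2)] s unfolding D_def by (cases "s = M") auto
      qed (use vw in auto)
    qed
    from this[unfolded lin] have "?H (N + x) - ?H N - D * x \<le> ?H M - ?H m - D * (M - m)"
      by (simp add: algebra_simps)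
    moreover have "\<bar>m + x\<bar> < pi / 2" using mlt N mM by linarith
    then have "?H (m + x) \<ge> ?H M + D * (m + x - M)" unfolding D_def by (intro saw_H_tangent mM)
    moreover have "?H (m + x) - ?H m < ?H (N + x) - ?H N"
      by (rule saw_H_increment) (use mM mlt N \<open>\<bar>m + x\<bar> < pi / 2\<close> in linarith)+
    ultimately show False by (simp add: algebra_simps)
  qed
  have MN: "M \<le> N + x"
  proof (rule ccontr)
    assume "\<not> M \<le> N + x"
    then have mlt: "N + x < M" by simp
    define D where "D = tan m + T"
    have "(\<Sum>e<q. ((-1) * ?H (u e) + D * u e) - ((-1) * ?H (l e) + D * l e)) \<le> ((-1) * ?H M + D * M) - ((-1) * ?H m + D * m)"
    proof (rule chain)
      fix v w assume vw: "v \<in> {m..M}" "w \<in> {m..M}" "v \<le> w"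
      show "(-1) * ?H w + D * w \<le> (-1) * ?H v + D * v"
      proof (rule antimono_from_deriv[of m M "\<lambda>s. (-1) * ?H s + D * s" "\<lambda>s. D - (tan s + T)"])
        fix s assume s: "m \<le> s" "s \<le> M"
        show "((\<lambda>a. (-1) * ?H a + D * a) has_real_derivative D - (tan s + T)) (at s)"
          using saw_H_deriv[OF inr[OF s], of T] by (auto intro!: derivative_eq_intros)
        show "D - (tan s + T) \<le> 0" using tan_mono_abs[OF mM(1) inr[OF s]] s unfolding D_def by (cases "s = m") auto
      qed (use vw in auto)
    qed
    from this[unfolded lin] have "?H (N + x) - ?H N - D * x \<ge> ?H M - ?H m - D * (M - m)"
      by (simp add: algebra_simps)
    moreover have b: "\<bar>M - x\<bar> < pi / 2" using mlt N mM by linarith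
    then have "?H (M - x) \<ge> ?H m + D * (M - x - m)" unfolding D_def by (intro saw_H_tangent mM)
    moreover have "?H (N + x) - ?H N < ?H (M - x + x) - ?H (M - x)"
      by (rule saw_H_increment) (use mM mlt N b in linarith)+
    ultimately show False by (simp add: algebra_simps)
  qed
  show "N \<le> l e \<and> u e \<le> N + x" if "e < q" for e using mem[OF that] mN MN by auto
  have "m < M"
  proof (rule ccontr)
    assume "\<not> m < M"
    then have "u e - l e = 0" if "e < q" for e using mem[OF that] by auto
    then show False using sx N(2) by simp
  qed
  define a b where "a = tan m + T" and "b = tan M + T"
  have tanmono: "tan v \<le> tan w" if "\<bar>v\<bar> < pi/2" "\<bar>w\<bar> < pi/2" "v \<le> w" for v w
    using tan_mono_abs[of v w] that by (cases "v = w") auto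
  have ab: "0 < a" "a < b" using tanmono[OF Nb(1) mM(1) mN] T(1) tan_mono_abs[OF mM(1,2) \<open>m < M\<close>] by (auto simp: a_def b_def)
  define B A where "B = (saw_P T b - saw_P T a) / (b - a)" and "A = saw_P T a - (saw_P T b - saw_P T a) / (b - a) * a"
  note ch = chord_bounds[OF saw_P_convex[OF T(2)] ab, folded A_def B_def]
  \<comment> \<open>The multipliers \<open>B\<close> and \<open>A\<close> act on two totals that are
    prescribed. The derivative of \<open>F\<close> is \<open>saw_P\<close> minus its chord:
    nonpositive on \<open>[m, M]\<close>, which bounds the chain by \<open>F M - F m\<close>, and
    nonnegative on \<open>[N, m]\<close> and \<open>[M, N + x]\<close>, which bounds this by
    \<open>F (N + x) - F N\<close>.\<close>
  define F where "F = (\<lambda>s. (?H s)\<^sup>2 / 2 - B * ?H s - A * s)"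
  have dF: "(F has_real_derivative saw_P T (tan s + T) - (A + B * (tan s + T))) (at s)" if "\<bar>s\<bar> < pi/2" for s
    unfolding F_def using saw_H_deriv[OF that, of T] saw_H_eq_P[OF that, of T]
    by (auto intro!: derivative_eq_intros simp: algebra_simps)
  have s1: "(\<Sum>e<q. F (u e) - F (l e)) \<le> F M - F m"
  proof (rule chain)
    fix v w assume vw: "v \<in> {m..M}" "w \<in> {m..M}" "v \<le> w"
    show "F w \<le> F v"
    proof (rule antimono_from_deriv[of m M F "\<lambda>s. saw_P T (tan s + T) - (A + B * (tan s + T))"])
      fix s assume s: "m \<le> s" "s \<le> M"
      show "(F has_real_derivative saw_P T (tan s + T) - (A + B * (tan s + T))) (at s)" using dF[OF inr[OF s]] .
      show "saw_P T (tan s + T) - (A + B * (tan s + T)) \<le> 0"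
        using ch(1)[of "tan s + T"] tanmono[OF mM(1) inr[OF s] s(1)] tanmono[OF inr[OF s] mM(2) s(2)]
        by (auto simp: a_def b_def)
    qed (use vw in auto)
  qed
  have s2: "F M \<le> F (N + x)"
  proof -
    have "- F (N + x) \<le> - F M"
    proof (rule antimono_from_deriv[of M "N + x" "\<lambda>s. - F s" "\<lambda>s. - (saw_P T (tan s + T) - (A + B * (tan s + T)))"])
      fix s assume s: "M \<le> s" "s \<le> N + x"
      have sb: "\<bar>s\<bar> < pi/2" using s mM N by linarith
      show "((\<lambda>s. - F s) has_real_derivative - (saw_P T (tan s + T) - (A + B * (tan s + T)))) (at s)"
        using dF[OF sb] by (rule DERIV_minus)
      show "- (saw_P T (tan s + T) - (A + B * (tan s + T))) \<le> 0"
        using ch(3)[of "tan s + T"] tanmono[OF mM(2) sb s(1)] by (auto simp: b_def)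
    qed (use MN in auto)
    then show ?thesis by simp
  qed
  have s3: "F N \<le> F m"
  proof -
    have "- F m \<le> - F N"
    proof (rule antimono_from_deriv[of N m "\<lambda>s. - F s" "\<lambda>s. - (saw_P T (tan s + T) - (A + B * (tan s + T)))"])
      fix s assume s: "N \<le> s" "s \<le> m"
      have sb: "\<bar>s\<bar> < pi/2" using s mM N by linarith
      show "((\<lambda>s. - F s) has_real_derivative - (saw_P T (tan s + T) - (A + B * (tan s + T)))) (at s)"
        using dF[OF sb] by (rule DERIV_minus)
      show "- (saw_P T (tan s + T) - (A + B * (tan s + T))) \<le> 0"
        using ch(2)[of "tan s + T"] tanmono[OF sb mM(1) s(2)] tanmono[OF Nb(1) sb s(1)] T(1) by (auto simp: a_def)
    qed (use mN in auto)
    then show ?thesis by simp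
  qed
  have "(\<Sum>e<q. F (u e) - F (l e)) \<le> F (N + x) - F N" using s1 s2 s3 by linarith
  moreover have "(\<Sum>e<q. F (u e) - F (l e)) = (\<Sum>e<q. (?H (u e))\<^sup>2 - (?H (l e))\<^sup>2) / 2 - (B * (?H (N + x) - ?H N) + A * x)"
    unfolding lin[symmetric] F_def sum_divide_distrib sum_subtractf[symmetric]
    by (rule sum.cong) (auto simp: field_simps)
  ultimately have "(\<Sum>e<q. (?H (u e))\<^sup>2 - (?H (l e))\<^sup>2) / 2 \<le> ((?H (N + x))\<^sup>2 - (?H N)\<^sup>2) / 2"
    unfolding F_def by (simp add: field_simps)
  then show "(\<Sum>e<q. (?H (u e))\<^sup>2 - (?H (l e))\<^sup>2) \<le> (?H (N + x))\<^sup>2 - (?H N)\<^sup>2" by simp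
qed

text \<open>The cyclic chain is cut open at an interval with smallest lower end, which is where
  \<open>saw_nat\<close> requires its chain to begin.\<close>

lemma saw_int:
  fixes l u :: "int \<Rightarrow> real"
  assumes lp: "\<And>e. l (e + int q) = l e" and up: "\<And>e. u (e + int q) = u e"
    and lu: "\<And>e. l e \<le> u e" and ul: "\<And>e. l (e + 1) \<le> u e"
    and q: "q > 0" and lb: "\<And>e. \<bar>l e\<bar> < pi / 2" and ub: "\<And>e. \<bar>u e\<bar> < pi / 2"
    and N: "- (pi / 2) < N" "0 < x" "N + x < pi / 2" and T: "0 < tan N + T" "T \<le> sqrt 3"
    and sx: "(\<Sum>e\<in>{0..<int q}. u e - l e) = x"
    and sH: "(\<Sum>e\<in>{0..<int q}. saw_H T (u e) - saw_H T (l e)) = saw_H T (N + x) - saw_H T N"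
  shows "N \<le> l e \<and> u e \<le> N + x"
    and "(\<Sum>e\<in>{0..<int q}. (saw_H T (u e))\<^sup>2 - (saw_H T (l e))\<^sup>2) \<le> (saw_H T (N + x))\<^sup>2 - (saw_H T N)\<^sup>2"
proof -
  have "\<exists>k\<in>{0..<int q}. \<forall>e\<in>{0..<int q}. l k \<le> l e"
  proof -
    have fin: "finite (l ` {0..<int q})" "l ` {0..<int q} \<noteq> {}" using q by auto
    then have "Min (l ` {0..<int q}) \<in> l ` {0..<int q}" by (rule Min_in)
    then show ?thesis using fin by (metis (no_types, lifting) Min_le imageE imageI)
  qed
  then obtain k where k: "k \<in> {0..<int q}" "\<And>e. e \<in> {0..<int q} \<Longrightarrow> l k \<le> l e" by auto
  have modp: "f (e mod int q) = f e" if "\<And>e. f (e + int q) = f e" for f :: "int \<Rightarrow> real" and e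
  proof -
    have st: "f (e + int q * int j) = f e" for e j
    proof (induction j)
      case (Suc j)
      then show ?case using that[of "e + int q * int j"] by (simp add: algebra_simps)
    qed auto
    show ?thesis
    proof (cases "e div int q \<ge> 0")
      case True
      have "f (e mod int q + int q * int (nat (e div int q))) = f (e mod int q)" by (rule st)
      then show ?thesis using True by simp
    next
      case False
      have "f (e + int q * int (nat (- (e div int q)))) = f e" by (rule st)
      moreover have "e + int q * int (nat (- (e div int q))) = e mod int q" using False
        by (simp add: algebra_simps minus_div_mult_eq_mod[symmetric])
      ultimately show ?thesis by simp
    qed
  qed
  have kmin: "l k \<le> l e" for e
  proof -
    have "l k \<le> l (e mod int q)" by (rule k(2)) (use q in auto)
    then show ?thesis using modp[of l, OF lp] by simp
  qed
  define l' u' where "l' = (\<lambda>e::nat. l (k + int e))" and "u' = (\<lambda>e::nat. u (k + int e))"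
  have conv: "(\<Sum>e\<in>{0..<int q}. f (u e) - f (l e)) = (\<Sum>e<q. f (u' e) - f (l' e))" for f :: "real \<Rightarrow> real"
  proof -
    have "(\<Sum>e\<in>{0..<int q}. f (u e) - f (l e)) = (\<Sum>e\<in>{k..<k + int q}. f (u e) - f (l e))"
      by (rule sum_periodic_int[symmetric]) (simp add: lp up)
    also have "\<dots> = (\<Sum>e<q. f (u' e) - f (l' e))" unfolding sum_int_window_nat l'_def u'_def ..
    finally show ?thesis .
  qed
  have ul': "l (k + (1 + int e)) \<le> u (k + int e)" for e using ul[of "k + int e"] by (simp add: algebra_simps)
  have A2: "l' (Suc e) \<le> u' e" for e using ul'[of e] unfolding l'_def u'_def by simp
  have A: "\<And>e. e < q \<Longrightarrow> l' e \<le> u' e" "\<And>e. e < q \<Longrightarrow> l' 0 \<le> l' e" "\<And>e. e < q \<Longrightarrow> \<bar>l' e\<bar> < pi / 2" "\<And>e. e < q \<Longrightarrow> \<bar>u' e\<bar> < pi / 2"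
    using lu lb ub kmin ul[of "k + int _"] by (auto simp: l'_def u'_def add.assoc add.commute)
  have sx': "(\<Sum>e<q. u' e - l' e) = x" using conv[of "\<lambda>v. v"] sx by simp
  have sH': "(\<Sum>e<q. saw_H T (u' e) - saw_H T (l' e)) = saw_H T (N + x) - saw_H T N"
    using conv[of "saw_H T"] sH by simp
  note R = saw_nat[OF A(1) A2 q A(2,3,4) N T sx' sH']
  show "(\<Sum>e\<in>{0..<int q}. (saw_H T (u e))\<^sup>2 - (saw_H T (l e))\<^sup>2) \<le> (saw_H T (N + x))\<^sup>2 - (saw_H T N)\<^sup>2"
    using R(2) conv[of "\<lambda>v. (saw_H T v)\<^sup>2"] by simp
  define j where "j = (e - k) mod int q"
  have j: "0 \<le> j" "j < int q" using q by (auto simp: j_def)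
  have "l (k + j) = l e" "u (k + j) = u e"
    unfolding j_def using modp[of "\<lambda>e. l (k + e)"] modp[of "\<lambda>e. u (k + e)"] lp[of "k + _"] up[of "k + _"]
    by (auto simp: add.assoc)
  then show "N \<le> l e \<and> u e \<le> N + x" using R(1)[of "nat j"] j by (auto simp: l'_def u'_def)
qed

subsection \<open>The climbing inequality\<close>

text \<open>Fix all coordinates except \<open>i\<close>. Since \<open>\<pi> i \<noteq> i\<close>,
  the value \<open>E (\<pi> i)\<close> is then fixed as well, and the inner average over
  \<open>E i\<close> is at most \<open>B i\<close> whatever this value is.\<close>

lemma independent_pairs_sum:
  fixes w :: "nat \<Rightarrow> int \<Rightarrow> real" and D :: "nat \<Rightarrow> int \<Rightarrow> int \<Rightarrow> real" and A :: "int set" and B :: "nat \<Rightarrow> real"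
  assumes fin: "finite I" "finite A" and w0: "\<And>i e. i \<in> I \<Longrightarrow> e \<in> A \<Longrightarrow> 0 \<le> w i e"
    and w1: "\<And>i. i \<in> I \<Longrightarrow> (\<Sum>e\<in>A. w i e) = 1"
    and D: "\<And>i f. i \<in> I \<Longrightarrow> (\<Sum>e\<in>A. w i e * D i f e) \<le> B i"
    and pi: "\<And>i. i \<in> I \<Longrightarrow> \<pi> i \<in> I \<and> \<pi> i \<noteq> i"
  shows "(\<Sum>E\<in>PiE I (\<lambda>_. A). (\<Prod>i\<in>I. w i (E i)) * (\<Sum>i\<in>I. D i (E (\<pi> i)) (E i))) \<le> (\<Sum>i\<in>I. B i)"
proof -
  let ?P = "PiE I (\<lambda>_. A)"
  have one: "(\<Sum>E\<in>?P. (\<Prod>i\<in>I. w i (E i)) * D i (E (\<pi> i)) (E i)) \<le> B i" if i: "i \<in> I" for i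
  proof -
    let ?J = "I - {i}" let ?Q = "PiE ?J (\<lambda>_. A)"
    have I: "I = insert i ?J" using i by auto
    have P: "?P = (\<lambda>(y, g). g(i := y)) ` (A \<times> ?Q)" using PiE_insert_eq[of i ?J "\<lambda>_. A"] I by simp
    have inj: "inj_on (\<lambda>(y, g). g(i := y)) (A \<times> ?Q)" by (rule inj_combinator) auto
    have prodw: "(\<Prod>j\<in>I. w j ((g(i := y)) j)) = w i y * (\<Prod>j\<in>?J. w j (g j))" for g y
      using fin i by (subst prod.remove[of I i]) (auto intro!: prod.cong)
    have "(\<Sum>E\<in>?P. (\<Prod>i\<in>I. w i (E i)) * D i (E (\<pi> i)) (E i))
      = (\<Sum>(y, g)\<in>A \<times> ?Q. (\<Prod>j\<in>I. w j ((g(i := y)) j)) * D i ((g(i := y)) (\<pi> i)) ((g(i := y)) i))"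
      unfolding P by (subst sum.reindex[OF inj]) (simp add: case_prod_unfold)
    also have "\<dots> = (\<Sum>(y, g)\<in>A \<times> ?Q. (\<Prod>j\<in>?J. w j (g j)) * (w i y * D i (g (\<pi> i)) y))"
      unfolding prodw using pi[OF i] by (intro sum.cong) (auto simp: algebra_simps)
    also have "\<dots> = (\<Sum>y\<in>A. \<Sum>g\<in>?Q. (\<Prod>j\<in>?J. w j (g j)) * (w i y * D i (g (\<pi> i)) y))"
      by (rule sum.cartesian_product[symmetric])
    also have "\<dots> = (\<Sum>g\<in>?Q. \<Sum>y\<in>A. (\<Prod>j\<in>?J. w j (g j)) * (w i y * D i (g (\<pi> i)) y))"
      by (rule sum.swap)
    also have "\<dots> = (\<Sum>g\<in>?Q. (\<Prod>j\<in>?J. w j (g j)) * (\<Sum>y\<in>A. w i y * D i (g (\<pi> i)) y))"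
      by (simp add: sum_distrib_left)
    also have "\<dots> \<le> (\<Sum>g\<in>?Q. (\<Prod>j\<in>?J. w j (g j)) * B i)"
      by (intro sum_mono mult_left_mono D[OF i] prod_nonneg) (auto intro!: w0 simp: PiE_def Pi_def)
    also have "\<dots> = (\<Prod>j\<in>?J. \<Sum>e\<in>A. w j e) * B i"
      using fin by (subst prod_sum_PiE) (auto simp: sum_distrib_right)
    also have "\<dots> = B i" using w1 by simp
    finally show ?thesis .
  qed
  have "(\<Sum>E\<in>?P. (\<Prod>i\<in>I. w i (E i)) * (\<Sum>i\<in>I. D i (E (\<pi> i)) (E i)))
     = (\<Sum>i\<in>I. \<Sum>E\<in>?P. (\<Prod>i\<in>I. w i (E i)) * D i (E (\<pi> i)) (E i))"
    unfolding sum_distrib_left by (rule sum.swap)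
  also have "\<dots> \<le> (\<Sum>i\<in>I. B i)" by (rule sum_mono) (rule one)
  finally show ?thesis .
qed

lemma cos_diff_over_cos:
  fixes c m :: real
  assumes "cos m > 0"
  shows "cos (c - m) / cos m = cos c + tan m * sin c"
  using assms by (simp add: cos_diff tan_def field_simps)

text \<open>The solution \<open>N\<close> in \<open>(- pi / 2, pi / 2)\<close> of
  \<open>cos (N + x) = exp (- K) * cos N\<close>: expand the left side and divide by
  \<open>cos N\<close>.\<close>

definition cut_N :: "real \<Rightarrow> real \<Rightarrow> real" where
  "cut_N x K = arctan ((cos x - exp (- K)) / sin x)"

lemma cut_N_props:
  assumes x: "0 < x" "x < pi" and K: "0 < K"
  shows "- (x / 2) < cut_N x K" "cut_N x K + x < pi / 2" "\<bar>cut_N x K\<bar> < pi / 2"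
    "cos (cut_N x K + x) = exp (- K) * cos (cut_N x K)"
proof -
  let ?N = "cut_N x K" let ?t = "(cos x - exp (- K)) / sin x"
  have sx: "sin x > 0" using x by (rule sin_gt_zero)
  show ab: "\<bar>?N\<bar> < pi / 2" unfolding cut_N_def by (rule arctan_abs)
  have cN: "cos ?N > 0" using ab by (intro cos_gt_zero_pi) auto
  have tN: "sin ?N = ?t * cos ?N" using tan_arctan[of ?t] cN unfolding cut_N_def tan_def by (simp add: field_simps)
  show eq: "cos (?N + x) = exp (- K) * cos ?N"
    unfolding cos_add tN using sx by (simp add: field_simps)
  have "cos (?N + x) > 0" unfolding eq using cN by simp
  show "?N + x < pi / 2"
  proof (rule ccontr)
    assume "\<not> ?N + x < pi / 2"
    then have "pi / 2 \<le> ?N + x" "?N + x \<le> pi / 2 + pi" using ab x by auto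
    then have "cos (?N + x - pi) \<ge> 0" by (intro cos_ge_zero) auto
    then show False using \<open>cos (?N + x) > 0\<close> by (simp add: cos_diff)
  qed
  \<comment> \<open>For \<open>K = 0\<close> the solution is \<open>- (x / 2)\<close>, which places
    \<open>[N, N + x]\<close> symmetrically about 0; a positive \<open>K\<close> moves it to the
    right.\<close>
  have "tan (- (x / 2)) < ?t"
  proof -
    have h: "sin (x/2) > 0" "cos (x/2) > 0" using x by (auto intro!: sin_gt_zero cos_gt_zero_pi)
    have sx2: "sin x = 2 * sin (x/2) * cos (x/2)" "cos x = 1 - 2 * (sin (x/2))\<^sup>2"
      using sin_double[of "x/2"] cos_double_sin[of "x/2"] by auto
    have "tan (- (x / 2)) * sin x = - 2 * (sin (x/2))\<^sup>2" unfolding sx2(1) tan_minus using h by (simp add: tan_def power2_eq_square)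
    also have "\<dots> = cos x - 1" unfolding sx2 by simp
    also have "\<dots> < cos x - exp (- K)" using K by simp
    finally show ?thesis using sx by (simp add: field_simps)
  qed
  then have "arctan (tan (- (x / 2))) < ?N" unfolding cut_N_def by (simp add: arctan_less_iff)
  then show "- (x / 2) < ?N" using x by (subst (asm) arctan_tan) auto
qed

text \<open>The marks of index \<open>k = i + \<sigma> t\<close> are unrolled into levels \<open>i\<close> and times \<open>t\<close>: \<open>S i t\<close> is the angle of the
  mark minus \<open>t \<theta>\<close> and \<open>G i t\<close> is the logarithm of the gauge there minus \<open>t L\<close>. In these coordinates
  the rotation by \<open>\<theta>\<close> moves the vertex \<open>(i, t)\<close> onto the side between \<open>(i, t + 1)\<close> and \<open>(i + 1, t + 1)\<close>.\<close>

locale level_system =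
  fixes q d s :: nat and S G :: "int \<Rightarrow> int \<Rightarrow> real" and x y L :: real
  assumes q0: "0 < q" and d2: "2 \<le> d" and s: "q * (d - 1) < s" "s < q * d"
    and xy: "0 < x" "x < pi" "0 < L"
    and S_q: "\<And>i t. S i (t + int q) = S i t - x"
    and G_q: "\<And>i t. G i (t + int q) = G i t - real q * L"
    and S_d: "\<And>i t. S (i + int d) (t + int s) = S i t + real d * y"
    and G_d: "\<And>i t. G (i + int d) (t + int s) = G i t - real s * L"
    and a_nonneg: "\<And>i t. S i (t + 1) \<le> S i t"
    and c_pos: "\<And>i t. S i t < S (i + 1) (t + 1)"
    and gap: "\<And>i t. S (i + 1) t - S i t < pi"
    and row: "\<And>i t. exp (G i t) * sin (S (i + 1) (t + 1) - S i (t + 1)) =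
        sin (S (i + 1) (t + 1) - S i t) * exp (G i (t + 1)) + sin (S i t - S i (t + 1)) * exp (G (i + 1) (t + 1))"
    and kink: "\<And>i t. sin (S (i + 1) t - S i t) * exp (G (i + 1) (t + 1))
        \<le> sin (S (i + 1) t - S (i + 1) (t + 1)) * exp (G i t) + sin (S (i + 1) (t + 1) - S i t) * exp (G (i + 1) t)"
begin

text \<open>The sinusoid through the vertices \<open>(i, t)\<close> and \<open>(i + 1, t + 1)\<close> is
  \<open>\<psi> \<mapsto> exp (G i t) * cos (\<psi> - S i t - sm i t) / cos (sm i t)\<close>; the angle \<open>sp i t\<close> is \<open>sm i t\<close>
  measured from \<open>S i (t + 1)\<close> instead of \<open>S i t\<close>.\<close>

definition "sm i t = arctan ((exp (G (i + 1) (t + 1) - G i t) - cos (S (i + 1) (t + 1) - S i t)) / sin (S (i + 1) (t + 1) - S i t))"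
definition "sp i t = sm i t + (S i t - S i (t + 1))"
definition "N = cut_N x (real q * L)"

lemma N_props: "- (x / 2) < N" "N + x < pi / 2" "\<bar>N\<bar> < pi / 2" "cos (N + x) = exp (- (real q * L)) * cos N"
  using cut_N_props[OF xy(1,2), of "real q * L"] xy q0 unfolding N_def by auto

lemma ac_bounds:
  "0 \<le> S i t - S i (t + 1)" "0 < S (i + 1) (t + 1) - S i t" "S (i + 1) (t + 1) - S i (t + 1) < pi"
  "sin (S (i + 1) (t + 1) - S i t) > 0" "sin (S (i + 1) (t + 1) - S i (t + 1)) > 0"
proof -
  show b: "0 \<le> S i t - S i (t + 1)" "0 < S (i + 1) (t + 1) - S i t" "S (i + 1) (t + 1) - S i (t + 1) < pi"
    using a_nonneg[of i t] c_pos[of i t] gap[of i "t + 1"] by auto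
  show "sin (S (i + 1) (t + 1) - S i t) > 0" "sin (S (i + 1) (t + 1) - S i (t + 1)) > 0"
    by (rule sin_gt_zero; use b in linarith)+
qed

lemma sm_bound: "\<bar>sm i t\<bar> < pi / 2" unfolding sm_def by (rule arctan_abs)

lemma cos_sm: "cos (sm i t) > 0" using sm_bound[of i t] by (intro cos_gt_zero_pi) auto

lemma up_ratio: "exp (G (i + 1) (t + 1) - G i t) = cos (S (i + 1) (t + 1) - S i t - sm i t) / cos (sm i t)"
proof -
  let ?c = "S (i + 1) (t + 1) - S i t"
  have "tan (sm i t) * sin ?c = exp (G (i + 1) (t + 1) - G i t) - cos ?c"
    unfolding sm_def tan_arctan using ac_bounds(4)[of i t] by simp
  moreover have "cos (?c - sm i t) / cos (sm i t) = cos ?c + tan (sm i t) * sin ?c"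
    by (rule cos_diff_over_cos[OF cos_sm])
  ultimately show ?thesis by simp
qed

lemma drop_ratio: "exp (G i (t + 1) - G i t) = cos (sp i t) / cos (sm i t)"
proof -
  let ?c = "S (i + 1) (t + 1) - S i t" and ?a = "S i t - S i (t + 1)"
  have ac: "S (i + 1) (t + 1) - S i (t + 1) = ?a + ?c" by simp
  have "exp (G i t) * sin (?a + ?c) = sin ?c * exp (G i (t + 1)) + sin ?a * exp (G (i + 1) (t + 1))"
    using row[of i t] unfolding ac by simp
  then have "sin (?a + ?c) = sin ?c * exp (G i (t + 1) - G i t) + sin ?a * exp (G (i + 1) (t + 1) - G i t)"
    by (simp add: exp_diff field_simps)
  then have "sin ?c * (exp (G i (t + 1) - G i t) * cos (sm i t)) = sin (?a + ?c) * cos (sm i t) - sin ?a * cos (?c - sm i t)"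
    using cos_sm[of i t] unfolding up_ratio by (simp add: field_simps)
  also have "\<dots> = sin ?c * cos (sp i t)"
    unfolding sp_def by (simp only: sin_add cos_add cos_diff) (simp add: algebra_simps)
  finally show ?thesis using ac_bounds(4)[of i t] cos_sm[of i t] by (simp add: field_simps)
qed

lemma sp_bound: "\<bar>sp i t\<bar> < pi / 2" "sm i t \<le> sp i t"
proof -
  have c: "cos (sp i t) > 0" using drop_ratio[of i t] cos_sm[of i t] by (metis exp_gt_zero zero_less_divide_iff not_less_iff_gr_or_eq)
  have b: "sm i t \<le> sp i t" "sp i t < sm i t + pi" unfolding sp_def using ac_bounds[of i t] by auto
  show "sm i t \<le> sp i t" by (rule b(1))
  have "sp i t < pi / 2"
  proof (rule ccontr)
    assume "\<not> sp i t < pi / 2"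
    then have "cos (sp i t - pi) \<ge> 0" using b sm_bound[of i t] by (intro cos_ge_zero) auto
    then show False using c by (simp add: cos_diff)
  qed
  then show "\<bar>sp i t\<bar> < pi / 2" using b sm_bound[of i t] by auto
qed

lemma cos_sp: "cos (sp i t) > 0" using sp_bound[of i t] by (intro cos_gt_zero_pi) auto

lemma kink_slopes: "sm i (t + 1) \<le> sp i t"
proof -
  define X Y Z where "X = exp (G i (t + 1))" and "Y = exp (G (i + 1) (t + 1))" and "Z = exp (G (i + 1) (t + 1 + 1))"
  define a' c' where "a' = S (i + 1) (t + 1) - S (i + 1) (t + 1 + 1)" and "c' = S (i + 1) (t + 1 + 1) - S i (t + 1)"
  define w where "w = S (i + 1) (t + 1) - S i (t + 1)"
  have w: "w = a' + c'" by (simp add: w_def a'_def c'_def)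
  have pos: "X > 0" "sin c' > 0" "sin w > 0" using ac_bounds(4)[of i "t+1"] ac_bounds(5)[of i t] by (auto simp: X_def w_def c'_def)
  have k: "sin w * Z \<le> sin a' * X + sin c' * Y"
    using kink[of i "t + 1"] by (simp add: X_def Y_def Z_def a'_def c'_def w_def)
  have tm: "tan (sm i (t + 1)) = (Z / X - cos c') / sin c'"
    unfolding sm_def tan_arctan by (simp add: X_def Z_def c'_def exp_diff)
  have "exp (G (i + 1) (t + 1) - G i (t + 1)) = exp (G (i + 1) (t + 1) - G i t) / exp (G i (t + 1) - G i t)"
    by (simp add: exp_diff)
  also have "\<dots> = cos (S (i + 1) (t + 1) - S i t - sm i t) / cos (sp i t)"
    unfolding up_ratio drop_ratio using cos_sm[of i t] by simp
  also have "S (i + 1) (t + 1) - S i t - sm i t = w - sp i t" by (simp add: w_def sp_def)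
  finally have "Y / X = cos (w - sp i t) / cos (sp i t)" by (simp add: X_def Y_def exp_diff)
  then have "tan (sp i t) * sin w = Y / X - cos w"
    using cos_diff_over_cos[OF cos_sp, of w i t] by simp
  then have tp: "tan (sp i t) = (Y / X - cos w) / sin w" using pos by (simp add: field_simps)
  have "sin a' = cos c' * sin w - cos w * sin c'"
    using sin_diff[of w c'] unfolding w by simp
  then have "sin w * Z - sin c' * Y \<le> X * (cos c' * sin w - cos w * sin c')"
    using k by (simp add: mult.commute)
  then have "(sin w * Z - sin c' * Y) / X \<le> cos c' * sin w - cos w * sin c'"
    using pos by (simp add: pos_divide_le_eq mult.commute)
  then have "(Z / X - cos c') * sin w \<le> (Y / X - cos w) * sin c'"
    by (simp add: diff_divide_distrib algebra_simps)
  then have "(Z / X - cos c') / sin c' \<le> (Y / X - cos w) / sin w"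
    using pos by (simp add: pos_divide_le_eq pos_le_divide_eq mult.commute)
  then have "tan (sm i (t + 1)) \<le> tan (sp i t)" unfolding tm tp .
  then show ?thesis using tan_mono_abs[OF sp_bound(1) sm_bound, of i t i "t+1"] by linarith
qed

lemma periodic_sm_sp: "sm i (t + int q) = sm i t" "sp i (t + int q) = sp i t"
proof -
  have e: "S i' (t' + int q) = S i' t' - x" "G i' (t' + int q) = G i' t' - real q * L" for i' t' using S_q G_q by auto
  have r: "t + int q + 1 = (t + 1) + int q" by simp
  show 1: "sm i (t + int q) = sm i t" unfolding sm_def r e by simp
  show "sp i (t + int q) = sp i t" unfolding sp_def r 1 e by simp
qed

definition "Lam T i t = G i t + T * S i t"
definition "Om T = real q * L + T * x"
text \<open>This is the drop of \<open>Lam T\<close> in one time step (\<open>alpha_eq\<close>),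
  written through the slopes so that the chain inequality applies to it.\<close>

definition "alpha T i t = saw_H T (sp i t) - saw_H T (sm i t)"

lemma Lam_q: "Lam T i (t + int q) = Lam T i t - Om T"
  unfolding Lam_def Om_def S_q G_q by (simp add: algebra_simps)

lemma Lam_d: "Lam T (i + int d) (t + int s) = Lam T i t + (T * real d * y - real s * L)"
  unfolding Lam_def S_d G_d by (simp add: algebra_simps)

lemma ln_drop: "G i t - G i (t + 1) = ln (cos (sm i t)) - ln (cos (sp i t))"
proof -
  have "G i (t + 1) - G i t = ln (cos (sp i t) / cos (sm i t))" by (subst drop_ratio[symmetric]) simp
  then show ?thesis using cos_sm[of i t] cos_sp[of i t] by (simp add: ln_div)
qed

lemma alpha_eq: "alpha T i t = Lam T i t - Lam T i (t + 1)"
  using ln_drop[of i t] unfolding alpha_def Lam_def saw_H_def by (simp add: sp_def algebra_simps)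

lemma saw_sum_x: "(\<Sum>e\<in>{0..<int q}. sp i e - sm i e) = x"
proof -
  have "(\<Sum>e\<in>{0..<0 + int q}. sp i e - sm i e) = (\<Sum>e<q. S i (0 + int e) - S i (0 + int e + 1))"
    unfolding sum_int_window_nat by (simp add: sp_def)
  also have "\<dots> = (\<Sum>e<q. S i (int e) - S i (int (Suc e)))" by (simp add: add.commute)
  also have "\<dots> = S i (int 0) - S i (int q)" by (rule sum_lessThan_telescope')
  also have "\<dots> = x" using S_q[of i 0] by simp
  finally show ?thesis by simp
qed

lemma alpha_window: "(\<Sum>e\<in>{t..<t + int q}. alpha T i e) = Om T"
proof -
  have "(\<Sum>e\<in>{t..<t + int q}. alpha T i e) = (\<Sum>e<q. Lam T i (t + int e) - Lam T i (t + int (Suc e)))"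
    unfolding sum_int_window_nat alpha_eq by (simp add: add.commute add.left_commute)
  also have "\<dots> = Lam T i (t + int 0) - Lam T i (t + int q)" by (rule sum_lessThan_telescope')
  also have "\<dots> = Om T" using Lam_q by simp
  finally show ?thesis .
qed

text \<open>The reason for the choice of \<open>N\<close>: the single interval
  \<open>[N, N + x]\<close> has the same total increments of the slope and of \<open>saw_H T\<close>
  as the chain of a level.\<close>

lemma Om_eq: "Om T = saw_H T (N + x) - saw_H T N"
proof -
  have cN: "cos N > 0" using N_props by (intro cos_gt_zero_pi) auto
  have "ln (cos (N + x)) = ln (cos N) - real q * L"
    unfolding N_props(4) using cN by (simp add: ln_mult)
  then show ?thesis unfolding saw_H_def Om_def by (simp add: algebra_simps)
qed

context
  fixes T :: real
  assumes T: "0 < tan N + T" "T \<le> sqrt 3"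
begin

lemma saw_facts:
  "N \<le> sm i e" "sp i e \<le> N + x"
  "(\<Sum>e\<in>{0..<int q}. (saw_H T (sp i e))\<^sup>2 - (saw_H T (sm i e))\<^sup>2) \<le> (saw_H T (N + x))\<^sup>2 - (saw_H T N)\<^sup>2"
proof -
  have sH: "(\<Sum>e\<in>{0..<int q}. saw_H T (sp i e) - saw_H T (sm i e)) = saw_H T (N + x) - saw_H T N"
    using alpha_window[of T i 0] Om_eq unfolding alpha_def by simp
  have b: "- (pi / 2) < N" using N_props by linarith
  note R = saw_int[where l="sm i" and u="sp i", OF periodic_sm_sp sp_bound(2) kink_slopes q0 sm_bound sp_bound(1) b xy(1) N_props(2) T saw_sum_x sH]
  show "N \<le> sm i e" "sp i e \<le> N + x" using R(1)[of e] by auto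
  show "(\<Sum>e\<in>{0..<int q}. (saw_H T (sp i e))\<^sup>2 - (saw_H T (sm i e))\<^sup>2) \<le> (saw_H T (N + x))\<^sup>2 - (saw_H T N)\<^sup>2"
    by (rule R(2))
qed

lemma tan_sm: "tan N + T \<le> tan (sm i e) + T"
  using saw_facts(1)[of i e] tan_mono_abs[OF N_props(3) sm_bound, of i e] by (cases "N = sm i e") auto

lemma alpha_lower: "alpha T i e \<ge> (tan N + T) * (S i e - S i (e + 1))"
proof -
  have "saw_H T (sp i e) \<ge> saw_H T (sm i e) + (tan (sm i e) + T) * (sp i e - sm i e)"
    by (rule saw_H_tangent) (rule sm_bound sp_bound)+
  moreover have "(tan (sm i e) + T) * (sp i e - sm i e) \<ge> (tan N + T) * (sp i e - sm i e)"
    using tan_sm[of i e] sp_bound(2)[of i e] by (intro mult_right_mono) auto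
  ultimately show ?thesis unfolding alpha_def by (simp add: sp_def)
qed

lemma alpha_nonneg: "alpha T i e \<ge> 0"
  using alpha_lower[of i e] mult_nonneg_nonneg[OF less_imp_le[OF T(1)] ac_bounds(1)[of i e]] by linarith

lemma Om_pos: "Om T > 0"
proof -
  have "(tan N + T) * x = (\<Sum>e\<in>{0..<int q}. (tan N + T) * (S 0 e - S 0 (e + 1)))"
    using saw_sum_x[of 0] by (simp add: sp_def flip: sum_distrib_left)
  also have "\<dots> \<le> (\<Sum>e\<in>{0..<int q}. alpha T 0 e)" by (rule sum_mono) (rule alpha_lower)
  also have "\<dots> = Om T" using alpha_window[of T 0 0] by simp
  finally show ?thesis using mult_pos_pos[OF T(1) xy(1)] by linarith
qed

lemma cos_w: "cos (S (i + 1) (e + 1) - S i e - sm i e) > 0"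
  using up_ratio[of i e] cos_sm[of i e] by (metis exp_gt_zero zero_less_divide_iff not_less_iff_gr_or_eq)

lemma w_bound: "\<bar>S (i + 1) (e + 1) - S i e - sm i e\<bar> < pi / 2"
proof -
  let ?w = "S (i + 1) (e + 1) - S i e - sm i e"
  have b: "- (pi/2) < ?w" "?w < 3 * pi / 2" using ac_bounds(1-3)[of i e] sm_bound[of i e] by auto
  have "?w < pi / 2"
  proof (rule ccontr)
    assume "\<not> ?w < pi / 2"
    then have "cos (?w - pi) \<ge> 0" using b by (intro cos_ge_zero) auto
    then show False using cos_w[of i e] by (simp add: cos_diff)
  qed
  then show ?thesis using b by linarith
qed

lemma ln_up: "G (i + 1) (e + 1) - G i e = ln (cos (S (i + 1) (e + 1) - S i e - sm i e)) - ln (cos (sm i e))"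
proof -
  have "G (i + 1) (e + 1) - G i e = ln (cos (S (i + 1) (e + 1) - S i e - sm i e) / cos (sm i e))"
    by (subst up_ratio[symmetric]) simp
  then show ?thesis using cos_sm[of i e] cos_w[of i e] by (simp add: ln_div)
qed

text \<open>Along the sinusoid of phase \<open>sm i e\<close>, logarithm plus \<open>T\<close> times
  angle exceeds its value at the vertex by at most \<open>saw_H T (sm i e)\<close>, because
  \<open>ln (cos w) + T * w\<close> is largest at \<open>w = arctan T\<close>. The shortfall at the
  actual target is a \<open>saw_H\<close> for \<open>- T\<close>, and it is the same when measured
  from either end of the time step.\<close>

lemma target_gap:
  "saw_H T (sm i e) - (Lam T (i + 1) (e + 1) - Lam T i e) = saw_H (- T) (S (i + 1) (e + 1) - S i e - sm i e)"
  "saw_H T (sp i e) - (Lam T (i + 1) (e + 1) - Lam T i (e + 1)) = saw_H (- T) (S (i + 1) (e + 1) - S i e - sm i e)"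
proof -
  show "saw_H T (sm i e) - (Lam T (i + 1) (e + 1) - Lam T i e) = saw_H (- T) (S (i + 1) (e + 1) - S i e - sm i e)"
    using ln_up[of i e] unfolding Lam_def saw_H_def by (simp add: arctan_minus algebra_simps)
  then show "saw_H T (sp i e) - (Lam T (i + 1) (e + 1) - Lam T i (e + 1)) = saw_H (- T) (S (i + 1) (e + 1) - S i e - sm i e)"
    using alpha_eq[of T i e] unfolding alpha_def by linarith
qed

lemma target_le:
  "Lam T (i + 1) (e + 1) - Lam T i e \<le> saw_H T (sm i e)"
  "Lam T (i + 1) (e + 1) - Lam T i (e + 1) \<le> saw_H T (sp i e)"
  using target_gap[of i e] saw_H_nonneg[OF w_bound[of i e], of "- T"] by linarith+

definition "slack i e = alpha T i e / 2 * ((saw_H T (sm i e) - (Lam T (i + 1) (e + 1) - Lam T i e))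
     + (saw_H T (sp i e) - (Lam T (i + 1) (e + 1) - Lam T i (e + 1))))"

text \<open>The two sources of loss at level \<open>i\<close>: the inequality for chains of slopes, and targets that lie below
  their best position.\<close>

definition "deficit i = (((saw_H T (N + x))\<^sup>2 - (saw_H T N)\<^sup>2
     - (\<Sum>e\<in>{0..<int q}. (saw_H T (sp i e))\<^sup>2 - (saw_H T (sm i e))\<^sup>2)) / 2 + (\<Sum>e\<in>{0..<int q}. slack i e)) / Om T"

lemma slack_nonneg: "0 \<le> slack i e"
  unfolding slack_def using alpha_nonneg[of i e] target_le[of i e] by simp

lemma deficit_nonneg: "0 \<le> deficit i"
  unfolding deficit_def using saw_facts(3)[of i] Om_pos
  by (intro divide_nonneg_pos add_nonneg_nonneg sum_nonneg slack_nonneg) auto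

lemma slack_zero:
  assumes "deficit i = 0" shows "slack i e = 0"
proof -
  have per: "slack i (e + int q) = slack i e" for e
  proof -
    have r: "e + int q + 1 = (e + 1) + int q" by simp
    show ?thesis unfolding slack_def alpha_def r Lam_q periodic_sm_sp by simp
  qed
  have "(\<Sum>e\<in>{0..<int q}. slack i e) \<le> deficit i * Om T"
    unfolding deficit_def using saw_facts(3)[of i] Om_pos by simp
  moreover have "(\<Sum>e'\<in>{e..<e + int q}. slack i e') = (\<Sum>e\<in>{0..<int q}. slack i e)"
    by (rule sum_periodic_int) (rule per)
  moreover have "slack i e \<le> (\<Sum>e'\<in>{e..<e + int q}. slack i e')"
    using q0 by (intro member_le_sum slack_nonneg) auto
  ultimately show ?thesis using assms slack_nonneg[of i e] by simp
qed

text \<open>Up to the shortfall, the height of the target is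
  \<open>Lam T i e + saw_H T (sm i e)\<close> and also
  \<open>Lam T i (e + 1) + saw_H T (sp i e)\<close>. As \<open>alpha\<close> is both the drop of
  \<open>Lam T\<close> and the increment of \<open>saw_H T\<close>, its product with the mean of the
  two expressions is a sum of half differences of squares; those of \<open>Lam T\<close>
  telescope.\<close>

lemma window_average:
  "(\<Sum>e\<in>{t..<t + int q}. alpha T i e * Lam T (i + 1) (e + 1)) = Om T * (Lam T i t + saw_H T N - deficit i)"
proof -
  have e1: "alpha T i e * Lam T (i + 1) (e + 1) =
      ((Lam T i e)\<^sup>2 - (Lam T i (e + 1))\<^sup>2) / 2 + ((saw_H T (sp i e))\<^sup>2 - (saw_H T (sm i e))\<^sup>2) / 2 - slack i e" for e
  proof -
    have 1: "(Lam T i e)\<^sup>2 - (Lam T i (e + 1))\<^sup>2 = alpha T i e * (Lam T i e + Lam T i (e + 1))"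
      unfolding alpha_eq by (simp add: power2_eq_square algebra_simps)
    have 2: "(saw_H T (sp i e))\<^sup>2 - (saw_H T (sm i e))\<^sup>2 = alpha T i e * (saw_H T (sp i e) + saw_H T (sm i e))"
      unfolding alpha_def by (simp add: power2_eq_square algebra_simps)
    show ?thesis unfolding 1 2 slack_def by (simp add: field_simps)
  qed
  have "(\<Sum>e\<in>{t..<t + int q}. alpha T i e * Lam T (i + 1) (e + 1)) =
     (\<Sum>e\<in>{t..<t + int q}. (Lam T i e)\<^sup>2 - (Lam T i (e + 1))\<^sup>2) / 2
      + (\<Sum>e\<in>{t..<t + int q}. (saw_H T (sp i e))\<^sup>2 - (saw_H T (sm i e))\<^sup>2) / 2
      - (\<Sum>e\<in>{t..<t + int q}. slack i e)"
    unfolding e1 sum_divide_distrib by (simp only: sum.distrib sum_subtractf)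
  also have "(\<Sum>e\<in>{t..<t + int q}. (Lam T i e)\<^sup>2 - (Lam T i (e + 1))\<^sup>2) = (Lam T i t)\<^sup>2 - (Lam T i t - Om T)\<^sup>2"
  proof -
    have "(\<Sum>e\<in>{t..<t + int q}. (Lam T i e)\<^sup>2 - (Lam T i (e + 1))\<^sup>2) = (\<Sum>e<q. (Lam T i (t + int e))\<^sup>2 - (Lam T i (t + int (Suc e)))\<^sup>2)"
      unfolding sum_int_window_nat by (simp add: add.commute add.left_commute)
    also have "\<dots> = (Lam T i (t + int 0))\<^sup>2 - (Lam T i (t + int q))\<^sup>2" by (rule sum_lessThan_telescope')
    finally show ?thesis using Lam_q by simp
  qed
  also have "(\<Sum>e\<in>{t..<t + int q}. (saw_H T (sp i e))\<^sup>2 - (saw_H T (sm i e))\<^sup>2) = (\<Sum>e\<in>{0..<int q}. (saw_H T (sp i e))\<^sup>2 - (saw_H T (sm i e))\<^sup>2)"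
    by (rule sum_periodic_int) (simp add: periodic_sm_sp)
  also have "(\<Sum>e\<in>{t..<t + int q}. slack i e) = (\<Sum>e\<in>{0..<int q}. slack i e)"
  proof (rule sum_periodic_int)
    fix e
    have r: "e + int q + 1 = (e + 1) + int q" by simp
    show "slack i (e + int q) = slack i e" unfolding slack_def alpha_def r Lam_q periodic_sm_sp by simp
  qed
  also have "(\<Sum>e\<in>{0..<int q}. (saw_H T (sp i e))\<^sup>2 - (saw_H T (sm i e))\<^sup>2) / 2
     = ((saw_H T N + Om T)\<^sup>2 - (saw_H T N)\<^sup>2) / 2 - Om T * deficit i + (\<Sum>e\<in>{0..<int q}. slack i e)"
    unfolding deficit_def using Om_pos Om_eq[of T] by (simp add: field_simps)
  finally show ?thesis by (simp add: power2_eq_square field_simps)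
qed

text \<open>\<open>lift f e\<close> is the first time after \<open>f\<close> that is congruent to \<open>e\<close> modulo \<open>q\<close>.\<close>

definition "lift f e = f + 1 + ((e - f - 1) mod int q)"
definition "climb i f e = Lam T (i + 1) (lift f e + 1) - Lam T i (f + 1)"

lemma lift_bounds: "f < lift f e" "lift f e \<le> f + int q"
proof -
  have "0 \<le> (e - f - 1) mod int q" "(e - f - 1) mod int q < int q" using q0 by auto
  then show "f < lift f e" "lift f e \<le> f + int q" unfolding lift_def by linarith+
qed

lemma lift_cong: "lift f e mod int q = e mod int q"
proof -
  have "(f + 1 + ((e - f - 1) mod int q)) mod int q = (f + 1 + (e - f - 1)) mod int q" by (rule mod_add_right_eq)
  then show ?thesis by (simp add: lift_def)
qed

lemma lift_unique:
  assumes "f < c" "c \<le> f + int q" "c mod int q = e mod int q"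
  shows "lift f e = c"
proof -
  have "(e - f - 1) mod int q = (c - f - 1) mod int q" using assms(3) by (metis mod_diff_left_eq)
  also have "\<dots> = c - f - 1" using assms by (intro mod_pos_pos_trivial) auto
  finally show ?thesis unfolding lift_def by simp
qed

lemma Lam_shift: "Lam T i (t + int q * k) = Lam T i t - real_of_int k * Om T"
proof -
  have up: "Lam T i (t + int q * int k) = Lam T i t - real k * Om T" for t k
  proof (induction k)
    case (Suc k)
    have "t + int q * int (Suc k) = (t + int q * int k) + int q" by (simp add: algebra_simps)
    then have "Lam T i (t + int q * int (Suc k)) = Lam T i (t + int q * int k) - Om T" by (simp only: Lam_q)
    then show ?case using Suc by (simp add: algebra_simps)
  qed auto
  show ?thesis
  proof (cases "k \<ge> 0")
    case True then show ?thesis using up[of t "nat k"] by simp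
  next
    case False
    then show ?thesis using up[of "t + int q * k" "nat (- k)"] by (simp add: algebra_simps)
  qed
qed

lemma climb_shift: "climb i (f + int q * k) e = climb i f e"
proof -
  have "lift (f + int q * k) e = lift f e + int q * k"
    by (rule lift_unique) (use lift_bounds[of f e] lift_cong[of f e] in auto)
  then have "lift (f + int q * k) e + 1 = (lift f e + 1) + int q * k" "f + int q * k + 1 = (f + 1) + int q * k" by auto
  then show ?thesis unfolding climb_def by (simp only: Lam_shift)
qed

lemma climb_average: "(\<Sum>e\<in>{0..<int q}. alpha T i e / Om T * climb i f e) = saw_H T N - deficit i"
proof -
  have "(\<Sum>e\<in>{0..<int q}. alpha T i e * climb i f e) = (\<Sum>e\<in>{f + 1..<f + 1 + int q}. alpha T i e * climb i f e)"
  proof (rule sum_periodic_int[symmetric])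
    fix e
    have "lift f (e + int q) = lift f e"
      by (rule lift_unique) (use lift_bounds lift_cong in auto)
    then show "alpha T i (e + int q) * climb i f (e + int q) = alpha T i e * climb i f e"
      by (simp add: climb_def alpha_def periodic_sm_sp)
  qed
  also have "\<dots> = (\<Sum>e\<in>{f + 1..<f + 1 + int q}. alpha T i e * Lam T (i + 1) (e + 1) - alpha T i e * Lam T i (f + 1))"
  proof (rule sum.cong[OF refl])
    fix e assume "e \<in> {f + 1..<f + 1 + int q}"
    then have "lift f e = e" by (intro lift_unique) auto
    then show "alpha T i e * climb i f e = alpha T i e * Lam T (i + 1) (e + 1) - alpha T i e * Lam T i (f + 1)"
      by (simp add: climb_def algebra_simps)
  qed
  also have "\<dots> = (\<Sum>e\<in>{f + 1..<f + 1 + int q}. alpha T i e * Lam T (i + 1) (e + 1)) - Om T * Lam T i (f + 1)"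
    by (simp add: sum_subtractf sum_distrib_right[symmetric] alpha_window)
  also have "\<dots> = Om T * (saw_H T N - deficit i)" unfolding window_average by (simp add: algebra_simps)
  finally have "(\<Sum>e\<in>{0..<int q}. alpha T i e * climb i f e) / Om T = saw_H T N - deficit i"
    using Om_pos by (simp add: field_simps)
  then show ?thesis by (simp add: sum_divide_distrib)
qed

text \<open>The start is the phase of the last level moved back by \<open>s\<close>, in accordance
  with the shift \<open>(d, s)\<close>. This closes the levels to a cycle in which each climb
  depends only on the phases of its own level and of the level before.\<close>

primrec chase :: "(nat \<Rightarrow> int) \<Rightarrow> nat \<Rightarrow> int" where
  "chase E 0 = E (d - 1) - int s"
| "chase E (Suc i) = lift (chase E i) (E i)"

lemma chase_sum: "(\<Sum>i<k. climb (int i) (chase E i) (E i)) = Lam T (int k) (chase E k + 1) - Lam T 0 (chase E 0 + 1)"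
  by (induction k) (auto simp: climb_def add.commute)

text \<open>After \<open>d\<close> lifts the time agrees with \<open>E (d - 1)\<close> modulo
  \<open>q\<close> and exceeds it by at most \<open>q * d - s < q\<close>, hence not at all.\<close>

lemma chase_end: "\<exists>m::nat. chase E d = E (d - 1) - int q * int m"
proof -
  have "d = Suc (d - 1)" using d2 by simp
  then have "chase E d = lift (chase E (d - 1)) (E (d - 1))" by (metis chase.simps(2))
  then have c: "E (d - 1) mod int q = chase E d mod int q" using lift_cong by simp
  then have "int q dvd E (d - 1) - chase E d" by (simp add: mod_eq_dvd_iff)
  then obtain m where m: "E (d - 1) - chase E d = int q * m" by (auto simp: dvd_def)
  have "chase E k \<le> chase E 0 + int q * int k" for k
  proof (induction k)
    case (Suc k)
    then show ?case using lift_bounds(2)[of "chase E k" "E k"] by (auto simp: algebra_simps)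
  qed auto
  from this[of d] have "chase E d \<le> E (d - 1) - int s + int q * int d" by simp
  moreover have "int q * int d < int s + int q"
  proof -
    have "d = Suc (d - 1)" using d2 by simp
    then have "q * d = q * (d - 1) + q" by (metis mult_Suc_right add.commute)
    then have "q * d < s + q" using s(1) by simp
    then show ?thesis by (metis of_nat_add of_nat_less_iff of_nat_mult)
  qed
  ultimately have mq: "int q * m > - int q" using m by linarith
  have "m > - 1"
  proof (rule ccontr)
    assume "\<not> m > - 1"
    then have "int q * m \<le> int q * (- 1)" by (intro mult_left_mono) auto
    then show False using mq by simp
  qed
  then show ?thesis using m by (intro exI[of _ "nat m"]) auto
qed

text \<open>Draw the phases \<open>E i\<close> modulo \<open>q\<close> independently with probabilities \<open>alpha T i e / Om T\<close>. Climbing through the levels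
  along these phases gains \<open>saw_H T N - deficit i\<close> on average at level \<open>i\<close>, and after \<open>d\<close> levels each outcome
  has gained at least \<open>T d y - s L\<close>.\<close>

theorem climb_bound:
  "T * real d * y - real s * L \<le> real d * saw_H T N - (\<Sum>i<d. deficit (int i))"
proof -
  let ?w = "\<lambda>i e. alpha T (int i) e / Om T"
  define D where "D = (\<lambda>i f e. if i = 0 then climb (int i) (f - int s) e else climb (int i) f e)"
  define pr where "pr = (\<lambda>i. if i = 0 then d - 1 else i - 1)"
  define Y where "Y = T * real d * y - real s * L"
  let ?P = "PiE {..<d} (\<lambda>_. {0..<int q})"
  let ?W = "\<lambda>E. \<Prod>i<d. ?w i (E i)"
  have w0: "0 \<le> ?w i e" for i e using alpha_nonneg[of "int i" e] Om_pos by simp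
  have w1: "(\<Sum>e\<in>{0..<int q}. ?w i e) = 1" for i
    using alpha_window[of T "int i" 0] Om_pos by (simp add: sum_divide_distrib[symmetric])
  have avg: "(\<Sum>E\<in>?P. ?W E * (\<Sum>i<d. D i (E (pr i)) (E i))) \<le> (\<Sum>i<d. saw_H T N - deficit (int i))"
  proof (rule independent_pairs_sum)
    show "(\<Sum>e\<in>{0..<int q}. ?w i e * D i f e) \<le> saw_H T N - deficit (int i)" for i f
      using climb_average[of "int i"] by (cases "i = 0") (auto simp: D_def)
    show "pr i \<in> {..<d} \<and> pr i \<noteq> i" if "i \<in> {..<d}" for i using that d2 by (auto simp: pr_def)
  qed (use w0 w1 in auto)
  have Dc: "D i (E (pr i)) (E i) = climb (int i) (chase E i) (E i)" if "i < d" for i E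
  proof (cases i)
    case 0
    then show ?thesis by (simp add: D_def pr_def)
  next
    case (Suc j)
    have "int q dvd E j - chase E i" using lift_cong[of "chase E j" "E j"] Suc by (simp add: mod_eq_dvd_iff dvd_diff_commute)
    then obtain k where "E j = chase E i + int q * k" by (auto simp: dvd_def algebra_simps)
    then have "climb (int i) (E j) (E i) = climb (int i) (chase E i) (E i)" by (simp only: climb_shift)
    then show ?thesis using Suc by (simp add: D_def pr_def)
  qed
  have ex: "Y \<le> (\<Sum>i<d. D i (E (pr i)) (E i))" for E
  proof -
    obtain m :: nat where m: "chase E d = E (d - 1) - int q * int m" using chase_end by blast
    have "(\<Sum>i<d. D i (E (pr i)) (E i)) = (\<Sum>i<d. climb (int i) (chase E i) (E i))"
      using Dc by (intro sum.cong) auto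
    also have "\<dots> = Lam T (int d) (chase E d + 1) - Lam T 0 (chase E 0 + 1)" by (rule chase_sum)
    also have "Lam T (int d) (chase E d + 1) = Lam T (0 + int d) ((E (d - 1) - int s + 1 + int q * (- int m)) + int s)"
      unfolding m by (simp add: algebra_simps)
    also have "\<dots> = Lam T 0 (E (d - 1) - int s + 1 + int q * (- int m)) + Y" unfolding Lam_d Y_def by simp
    also have "\<dots> = Lam T 0 (E (d - 1) - int s + 1) + real m * Om T + Y" unfolding Lam_shift by simp
    finally show ?thesis using Om_pos by simp
  qed
  have sW: "(\<Sum>E\<in>?P. ?W E) = 1"
  proof -
    have "(\<Sum>E\<in>?P. ?W E) = (\<Prod>i<d. \<Sum>e\<in>{0..<int q}. ?w i e)" by (rule prod_sum_PiE[symmetric]) auto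
    then show ?thesis using w1 by simp
  qed
  have "Y = (\<Sum>E\<in>?P. ?W E * Y)" unfolding sum_distrib_right[symmetric] sW by simp
  also have "\<dots> \<le> (\<Sum>E\<in>?P. ?W E * (\<Sum>i<d. D i (E (pr i)) (E i)))"
    using w0 by (intro sum_mono mult_left_mono ex prod_nonneg) auto
  also note avg
  finally show ?thesis by (simp add: Y_def sum_subtractf)
qed

lemma climb_bound': "T * real d * y - real s * L \<le> real d * saw_H T N"
  using climb_bound sum_nonneg[of "{..<d}" "\<lambda>i. deficit (int i)"] deficit_nonneg by force

lemma Lam_antitone: "t \<le> t' \<Longrightarrow> Lam T i t' \<le> Lam T i t"
proof (induction t' rule: int_ge_induct)
  case (step t')
  then show ?case using alpha_eq[of T i t'] alpha_nonneg[of i t'] by linarith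
qed simp

text \<open>The deterministic counterpart of the random climb: the weights \<open>alpha\<close> are
  nonnegative with positive total, so in every window some target is no higher than the
  average.\<close>

lemma climb_exists: "\<exists>t'. t' \<le> t + int q * int k \<and> Lam T (i + int k) t' \<le> Lam T i t + real k * saw_H T N"
proof (induction k)
  case 0
  show ?case by (intro exI[of _ t]) simp
next
  case (Suc k)
  then obtain t' where t': "t' \<le> t + int q * int k" "Lam T (i + int k) t' \<le> Lam T i t + real k * saw_H T N" by blast
  let ?j = "i + int k" and ?v = "Lam T (i + int k) t' + saw_H T N"
  have "\<exists>e\<in>{t'..<t' + int q}. Lam T (?j + 1) (e + 1) \<le> ?v"
  proof (rule ccontr)
    assume c: "\<not> ?thesis"
    have nn: "\<forall>e\<in>{t'..<t' + int q}. 0 \<le> alpha T ?j e * (Lam T (?j + 1) (e + 1) - ?v)"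
      using c alpha_nonneg by (auto intro!: mult_nonneg_nonneg)
    have "(\<Sum>e\<in>{t'..<t' + int q}. alpha T ?j e * (Lam T (?j + 1) (e + 1) - ?v))
        = Om T * (?v - deficit ?j) - Om T * ?v"
      unfolding right_diff_distrib sum_subtractf window_average by (simp add: alpha_window flip: sum_distrib_right)
    also have "\<dots> \<le> 0" using deficit_nonneg[of ?j] Om_pos by (simp add: right_diff_distrib)
    finally have "(\<Sum>e\<in>{t'..<t' + int q}. alpha T ?j e * (Lam T (?j + 1) (e + 1) - ?v)) = 0"
      using sum_nonneg[of "{t'..<t' + int q}" "\<lambda>e. alpha T ?j e * (Lam T (?j + 1) (e + 1) - ?v)"] nn by force
    then have "\<forall>e\<in>{t'..<t' + int q}. alpha T ?j e * (Lam T (?j + 1) (e + 1) - ?v) = 0"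
      using nn by (subst (asm) sum_nonneg_eq_0_iff) auto
    then have "\<forall>e\<in>{t'..<t' + int q}. alpha T ?j e = 0" using c by force
    then have "(\<Sum>e\<in>{t'..<t' + int q}. alpha T ?j e) = 0" by simp
    then show False using alpha_window[of T ?j t'] Om_pos by simp
  qed
  then obtain e where e: "e \<in> {t'..<t' + int q}" "Lam T (?j + 1) (e + 1) \<le> ?v" by blast
  show ?case
  proof (intro exI[of _ "e + 1"] conjI)
    show "e + 1 \<le> t + int q * int (Suc k)" using e t' by (simp add: algebra_simps)
    have "i + int (Suc k) = ?j + 1" by simp
    then show "Lam T (i + int (Suc k)) (e + 1) \<le> Lam T i t + real (Suc k) * saw_H T N"
      using e(2) t'(2) by (simp add: algebra_simps)
  qed
qed

text \<open>A vanishing \<open>c\<close> would allow a climb through all levels that pays for only \<open>d - 1\<close> of them.\<close>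

lemma c_lower:
  "T * real d * y - real s * L - (real d - 1) * saw_H T N \<le> (S (i + 1) (t + 1) - S i t) * (tan (N + x) + T)"
proof -
  obtain t' where t': "t' \<le> t + 1 + int q * int (d - 1)" "Lam T (i + 1 + int (d - 1)) t' \<le> Lam T (i + 1) (t + 1) + real (d - 1) * saw_H T N"
    using climb_exists by blast
  have "int (q * (d - 1)) < int s" using s(1) by (simp only: of_nat_less_iff)
  then have "t' \<le> t + int s" using t'(1) by simp
  then have "Lam T (i + int d) (t + int s) \<le> Lam T (i + int d) t'" by (rule Lam_antitone)
  moreover have "i + 1 + int (d - 1) = i + int d" "real (d - 1) = real d - 1" using d2 by auto
  ultimately have 1: "Lam T i t + (T * real d * y - real s * L) \<le> Lam T (i + 1) (t + 1) + (real d - 1) * saw_H T N"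
    using t'(2) unfolding Lam_d by simp
  let ?c = "S (i + 1) (t + 1) - S i t"
  have c0: "0 < ?c" by (rule ac_bounds)
  have wb: "\<bar>?c - sm i t\<bar> < pi / 2" by (rule w_bound)
  \<comment> \<open>The climb from \<open>(i, t)\<close> to \<open>(i + 1, t + 1)\<close> is a
    concave function of \<open>?c\<close> that vanishes at \<open>?c = 0\<close>; it lies below its
    tangent there, which has slope \<open>tan (sm i t) + T\<close>.\<close>
  have "saw_H (- T) (?c - sm i t) \<ge> saw_H (- T) (- sm i t) + (tan (- sm i t) + - T) * (?c - sm i t - - sm i t)"
    by (rule saw_H_tangent) (use wb sm_bound[of i t] in auto)
  then have 2: "ln (cos (?c - sm i t)) + T * (?c - sm i t) \<le> ln (cos (sm i t)) - T * sm i t + (tan (sm i t) + T) * ?c"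
    unfolding saw_H_def by (simp add: algebra_simps)
  have "Lam T (i + 1) (t + 1) - Lam T i t = ln (cos (?c - sm i t)) - ln (cos (sm i t)) + T * ?c"
    unfolding Lam_def using ln_up[of i t] by (simp add: algebra_simps)
  also have "\<dots> \<le> (tan (sm i t) + T) * ?c" using 2 by (simp add: algebra_simps)
  also have "\<dots> \<le> (tan (N + x) + T) * ?c"
  proof -
    have "sm i t \<le> N + x" using saw_facts(2)[of i t] sp_bound(2)[of i t] by linarith
    moreover have "\<bar>N + x\<bar> < pi / 2" using N_props xy by linarith
    ultimately have "tan (sm i t) \<le> tan (N + x)" using tan_mono_abs[OF sm_bound, of "N + x" i t] by (cases "sm i t = N + x") auto
    then show ?thesis using c0 by (intro mult_right_mono) auto
  qed
  finally show ?thesis using 1 by (simp add: algebra_simps)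
qed

end

end

subsection \<open>The Karpelevich curve in polar form\<close>

text \<open>The curve \<open>karp_g = 0\<close> is the Karpelevich--Ito curve in the polar coordinates \<open>exp (- L) *\<^sub>R cis \<theta>\<close>, with the
  parameter \<open>\<alpha>\<close> eliminated; \<open>karp_V\<close> is the form of the same inequality that the optimal slope
  \<open>T = tan (y - N)\<close> yields.\<close>

definition karp_g :: "nat \<Rightarrow> nat \<Rightarrow> nat \<Rightarrow> real \<Rightarrow> real \<Rightarrow> real \<Rightarrow> real" where
  "karp_g q d s x y L = exp (- (real s / real d) * L) * sin x + exp (- (real q * L)) * sin y - sin (x + y)"

definition karp_V :: "nat \<Rightarrow> nat \<Rightarrow> nat \<Rightarrow> real \<Rightarrow> real \<Rightarrow> real \<Rightarrow> real" where
  "karp_V q d s x y L = real d * (ln (cos (y - cut_N x (real q * L))) - ln (cos (cut_N x (real q * L)))) + real s * L"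

lemma cos_pos_abs: "\<bar>w\<bar> < pi / 2 \<Longrightarrow> cos w > 0" by (intro cos_gt_zero_pi) auto

text \<open>Write \<open>x + y = (y - N) + (N + x)\<close> and eliminate \<open>cos (N + x)\<close>
  by the equation for \<open>N\<close>. What remains compares two positive quantities, and
  \<open>karp_V\<close> compares their logarithms.\<close>

lemma karp_g_ident:
  assumes x: "0 < x" "x < pi" and K: "0 < real q * L"
  defines "N \<equiv> cut_N x (real q * L)"
  shows "karp_g q d s x y L = sin x * (exp (- (real s / real d) * L) - cos (y - N) / cos N)"
proof -
  note P = cut_N_props[OF x K, folded N_def]
  have cN: "cos N > 0" by (rule cos_pos_abs[OF P(3)])
  have "sin (x + y) * cos N = sin y * cos (N + x) + sin x * cos (y - N)"
  proof -
    have "sin (x + y) = sin (y - N + (N + x))" by (simp add: add.commute)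
    also have "\<dots> = sin (y - N) * cos (N + x) + cos (y - N) * sin (N + x)" by (rule sin_add)
    finally have "sin (x + y) * cos N = (sin (y - N) * cos N) * cos (N + x) + cos (y - N) * (sin (N + x) * cos N)"
      by (simp add: algebra_simps)
    also have "sin (y - N) * cos N = sin y - cos (y - N) * sin N" using sin_add[of "y - N" N] by simp
    also have "sin (N + x) * cos N = sin x + cos (N + x) * sin N" using sin_diff[of "N + x" N] by simp
    finally show ?thesis by (simp add: algebra_simps)
  qed
  then have "sin (x + y) = sin y * exp (- (real q * L)) + sin x * (cos (y - N) / cos N)"
    unfolding P(4) using cN by (simp add: field_simps)
  then show ?thesis unfolding karp_g_def by (simp add: algebra_simps)
qed

lemma karp_V_iff:
  assumes x: "0 < x" "x < pi" and K: "0 < real q * L" and d: "0 < d"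
  defines "N \<equiv> cut_N x (real q * L)"
  assumes yN: "\<bar>y - N\<bar> < pi / 2"
  shows "karp_V q d s x y L \<ge> 0 \<longleftrightarrow> karp_g q d s x y L \<le> 0"
    "karp_V q d s x y L = 0 \<longleftrightarrow> karp_g q d s x y L = 0"
proof -
  note P = cut_N_props[OF x K, folded N_def]
  have c: "cos N > 0" "cos (y - N) > 0" using cos_pos_abs[OF P(3)] cos_pos_abs[OF yN] by auto
  have sx: "sin x > 0" using x by (rule sin_gt_zero)
  have l: "ln (cos (y - N)) - ln (cos N) = ln (cos (y - N) / cos N)" using c by (simp add: ln_div)
  have r: "cos (y - N) / cos N = exp (ln (cos (y - N) / cos N))" using c by simp
  have V: "karp_V q d s x y L = real d * (ln (cos (y - N) / cos N) - (- (real s / real d) * L))"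
    unfolding karp_V_def N_def[symmetric] l using d by (simp add: field_simps)
  have g: "karp_g q d s x y L = sin x * (exp (- (real s / real d) * L) - exp (ln (cos (y - N) / cos N)))"
    using karp_g_ident[OF x K, of d s y] unfolding N_def[symmetric] r[symmetric] .
  show "karp_V q d s x y L \<ge> 0 \<longleftrightarrow> karp_g q d s x y L \<le> 0"
    unfolding V g using d sx by (simp add: zero_le_mult_iff mult_le_0_iff) linarith
  show "karp_V q d s x y L = 0 \<longleftrightarrow> karp_g q d s x y L = 0"
    unfolding V g using d sx by auto
qed

lemma saw_H_tan:
  assumes "\<bar>w\<bar> < pi / 2"
  shows "saw_H (tan w) N = - ln (cos N) + tan w * N + (ln (cos w) + tan w * w)"
  using arctan_tan[of w] assms unfolding saw_H_def by auto

context level_system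
begin

text \<open>The derivative of \<open>T * y - saw_H T N\<close> in \<open>T\<close> is
  \<open>y - N - arctan T\<close>, so the climbing inequality is strongest at
  \<open>T = tan (y - N)\<close>, where it reads \<open>karp_V \<ge> 0\<close>. The first claim says
  that this slope is below \<open>sqrt 3\<close>.\<close>

lemma V_nonneg:
  assumes y: "0 < y" and xy3: "x + y < 2 * pi / 3"
  shows "y - N < pi / 3" "\<bar>y - N\<bar> < pi / 2" "karp_V q d s x y L \<ge> 0"
proof -
  have d0: "0 < d" using d2 by simp
  have path: "0 \<le> real d * saw_H T N - (T * real d * y - real s * L)" if T: "0 < tan N + T" "T \<le> sqrt 3" for T
    using climb_bound'[OF T] by linarith
  \<comment> \<open>If \<open>y - N \<ge> pi / 3\<close>, the optimal slope is not admissible, but \<open>T = sqrt 3\<close> is already contradictory.\<close>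
  have tan3: "tan (pi / 3) = sqrt 3" by (rule tan_60)
  have N1: "- (pi / 3) < N" using N_props(1) xy3 y by linarith
  have tanN: "tan N > - sqrt 3"
  proof -
    have "tan (- (pi / 3)) < tan N" by (rule tan_mono_abs) (use N_props N1 in auto)
    then show ?thesis using tan3 by simp
  qed
  show y3: "y - N < pi / 3"
  proof (rule ccontr)
    assume "\<not> y - N < pi / 3"
    define N' where "N' = y - pi / 3"
    have NN: "N \<le> N'" using \<open>\<not> y - N < pi / 3\<close> by (simp add: N'_def)
    have Nx: "N' + x < pi / 3" using xy3 by (simp add: N'_def)
    \<comment> \<open>Up to constants, \<open>F\<close> is the climbing inequality for
      \<open>T = sqrt 3\<close> with \<open>L\<close> eliminated by
      \<open>real q * L = ln (cos N) - ln (cos (N + x))\<close>. It increases in \<open>w\<close>,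
      so \<open>N\<close> may be replaced by \<open>N'\<close>; there \<open>s < q * d\<close> gives
      the opposite sign.\<close>
    define F where "F = (\<lambda>w. real d * (- ln (cos w) + sqrt 3 * w) + real s / real q * (ln (cos w) - ln (cos (w + x))))"
    have "F N \<le> F N'"
    proof (rule DERIV_nonneg_imp_nondecreasing[OF NN])
      fix w assume w: "N \<le> w" "w \<le> N'"
      have b: "\<bar>w\<bar> < pi / 2" "\<bar>w + x\<bar> < pi / 2" using w N1 Nx xy(1) by linarith+
      have c: "cos w > 0" "cos (w + x) > 0" using b by (auto intro: cos_pos_abs)
      have "((\<lambda>w. - ln (cos w) + sqrt 3 * w) has_real_derivative tan w + sqrt 3) (at w)"
        "((\<lambda>w. ln (cos w) - ln (cos (w + x))) has_real_derivative tan (w + x) - tan w) (at w)"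
        using c by (auto intro!: derivative_eq_intros simp: tan_def field_simps)
      then have "(F has_real_derivative real d * (tan w + sqrt 3) + real s / real q * (tan (w + x) - tan w)) (at w)"
        unfolding F_def by (rule DERIV_add[OF DERIV_cmult DERIV_cmult])
      moreover have "tan w + sqrt 3 \<ge> 0" using tanN tan_mono_abs[OF N_props(3) b(1)] w by (cases "w = N") auto
      moreover have "tan (w + x) - tan w \<ge> 0" using tan_mono_abs[OF b] xy(1) by auto
      ultimately show "\<exists>y. (F has_real_derivative y) (at w) \<and> 0 \<le> y"
        by (intro exI[of _ "real d * (tan w + sqrt 3) + real s / real q * (tan (w + x) - tan w)"]) auto
    qed
    moreover have "0 \<le> real d * saw_H (tan (pi/3)) N - (tan (pi/3) * real d * y - real s * L)"
      by (rule path) (use tanN tan3 in auto)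
    then have "0 \<le> F N + real d * (ln (cos (pi / 3)) + sqrt 3 * (pi / 3)) - sqrt 3 * real d * y"
    proof -
      have cN: "cos N > 0" by (rule cos_pos_abs[OF N_props(3)])
      have "real q * L = ln (cos N) - ln (cos (N + x))" unfolding N_props(4) using cN by (simp add: ln_mult)
      then have "real s * L = real s / real q * (ln (cos N) - ln (cos (N + x)))" using q0 by (metis (no_types, opaque_lifting) mult.assoc nonzero_eq_divide_eq of_nat_0_less_iff order_less_irrefl times_divide_eq_left times_divide_eq_right mult.commute)
      moreover have p3: "\<bar>pi / 3\<bar> < pi / 2" by simp
      moreover have h: "saw_H (sqrt 3) N = - ln (cos N) + sqrt 3 * N + (ln (cos (pi / 3)) + sqrt 3 * (pi / 3))"
        using saw_H_tan[OF p3, of N] unfolding tan3 .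
      ultimately show ?thesis using \<open>0 \<le> real d * saw_H (tan (pi/3)) N - (tan (pi/3) * real d * y - real s * L)\<close>
        unfolding tan3 F_def h by (simp add: algebra_simps)
    qed
    ultimately have F0: "0 \<le> F N' + real d * (ln (cos (pi / 3)) + sqrt 3 * (pi / 3)) - sqrt 3 * real d * y" by linarith
    have b: "\<bar>N'\<bar> < pi / 2" "\<bar>N' + x\<bar> < pi / 3" "0 < N' + x" "\<bar>N' + x\<bar> < pi / 2" using NN N1 Nx xy(1) N_props(1) by linarith+
    have "cos (pi / 3) < cos (N' + x)" using b Nx by (intro cos_monotone_0_pi) auto
    then have l1: "ln (cos (pi / 3)) < ln (cos (N' + x))" by (subst ln_less_cancel_iff) (auto simp: cos_60)
    have "cos (N' + x) < cos N'"
    proof (cases "N' \<ge> 0")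
      case True then show ?thesis using b xy(1) by (intro cos_monotone_0_pi) auto
    next
      case False
      have "cos (N' + x) < cos (- N')" using False b NN N_props(1) by (intro cos_monotone_0_pi) linarith+
      then show ?thesis by simp
    qed
    then have l2: "ln (cos N') - ln (cos (N' + x)) > 0" using cos_pos_abs[OF b(1)] cos_pos_abs[OF b(4)] by simp
    have sq: "real s / real q < real d" using s(2) q0 by (simp add: field_simps) (metis of_nat_less_iff of_nat_mult mult.commute)
    have "F N' + real d * (ln (cos (pi / 3)) + sqrt 3 * (pi / 3)) - sqrt 3 * real d * y
        = real d * (ln (cos (pi / 3)) - ln (cos N')) + real s / real q * (ln (cos N') - ln (cos (N' + x)))"
      unfolding F_def N'_def by (simp add: algebra_simps)
    also have "\<dots> < real d * (ln (cos (pi / 3)) - ln (cos N')) + real d * (ln (cos N') - ln (cos (N' + x)))"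
      using mult_strict_right_mono[OF sq l2] by linarith
    also have "\<dots> = real d * (ln (cos (pi / 3)) - ln (cos (N' + x)))" by (simp add: algebra_simps)
    also have "\<dots> < 0" using l1 d0 by (simp add: mult_pos_neg)
    finally show False using F0 by simp
  qed
  show yb: "\<bar>y - N\<bar> < pi / 2" using y3 y N_props by linarith
  have "0 \<le> real d * saw_H (tan (y - N)) N - (tan (y - N) * real d * y - real s * L)"
  proof (rule path)
    have "tan (- N) < tan (y - N)" by (rule tan_mono_abs) (use N_props yb y in auto)
    then show "0 < tan N + tan (y - N)" by simp
    have "tan (y - N) < tan (pi / 3)" by (rule tan_mono_abs) (use yb y3 in auto)
    then show "tan (y - N) \<le> sqrt 3" using tan3 by simp
  qed
  then show "karp_V q d s x y L \<ge> 0"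
    unfolding saw_H_tan[OF yb] karp_V_def N_def[symmetric] by (simp add: algebra_simps)
qed

lemma g_nonpos:
  assumes "0 < y" "x + y < 2 * pi / 3"
  shows "karp_g q d s x y L \<le> 0"
  using V_nonneg[OF assms] karp_V_iff(1)[OF xy(1,2), of q L d y s] d2 xy(3) q0 unfolding N_def by auto

end

subsection \<open>Perron vectors preserving convexity\<close>

lemma compact_box_nat: "compact {h :: nat \<Rightarrow> real. \<forall>k. h k \<in> {0..1}}"
proof -
  have "compactin (product_topology (\<lambda>_. euclidean) UNIV) (PiE (UNIV::nat set) (\<lambda>_. {0..1::real}))"
    by (subst compactin_PiE) auto
  moreover have "PiE (UNIV::nat set) (\<lambda>_. {0..1::real}) = {h. \<forall>k. h k \<in> {0..1}}" by auto
  ultimately show ?thesis by (simp add: euclidean_product_topology)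
qed

lemma periodic_mod_int:
  fixes f :: "int \<Rightarrow> 'a"
  assumes "\<And>k. f (k + int n) = f k"
  shows "f (k + int n * j) = f k" "f (k mod int n) = f k"
proof -
  have up: "f (k + int n * int j) = f k" for k j
  proof (induction j)
    case (Suc j)
    then show ?case using assms[of "k + int n * int j"] by (simp add: algebra_simps)
  qed auto
  have g: "f (k + int n * j) = f k" for k j
  proof (cases "j \<ge> 0")
    case True then show ?thesis using up[of k "nat j"] by simp
  next
    case False then show ?thesis using up[of "k + int n * j" "nat (- j)"] by simp
  qed
  show "f (k + int n * j) = f k" by (rule g)
  have "f (k mod int n + int n * (k div int n)) = f (k mod int n)" by (rule g)
  then show "f (k mod int n) = f k" by simp
qed

text \<open>\<open>P\<close> and \<open>Q\<close> stand for the interpolation weights of an image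
  point on its side, and \<open>bend g k \<ge> 0\<close> for convexity at vertex \<open>k\<close> of
  the polygon with gauge values \<open>g\<close>. With abstract coefficients the problem is visibly
  linear.\<close>

locale cyclic_matrix =
  fixes n :: nat and \<sigma> :: int and P Q A B E :: "int \<Rightarrow> real"
  assumes n0: "0 < n"
    and per: "\<And>k. P (k + int n) = P k" "\<And>k. Q (k + int n) = Q k" "\<And>k. A (k + int n) = A k"
      "\<And>k. B (k + int n) = B k" "\<And>k. E (k + int n) = E k"
    and pos: "\<And>k. 0 < P k" "\<And>k. 0 < Q k"
begin

definition spread :: "(int \<Rightarrow> real) \<Rightarrow> int \<Rightarrow> real" where
  "spread g k = P k * g (k + \<sigma>) + Q k * g (k + \<sigma> + 1)"

definition bend :: "(int \<Rightarrow> real) \<Rightarrow> int \<Rightarrow> real" where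
  "bend g k = A k * g (k - 1) + B k * g (k + 1) - E k * g k"

definition cyc :: "(int \<Rightarrow> real) \<Rightarrow> bool" where "cyc g \<longleftrightarrow> (\<forall>k. g (k + int n) = g k)"

lemma cyc_spread: "cyc g \<Longrightarrow> cyc (spread g)"
  unfolding cyc_def spread_def using per by (metis (no_types, opaque_lifting) add.assoc add.commute)

lemma spread_scale: "spread (\<lambda>k. c * g k) = (\<lambda>k. c * spread g k)"
  unfolding spread_def by (auto simp: algebra_simps)

lemma spread_diff: "spread (\<lambda>k. g k - h k) = (\<lambda>k. spread g k - spread h k)"
  unfolding spread_def by (auto simp: algebra_simps)

text \<open>In the \<open>j\<close>-th iterate the entry \<open>k\<close> has positive weight on all
  of \<open>k + j * \<sigma>, ..., k + j * \<sigma> + j\<close>; for \<open>j = n\<close> this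
  window meets every residue class modulo \<open>n\<close>.\<close>

lemma iter_pos:
  assumes "cyc g" "\<And>k. 0 \<le> g k" "0 < g k0"
  shows "0 < (spread ^^ n) g k"
proof -
  have nn: "0 \<le> (spread ^^ j) g k" for j k
    using assms(2) by (induction j arbitrary: k) (auto simp: spread_def intro!: add_nonneg_nonneg mult_nonneg_nonneg less_imp_le[OF pos(1)] less_imp_le[OF pos(2)])
  have reach: "0 \<le> i \<Longrightarrow> i \<le> int j \<Longrightarrow> 0 < g (k + int j * \<sigma> + i) \<Longrightarrow> 0 < (spread ^^ j) g k" for i j k
  proof (induction j arbitrary: i k)
    case (Suc j)
    show ?case
    proof (cases "i \<le> int j")
      case True
      have "0 < (spread ^^ j) g (k + \<sigma>)" using Suc.prems True by (intro Suc.IH[of i]) (auto simp: algebra_simps)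
      then have "0 < P k * (spread ^^ j) g (k + \<sigma>)" using pos by simp
      moreover have "0 \<le> Q k * (spread ^^ j) g (k + \<sigma> + 1)" using nn[of j "k + \<sigma> + 1"] pos(2)[of k] by simp
      moreover have "(spread ^^ Suc j) g k = P k * (spread ^^ j) g (k + \<sigma>) + Q k * (spread ^^ j) g (k + \<sigma> + 1)"
        by (simp only: funpow.simps comp_def) (rule spread_def)
      ultimately show ?thesis by linarith
    next
      case False
      have "0 < (spread ^^ j) g (k + \<sigma> + 1)" using Suc.prems False by (intro Suc.IH[of "i - 1"]) (auto simp: algebra_simps)
      then have "0 < Q k * (spread ^^ j) g (k + \<sigma> + 1)" using pos by simp
      moreover have "0 \<le> P k * (spread ^^ j) g (k + \<sigma>)" using nn[of j "k + \<sigma>"] pos(1)[of k] by simp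
      moreover have "(spread ^^ Suc j) g k = P k * (spread ^^ j) g (k + \<sigma>) + Q k * (spread ^^ j) g (k + \<sigma> + 1)"
        by (simp only: funpow.simps comp_def) (rule spread_def)
      ultimately show ?thesis by linarith
    qed
  qed auto
  have p: "g (k + int n) = g k" for k using assms(1) by (simp add: cyc_def)
  define i where "i = (k0 - k - int n * \<sigma>) mod int n"
  have "(k + int n * \<sigma> + i) mod int n = k0 mod int n"
    unfolding i_def mod_add_right_eq by simp
  then have "g (k + int n * \<sigma> + i) = g k0" using periodic_mod_int(2)[of g n, OF p] by metis
  moreover have "0 \<le> i" "i \<le> int n" using n0 by (auto simp: i_def less_imp_le)
  ultimately show ?thesis using reach[of i n k] assms(3) by simp
qed

text \<open>Compactness gives a least \<open>\<Lambda>\<close> for which some normalised nonnegative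
  vector with \<open>bend \<ge> 0\<close> satisfies \<open>spread g \<le> \<Lambda> * g\<close>. If
  one row were strict, \<open>n\<close> applications of \<open>spread\<close> would make all rows
  strict and preserve \<open>bend \<ge> 0\<close>, so a smaller factor would do. Minimising over
  convex vectors only is what makes the eigenvector convex.\<close>

theorem perron_vector:
  assumes pres: "\<And>g. cyc g \<Longrightarrow> (\<And>k. 0 \<le> bend g k) \<Longrightarrow> (\<And>k. 0 \<le> bend (spread g) k)"
    and g0: "cyc g0" "\<And>k. 0 < g0 k" "\<And>k. 0 \<le> bend g0 k" "\<And>k. spread g0 k \<le> \<Lambda>0 * g0 k"
  shows "\<exists>g \<Lambda>. cyc g \<and> (\<forall>k. 0 < g k) \<and> (\<forall>k. 0 \<le> bend g k) \<and> (\<forall>k. spread g k = \<Lambda> * g k) \<and> \<Lambda> \<le> \<Lambda>0 \<and> 0 < \<Lambda>"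
proof -
  define ex where "ex = (\<lambda>h::nat \<Rightarrow> real. \<lambda>k::int. h (nat (k mod int n)))"
  have cex: "cyc (ex h)" for h by (simp add: cyc_def ex_def)
  define F where "F = {p :: real \<times> (nat \<Rightarrow> real). (\<Sum>k<n. snd p k) = 1 \<and> (\<forall>k. 0 \<le> bend (ex (snd p)) k) \<and>
      (\<forall>k. spread (ex (snd p)) k \<le> fst p * ex (snd p) k)}"
  define X where "X = ({0..\<Lambda>0} \<times> {h :: nat \<Rightarrow> real. \<forall>k. h k \<in> {0..1}}) \<inter> F"
  have cont: "continuous_on UNIV (\<lambda>p :: real \<times> (nat \<Rightarrow> real). snd p k)" for k
    by (rule continuous_on_product_then_coordinatewise) (intro continuous_intros)
  have cont': "continuous_on UNIV (\<lambda>p :: real \<times> (nat \<Rightarrow> real). ex (snd p) k)" for k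
    unfolding ex_def by (rule cont)
  have "closed F"
    unfolding F_def bend_def spread_def
    by (intro closed_Collect_conj closed_Collect_all closed_Collect_eq closed_Collect_le continuous_intros cont cont')
  then have cX: "compact X" unfolding X_def by (intro compact_Int_closed compact_Times compact_box_nat compact_Icc)
  have norm: "\<exists>h. (\<Lambda>, h) \<in> X \<and> (\<exists>c>0. \<forall>k. ex h k = c * g k)" if g: "cyc g" "\<And>k. 0 \<le> g k" "0 < g k0"
      "\<And>k. 0 \<le> bend g k" "\<And>k. spread g k \<le> \<Lambda> * g k" "0 \<le> \<Lambda>" "\<Lambda> \<le> \<Lambda>0" for g \<Lambda> k0
  proof -
    have p: "g (k + int n) = g k" for k using g(1) by (simp add: cyc_def)
    define s where "s = (\<Sum>k<n. g (int k))"
    have "g (k0 mod int n) = g k0" by (rule periodic_mod_int(2)) (rule p)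
    then have "0 < g (int (nat (k0 mod int n)))" using g(3) n0 by simp
    moreover have "nat (k0 mod int n) < n" using n0 by (simp add: nat_less_iff)
    ultimately have s: "0 < s" unfolding s_def using g(2) by (intro sum_pos2[of _ "nat (k0 mod int n)"]) auto
    define h where "h = (\<lambda>k::nat. if k < n then g (int k) / s else 0)"
    have exh: "ex h k = (1/s) * g k" for k
    proof -
      have "nat (k mod int n) < n" using n0 by (simp add: nat_less_iff)
      then have "ex h k = g (k mod int n) / s" using n0 by (simp add: ex_def h_def)
      then show ?thesis using periodic_mod_int(2)[of g n, OF p] by simp
    qed
    have "h k \<in> {0..1}" for k
    proof (cases "k < n")
      case True
      have "g (int k) \<le> s" unfolding s_def using g(2) True by (intro member_le_sum) auto
      then show ?thesis using True g(2)[of "int k"] s by (simp add: h_def)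
    qed (simp add: h_def)
    moreover have "(\<Sum>k<n. h k) = 1" using s by (simp add: h_def s_def sum_divide_distrib[symmetric])
    moreover have "bend (ex h) k \<ge> 0" for k
    proof -
      have "bend (ex h) k = (1/s) * bend g k" unfolding bend_def exh by (simp add: algebra_simps diff_divide_distrib add_divide_distrib)
      then show ?thesis using g(4)[of k] s by simp
    qed
    moreover have "spread (ex h) k \<le> \<Lambda> * ex h k" for k
    proof -
      have "spread (ex h) k = (1/s) * spread g k" unfolding spread_def exh by (simp add: algebra_simps add_divide_distrib)
      moreover have "(1/s) * spread g k \<le> (1/s) * (\<Lambda> * g k)" using g(5)[of k] s by (intro mult_left_mono) auto
      ultimately show ?thesis unfolding exh by (simp add: algebra_simps)
    qed
    ultimately have "(\<Lambda>, h) \<in> X" using g(6,7) by (auto simp: X_def F_def)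
    moreover have "\<exists>c>0. \<forall>k. ex h k = c * g k" using exh s by (intro exI[of _ "1/s"]) auto
    ultimately show ?thesis by blast
  qed
  have L0: "0 \<le> \<Lambda>0"
  proof -
    have "0 < spread g0 0" unfolding spread_def using pos g0(2) by (intro add_pos_pos mult_pos_pos) auto
    then have "0 < \<Lambda>0 * g0 0" using g0(4)[of 0] by linarith
    then show ?thesis using g0(2)[of 0] by (simp add: zero_less_mult_iff)
  qed
  have "X \<noteq> {}" using norm[OF g0(1) less_imp_le[OF g0(2)] g0(2) g0(3) g0(4) L0] by auto
  then obtain p where p: "p \<in> X" "\<And>p'. p' \<in> X \<Longrightarrow> fst p \<le> fst p'"
    using continuous_attains_inf[OF cX _ continuous_on_fst[OF continuous_on_id]] by (auto simp: id_def)
  define \<Lambda> g where "\<Lambda> = fst p" and "g = ex (snd p)"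
  have cg: "cyc g" unfolding g_def by (rule cex)
  have L: "0 \<le> \<Lambda>" "\<Lambda> \<le> \<Lambda>0" and gF: "\<And>k. 0 \<le> bend g k" "\<And>k. spread g k \<le> \<Lambda> * g k" and sum1: "(\<Sum>k<n. snd p k) = 1"
    and g_nn: "\<And>k. 0 \<le> g k"
    using p(1) unfolding X_def F_def \<Lambda>_def g_def ex_def by (auto simp: mem_Times_iff)
  obtain k1 where k1: "0 < g k1"
  proof -
    have "\<exists>k<n. 0 < snd p k"
    proof (rule ccontr)
      assume "\<not> (\<exists>k<n. 0 < snd p k)"
      then have "(\<Sum>k<n. snd p k) \<le> 0" by (intro sum_nonpos) (meson lessThan_iff not_less)
      then show False using sum1 by simp
    qed
    then obtain k where "k < n" "0 < snd p k" by auto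
    then have "0 < g (int k)" by (simp add: g_def ex_def)
    then show ?thesis using that by blast
  qed
  have citer: "cyc ((spread ^^ j) g)" for j using cg cyc_spread by (induction j) auto
  have bend_iter: "0 \<le> bend ((spread ^^ j) g) k" for j k
    using gF(1) pres[OF citer] by (induction j arbitrary: k) auto
  have gp: "0 < (spread ^^ n) g k" for k by (rule iter_pos[OF cg g_nn k1])
  have tight: "spread g k = \<Lambda> * g k" for k
  proof (rule ccontr)
    assume ne: "spread g k \<noteq> \<Lambda> * g k"
    define sl where "sl = (\<lambda>k. \<Lambda> * g k - spread g k)"
    have slnn: "0 \<le> sl k" for k using gF(2)[of k] by (simp add: sl_def)
    have slk: "0 < sl k" using ne gF(2)[of k] by (simp add: sl_def)
    have csl: "cyc sl" using cg cyc_spread[OF cg] by (simp add: sl_def cyc_def)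
    define G where "G = (spread ^^ n) g"
    have "(spread ^^ j) sl = (\<lambda>k. \<Lambda> * (spread ^^ j) g k - spread ((spread ^^ j) g) k)" for j
    proof (induction j)
      case (Suc j)
      then show ?case by (simp add: spread_diff spread_scale)
    qed (simp add: sl_def)
    then have slp: "spread G k < \<Lambda> * G k" for k
      using iter_pos[OF csl slnn slk, of k] by (simp add: G_def)
    have Gp: "0 < G k" for k unfolding G_def by (rule gp)
    define \<Lambda>' where "\<Lambda>' = Max ((\<lambda>k. spread G (int k) / G (int k)) ` {..<n})"
    have fin: "finite ((\<lambda>k. spread G (int k) / G (int k)) ` {..<n})" "(\<lambda>k. spread G (int k) / G (int k)) ` {..<n} \<noteq> {}"
      using n0 by auto
    have "\<Lambda>' < \<Lambda>" unfolding \<Lambda>'_def using slp Gp by (subst Max_less_iff[OF fin]) (auto simp: field_simps)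
    moreover have le: "spread G k \<le> \<Lambda>' * G k" for k
    proof -
      have pG: "G (k + int n) = G k" "spread G (k + int n) = spread G k" for k
        using citer cyc_spread[OF citer] by (auto simp: G_def cyc_def)
      have "nat (k mod int n) < n" using n0 by (simp add: nat_less_iff)
      then have "spread G (int (nat (k mod int n))) / G (int (nat (k mod int n))) \<le> \<Lambda>'"
        unfolding \<Lambda>'_def by (intro Max_ge[OF fin(1)] image_eqI[where x="nat (k mod int n)"]) simp_all
      then have "spread G (k mod int n) / G (k mod int n) \<le> \<Lambda>'" using n0 by simp
      then have "spread G k / G k \<le> \<Lambda>'"
        using periodic_mod_int(2)[of G n, OF pG(1)] periodic_mod_int(2)[of "spread G" n, OF pG(2)] by simp
      then show ?thesis using Gp[of k] by (simp add: field_simps)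
    qed
    moreover have "0 \<le> \<Lambda>'"
    proof -
      have "0 < spread G 0" unfolding spread_def using pos Gp by (intro add_pos_pos mult_pos_pos) auto
      then have "0 < \<Lambda>' * G 0" using le[of 0] by linarith
      then show ?thesis using Gp[of 0] by (simp add: zero_less_mult_iff)
    qed
    ultimately have "\<exists>h. (\<Lambda>', h) \<in> X"
      using norm[of G 0 \<Lambda>'] citer[of n] Gp bend_iter[of n] L by (auto simp: G_def less_imp_le)
    then obtain h where "(\<Lambda>', h) \<in> X" by blast
    then have "fst p \<le> fst (\<Lambda>', h)" by (rule p(2))
    then show False using \<open>\<Lambda>' < \<Lambda>\<close> by (simp add: \<Lambda>_def)
  qed
  have gpos: "0 < g k" for k
  proof -
    have "(spread ^^ j) g = (\<lambda>k. \<Lambda> ^ j * g k)" for j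
    proof (induction j)
      case (Suc j)
      have "(spread ^^ Suc j) g = spread (\<lambda>k. \<Lambda> ^ j * g k)" by (simp only: funpow.simps comp_def Suc)
      then show ?case unfolding spread_scale tight by (simp add: mult_ac)
    qed simp
    then have "0 < \<Lambda> ^ n * g k" using gp[of k] by simp
    then show ?thesis using L(1) g_nn[of k] by (simp add: zero_less_mult_iff)
  qed
  have "0 < spread g 0" unfolding spread_def using pos gpos by (intro add_pos_pos mult_pos_pos) auto
  then have "0 < \<Lambda>" using tight[of 0] gpos[of 0] by (simp add: zero_less_mult_iff)
  then show ?thesis using cg gpos gF(1) tight L by blast
qed

end

section \<open>Sinusoids through two points as sides of a polygon\<close>

lemma sin_three_term:
  fixes u v w q :: real
  shows "sin (w - v) * sin (q - u) + sin (v - u) * sin (q - w) = sin (w - u) * sin (q - v)"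
proof -
  have 1: "sin (w - v) * sin (q - u) = (cos (w - v - (q - u)) - cos (w - v + (q - u))) / 2" by (rule sin_times_sin)
  have 2: "sin (v - u) * sin (q - w) = (cos (v - u - (q - w)) - cos (v - u + (q - w))) / 2" by (rule sin_times_sin)
  have 3: "sin (w - u) * sin (q - v) = (cos (w - u - (q - v)) - cos (w - u + (q - v))) / 2" by (rule sin_times_sin)
  have "cos (v - u + (q - w)) = cos (w - v - (q - u))" using cos_minus[of "w - v - (q - u)"] by (simp add: algebra_simps)
  moreover have "v - u - (q - w) = w - u - (q - v)" "w - v + (q - u) = w - u + (q - v)" by simp_all
  ultimately show ?thesis unfolding 1 2 3 by argo
qed

text \<open>The combination of \<open>cos\<close> and \<open>sin\<close> with the values
  \<open>ga\<close> at \<open>a\<close> and \<open>gb\<close> at \<open>b\<close>. As a function of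
  the polar angle, the gauge of a polygon has this form along each side.\<close>

definition sin_chord :: "real \<Rightarrow> real \<Rightarrow> real \<Rightarrow> real \<Rightarrow> real \<Rightarrow> real" where
  "sin_chord a b ga gb w = (sin (b - w) * ga + sin (w - a) * gb) / sin (b - a)"

lemma sin_chord_three:
  "sin (w - v) * sin_chord a b ga gb u + sin (v - u) * sin_chord a b ga gb w = sin (w - u) * sin_chord a b ga gb v"
proof -
  have 1: "sin (w - v) * sin (b - u) + sin (v - u) * sin (b - w) = sin (w - u) * sin (b - v)"
    by (rule sin_three_term)
  have "sin (w - v) * sin (u - a) + sin (v - u) * sin (w - a) = sin (w - u) * sin (v - a)"
    using sin_three_term[of w v a u] sin_minus[of "u - a"] sin_minus[of "w - a"] sin_minus[of "v - a"]
    by simp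
  then have "(sin (w - v) * sin (b - u) + sin (v - u) * sin (b - w)) * ga + (sin (w - v) * sin (u - a) + sin (v - u) * sin (w - a)) * gb
     = sin (w - u) * (sin (b - v) * ga + sin (v - a) * gb)" unfolding 1 by (simp add: algebra_simps)
  then show ?thesis unfolding sin_chord_def times_divide_eq_right add_divide_distrib[symmetric]
    by (simp add: algebra_simps)
qed

text \<open>Both chords agree at \<open>b\<close>, so their difference is a multiple of
  \<open>sin (w - b)\<close>; the coefficient measures the kink at \<open>b\<close> and is
  nonnegative for a convex polygon.\<close>

lemma sin_chord_extend:
  assumes "sin (b - a) \<noteq> 0" "sin (c - b) \<noteq> 0"
  shows "sin_chord b c gb gc w - sin_chord a b ga gb w =
     sin (w - b) * (sin (b - a) * gc + sin (c - b) * ga - sin (c - a) * gb) / (sin (b - a) * sin (c - b))"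
proof -
  have t: "sin (w - b) * sin (c - a) + sin (b - a) * sin (c - w) = sin (w - a) * sin (c - b)"
    by (rule sin_three_term)
  have m: "sin (b - w) = - sin (w - b)" using sin_minus[of "w - b"] by simp
  have "sin_chord b c gb gc w - sin_chord a b ga gb w =
    ((sin (c - w) * gb + sin (w - b) * gc) * sin (b - a) - (sin (b - w) * ga + sin (w - a) * gb) * sin (c - b)) / (sin (b - a) * sin (c - b))"
    unfolding sin_chord_def using assms by (simp add: field_simps)
  also have "(sin (c - w) * gb + sin (w - b) * gc) * sin (b - a) - (sin (b - w) * ga + sin (w - a) * gb) * sin (c - b)
     = sin (w - b) * (sin (b - a) * gc + sin (c - b) * ga) - (sin (w - a) * sin (c - b) - sin (b - a) * sin (c - w)) * gb"
    unfolding m by (simp add: algebra_simps)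
  also have "sin (w - a) * sin (c - b) - sin (b - a) * sin (c - w) = sin (w - b) * sin (c - a)" using t by simp
  finally show ?thesis by (simp add: algebra_simps)
qed

lemma sin_chord_ends:
  assumes "sin (b - a) \<noteq> 0"
  shows "sin_chord a b ga gb a = ga" "sin_chord a b ga gb b = gb"
  using assms by (auto simp: sin_chord_def)

text \<open>The points \<open>u \<le> v \<le> w\<close> lie on consecutive chords of a polygon whose gauge has the
  values \<open>g0, \<dots>, g3\<close> at the angles \<open>t0 < \<dots> < t3\<close>; convexity at the two inner vertices is inherited.\<close>

lemma sin_convex_inherit:
  fixes t0 t1 t2 t3 :: real
  assumes gaps: "0 < t1 - t0" "t1 - t0 < pi" "0 < t2 - t1" "t2 - t1 < pi" "0 < t3 - t2" "t3 - t2 < pi"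
    and k1: "0 \<le> sin (t2 - t1) * g0 + sin (t1 - t0) * g2 - sin (t2 - t0) * g1"
    and k2: "0 \<le> sin (t3 - t2) * g1 + sin (t2 - t1) * g3 - sin (t3 - t1) * g2"
    and u: "t0 \<le> u" "u \<le> t1" and w: "t2 \<le> w" "w \<le> t3" and v: "0 \<le> v - u" "v - u \<le> pi" "0 \<le> w - v" "w - v \<le> pi"
  shows "sin (w - u) * sin_chord t1 t2 g1 g2 v \<le>
     sin (w - v) * sin_chord t0 t1 g0 g1 u + sin (v - u) * sin_chord t2 t3 g2 g3 w"
proof -
  have s: "sin (t1 - t0) > 0" "sin (t2 - t1) > 0" "sin (t3 - t2) > 0" using gaps by (auto intro: sin_gt_zero)
  have "sin_chord t1 t2 g1 g2 u - sin_chord t0 t1 g0 g1 u =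
     sin (u - t1) * (sin (t1 - t0) * g2 + sin (t2 - t1) * g0 - sin (t2 - t0) * g1) / (sin (t1 - t0) * sin (t2 - t1))"
    using s by (intro sin_chord_extend) auto
  moreover have "sin (t1 - u) \<ge> 0" using u gaps by (intro sin_ge_zero) auto
  then have "sin (u - t1) \<le> 0" using sin_minus[of "t1 - u"] by simp
  ultimately have 1: "sin_chord t1 t2 g1 g2 u \<le> sin_chord t0 t1 g0 g1 u"
    using k1 s by (smt (verit, ccfv_SIG) divide_nonpos_pos mult_nonneg_nonpos mult_pos_pos mult.commute)
  have "sin_chord t2 t3 g2 g3 w - sin_chord t1 t2 g1 g2 w =
     sin (w - t2) * (sin (t2 - t1) * g3 + sin (t3 - t2) * g1 - sin (t3 - t1) * g2) / (sin (t2 - t1) * sin (t3 - t2))"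
    using s by (intro sin_chord_extend) auto
  moreover have "sin (w - t2) \<ge> 0" using w gaps by (intro sin_ge_zero) auto
  ultimately have 2: "sin_chord t1 t2 g1 g2 w \<le> sin_chord t2 t3 g2 g3 w"
    using k2 s by (smt (verit, ccfv_SIG) divide_nonneg_pos mult_nonneg_nonneg mult_pos_pos)
  have "sin (w - v) \<ge> 0" "sin (v - u) \<ge> 0" using v by (auto intro: sin_ge_zero)
  then have "sin (w - v) * sin_chord t1 t2 g1 g2 u + sin (v - u) * sin_chord t1 t2 g1 g2 w
     \<le> sin (w - v) * sin_chord t0 t1 g0 g1 u + sin (v - u) * sin_chord t2 t3 g2 g3 w"
    using 1 2 by (intro add_mono mult_left_mono) auto
  then show ?thesis unfolding sin_chord_three .
qed

section \<open>Arithmetic of the parameters and coordinates of the sector\<close>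

locale karp_params =
  fixes q d z n s p r :: nat
  assumes q2: "2 \<le> q" and d2: "2 \<le> d" and z: "1 \<le> z" "z \<le> q - 1" and coqz: "coprime q z"
    and n_def: "n = q * d" and s_def: "s = q * d - z"
    and p: "p \<in> {1..q - 1}" and pz: "[p * z = 1] (mod q)" and r_def: "r = (p * s + 1) div q"
begin

lemma z_less: "z < q" using z q2 by auto

lemma s_props: "s + z = n" "q * (d - 1) < s" "s < q * d" "3 \<le> s" "q < s"
proof -
  have "d = Suc (d - 1)" using d2 by simp
  then have e: "q * d = q * (d - 1) + q" by (metis mult_Suc_right add.commute)
  have ge: "q * 1 \<le> q * (d - 1)" using d2 by (intro mult_le_mono2) auto
  show "s + z = n" "q * (d - 1) < s" "s < q * d" using e z z_less ge by (auto simp: n_def s_def)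
  show "q < s" using e z_less ge unfolding s_def by linarith
  then show "3 \<le> s" using q2 by simp
qed

lemma q_dvd: "q dvd p * s + 1"
proof -
  have "[p * z = 1] (mod q)" by (rule pz)
  then have "int q dvd int p * int z - 1" by (simp add: cong_iff_dvd_diff cong_int_iff[symmetric])
  then have "int q dvd int p * int n - (int p * int z - 1)" unfolding n_def by (simp add: dvd_diff)
  moreover have "int p * int n - (int p * int z - 1) = int (p * s + 1)"
    using s_props(1) by (simp add: algebra_simps flip: of_nat_add of_nat_mult distrib_left)
  ultimately show ?thesis by (metis int_dvd_int_iff)
qed

lemma rq: "r * q = p * s + 1" using q_dvd by (simp add: r_def)

text \<open>The two identities that follow say that the level shifts \<open>(0, q)\<close> and
  \<open>(d, s)\<close> change the index \<open>i + \<sigma> * t\<close> by \<open>p * n\<close> and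
  \<open>r * n\<close>, that is, by \<open>p\<close> and \<open>r\<close> full turns of the
  \<open>n\<close> marks.\<close>

definition \<sigma> :: int where "\<sigma> = int (d * p)"

lemma sigma_q: "\<sigma> * int q = int p * int n" by (simp add: \<sigma>_def n_def)

lemma sigma_s: "int n * int r - \<sigma> * int s = int d"
proof -
  have "int n * int r = int d * int (r * q)" by (simp add: n_def)
  also have "\<dots> = int d * (int p * int s + 1)" unfolding rq by simp
  finally show ?thesis by (simp add: \<sigma>_def algebra_simps)
qed

lemma n_pos: "0 < n" "0 < q" "0 < d" "0 < s" using q2 d2 s_props by (auto simp: n_def)

end

locale karp_sector = karp_params +
  fixes \<theta> :: real
  assumes sector: "2 * pi * real p / real q < \<theta>" "\<theta> < 2 * pi * real r / real s"
begin

definition x where "x = real q * \<theta> - 2 * pi * real p"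
definition y where "y = (2 * pi * real r - real s * \<theta>) / real d"

lemma xy_sum: "real s * x + real n * y = 2 * pi"
proof -
  have "real n * y = real q * (2 * pi * real r - real s * \<theta>)" using n_pos by (simp add: y_def n_def)
  then have "real s * x + real n * y = 2 * pi * (real (r * q) - real p * real s)"
    by (simp add: x_def algebra_simps)
  then show ?thesis unfolding rq by simp
qed

lemma x_pos: "0 < x" using sector(1) n_pos by (simp add: x_def field_simps)
lemma y_pos: "0 < y" using sector(2) n_pos by (simp add: y_def field_simps)

text \<open>Comes from \<open>s \<ge> 3\<close> in \<open>s * x + n * y = 2 * pi\<close>; it is what
  later excludes \<open>y - N \<ge> pi / 3\<close>.\<close>

lemma xy_small: "x + y < 2 * pi / 3"
proof -
  have "real s * y < real n * y" using s_props(3) y_pos by (simp add: n_def del: of_nat_mult)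
  then have "real s * (x + y) < 2 * pi" using xy_sum by (simp add: distrib_left)
  moreover have "3 * (x + y) \<le> real s * (x + y)" using s_props(4) x_pos y_pos by (intro mult_right_mono) auto
  ultimately show ?thesis by simp
qed

lemma x_small: "x < 2 * pi / 3" "x < pi" "y < 2 * pi / 3" "y < pi" using xy_small y_pos x_pos pi_gt_zero by linarith+

lemma theta_q: "real q * \<theta> = x + 2 * pi * real p" by (simp add: x_def)
lemma theta_s: "real s * \<theta> = 2 * pi * real r - real d * y" using n_pos by (simp add: y_def)

end

lemma sin_add_less:
  fixes a c :: real
  assumes "0 < a" "0 < c" "a + c < pi"
  shows "sin (a + c) < sin a + sin c"
proof -
  have s: "sin a > 0" "sin c > 0" using assms by (auto intro: sin_gt_zero)
  have "cos a < 1" "cos c < 1" using assms cos_monotone_0_pi[of 0 a] cos_monotone_0_pi[of 0 c] by auto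
  then have "sin a * cos c < sin a" "cos a * sin c < sin c" using s by auto
  then show ?thesis by (simp add: sin_add)
qed

context karp_sector
begin

lemma eigen_levels:
  fixes \<psi> g :: "int \<Rightarrow> real"
  assumes psi_per: "\<And>k. \<psi> (k + int n) = \<psi> k + 2 * pi"
    and inc: "\<And>k. \<psi> k < \<psi> (k + 1)" and gap: "\<And>k. \<psi> (k + 1) - \<psi> k < pi"
    and lo: "\<And>j. \<psi> (j + \<sigma>) \<le> \<psi> j + \<theta>" and hi: "\<And>j. \<psi> j + \<theta> < \<psi> (j + \<sigma> + 1)"
    and g: "\<And>k. g (k + int n) = g k" "\<And>k. 0 < g k"
    and conv: "\<And>k. 0 \<le> sin (\<psi> (k + 1) - \<psi> k) * g (k - 1) + sin (\<psi> k - \<psi> (k - 1)) * g (k + 1) - sin (\<psi> (k + 1) - \<psi> (k - 1)) * g k"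
    and rows: "\<And>k. sin_chord (\<psi> (k + \<sigma>)) (\<psi> (k + \<sigma> + 1)) (g (k + \<sigma>)) (g (k + \<sigma> + 1)) (\<psi> k + \<theta>) = exp L * g k"
    and L: "0 < L"
  shows "level_system q d s (\<lambda>i t. \<psi> (i + \<sigma> * t) - real_of_int t * \<theta>)
    (\<lambda>i t. ln (g (i + \<sigma> * t)) - real_of_int t * L) x y L"
proof -
  have sg: "0 < sin (\<psi> (k + 1) - \<psi> k)" for k using inc[of k] gap[of k] by (intro sin_gt_zero) auto
  have ac: "0 \<le> \<psi> k + \<theta> - \<psi> (k + \<sigma>)" "0 < \<psi> (k + \<sigma> + 1) - (\<psi> k + \<theta>)"
    "\<psi> k + \<theta> - \<psi> (k + \<sigma>) < pi" "\<psi> (k + \<sigma> + 1) - (\<psi> k + \<theta>) < pi" for k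
    using lo[of k] hi[of k] gap[of "k + \<sigma>"] by auto
  have sac: "0 \<le> sin (\<psi> k + \<theta> - \<psi> (k + \<sigma>))" "0 < sin (\<psi> (k + \<sigma> + 1) - (\<psi> k + \<theta>))" for k
    using ac[of k] by (auto intro!: sin_gt_zero sin_ge_zero)
  define G where "G = (\<lambda>i t. ln (g (i + \<sigma> * t)) - real_of_int t * L)"
  define S where "S = (\<lambda>i t. \<psi> (i + \<sigma> * t) - real_of_int t * \<theta>)"
  have perj: "\<psi> (k + int n * j) = \<psi> k + 2 * pi * real_of_int j" for k j
  proof -
    have "(\<lambda>k. \<psi> k - 2 * pi * real_of_int k / real n) (k + int n * j) = (\<lambda>k. \<psi> k - 2 * pi * real_of_int k / real n) k"
      by (rule periodic_mod_int(1)) (use psi_per n_pos in \<open>simp add: field_simps\<close>)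
    then have "\<psi> (k + int n * j) - 2 * pi * real_of_int (k + int n * j) / real n = \<psi> k - 2 * pi * real_of_int k / real n" .
    moreover have "2 * pi * real_of_int (k + int n * j) / real n = 2 * pi * real_of_int k / real n + 2 * pi * real_of_int j"
      using n_pos by (simp add: field_simps)
    ultimately show ?thesis by simp
  qed
  have gj: "g (k + int n * j) = g k" for k j by (rule periodic_mod_int(1)) (rule g(1))
  have row: "sin (\<psi> (k + \<sigma> + 1) - (\<psi> k + \<theta>)) * g (k + \<sigma>) + sin (\<psi> k + \<theta> - \<psi> (k + \<sigma>)) * g (k + \<sigma> + 1)
     = exp L * g k * sin (\<psi> (k + \<sigma> + 1) - \<psi> (k + \<sigma>))" for k
    using rows[of k] sg[of "k + \<sigma>"] unfolding sin_chord_def by (simp add: field_simps)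
  have eG: "exp (G i t) = g (i + \<sigma> * t) * exp (- (real_of_int t * L))" for i t
    unfolding G_def diff_conv_add_uminus exp_add using g(2) by simp
  have eL: "exp (- ((real_of_int t + 1) * L)) * exp L = exp (- (real_of_int t * L))" for t
    unfolding exp_add[symmetric] by (simp add: algebra_simps)
  have "level_system q d s S G x y L"
  proof
    show "S i (t + int q) = S i t - x" for i t
    proof -
      have e: "i + \<sigma> * (t + int q) = (i + \<sigma> * t) + int n * int p" using sigma_q by (simp add: algebra_simps)
      then show ?thesis unfolding S_def e perj using theta_q by (simp add: algebra_simps)
    qed
    show "G i (t + int q) = G i t - real q * L" for i t
    proof -
      have e: "i + \<sigma> * (t + int q) = (i + \<sigma> * t) + int n * int p" using sigma_q by (simp add: algebra_simps)
      then show ?thesis unfolding G_def e gj by (simp add: algebra_simps)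
    qed
    show "S (i + int d) (t + int s) = S i t + real d * y" for i t
    proof -
      have e: "i + int d + \<sigma> * (t + int s) = (i + \<sigma> * t) + int n * int r" using sigma_s by (simp add: algebra_simps)
      then show ?thesis unfolding S_def e perj using theta_s by (simp add: algebra_simps)
    qed
    show "G (i + int d) (t + int s) = G i t - real s * L" for i t
    proof -
      have e: "i + int d + \<sigma> * (t + int s) = (i + \<sigma> * t) + int n * int r" using sigma_s by (simp add: algebra_simps)
      then show ?thesis unfolding G_def e gj by (simp add: algebra_simps)
    qed
    fix i t
    define k where "k = i + \<sigma> * t"
    have idx: "i + \<sigma> * (t + 1) = k + \<sigma>" "i + 1 + \<sigma> * (t + 1) = k + \<sigma> + 1" "i + 1 + \<sigma> * t = k + 1" "i + \<sigma> * t = k"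
      by (auto simp: k_def algebra_simps)
    note SS = S_def idx
    show "S i (t + 1) \<le> S i t" unfolding SS using ac(1)[of k] by (simp add: algebra_simps)
    show "S i t < S (i + 1) (t + 1)" unfolding SS using ac(2)[of k] by (simp add: algebra_simps)
    show "S (i + 1) t - S i t < pi" unfolding SS using gap[of k] by simp
    have d1: "S (i + 1) (t + 1) - S i (t + 1) = \<psi> (k + \<sigma> + 1) - \<psi> (k + \<sigma>)"
      "S (i + 1) (t + 1) - S i t = \<psi> (k + \<sigma> + 1) - (\<psi> k + \<theta>)"
      "S i t - S i (t + 1) = \<psi> k + \<theta> - \<psi> (k + \<sigma>)"
      "S (i + 1) t - S i t = \<psi> (k + 1) - \<psi> k"
      "S (i + 1) t - S (i + 1) (t + 1) = \<psi> (k + 1) + \<theta> - \<psi> (k + \<sigma> + 1)"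
      unfolding SS by (simp_all add: algebra_simps)
    define w where "w = exp (- (real_of_int (t + 1) * L))"
    have w: "w > 0" "exp (- (real_of_int t * L)) = w * exp L" using eL[of t] by (auto simp: w_def)
    have w': "exp (- (real_of_int (t + 1) * L)) = w" by (simp add: w_def)
    show "exp (G i t) * sin (S (i + 1) (t + 1) - S i (t + 1)) =
        sin (S (i + 1) (t + 1) - S i t) * exp (G i (t + 1)) + sin (S i t - S i (t + 1)) * exp (G (i + 1) (t + 1))"
    proof -
      have "g k * (w * exp L) * sin (\<psi> (k + \<sigma> + 1) - \<psi> (k + \<sigma>)) = w * (exp L * g k * sin (\<psi> (k + \<sigma> + 1) - \<psi> (k + \<sigma>)))" by simp
      then show ?thesis unfolding eG d1 idx w' w(2) row[symmetric] by (simp add: algebra_simps)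
    qed
    show "sin (S (i + 1) t - S i t) * exp (G (i + 1) (t + 1))
        \<le> sin (S (i + 1) t - S (i + 1) (t + 1)) * exp (G i t) + sin (S (i + 1) (t + 1) - S i t) * exp (G (i + 1) t)"
    proof -
      define m where "m = k + \<sigma>"
      define u v where "u = \<psi> k + \<theta>" and "v = \<psi> (k + 1) + \<theta>"
      have ee: "k + 1 + \<sigma> = m + 1" "m + 1 + 1 = m + 2" by (auto simp: m_def)
      \<comment> \<open>\<open>C\<close> prolongs the side from \<open>m\<close> to
        \<open>m + 1\<close>. The three-term identity at \<open>u\<close>,
        \<open>\<psi> (m + 1)\<close> and \<open>v\<close> expresses its value at the mark. At
        \<open>u\<close> the eigenvector equation applies; at \<open>v\<close>, beyond the mark,
        convexity puts \<open>C\<close> below the next side.\<close>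
      define C where "C = sin_chord (\<psi> m) (\<psi> (m + 1)) (g m) (g (m + 1))"
      have Cu: "C u = exp L * g k" using rows[of k] unfolding C_def u_def m_def by simp
      have Cm: "C (\<psi> (m + 1)) = g (m + 1)" unfolding C_def by (rule sin_chord_ends(2)) (use sg[of m] in auto)
      have "sin_chord (\<psi> (m + 1)) (\<psi> (m + 2)) (g (m + 1)) (g (m + 2)) v - C v =
         sin (v - \<psi> (m + 1)) * (sin (\<psi> (m + 1) - \<psi> m) * g (m + 2) + sin (\<psi> (m + 2) - \<psi> (m + 1)) * g m - sin (\<psi> (m + 2) - \<psi> m) * g (m + 1)) / (sin (\<psi> (m + 1) - \<psi> m) * sin (\<psi> (m + 2) - \<psi> (m + 1)))"
        unfolding C_def by (rule sin_chord_extend) (use sg[of m] sg[of "m + 1"] in \<open>auto simp: add.commute\<close>)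
      moreover have "0 \<le> sin (\<psi> (m + 1) - \<psi> m) * g (m + 2) + sin (\<psi> (m + 2) - \<psi> (m + 1)) * g m - sin (\<psi> (m + 2) - \<psi> m) * g (m + 1)"
        using conv[of "m + 1"] unfolding ee(2) by (simp add: add.commute)
      moreover have "0 \<le> sin (v - \<psi> (m + 1))"
        using sac(1)[of "k + 1"] unfolding ee(1) v_def by simp
      ultimately have "C v \<le> sin_chord (\<psi> (m + 1)) (\<psi> (m + 2)) (g (m + 1)) (g (m + 2)) v"
        using sg[of m] sg[of "m + 1"] ee(2) by (smt (verit, ccfv_SIG) divide_nonneg_pos mult_nonneg_nonneg mult_pos_pos)
      also have "\<dots> = exp L * g (k + 1)" using rows[of "k + 1"] unfolding v_def ee by simp
      finally have Cv: "C v \<le> exp L * g (k + 1)" .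
      have "sin (v - u) * C (\<psi> (m + 1)) = sin (v - \<psi> (m + 1)) * C u + sin (\<psi> (m + 1) - u) * C v"
        unfolding C_def by (rule sin_chord_three[symmetric])
      also have "\<dots> \<le> sin (v - \<psi> (m + 1)) * (exp L * g k) + sin (\<psi> (m + 1) - u) * (exp L * g (k + 1))"
        using Cu Cv sac(2)[of k] by (auto simp: u_def m_def intro!: mult_left_mono)
      finally have "w * (sin (v - u) * g (m + 1)) \<le> w * (sin (v - \<psi> (m + 1)) * (exp L * g k) + sin (\<psi> (m + 1) - u) * (exp L * g (k + 1)))"
        unfolding Cm using w(1) by (intro mult_left_mono) auto
      then show ?thesis unfolding eG d1 idx w' w(2) by (simp add: u_def v_def m_def algebra_simps)
    qed
  qed (use n_pos d2 s_props x_pos x_small L in auto)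
  then show ?thesis unfolding S_def G_def .
qed

text \<open>Strict inequalities make both weights of every row positive, as
  \<open>perron_vector\<close> requires, and \<open>sin_convex_inherit\<close> shows that a row
  application preserves convexity. The supersolution \<open>g0\<close> is only the starting vector
  that bounds the eigenvalue.\<close>

theorem strict_marks:
  fixes \<psi> :: "int \<Rightarrow> real" and g0 :: "int \<Rightarrow> real"
  assumes psi_per: "\<And>k. \<psi> (k + int n) = \<psi> k + 2 * pi"
    and inc: "\<And>k. \<psi> k < \<psi> (k + 1)" and gap: "\<And>k. \<psi> (k + 1) - \<psi> k < pi"
    and lo: "\<And>j. \<psi> (j + \<sigma>) < \<psi> j + \<theta>" and hi: "\<And>j. \<psi> j + \<theta> < \<psi> (j + \<sigma> + 1)"
    and g0: "\<And>k. g0 (k + int n) = g0 k" "\<And>k. 0 < g0 k"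
    and conv: "\<And>k. 0 \<le> sin (\<psi> (k + 1) - \<psi> k) * g0 (k - 1) + sin (\<psi> k - \<psi> (k - 1)) * g0 (k + 1) - sin (\<psi> (k + 1) - \<psi> (k - 1)) * g0 k"
    and rows: "\<And>k. sin_chord (\<psi> (k + \<sigma>)) (\<psi> (k + \<sigma> + 1)) (g0 (k + \<sigma>)) (g0 (k + \<sigma> + 1)) (\<psi> k + \<theta>) \<le> \<Lambda>0 * g0 k"
  shows "\<exists>L G. 0 < L \<and> exp L \<le> \<Lambda>0 \<and> level_system q d s (\<lambda>i t. \<psi> (i + \<sigma> * t) - real_of_int t * \<theta>) G x y L"
proof -
  define P where "P = (\<lambda>k. sin (\<psi> (k + \<sigma> + 1) - (\<psi> k + \<theta>)) / sin (\<psi> (k + \<sigma> + 1) - \<psi> (k + \<sigma>)))"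
  define Q where "Q = (\<lambda>k. sin (\<psi> k + \<theta> - \<psi> (k + \<sigma>)) / sin (\<psi> (k + \<sigma> + 1) - \<psi> (k + \<sigma>)))"
  define A where "A = (\<lambda>k. sin (\<psi> (k + 1) - \<psi> k))"
  define B where "B = (\<lambda>k. sin (\<psi> k - \<psi> (k - 1)))"
  define E where "E = (\<lambda>k. sin (\<psi> (k + 1) - \<psi> (k - 1)))"
  have sg: "0 < sin (\<psi> (k + 1) - \<psi> k)" for k using inc[of k] gap[of k] by (intro sin_gt_zero) auto
  have ac: "0 < \<psi> k + \<theta> - \<psi> (k + \<sigma>)" "0 < \<psi> (k + \<sigma> + 1) - (\<psi> k + \<theta>)"
    "\<psi> k + \<theta> - \<psi> (k + \<sigma>) < pi" "\<psi> (k + \<sigma> + 1) - (\<psi> k + \<theta>) < pi" for k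
    using lo[of k] hi[of k] gap[of "k + \<sigma>"] by auto
  have sac: "0 < sin (\<psi> k + \<theta> - \<psi> (k + \<sigma>))" "0 < sin (\<psi> (k + \<sigma> + 1) - (\<psi> k + \<theta>))" for k
    using ac[of k] by (auto intro!: sin_gt_zero)
  have psi_per': "\<psi> (k + int n + j) = \<psi> (k + j) + 2 * pi" "\<psi> (k + int n - j) = \<psi> (k - j) + 2 * pi"
    "\<psi> (k + int n + j + i) = \<psi> (k + j + i) + 2 * pi" for k j i
    using psi_per[of "k + j"] psi_per[of "k - j"] psi_per[of "k + j + i"] by (auto simp: algebra_simps)
  interpret cyclic_matrix n \<sigma> P Q A B E
  proof
    show "0 < P k" "0 < Q k" for k unfolding P_def Q_def using sg[of "k + \<sigma>"] sac[of k] by simp_all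
    have aux: "a + 2 * pi - (b + 2 * pi + t) = a - (b + t)" "a + 2 * pi + t - (b + 2 * pi) = a + t - b"
      "a + 2 * pi - (b + 2 * pi) = a - b" for a b t :: real by simp_all
    show "P (k + int n) = P k" "Q (k + int n) = Q k" "A (k + int n) = A k" "B (k + int n) = B k" "E (k + int n) = E k" for k
      by (simp_all only: P_def Q_def A_def B_def E_def psi_per' psi_per aux)
  qed (use n_pos in simp)
  have spread: "spread g k = sin_chord (\<psi> (k + \<sigma>)) (\<psi> (k + \<sigma> + 1)) (g (k + \<sigma>)) (g (k + \<sigma> + 1)) (\<psi> k + \<theta>)" for g k
    unfolding spread_def unfolding sin_chord_def P_def Q_def by (simp add: add_divide_distrib)
  have bendI: "0 \<le> bend g k \<longleftrightarrow> 0 \<le> sin (\<psi> (k + 1) - \<psi> k) * g (k - 1) + sin (\<psi> k - \<psi> (k - 1)) * g (k + 1) - sin (\<psi> (k + 1) - \<psi> (k - 1)) * g k" for g k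
    unfolding bend_def unfolding A_def B_def E_def by simp
  have "\<exists>g \<Lambda>. cyc g \<and> (\<forall>k. 0 < g k) \<and> (\<forall>k. 0 \<le> bend g k) \<and> (\<forall>k. spread g k = \<Lambda> * g k) \<and> \<Lambda> \<le> \<Lambda>0 \<and> 0 < \<Lambda>"
  proof (rule perron_vector[where ?g0.0=g0])
    fix g k assume g: "cyc g" "\<And>k. 0 \<le> bend g k"
    define m where "m = k + \<sigma>"
    have e: "k - 1 + \<sigma> = m - 1" "k - 1 + \<sigma> + 1 = m" "k + \<sigma> = m" "k + 1 + \<sigma> = m + 1" "m + 1 + 1 = m + 2" by (auto simp: m_def)
    have "sin (\<psi> (k + 1) + \<theta> - (\<psi> (k - 1) + \<theta>)) * sin_chord (\<psi> m) (\<psi> (m + 1)) (g m) (g (m + 1)) (\<psi> k + \<theta>) \<le>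
     sin (\<psi> (k + 1) + \<theta> - (\<psi> k + \<theta>)) * sin_chord (\<psi> (m - 1)) (\<psi> m) (g (m - 1)) (g m) (\<psi> (k - 1) + \<theta>)
      + sin (\<psi> k + \<theta> - (\<psi> (k - 1) + \<theta>)) * sin_chord (\<psi> (m + 1)) (\<psi> (m + 2)) (g (m + 1)) (g (m + 2)) (\<psi> (k + 1) + \<theta>)"
    proof (rule sin_convex_inherit)
      show "0 \<le> sin (\<psi> (m + 1) - \<psi> m) * g (m - 1) + sin (\<psi> m - \<psi> (m - 1)) * g (m + 1) - sin (\<psi> (m + 1) - \<psi> (m - 1)) * g m"
        using g(2)[of m] unfolding bendI .
      show "0 \<le> sin (\<psi> (m + 2) - \<psi> (m + 1)) * g m + sin (\<psi> (m + 1) - \<psi> m) * g (m + 2) - sin (\<psi> (m + 2) - \<psi> m) * g (m + 1)"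
        using g(2)[of "m + 1"] unfolding bendI by (simp add: add.commute)
    qed (use inc[of "m - 1"] inc[of m] inc[of "m + 1"] gap[of "m - 1"] gap[of m] gap[of "m + 1"] ac[of "k - 1"] ac[of k] ac[of "k + 1"]
        inc[of "k - 1"] inc[of k] gap[of "k - 1"] gap[of k] in \<open>simp_all add: e add.commute[of 1]\<close>)
    then show "0 \<le> bend (spread g) k" unfolding bendI spread e by simp
  qed (use g0 conv rows in \<open>auto simp: cyc_def bendI spread\<close>)
  then obtain g \<Lambda> where g: "\<And>k. g (k + int n) = g k" "\<And>k. 0 < g k" "\<And>k. 0 \<le> bend g k" "\<And>k. spread g k = \<Lambda> * g k"
    and L0: "\<Lambda> \<le> \<Lambda>0" "0 < \<Lambda>" unfolding cyc_def by blast
  \<comment> \<open>At a smallest entry of \<open>g\<close> the row exceeds that entry, because its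
    weights \<open>sin c / sin (a + c)\<close> and \<open>sin a / sin (a + c)\<close> add up to more
    than 1.\<close>
  have L1: "1 < \<Lambda>"
  proof -
    have fin: "finite (g ` {0..<int n})" "g ` {0..<int n} \<noteq> {}" using n_pos by auto
    then have "Min (g ` {0..<int n}) \<in> g ` {0..<int n}" by (rule Min_in)
    then obtain k where k: "k \<in> {0..<int n}" "g k = Min (g ` {0..<int n})" by auto
    have min: "g k \<le> g j" for j
    proof -
      have "g (j mod int n) \<in> g ` {0..<int n}" using n_pos by auto
      then have "g k \<le> g (j mod int n)" using k fin by simp
      then show ?thesis using periodic_mod_int(2)[of g n j] g(1) by metis
    qed
    define a c where "a = \<psi> k + \<theta> - \<psi> (k + \<sigma>)" and "c = \<psi> (k + \<sigma> + 1) - (\<psi> k + \<theta>)"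
    have acs: "a + c = \<psi> (k + \<sigma> + 1) - \<psi> (k + \<sigma>)" by (simp add: a_def c_def)
    have "sin (a + c) * g k < (sin a + sin c) * g k"
      using sin_add_less[of a c] ac[of k] gap[of "k + \<sigma>"] g(2)[of k] acs by (intro mult_strict_right_mono) (auto simp: a_def c_def)
    also have "\<dots> \<le> sin c * g (k + \<sigma>) + sin a * g (k + \<sigma> + 1)"
      using sac[of k] min[of "k + \<sigma>"] min[of "k + \<sigma> + 1"] by (simp add: a_def c_def distrib_right add.commute add_mono)
    also have "\<dots> = spread g k * sin (a + c)"
      unfolding spread sin_chord_def using sg[of "k + \<sigma>"] by (simp add: acs a_def c_def)
    finally have "sin (a + c) * g k < \<Lambda> * g k * sin (a + c)" unfolding g(4) .
    then have "(sin (a + c) * g k) * 1 < (sin (a + c) * g k) * \<Lambda>" by (simp add: mult_ac)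
    moreover have "0 < sin (a + c) * g k" using sg[of "k + \<sigma>"] g(2)[of k] acs by simp
    ultimately show ?thesis by (simp only: mult_less_cancel_left_pos)
  qed
  define L where "L = ln \<Lambda>"
  have L: "0 < L" "exp L = \<Lambda>" using L1 by (auto simp: L_def)
  have "level_system q d s (\<lambda>i t. \<psi> (i + \<sigma> * t) - real_of_int t * \<theta>)
    (\<lambda>i t. ln (g (i + \<sigma> * t)) - real_of_int t * L) x y L"
    by (rule eigen_levels) (use psi_per inc gap hi g L less_imp_le[OF lo] in \<open>auto simp: bendI spread\<close>)
  then show ?thesis using L L0(1) by blast
qed

end

subsection \<open>Gauges of invariant polygons\<close>

definition cr :: "complex \<Rightarrow> complex \<Rightarrow> real" where
  "cr u v = Re u * Im v - Im u * Re v"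

lemma cr_simps:
  "cr (u + v) w = cr u w + cr v w" "cr u (v + w) = cr u v + cr u w" "cr (a *\<^sub>R u) v = a * cr u v"
  "cr u (a *\<^sub>R v) = a * cr u v" "cr u u = 0" "cr 0 v = 0" "cr u 0 = 0"
  by (auto simp: cr_def algebra_simps)

lemma cr_swap: "cr u v = - cr v u" by (simp add: cr_def)

lemma cr_cis: "cr (cis a) (cis b) = sin (b - a)" by (simp add: cr_def sin_diff algebra_simps)

lemma cramer: "cr u v *\<^sub>R w = cr w v *\<^sub>R u + cr u w *\<^sub>R v"
  by (rule complex_eqI) (auto simp: cr_def algebra_simps)

definition sublin :: "(complex \<Rightarrow> real) \<Rightarrow> bool" where
  "sublin \<gamma> \<longleftrightarrow> (\<forall>z w. \<gamma> (z + w) \<le> \<gamma> z + \<gamma> w) \<and> (\<forall>c\<ge>0. \<forall>z. \<gamma> (c *\<^sub>R z) = c * \<gamma> z)"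

inductive cone_rep :: "(int \<Rightarrow> real) \<Rightarrow> (int \<Rightarrow> real) \<Rightarrow> complex \<Rightarrow> real \<Rightarrow> bool" for \<phi> w where
  zero: "cone_rep \<phi> w 0 0"
| step: "cone_rep \<phi> w z W \<Longrightarrow> 0 \<le> c \<Longrightarrow> cone_rep \<phi> w (z + c *\<^sub>R cis (\<phi> j)) (W + c * w j)"
| weaken: "cone_rep \<phi> w z W \<Longrightarrow> W \<le> W' \<Longrightarrow> cone_rep \<phi> w z W'"

lemma cone_rep_add: "cone_rep \<phi> w z' W' \<Longrightarrow> cone_rep \<phi> w z W \<Longrightarrow> cone_rep \<phi> w (z + z') (W + W')"
proof (induction rule: cone_rep.induct)
  case (step z' W' c j)
  then have "cone_rep \<phi> w ((z + z') + c *\<^sub>R cis (\<phi> j)) ((W + W') + c * w j)" by (intro cone_rep.step) auto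
  then show ?case by (simp add: algebra_simps)
next
  case (weaken z' W' W'')
  then show ?case using cone_rep.weaken[of \<phi> w "z + z'" "W + W'" "W + W''"] by simp
qed simp

lemma cone_rep_scale: "cone_rep \<phi> w z W \<Longrightarrow> 0 \<le> a \<Longrightarrow> cone_rep \<phi> w (a *\<^sub>R z) (a * W)"
proof (induction rule: cone_rep.induct)
  case (step z W c j)
  then have "cone_rep \<phi> w (a *\<^sub>R z + (a * c) *\<^sub>R cis (\<phi> j)) (a * W + (a * c) * w j)" by (intro cone_rep.step) auto
  then show ?case by (simp add: algebra_simps)
next
  case (weaken z W W')
  then show ?case using cone_rep.weaken[of \<phi> w "a *\<^sub>R z" "a * W" "a * W'"] by (simp add: mult_left_mono)
qed (simp add: cone_rep.zero)

lemma cone_rep_basis: "0 \<le> c \<Longrightarrow> cone_rep \<phi> w (c *\<^sub>R cis (\<phi> j)) (c * w j)"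
  using cone_rep.step[OF cone_rep.zero, of c \<phi> w j] by simp

lemma cone_rep_sublin:
  assumes "cone_rep \<phi> w z W" "sublin \<gamma>" "\<And>k. \<gamma> (cis (\<phi> k)) \<le> w k"
  shows "\<gamma> z \<le> W"
  using assms(1)
proof (induction rule: cone_rep.induct)
  case zero
  have "\<gamma> (0 *\<^sub>R 0) = 0 * \<gamma> 0" using assms(2) unfolding sublin_def by blast
  then show ?case by simp
next
  case (step z W c j)
  have "\<gamma> (z + c *\<^sub>R cis (\<phi> j)) \<le> \<gamma> z + c * \<gamma> (cis (\<phi> j))"
    using assms(2) step(2) unfolding sublin_def by metis
  also have "\<dots> \<le> W + c * w j" using step assms(3)[of j] by (intro add_mono mult_left_mono) auto
  finally show ?case .
qed simp

lemma cone_rep_halfplane: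
  assumes "cone_rep \<phi> w z W" "\<And>j. cos (\<phi> j - m) \<le> 0"
  shows "Re (cis (- m) * z) \<le> 0"
  using assms(1)
proof (induction rule: cone_rep.induct)
  case (step z W c j)
  have "cis (- m) * (c *\<^sub>R cis (\<phi> j)) = c *\<^sub>R cis (\<phi> j - m)" by (simp add: cis_mult add.commute)
  then have "Re (cis (- m) * (z + c *\<^sub>R cis (\<phi> j))) = Re (cis (- m) * z) + Re (c *\<^sub>R cis (\<phi> j - m))"
    by (simp only: distrib_left plus_complex.simps)
  also have "Re (c *\<^sub>R cis (\<phi> j - m)) = c * cos (\<phi> j - m)" by simp
  finally have "Re (cis (- m) * (z + c *\<^sub>R cis (\<phi> j))) = Re (cis (- m) * z) + c * cos (\<phi> j - m)" .
  then show ?case using step assms(2)[of j] by (smt (verit) mult_nonneg_nonpos)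
qed auto

text \<open>Gauges are encoded by their values at the directions \<open>cis (\<phi> k)\<close> of the vertices of an invariant polygon;
  \<open>cone_rep \<phi> w z W\<close> says that \<open>z\<close> is a nonnegative combination of these directions of total weight at
  most \<open>W\<close>. Marks may coincide, so a polygon with fewer than \<open>N\<close> vertices is allowed.\<close>

definition marks :: "nat \<Rightarrow> (int \<Rightarrow> real) \<Rightarrow> bool" where
  "marks N \<phi> \<longleftrightarrow> 0 < N \<and> mono \<phi> \<and> (\<forall>k. \<phi> (k + int N) = \<phi> k + 2 * pi)"

lemma marks_shift:
  assumes "marks N \<phi>" shows "\<phi> (k + int N * j) = \<phi> k + 2 * pi * real_of_int j"
proof -
  have N: "0 < N" "\<And>k. \<phi> (k + int N) = \<phi> k + 2 * pi" using assms by (auto simp: marks_def)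
  have "(\<lambda>k. \<phi> k - 2 * pi * real_of_int k / real N) (k + int N * j) = (\<lambda>k. \<phi> k - 2 * pi * real_of_int k / real N) k"
    by (rule periodic_mod_int(1)) (use N in \<open>simp add: field_simps\<close>)
  then have "\<phi> (k + int N * j) - 2 * pi * real_of_int (k + int N * j) / real N = \<phi> k - 2 * pi * real_of_int k / real N" .
  moreover have "2 * pi * real_of_int (k + int N * j) / real N = 2 * pi * real_of_int k / real N + 2 * pi * real_of_int j"
    using N by (simp add: field_simps)
  ultimately show ?thesis by simp
qed

lemma marks_interval:
  assumes "marks N \<phi>" obtains k where "\<phi> k \<le> \<alpha>" "\<alpha> < \<phi> (k + 1)"
proof -
  define j where "j = \<lfloor>(\<alpha> - \<phi> 0) / (2 * pi)\<rfloor>"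
  have "real_of_int j \<le> (\<alpha> - \<phi> 0) / (2 * pi)" "(\<alpha> - \<phi> 0) / (2 * pi) < real_of_int j + 1"
    unfolding j_def by linarith+
  then have 1: "\<phi> (0 + int N * j) \<le> \<alpha>" "\<alpha> < \<phi> (0 + int N * (j + 1))"
    unfolding marks_shift[OF assms] by (auto simp: field_simps)
  have "\<exists>k. \<phi> k \<le> \<alpha> \<and> \<alpha> < \<phi> (k + 1)"
  proof (rule ccontr)
    assume c: "\<not> ?thesis"
    have "\<phi> k \<le> \<alpha>" if "0 + int N * j \<le> k" for k
      using that by (induction k rule: int_ge_induct) (use 1 c in \<open>auto simp: not_less\<close>)
    moreover have "0 + int N * j \<le> 0 + int N * (j + 1)" by (simp add: algebra_simps)
    ultimately show False using 1(2) by (meson not_less)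
  qed
  then show ?thesis using that by blast
qed

lemma marks_window:
  assumes "marks N \<phi>"
  obtains m :: int where "\<phi> (k + 1) \<le> \<phi> j + 2 * pi * real_of_int m" "\<phi> j + 2 * pi * real_of_int m \<le> \<phi> k + 2 * pi"
proof -
  have N: "0 < N" and mono: "mono \<phi>" and per: "\<phi> (k + int N) = \<phi> k + 2 * pi" using assms by (auto simp: marks_def)
  define m where "m = - ((j - k - 1) div int N)"
  have e: "j + int N * m = k + 1 + (j - k - 1) mod int N" unfolding m_def
    by (simp add: algebra_simps minus_mult_div_eq_mod[symmetric])
  have b: "0 \<le> (j - k - 1) mod int N" "(j - k - 1) mod int N < int N" using N by auto
  have "\<phi> (k + 1) \<le> \<phi> (j + int N * m)" "\<phi> (j + int N * m) \<le> \<phi> (k + int N)"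
    unfolding e using b by (auto intro!: monoD[OF mono])
  then show ?thesis using that[of m] unfolding marks_shift[OF assms] per by simp
qed

text \<open>The unit ball of \<open>\<gamma>\<close> is a polygon around 0 that multiplication by
  \<open>lam\<close> maps into itself. Linearity between consecutive marks says that all its
  vertices lie in the directions of the \<open>N\<close> marks.\<close>

definition adm :: "complex \<Rightarrow> nat \<Rightarrow> (complex \<Rightarrow> real) \<Rightarrow> (int \<Rightarrow> real) \<Rightarrow> bool" where
  "adm lam N \<gamma> \<phi> \<longleftrightarrow> sublin \<gamma> \<and> (\<forall>z. z \<noteq> 0 \<longrightarrow> 0 < \<gamma> z) \<and> (\<forall>z. \<gamma> (lam * z) \<le> \<gamma> z) \<and> marks N \<phi>
     \<and> (\<forall>k. \<phi> (k + 1) - \<phi> k < pi)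
     \<and> (\<forall>k a b. 0 \<le> a \<longrightarrow> 0 \<le> b \<longrightarrow>
          \<gamma> (a *\<^sub>R cis (\<phi> k) + b *\<^sub>R cis (\<phi> (k + 1))) = a * \<gamma> (cis (\<phi> k)) + b * \<gamma> (cis (\<phi> (k + 1))))"

lemma cis_between:
  assumes "0 < b - a" "b - a < pi"
  shows "cis t = (sin (b - t) / sin (b - a)) *\<^sub>R cis a + (sin (t - a) / sin (b - a)) *\<^sub>R cis b"
proof -
  have s: "sin (b - a) > 0" using assms by (intro sin_gt_zero) auto
  have "cr (cis a) (cis b) *\<^sub>R cis t = cr (cis t) (cis b) *\<^sub>R cis a + cr (cis a) (cis t) *\<^sub>R cis b" by (rule cramer)
  then have "sin (b - a) *\<^sub>R cis t = sin (b - t) *\<^sub>R cis a + sin (t - a) *\<^sub>R cis b" unfolding cr_cis .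
  then have "(1 / sin (b - a)) *\<^sub>R (sin (b - a) *\<^sub>R cis t) = (1 / sin (b - a)) *\<^sub>R (sin (b - t) *\<^sub>R cis a + sin (t - a) *\<^sub>R cis b)" by simp
  then show ?thesis using s by (simp add: scaleR_add_right)
qed

section \<open>The gauge of an invariant polygon\<close>

locale polygon =
  fixes lam :: complex and N :: nat and \<phi> w :: "int \<Rightarrow> real" and q :: nat and \<rho> x :: real
  assumes marks: "marks N \<phi>" and w: "\<And>k. 0 < w k" "\<And>k. w (k + int N) = w k"
    and lamq: "lam ^ q = \<rho> *\<^sub>R cis x" "0 < \<rho>" "0 < x" "x < pi"
    and inv: "\<And>k. cone_rep \<phi> w (lam * cis (\<phi> k)) (w k)"
begin

lemma rep_lam: "cone_rep \<phi> w z W \<Longrightarrow> cone_rep \<phi> w (lam * z) W"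
proof (induction rule: cone_rep.induct)
  case (step z W c j)
  have "cone_rep \<phi> w (c *\<^sub>R (lam * cis (\<phi> j))) (c * w j)" using step inv by (intro cone_rep_scale) auto
  then have "cone_rep \<phi> w (lam * z + c *\<^sub>R (lam * cis (\<phi> j))) (W + c * w j)" using step by (intro cone_rep_add) auto
  then show ?case by (simp add: distrib_left)
next
  case (weaken z W W') then show ?case using cone_rep.weaken by blast
qed (auto intro: cone_rep.zero)

lemma rep_lam_pow: "cone_rep \<phi> w z W \<Longrightarrow> cone_rep \<phi> w (lam ^ i * z) W"
  by (induction i) (auto simp: mult.assoc dest: rep_lam)

text \<open>With a gap of at least \<open>pi\<close> all marks, and with them all images of the
  polygon, lie in the half plane opposite to the bisector \<open>m\<close> of the gap. But the
  powers \<open>lam ^ (q * j)\<close> turn by steps of \<open>x < pi\<close>, so one of them carries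
  \<open>cis (\<phi> 0)\<close> to within less than \<open>pi / 2\<close> of the direction
  \<open>m\<close>.\<close>

lemma gap: "\<phi> (k + 1) - \<phi> k < pi"
proof (rule ccontr)
  assume c: "\<not> ?thesis"
  define m where "m = (\<phi> k + \<phi> (k + 1)) / 2"
  have neg: "cos (\<phi> j - m) \<le> 0" for j
  proof -
    obtain i :: int where i: "\<phi> (k + 1) \<le> \<phi> j + 2 * pi * real_of_int i" "\<phi> j + 2 * pi * real_of_int i \<le> \<phi> k + 2 * pi"
      using marks_window[OF marks] by blast
    have "\<bar>\<phi> j - m + 2 * pi * real_of_int i - pi\<bar> \<le> pi / 2" unfolding m_def using i c by (auto simp: field_simps abs_le_iff)
    then have "0 \<le> cos (\<phi> j - m + 2 * pi * real_of_int i - pi)" by (intro cos_ge_zero) linarith+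
    also have "\<dots> = - cos (\<phi> j - m + 2 * pi * real_of_int i)" by (simp add: cos_diff)
    also have "cos (\<phi> j - m + 2 * pi * real_of_int i) = cos (\<phi> j - m)" by (simp add: cos_add)
    finally show ?thesis by simp
  qed
  \<comment> \<open>\<open>M\<close> full turns make \<open>t\<close> nonnegative, so that its
    nearest integer can serve as the exponent \<open>j\<close>; the rounding error of at most 1/2 is
    an angle of at most \<open>x / 2\<close>.\<close>
  define M where "M = \<lceil>(\<phi> 0 - m) / (2 * pi)\<rceil>"
  define t where "t = (m + 2 * pi * real_of_int M - \<phi> 0) / x"
  have "(\<phi> 0 - m) / (2 * pi) \<le> real_of_int M" unfolding M_def by simp
  then have t0: "0 \<le> t" using lamq unfolding t_def by (simp add: field_simps)
  define j where "j = nat (round t)"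
  have "0 \<le> round t" using t0 by (simp add: round_def)
  then have j: "\<bar>real j - t\<bar> \<le> 1 / 2" using of_int_round_abs_le[of t] by (simp add: j_def)
  have "\<bar>x * (real j - t)\<bar> \<le> x * (1 / 2)" unfolding abs_mult using j lamq by (intro mult_mono) auto
  moreover have "x * (real j - t) = real j * x + \<phi> 0 - m - 2 * pi * real_of_int M" using lamq by (simp add: t_def field_simps)
  ultimately have "\<bar>real j * x + \<phi> 0 - m - 2 * pi * real_of_int M\<bar> < pi / 2" using lamq by auto
  then have "0 < cos (real j * x + \<phi> 0 - m - 2 * pi * real_of_int M)" by (intro cos_gt_zero_pi) linarith+
  also have "\<dots> = cos (real j * x + \<phi> 0 - m)" by (simp add: cos_diff[of "real j * x + \<phi> 0 - m"])
  finally have pos: "0 < cos (real j * x + \<phi> 0 - m)" .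
  have "cone_rep \<phi> w (1 *\<^sub>R cis (\<phi> 0)) (1 * w 0)" by (rule cone_rep_basis) simp
  then have "cone_rep \<phi> w (lam ^ (q * j) * cis (\<phi> 0)) (w 0)" using rep_lam_pow by simp
  then have "Re (cis (- m) * (lam ^ (q * j) * cis (\<phi> 0))) \<le> 0" by (rule cone_rep_halfplane) (rule neg)
  moreover have "cis (- m) * (lam ^ (q * j) * cis (\<phi> 0)) = (\<rho> ^ j) *\<^sub>R cis (real j * x + \<phi> 0 - m)"
  proof -
    have "lam ^ (q * j) = (\<rho> ^ j) *\<^sub>R cis (real j * x)"
      unfolding power_mult lamq(1) by (simp only: scaleR_power Complex.DeMoivre)
    then show ?thesis by (simp add: cis_mult algebra_simps)
  qed
  moreover have "0 < \<rho> ^ j * cos (real j * x + \<phi> 0 - m)" using pos lamq(2) by simp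
  ultimately show False by simp
qed

lemma rep_exists: "\<exists>W. cone_rep \<phi> w z W"
proof -
  obtain k where k: "\<phi> k \<le> Arg z" "Arg z < \<phi> (k + 1)" using marks_interval[OF marks] by blast
  have g: "0 < \<phi> (k + 1) - \<phi> k" "\<phi> (k + 1) - \<phi> k < pi" using k gap by auto
  have s: "0 \<le> sin (\<phi> (k + 1) - Arg z)" "0 \<le> sin (Arg z - \<phi> k)" "0 < sin (\<phi> (k + 1) - \<phi> k)"
    using k g by (auto intro!: sin_ge_zero sin_gt_zero)
  have "cone_rep \<phi> w (norm z *\<^sub>R cis (Arg z)) (norm z * ((sin (\<phi> (k + 1) - Arg z) / sin (\<phi> (k + 1) - \<phi> k)) * w k + (sin (Arg z - \<phi> k) / sin (\<phi> (k + 1) - \<phi> k)) * w (k + 1)))"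
    unfolding cis_between[OF g, of "Arg z"]
    using s by (intro cone_rep_scale cone_rep_add[OF cone_rep_basis cone_rep_basis]) auto
  moreover have "norm z *\<^sub>R cis (Arg z) = z" using rcis_cmod_Arg[of z] by (simp add: rcis_def scaleR_conv_of_real)
  ultimately show ?thesis by auto
qed

lemma w_min: obtains \<mu> where "0 < \<mu>" "\<And>k. \<mu> \<le> w k"
proof -
  have N: "0 < N" using marks by (simp add: marks_def)
  have fin: "finite (w ` {0..<int N})" "w ` {0..<int N} \<noteq> {}" using N by auto
  have "Min (w ` {0..<int N}) \<in> w ` {0..<int N}" by (rule Min_in[OF fin])
  then have 1: "0 < Min (w ` {0..<int N})" using w by auto
  have "Min (w ` {0..<int N}) \<le> w k" for k
  proof -
    have "w (k mod int N) = w k" by (rule periodic_mod_int(2)) (rule w)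
    moreover have "w (k mod int N) \<in> w ` {0..<int N}" using N by auto
    ultimately show ?thesis using fin by (metis Min_le)
  qed
  then show ?thesis using that[OF 1] by blast
qed

lemma rep_norm:
  assumes "\<And>k. \<mu> \<le> w k" "0 \<le> \<mu>" "cone_rep \<phi> w z W" shows "\<mu> * norm z \<le> W"
proof (rule cone_rep_sublin[OF assms(3), of "\<lambda>z. \<mu> * norm z"])
  show "sublin (\<lambda>z. \<mu> * norm z)"
    unfolding sublin_def using assms(2) by (auto simp: distrib_left[symmetric] norm_triangle_ineq intro!: mult_left_mono)
  show "\<mu> * norm (cis (\<phi> k)) \<le> w k" for k using assms(1) by simp
qed

definition gauge :: "complex \<Rightarrow> real" where "gauge z = Inf {W. cone_rep \<phi> w z W}"

lemma rep_nonneg: "cone_rep \<phi> w z W \<Longrightarrow> 0 \<le> W"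
  using rep_norm[of 0 z W] w(1) by (auto simp: less_imp_le)

lemma gauge_le: "cone_rep \<phi> w z W \<Longrightarrow> gauge z \<le> W"
  unfolding gauge_def by (rule cInf_lower) (auto intro!: bdd_belowI[of _ 0] rep_nonneg)

lemma gauge_greatest: "(\<And>W. cone_rep \<phi> w z W \<Longrightarrow> b \<le> W) \<Longrightarrow> b \<le> gauge z"
  unfolding gauge_def by (rule cInf_greatest) (use rep_exists in auto)

lemma gauge_sublin: "sublin gauge"
  unfolding sublin_def
proof (intro conjI allI impI)
  fix z z'
  have "gauge (z + z') - W' \<le> gauge z" if W': "cone_rep \<phi> w z' W'" for W'
  proof (rule gauge_greatest)
    fix W assume "cone_rep \<phi> w z W"
    then have "gauge (z + z') \<le> W + W'" using W' by (intro gauge_le cone_rep_add)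
    then show "gauge (z + z') - W' \<le> W" by simp
  qed
  then have "gauge (z + z') - gauge z \<le> gauge z'" by (intro gauge_greatest) (auto simp: algebra_simps)
  then show "gauge (z + z') \<le> gauge z + gauge z'" by simp
next
  have le: "gauge (c *\<^sub>R z) \<le> c * gauge z" if c: "0 < c" for c z
  proof -
    have "gauge (c *\<^sub>R z) / c \<le> gauge z"
    proof (rule gauge_greatest)
      fix W assume "cone_rep \<phi> w z W"
      then have "gauge (c *\<^sub>R z) \<le> c * W" using c by (intro gauge_le cone_rep_scale) auto
      then show "gauge (c *\<^sub>R z) / c \<le> W" using c by (simp add: field_simps)
    qed
    then show ?thesis using c by (simp add: field_simps)
  qed
  fix c :: real and z assume "0 \<le> c"
  show "gauge (c *\<^sub>R z) = c * gauge z"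
  proof (cases "c = 0")
    case True
    have "gauge 0 \<le> 0" by (rule gauge_le) (rule cone_rep.zero)
    moreover have "0 \<le> gauge 0" by (rule gauge_greatest) (rule rep_nonneg)
    ultimately show ?thesis using True by simp
  next
    case False
    then have c: "0 < c" using \<open>0 \<le> c\<close> by simp
    have "gauge ((1/c) *\<^sub>R (c *\<^sub>R z)) \<le> (1/c) * gauge (c *\<^sub>R z)" using c by (intro le) auto
    then have "c * gauge z \<le> gauge (c *\<^sub>R z)" using c by (simp add: field_simps)
    then show ?thesis using le[OF c, of z] by simp
  qed
qed

lemma gauge_mark: "gauge (cis (\<phi> k)) \<le> w k"
  using gauge_le[OF cone_rep_basis[of 1 \<phi> w k]] by simp

text \<open>No mark lies inside the sector between \<open>\<phi> k\<close> and
  \<open>\<phi> (k + 1)\<close>. Hence each is at most \<open>pi\<close> counterclockwise of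
  \<open>\<phi> (k + 1)\<close> or at most \<open>pi\<close> clockwise of \<open>\<phi> k\<close>,
  and the steps of a representation are sorted by these two cases.\<close>

lemma rep_split:
  assumes "cone_rep \<phi> w z W"
  shows "\<exists>R L. z = R + L \<and> gauge R + gauge L \<le> W \<and> 0 \<le> cr R (cis (\<phi> k)) \<and> 0 \<le> cr (cis (\<phi> (k + 1))) L"
  using assms
proof (induction rule: cone_rep.induct)
  case zero
  have "gauge (0 *\<^sub>R 0) = 0 * gauge 0" using gauge_sublin unfolding sublin_def by blast
  then show ?case by (intro exI[of _ 0]) (auto simp: cr_simps)
next
  case (step z W c j)
  then obtain R L where RL: "z = R + L" "gauge R + gauge L \<le> W" "0 \<le> cr R (cis (\<phi> k))" "0 \<le> cr (cis (\<phi> (k + 1))) L" by blast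
  have sub: "gauge (v + c *\<^sub>R cis (\<phi> j)) \<le> gauge v + c * w j" for v
  proof -
    have "gauge (v + c *\<^sub>R cis (\<phi> j)) \<le> gauge v + gauge (c *\<^sub>R cis (\<phi> j))" using gauge_sublin unfolding sublin_def by blast
    also have "gauge (c *\<^sub>R cis (\<phi> j)) \<le> c * w j" using step by (intro gauge_le cone_rep_basis)
    finally show ?thesis by simp
  qed
  obtain i :: int where i: "\<phi> (k + 1) \<le> \<phi> j + 2 * pi * real_of_int i" "\<phi> j + 2 * pi * real_of_int i \<le> \<phi> k + 2 * pi"
    using marks_window[OF marks] by blast
  define v where "v = \<phi> j + 2 * pi * real_of_int i"
  have cv: "cis (\<phi> j) = cis v" by (simp add: v_def cis_mult[symmetric])
  have "\<phi> k \<le> \<phi> (k + 1)" using marks by (simp add: marks_def monoD)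
  then consider "v \<le> \<phi> (k + 1) + pi" | "\<phi> k + pi \<le> v" by linarith
  then show ?case
  proof cases
    case 1
    then have "0 \<le> sin (v - \<phi> (k + 1))" using i by (intro sin_ge_zero) (auto simp: v_def)
    then have "0 \<le> cr (cis (\<phi> (k + 1))) (c *\<^sub>R cis (\<phi> j))" using step unfolding cv by (simp add: cr_simps cr_cis)
    then show ?thesis using RL sub[of L] by (intro exI[of _ R] exI[of _ "L + c *\<^sub>R cis (\<phi> j)"]) (auto simp: cr_simps)
  next
    case 2
    have "0 \<le> sin (\<phi> k + 2 * pi - v)" using 2 i by (intro sin_ge_zero) (auto simp: v_def)
    moreover have "sin (\<phi> k + 2 * pi - v) = sin (\<phi> k - v)" by (simp add: sin_diff)
    ultimately have "0 \<le> cr (c *\<^sub>R cis (\<phi> j)) (cis (\<phi> k))" using step unfolding cv by (simp add: cr_simps cr_cis)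
    then show ?thesis using RL sub[of R] by (intro exI[of _ "R + c *\<^sub>R cis (\<phi> j)"] exI[of _ L]) (auto simp: cr_simps)
  qed
next
  case (weaken z W W') then show ?case by force
qed

text \<open>Split a representation as \<open>z = R + L\<close>. By Cramer's rule \<open>D\<close>
  times \<open>cis (\<phi> k)\<close> is a nonnegative combination of \<open>R\<close> and
  \<open>z\<close>, and \<open>D\<close> times \<open>cis (\<phi> (k + 1))\<close> one of
  \<open>L\<close> and \<open>z\<close>. Sublinearity in both, weighted by \<open>a\<close> and
  \<open>b\<close>, bounds the sum of the gauges by the weight of the representation.\<close>

lemma gauge_additive:
  assumes "0 \<le> a" "0 \<le> b"
  shows "gauge (a *\<^sub>R cis (\<phi> k) + b *\<^sub>R cis (\<phi> (k + 1))) = a * gauge (cis (\<phi> k)) + b * gauge (cis (\<phi> (k + 1)))"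
proof -
  have sub: "gauge (u + v) \<le> gauge u + gauge v" and hom: "0 \<le> c \<Longrightarrow> gauge (c *\<^sub>R u) = c * gauge u" for u v c
    using gauge_sublin unfolding sublin_def by auto
  let ?e = "cis (\<phi> k)" and ?f = "cis (\<phi> (k + 1))"
  define z where "z = a *\<^sub>R ?e + b *\<^sub>R ?f"
  have mono: "\<phi> k \<le> \<phi> (k + 1)" using marks by (simp add: marks_def monoD)
  consider "a = 0" | "b = 0" | "\<phi> k = \<phi> (k + 1)" | "0 < a" "0 < b" "\<phi> k < \<phi> (k + 1)" using assms mono by linarith
  then show ?thesis
  proof cases
    case 3
    have "a *\<^sub>R ?e + b *\<^sub>R ?f = (a + b) *\<^sub>R ?e" unfolding 3 by (simp add: scaleR_add_left)
    then show ?thesis using hom[of "a + b" ?e] assms 3 by (simp add: distrib_right)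
  next
    case 4
    define \<delta> where "\<delta> = cr ?e ?f"
    have d: "0 < \<delta>" unfolding \<delta>_def cr_cis using 4 gap[of k] by (intro sin_gt_zero) auto
    have "a * gauge ?e + b * gauge ?f \<le> gauge z"
    proof (rule gauge_greatest)
      fix W assume "cone_rep \<phi> w z W"
      then obtain R L where RL: "z = R + L" "gauge R + gauge L \<le> W" "0 \<le> cr R ?e" "0 \<le> cr ?f L" using rep_split by blast
      define A B D where "A = cr R ?e" and "B = cr ?f L" and "D = cr R z"
      have L: "L = z + (- 1) *\<^sub>R R" using RL(1) by simp
      have ef: "cr ?f ?e = - \<delta>" unfolding \<delta>_def by (rule cr_swap)
      have B: "B = - (a * \<delta>) + cr R ?f"
        unfolding B_def L z_def cr_simps ef using cr_swap[of ?f R] by simp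
      have D: "D = a * A + b * cr R ?f" unfolding D_def z_def A_def cr_simps by simp
      have AB: "a * A + b * B = D - a * b * \<delta>" unfolding B D by (simp add: algebra_simps)
      have "0 \<le> a * A + b * B" using RL(3,4) assms by (simp add: A_def B_def)
      then have Dp: "0 < D" using AB 4 d by (smt (verit) mult_pos_pos)
      have zL: "cr z L = D" unfolding L cr_simps D_def using cr_swap[of z R] by simp
      have "D *\<^sub>R ?e = (b * \<delta>) *\<^sub>R R + A *\<^sub>R z"
        using cramer[of R z ?e] unfolding D_def A_def by (simp add: z_def cr_simps \<delta>_def)
      then have 1: "D * gauge ?e \<le> b * \<delta> * gauge R + A * gauge z"
        using hom[of D ?e] sub[of "(b * \<delta>) *\<^sub>R R" "A *\<^sub>R z"] hom[of "b * \<delta>" R] hom[of A z] Dp 4 d RL(3) by (simp add: A_def)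
      have "D *\<^sub>R ?f = (a * \<delta>) *\<^sub>R L + B *\<^sub>R z"
      proof -
        have "cr z L *\<^sub>R ?f = cr ?f L *\<^sub>R z + cr z ?f *\<^sub>R L" by (rule cramer)
        moreover have "cr z ?f = a * \<delta>" by (simp add: z_def cr_simps \<delta>_def)
        ultimately show ?thesis unfolding zL B_def by (simp add: add.commute)
      qed
      then have 2: "D * gauge ?f \<le> a * \<delta> * gauge L + B * gauge z"
        using hom[of D ?f] sub[of "(a * \<delta>) *\<^sub>R L" "B *\<^sub>R z"] hom[of "a * \<delta>" L] hom[of B z] Dp 4 d RL(4) by (simp add: B_def)
      have "D * (a * gauge ?e + b * gauge ?f) = a * (D * gauge ?e) + b * (D * gauge ?f)" by (simp add: algebra_simps)
      also have "\<dots> \<le> a * (b * \<delta> * gauge R + A * gauge z) + b * (a * \<delta> * gauge L + B * gauge z)"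
        using 1 2 assms by (intro add_mono mult_left_mono) auto
      also have "\<dots> = a * b * \<delta> * (gauge R + gauge L) + (a * A + b * B) * gauge z" by (simp add: algebra_simps)
      also have "\<dots> \<le> a * b * \<delta> * W + (a * A + b * B) * W"
      proof -
        have "gauge z \<le> W" using sub[of R L] RL by simp
        then show ?thesis using RL(2) 4 d \<open>0 \<le> a * A + b * B\<close> by (intro add_mono mult_left_mono) auto
      qed
      also have "\<dots> = D * W" unfolding AB by (simp add: algebra_simps)
      finally show "a * gauge ?e + b * gauge ?f \<le> W" using Dp by simp
    qed
    moreover have "gauge z \<le> a * gauge ?e + b * gauge ?f"
      using sub[of "a *\<^sub>R ?e" "b *\<^sub>R ?f"] hom assms by (simp add: z_def)
    ultimately show ?thesis by (simp add: z_def)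
  qed (use hom assms in auto)
qed

theorem gauge_adm: "adm lam N gauge \<phi>"
proof -
  obtain \<mu> where mu: "0 < \<mu>" "\<And>k. \<mu> \<le> w k" using w_min by blast
  have "0 < gauge z" if "z \<noteq> 0" for z
  proof -
    have "\<mu> * norm z \<le> gauge z" using mu by (intro gauge_greatest rep_norm) auto
    moreover have "0 < \<mu> * norm z" using mu that by simp
    ultimately show ?thesis by linarith
  qed
  moreover have "gauge (lam * z) \<le> gauge z" for z by (rule gauge_greatest) (intro gauge_le rep_lam)
  ultimately show ?thesis unfolding adm_def using gauge_sublin marks gap gauge_additive by auto
qed

lemma gauge_dominates:
  assumes "sublin \<gamma>" "\<And>k. \<gamma> (cis (\<phi> k)) \<le> w k" shows "\<gamma> z \<le> gauge z"
  by (rule gauge_greatest) (rule cone_rep_sublin[OF _ assms])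

end

section \<open>From stochastic matrices to invariant polygons\<close>

lemma eigen_rows:
  assumes "lam \<in> karpelevich_region N"
  obtains A :: "nat \<Rightarrow> nat \<Rightarrow> real" and v :: "nat \<Rightarrow> complex" and k0 where
    "\<And>i j. i < N \<Longrightarrow> j < N \<Longrightarrow> 0 \<le> A i j" "\<And>i. i < N \<Longrightarrow> (\<Sum>j<N. A i j) = 1"
    "\<And>i. i < N \<Longrightarrow> lam * v i = (\<Sum>j<N. A i j *\<^sub>R v j)" "k0 < N" "v k0 \<noteq> 0"
proof -
  obtain M where M: "stochastic_mat N M" "eigenvalue (map_mat complex_of_real M) lam"
    using assms by (auto simp: karpelevich_region_def)
  then obtain u where u: "u \<in> carrier_vec N" "u \<noteq> 0\<^sub>v N" "map_mat complex_of_real M *\<^sub>v u = lam \<cdot>\<^sub>v u"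
    unfolding eigenvalue_def eigenvector_def stochastic_mat_def by auto
  have Mc: "M \<in> carrier_mat N N" using M by (simp add: stochastic_mat_def)
  have row: "lam * (u $ i) = (\<Sum>j<N. (M $$ (i, j)) *\<^sub>R (u $ j))" if "i < N" for i
  proof -
    have "lam * (u $ i) = (lam \<cdot>\<^sub>v u) $ i" using that u by simp
    also have "\<dots> = (map_mat complex_of_real M *\<^sub>v u) $ i" using u by simp
    also have "\<dots> = (\<Sum>j\<in>{0..<N}. complex_of_real (M $$ (i, j)) * (u $ j))"
      using that u(1) Mc by (auto simp: scalar_prod_def intro!: sum.cong)
    finally show ?thesis by (simp add: scaleR_conv_of_real atLeast0LessThan)
  qed
  obtain k0 where "k0 < N" "u $ k0 \<noteq> 0"
    using u by (metis carrier_vecD eq_vecI index_zero_vec(1) index_zero_vec(2))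
  then show ?thesis using that[of "\<lambda>i j. M $$ (i, j)" "\<lambda>i. u $ i" k0] M row by (auto simp: stochastic_mat_def)
qed

text \<open>The entries of an eigenvector span the polygon: row \<open>i\<close> of the eigenvalue
  equation writes \<open>lam * v i\<close> as a convex combination of the entries. Sorted by
  argument and continued by full turns, their directions are the marks.\<close>

theorem initial_adm:
  assumes reg: "lam \<in> karpelevich_region N"
    and lamq: "lam ^ q = \<rho> *\<^sub>R cis x" "0 < \<rho>" "0 < x" "x < pi"
  shows "\<exists>\<gamma> \<phi>. adm lam N \<gamma> \<phi>"
proof -
  obtain A :: "nat \<Rightarrow> nat \<Rightarrow> real" and v :: "nat \<Rightarrow> complex" and k0 where
    A: "\<And>i j. i < N \<Longrightarrow> j < N \<Longrightarrow> 0 \<le> A i j" "\<And>i. i < N \<Longrightarrow> (\<Sum>j<N. A i j) = 1"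
    and row: "\<And>i. i < N \<Longrightarrow> lam * v i = (\<Sum>j<N. A i j *\<^sub>R v j)" and k0: "k0 < N" "v k0 \<noteq> 0"
    by (rule eigen_rows[OF reg]) (rule that, assumption+)
  have N: "0 < N" using k0 by simp
  \<comment> \<open>A zero entry has no direction; a repetition of the entry \<open>k0\<close> takes
    its place, which keeps the number of marks at \<open>N\<close>.\<close>
  define h where "h = (\<lambda>k. if v k \<noteq> 0 then k else k0)"
  have h: "v (h k) \<noteq> 0" "k < N \<Longrightarrow> h k < N" for k using k0 by (auto simp: h_def)
  define key where "key = (\<lambda>k. Arg2pi (v (h k)))"
  define ks where "ks = sort_key key [0..<N]"
  have ks: "length ks = N" "set ks = {..<N}" by (auto simp: ks_def)
  have sorted: "i \<le> j \<Longrightarrow> j < N \<Longrightarrow> key (ks ! i) \<le> key (ks ! j)" for i j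
    using sorted_sort_key[of key "[0..<N]"] sorted_nth_mono[of "map key ks" i j] ks by (simp add: ks_def)
  define ix where "ix = (\<lambda>k. ks ! nat (k mod int N))"
  have nm: "nat (k mod int N) < N" for k using N by (simp add: nat_less_iff)
  have ix: "ix k < N" for k using ks nm nth_mem[of "nat (k mod int N)" ks] by (auto simp: ix_def)
  have ixN: "ix (k + int N) = ix k" for k by (simp add: ix_def)
  have surj: "\<exists>k. ix k = j" if "j < N" for j
  proof -
    have "j \<in> set ks" using ks(2) that by simp
    then obtain i where "i < N" "ks ! i = j" unfolding in_set_conv_nth ks(1) by blast
    then show ?thesis by (intro exI[of _ "int i"]) (simp add: ix_def)
  qed
  define \<phi> where "\<phi> = (\<lambda>k. key (ix k) + 2 * pi * real_of_int (k div int N))"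
  define w where "w = (\<lambda>k. 1 / norm (v (h (ix k))))"
  have key: "0 \<le> key i" "key i < 2 * pi" for i using Arg2pi[of "v (h i)"] by (auto simp: key_def)
  have cis_v: "v (h (ix k)) = norm (v (h (ix k))) *\<^sub>R cis (\<phi> k)" for k
  proof -
    have "cis (\<phi> k) = cis (key (ix k)) * cis (2 * pi * real_of_int (k div int N))" by (simp only: \<phi>_def cis_mult)
    also have "cis (2 * pi * real_of_int (k div int N)) = 1" by (rule cis_multiple_2pi) auto
    finally show ?thesis using Arg2pi_eq[of "v (h (ix k))"] by (simp add: key_def cis_conv_exp scaleR_conv_of_real mult.commute)
  qed
  have mono: "\<phi> k \<le> \<phi> k'" if "k \<le> k'" for k k'
  proof (cases "k div int N = k' div int N")
    case True
    have "k mod int N \<le> k' mod int N" using that True by (simp add: minus_div_mult_eq_mod[symmetric])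
    then have "key (ix k) \<le> key (ix k')" unfolding ix_def using nm by (intro sorted) (auto intro: nat_mono)
    then show ?thesis using True by (simp add: \<phi>_def)
  next
    case False
    then have "k div int N + 1 \<le> k' div int N" using that N zdiv_mono1[of k k' "int N"] by simp
    then have "real_of_int (k div int N) + 1 \<le> real_of_int (k' div int N)" by linarith
    then have "2 * pi * (real_of_int (k div int N) + 1) \<le> 2 * pi * real_of_int (k' div int N)" by (intro mult_left_mono) auto
    then show ?thesis using key[of "ix k"] key[of "ix k'"] by (simp add: \<phi>_def algebra_simps)
  qed
  have m: "marks N \<phi>"
    unfolding marks_def using N mono by (auto simp: mono_def \<phi>_def ixN algebra_simps)
  have repv: "cone_rep \<phi> w (v j) 1" if j: "j < N" for j
  proof (cases "v j = 0")
    case True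
    then show ?thesis using cone_rep.weaken[OF cone_rep.zero, of 1] by simp
  next
    case False
    obtain k where k: "ix k = j" using surj[OF j] by blast
    have hj: "h j = j" using False by (simp add: h_def)
    have "cone_rep \<phi> w (norm (v j) *\<^sub>R cis (\<phi> k)) (norm (v j) * w k)" by (rule cone_rep_basis) simp
    then show ?thesis using cis_v[of k] False by (simp add: k hj w_def)
  qed
  have rep_sum: "cone_rep \<phi> w (\<Sum>j\<in>J. a j *\<^sub>R v j) (\<Sum>j\<in>J. a j)" if "finite J" "\<And>j. j \<in> J \<Longrightarrow> j < N \<and> 0 \<le> a j" for J a
    using that
  proof (induction J rule: finite_induct)
    case (insert j J)
    have "cone_rep \<phi> w (a j *\<^sub>R v j) (a j * 1)" using insert repv by (intro cone_rep_scale) auto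
    then have "cone_rep \<phi> w ((\<Sum>j\<in>J. a j *\<^sub>R v j) + a j *\<^sub>R v j) ((\<Sum>j\<in>J. a j) + a j * 1)"
      using insert by (intro cone_rep_add) auto
    then show ?case using insert by (simp add: add.commute)
  qed (simp add: cone_rep.zero)
  have inv: "cone_rep \<phi> w (lam * cis (\<phi> k)) (w k)" for k
  proof -
    define i where "i = h (ix k)"
    have i: "i < N" "v i \<noteq> 0" using h ix by (auto simp: i_def)
    have "cone_rep \<phi> w (lam * v i) 1"
      using rep_sum[of "{..<N}" "A i"] A i row[OF i(1)] by auto
    then have "cone_rep \<phi> w ((1 / norm (v i)) *\<^sub>R (lam * v i)) ((1 / norm (v i)) * 1)" by (rule cone_rep_scale) simp
    moreover have "(1 / norm (v i)) *\<^sub>R (lam * v i) = lam * cis (\<phi> k)"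
    proof -
      have "(1 / norm (v i)) *\<^sub>R v i = (1 / norm (v i)) *\<^sub>R (norm (v i) *\<^sub>R cis (\<phi> k))"
        using cis_v[of k] by (simp add: i_def)
      also have "\<dots> = cis (\<phi> k)" using i by simp
      finally show ?thesis by (metis mult_scaleR_right)
    qed
    ultimately show ?thesis by (simp add: w_def i_def)
  qed
  interpret polygon lam N \<phi> w q \<rho> x
    using m inv lamq h by unfold_locales (auto simp: w_def ixN)
  show ?thesis using gauge_adm by blast
qed

subsection \<open>Moving the marks\<close>

lemma adm_D:
  assumes "adm lam N \<gamma> \<phi>"
  shows "sublin \<gamma>" "\<And>z. z \<noteq> 0 \<Longrightarrow> 0 < \<gamma> z" "\<gamma> (lam * z) \<le> \<gamma> z" "marks N \<phi>" "\<phi> (k + 1) - \<phi> k < pi"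
    "0 \<le> a \<Longrightarrow> 0 \<le> b \<Longrightarrow> \<gamma> (a *\<^sub>R cis (\<phi> k) + b *\<^sub>R cis (\<phi> (k + 1))) = a * \<gamma> (cis (\<phi> k)) + b * \<gamma> (cis (\<phi> (k + 1)))"
    "\<gamma> (z + z') \<le> \<gamma> z + \<gamma> z'" "0 \<le> c \<Longrightarrow> \<gamma> (c *\<^sub>R z) = c * \<gamma> z"
  using assms unfolding adm_def sublin_def by auto

lemma marks_D:
  assumes "marks N \<phi>"
  shows "0 < N" "i \<le> j \<Longrightarrow> \<phi> i \<le> \<phi> j" "\<phi> i < \<phi> j \<Longrightarrow> i < j" "\<phi> (k + int N) = \<phi> k + 2 * pi"
proof -
  have m: "mono \<phi>" using assms by (simp add: marks_def)
  show "0 < N" "\<phi> (k + int N) = \<phi> k + 2 * pi" using assms by (simp_all add: marks_def)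
  show "i \<le> j \<Longrightarrow> \<phi> i \<le> \<phi> j" using m by (rule monoD)
  show "i < j" if "\<phi> i < \<phi> j" using monoD[OF m, of j i] that by (meson not_less)
qed

lemma adm_linear:
  assumes adm: "adm lam N \<gamma> \<phi>" and ang: "\<phi> i \<le> \<alpha>" "\<alpha> \<le> \<beta>" "\<beta> \<le> \<phi> (i + 1)" and ab: "0 \<le> a" "0 \<le> b"
  shows "\<gamma> (a *\<^sub>R cis \<alpha> + b *\<^sub>R cis \<beta>) = a * \<gamma> (cis \<alpha>) + b * \<gamma> (cis \<beta>)"
proof (cases "\<phi> i = \<phi> (i + 1)")
  case True
  then have e: "\<beta> = \<alpha>" using ang by simp
  have "a *\<^sub>R cis \<alpha> + b *\<^sub>R cis \<beta> = (a + b) *\<^sub>R cis \<alpha>" unfolding e by (simp add: scaleR_add_left)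
  then show ?thesis using adm_D(8)[OF adm, of "a + b" "cis \<alpha>"] ab by (simp add: e distrib_right)
next
  case False
  have g: "0 < \<phi> (i + 1) - \<phi> i" "\<phi> (i + 1) - \<phi> i < pi"
    using False ang adm_D(5)[OF adm, of i] by auto
  let ?s = "sin (\<phi> (i + 1) - \<phi> i)"
  have s: "0 < ?s" using g by (intro sin_gt_zero) auto
  have rep: "\<exists>a b. 0 \<le> a \<and> 0 \<le> b \<and> cis t = a *\<^sub>R cis (\<phi> i) + b *\<^sub>R cis (\<phi> (i + 1))" if "\<phi> i \<le> t" "t \<le> \<phi> (i + 1)" for t
    using cis_between[OF g, of t] s that g
    by (intro exI[of _ "sin (\<phi> (i + 1) - t) / ?s"] exI[of _ "sin (t - \<phi> i) / ?s"]) (auto intro!: sin_ge_zero divide_nonneg_pos)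
  obtain a1 a2 where a: "0 \<le> a1" "0 \<le> a2" "cis \<alpha> = a1 *\<^sub>R cis (\<phi> i) + a2 *\<^sub>R cis (\<phi> (i + 1))" using rep[of \<alpha>] ang by auto
  obtain b1 b2 where b: "0 \<le> b1" "0 \<le> b2" "cis \<beta> = b1 *\<^sub>R cis (\<phi> i) + b2 *\<^sub>R cis (\<phi> (i + 1))" using rep[of \<beta>] ang by auto
  have e: "a *\<^sub>R cis \<alpha> + b *\<^sub>R cis \<beta> = (a * a1 + b * b1) *\<^sub>R cis (\<phi> i) + (a * a2 + b * b2) *\<^sub>R cis (\<phi> (i + 1))"
    unfolding a(3) b(3) by (simp add: algebra_simps)
  have nn: "0 \<le> a * a1 + b * b1" "0 \<le> a * a2 + b * b2" using ab a b by auto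
  show ?thesis
    unfolding e adm_D(6)[OF adm nn]
    unfolding a(3) b(3) adm_D(6)[OF adm a(1,2)] adm_D(6)[OF adm b(1,2)] by (simp add: algebra_simps)
qed

lemma marks_last_less:
  assumes "marks N \<phi>" obtains l where "\<phi> l < \<alpha>" "\<alpha> \<le> \<phi> (l + 1)"
proof -
  have "marks N (\<lambda>k. - \<phi> (- k))"
    unfolding marks_def
  proof (intro conjI allI monoI)
    show "- \<phi> (- (k + int N)) = - \<phi> (- k) + 2 * pi" for k
      using marks_D(4)[OF assms, of "- (k + int N)"] by simp
  qed (use marks_D(1,2)[OF assms] in auto)
  then obtain k where "- \<phi> (- k) \<le> - \<alpha>" "- \<alpha> < - \<phi> (- (k + 1))" using marks_interval[of N _ "- \<alpha>"] by blast
  then show ?thesis using that[of "- (k + 1)"] by simp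
qed

context karp_sector
begin

text \<open>The new polygon has its vertices on the boundary of the old one, in the directions
  \<open>\<phi>'\<close>. The image of a vertex lies in the old polygon; it lies in the new one
  because its direction is a new mark, or because no old vertex lies inside the new gap around it,
  so that the new side there is a piece of an old side.\<close>

lemma inscribe:
  fixes \<rho> :: real
  defines "lam \<equiv> \<rho> *\<^sub>R cis \<theta>"
  assumes rho: "0 < \<rho>" and adm: "adm lam N \<gamma> \<phi>" and mk: "marks n \<phi>'"
    and im: "\<And>m. \<exists>l. \<phi>' m + \<theta> = \<phi>' l \<or>
        (\<phi>' l \<le> \<phi>' m + \<theta> \<and> \<phi>' m + \<theta> \<le> \<phi>' (l + 1) \<and> (\<forall>i. \<not> (\<phi>' l < \<phi> i \<and> \<phi> i < \<phi>' (l + 1))))"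
  shows "\<exists>\<gamma>'. adm lam n \<gamma>' \<phi>' \<and> (\<forall>k. \<gamma>' (cis (\<phi>' k)) = \<gamma> (cis (\<phi>' k)))"
proof -
  define w where "w = (\<lambda>k. \<gamma> (cis (\<phi>' k)))"
  have lamq: "lam ^ q = (\<rho> ^ q) *\<^sub>R cis x"
  proof -
    have "lam ^ q = (\<rho> ^ q) *\<^sub>R cis (real q * \<theta>)" unfolding lam_def by (simp only: scaleR_power Complex.DeMoivre)
    also have "cis (real q * \<theta>) = cis x * cis (2 * pi * real p)" unfolding theta_q by (simp only: cis_mult)
    also have "cis (2 * pi * real p) = 1" by (rule cis_multiple_2pi) auto
    finally show ?thesis by simp
  qed
  have per: "cis (\<phi>' (k + int n)) = cis (\<phi>' k)" for k
  proof -
    have "cis (\<phi>' (k + int n)) = cis (\<phi>' k) * cis (2 * pi)" using marks_D(4)[OF mk] by (simp only: cis_mult)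
    then show ?thesis by simp
  qed
  have inv: "cone_rep \<phi>' w (lam * cis (\<phi>' m)) (w m)" for m
  proof -
    have lm: "lam * cis (\<phi>' m) = \<rho> *\<^sub>R cis (\<phi>' m + \<theta>)" by (simp add: lam_def cis_mult add.commute)
    have le: "\<gamma> (\<rho> *\<^sub>R cis (\<phi>' m + \<theta>)) \<le> w m" unfolding lm[symmetric] w_def by (rule adm_D(3)[OF adm])
    have caseA: ?thesis if "\<phi>' m + \<theta> = \<phi>' l" for l
    proof -
      have "cone_rep \<phi>' w (\<rho> *\<^sub>R cis (\<phi>' l)) (\<rho> * w l)" using rho by (intro cone_rep_basis) auto
      moreover have "\<rho> * w l \<le> w m" using le adm_D(8)[OF adm, of \<rho>] rho unfolding that by (simp add: w_def)
      ultimately show ?thesis unfolding lm that by (rule cone_rep.weaken)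
    qed
    obtain l where "\<phi>' m + \<theta> = \<phi>' l \<or> (\<phi>' l \<le> \<phi>' m + \<theta> \<and> \<phi>' m + \<theta> \<le> \<phi>' (l + 1) \<and> (\<forall>i. \<not> (\<phi>' l < \<phi> i \<and> \<phi> i < \<phi>' (l + 1))))"
      using im by blast
    then consider "\<phi>' m + \<theta> = \<phi>' l" | "\<phi>' l < \<phi>' m + \<theta>" "\<phi>' m + \<theta> \<le> \<phi>' (l + 1)" "\<And>i. \<not> (\<phi>' l < \<phi> i \<and> \<phi> i < \<phi>' (l + 1))"
      by force
    then show ?thesis
    proof cases
      case 2
      obtain i where i: "\<phi> i \<le> \<phi>' l" "\<phi>' l < \<phi> (i + 1)" using marks_interval[OF adm_D(4)[OF adm]] by blast
      have i2: "\<phi>' (l + 1) \<le> \<phi> (i + 1)" using 2(3)[of "i + 1"] i by auto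
      have g: "0 < \<phi>' (l + 1) - \<phi>' l" "\<phi>' (l + 1) - \<phi>' l < pi"
        using 2 i i2 adm_D(5)[OF adm, of i] by auto
      define a b where "a = \<rho> * (sin (\<phi>' (l + 1) - (\<phi>' m + \<theta>)) / sin (\<phi>' (l + 1) - \<phi>' l))"
        and "b = \<rho> * (sin (\<phi>' m + \<theta> - \<phi>' l) / sin (\<phi>' (l + 1) - \<phi>' l))"
      have ab: "0 \<le> a" "0 \<le> b" unfolding a_def b_def using 2 g rho
        by (auto intro!: mult_nonneg_nonneg divide_nonneg_pos sin_ge_zero sin_gt_zero)
      have z: "\<rho> *\<^sub>R cis (\<phi>' m + \<theta>) = a *\<^sub>R cis (\<phi>' l) + b *\<^sub>R cis (\<phi>' (l + 1))"
        unfolding cis_between[OF g, of "\<phi>' m + \<theta>"] a_def b_def by (simp add: scaleR_add_right)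
      have "a * w l + b * w (l + 1) = \<gamma> (\<rho> *\<^sub>R cis (\<phi>' m + \<theta>))"
        unfolding z w_def using g by (intro adm_linear[OF adm i(1) _ i2 ab, symmetric]) auto
      then have "a * w l + b * w (l + 1) \<le> w m" using le by simp
      moreover have "cone_rep \<phi>' w (a *\<^sub>R cis (\<phi>' l) + b *\<^sub>R cis (\<phi>' (l + 1))) (a * w l + b * w (l + 1))"
        using ab by (intro cone_rep_add[OF cone_rep_basis cone_rep_basis])
      ultimately show ?thesis unfolding lm z by (blast intro: cone_rep.weaken)
    qed (rule caseA)
  qed
  interpret polygon lam n \<phi>' w q "\<rho> ^ q" x
  proof
    show "0 < w k" for k unfolding w_def by (rule adm_D(2)[OF adm]) simp
    show "w (k + int n) = w k" for k unfolding w_def per ..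
  qed (use mk lamq rho x_pos x_small inv in auto)
  have "gauge (cis (\<phi>' k)) = \<gamma> (cis (\<phi>' k))" for k
    using gauge_mark[of k] gauge_dominates[OF adm_D(1)[OF adm], of "cis (\<phi>' k)"] by (force simp: w_def)
  then show ?thesis using gauge_adm by blast
qed

text \<open>The number of steps is bounded by \<open>q\<close> and \<open>n\<close> because \<open>j - q \<sigma>\<close> and \<open>j - n (\<sigma> + 1)\<close> are congruent to \<open>j\<close> modulo \<open>n\<close>
  while \<open>2 \<pi> p / q < \<theta> \<le> 2 \<pi> (\<sigma> + 1) / n\<close>, so that a full turn never improves the extremum.\<close>

definition low :: "(int \<Rightarrow> real) \<Rightarrow> int \<Rightarrow> real" where
  "low \<phi> j = Min ((\<lambda>i::nat. \<phi> (j - int i * \<sigma>) + real i * \<theta>) ` {..<q})"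

definition high :: "(int \<Rightarrow> real) \<Rightarrow> int \<Rightarrow> real" where
  "high \<phi> j = Max ((\<lambda>i::nat. \<phi> (j - int i * (\<sigma> + 1)) + real i * \<theta>) ` {..<n})"

lemma low_le: "i < q \<Longrightarrow> low \<phi> j \<le> \<phi> (j - int i * \<sigma>) + real i * \<theta>"
  unfolding low_def by (intro Min_le) auto

lemma low_le_self: "low \<phi> j \<le> \<phi> j" using low_le[of 0 \<phi> j] n_pos by simp

lemma low_attained: obtains i where "i < q" "low \<phi> j = \<phi> (j - int i * \<sigma>) + real i * \<theta>"
proof -
  have "low \<phi> j \<in> (\<lambda>i::nat. \<phi> (j - int i * \<sigma>) + real i * \<theta>) ` {..<q}"
    unfolding low_def using n_pos by (intro Min_in) auto
  then show ?thesis using that by auto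
qed

lemma high_ge: "i < n \<Longrightarrow> \<phi> (j - int i * (\<sigma> + 1)) + real i * \<theta> \<le> high \<phi> j"
  unfolding high_def by (intro Max_ge) auto

lemma high_ge_self: "\<phi> j \<le> high \<phi> j" using high_ge[of 0 \<phi> j] n_pos by simp

lemma high_attained: obtains i where "i < n" "high \<phi> j = \<phi> (j - int i * (\<sigma> + 1)) + real i * \<theta>"
proof -
  have "high \<phi> j \<in> (\<lambda>i::nat. \<phi> (j - int i * (\<sigma> + 1)) + real i * \<theta>) ` {..<n}"
    unfolding high_def using n_pos by (intro Max_in) auto
  then show ?thesis using that by auto
qed

lemma marks_low: assumes "marks n \<phi>" shows "marks n (low \<phi>)"
proof -
  have "low \<phi> j \<le> low \<phi> j'" if "j \<le> j'" for j j'
  proof -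
  obtain i where i: "i < q" "low \<phi> j' = \<phi> (j' - int i * \<sigma>) + real i * \<theta>" by (rule low_attained[of \<phi> "j'"])
  have "\<phi> (j - int i * \<sigma>) \<le> \<phi> (j' - int i * \<sigma>)" using \<open>j \<le> j'\<close> by (intro marks_D(2)[OF assms]) auto
  then show ?thesis using low_le[OF i(1), of \<phi> j] i(2) by linarith
  qed
  then have 1: "mono (low \<phi>)" by (rule monoI)
  have "low \<phi> (k + int n) = low \<phi> k + 2 * pi" for k
  proof -
  have e: "\<phi> (k + int n - int i * \<sigma>) = \<phi> (k - int i * \<sigma>) + 2 * pi" for i
    using marks_D(4)[OF assms, of "k - int i * \<sigma>"] by (simp add: algebra_simps)
  obtain i where i: "i < q" "low \<phi> k = \<phi> (k - int i * \<sigma>) + real i * \<theta>" by (rule low_attained[of \<phi> "k"])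
  obtain i' where i': "i' < q" "low \<phi> (k + int n) = \<phi> (k + int n - int i' * \<sigma>) + real i' * \<theta>" by (rule low_attained[of \<phi> "(k + int n)"])
  show ?thesis
    using low_le[OF i(1), of \<phi> "k + int n"] low_le[OF i'(1), of \<phi> k] i(2) i'(2) e by auto
  qed
  then show ?thesis unfolding marks_def using 1 n_pos by blast
qed

lemma marks_high: assumes "marks n \<phi>" shows "marks n (high \<phi>)"
proof -
  have "high \<phi> j \<le> high \<phi> j'" if "j \<le> j'" for j j'
  proof -
  obtain i where i: "i < n" "high \<phi> j = \<phi> (j - int i * (\<sigma> + 1)) + real i * \<theta>" by (rule high_attained[of \<phi> "j"])
  have "\<phi> (j - int i * (\<sigma> + 1)) \<le> \<phi> (j' - int i * (\<sigma> + 1))" using \<open>j \<le> j'\<close> by (intro marks_D(2)[OF assms]) auto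
  then show ?thesis using high_ge[OF i(1), of \<phi> j'] i(2) by linarith
  qed
  then have 1: "mono (high \<phi>)" by (rule monoI)
  have "high \<phi> (k + int n) = high \<phi> k + 2 * pi" for k
  proof -
  have e: "\<phi> (k + int n - int i * (\<sigma> + 1)) = \<phi> (k - int i * (\<sigma> + 1)) + 2 * pi" for i
    using marks_D(4)[OF assms, of "k - int i * (\<sigma> + 1)"] by (simp add: algebra_simps)
  obtain i where i: "i < n" "high \<phi> k = \<phi> (k - int i * (\<sigma> + 1)) + real i * \<theta>" by (rule high_attained[of \<phi> "k"])
  obtain i' where i': "i' < n" "high \<phi> (k + int n) = \<phi> (k + int n - int i' * (\<sigma> + 1)) + real i' * \<theta>" by (rule high_attained[of \<phi> "(k + int n)"])
  show ?thesis
    using high_ge[OF i(1), of \<phi> "k + int n"] high_ge[OF i'(1), of \<phi> k] i(2) i'(2) e by auto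
  qed
  then show ?thesis unfolding marks_def using 1 n_pos by blast
qed

text \<open>If the minimum is attained at \<open>q - 1\<close> steps, one more step completes
  \<open>p\<close> full turns and gives \<open>\<phi> (j + \<sigma>) + x\<close> with
  \<open>x > 0\<close>.\<close>

lemma low_step: assumes "marks n \<phi>" shows "low \<phi> (j + \<sigma>) \<le> low \<phi> j + \<theta>"
proof -
  obtain i where i: "i < q" "low \<phi> j = \<phi> (j - int i * \<sigma>) + real i * \<theta>" by (rule low_attained[of \<phi> "j"])
  show ?thesis
  proof (cases "Suc i < q")
    case True
    then show ?thesis using low_le[OF True, of \<phi> "j + \<sigma>"] i(2) by (simp add: algebra_simps)
  next
    case False
    then have qi: "int q = int i + 1" "real q = real i + 1" using i by auto
    have e: "j - int i * \<sigma> = j + \<sigma> + int n * (- int p)" using sigma_q unfolding qi(1) by (simp add: algebra_simps)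
    have "\<phi> (j - int i * \<sigma>) = \<phi> (j + \<sigma>) - 2 * pi * real p" unfolding e marks_shift[OF assms] by simp
    then have "low \<phi> j + \<theta> = \<phi> (j + \<sigma>) + x" using i(2) theta_q qi(2) by (simp add: algebra_simps)
    then show ?thesis using low_le_self[of \<phi> "j + \<sigma>"] x_pos by linarith
  qed
qed

lemma low_lowered: assumes "marks n \<phi>" "low \<phi> j < \<phi> j" shows "low \<phi> j = low \<phi> (j - \<sigma>) + \<theta>"
proof -
  obtain i where i: "i < q" "low \<phi> j = \<phi> (j - int i * \<sigma>) + real i * \<theta>" by (rule low_attained[of \<phi> "j"])
  then obtain i' where i': "i = Suc i'" using assms(2) by (cases i) auto
  have "low \<phi> (j - \<sigma>) \<le> \<phi> (j - \<sigma> - int i' * \<sigma>) + real i' * \<theta>" using i i' by (intro low_le) auto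
  then have "low \<phi> (j - \<sigma>) + \<theta> \<le> low \<phi> j" using i(2) unfolding i' by (simp add: algebra_simps)
  then show ?thesis using low_step[OF assms(1), of "j - \<sigma>"] by simp
qed

lemma d_le_s: "d \<le> s"
proof -
  have "d - 1 \<le> q * (d - 1)" using n_pos by simp
  then show ?thesis using s_props(2) by linarith
qed

lemma theta_n: "real n * \<theta> \<le> 2 * pi * (real_of_int \<sigma> + 1)"
proof -
  have "real s * (real n * \<theta>) = real n * (real s * \<theta>)" by simp
  also have "\<dots> \<le> real n * (2 * pi * real r)" using theta_s y_pos by (intro mult_left_mono) auto
  also have "\<dots> = 2 * pi * (real_of_int \<sigma> * real s + real d)"
  proof -
    have "real_of_int (int n * int r) = real_of_int (\<sigma> * int s + int d)" using sigma_s by (intro arg_cong[of _ _ real_of_int]) linarith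
    then have "real n * real r = real_of_int \<sigma> * real s + real d" by simp
    moreover have "real n * (2 * pi * real r) = 2 * pi * (real n * real r)" by simp
    ultimately show ?thesis by simp
  qed
  also have "\<dots> \<le> 2 * pi * (real_of_int \<sigma> * real s + real s)" using d_le_s by (intro mult_left_mono add_left_mono) auto
  also have "\<dots> = real s * (2 * pi * (real_of_int \<sigma> + 1))" by (simp add: algebra_simps)
  finally show ?thesis using n_pos by simp
qed

lemma high_step: assumes "marks n \<phi>" shows "high \<phi> j + \<theta> \<le> high \<phi> (j + \<sigma> + 1)"
proof -
  obtain i where i: "i < n" "high \<phi> j = \<phi> (j - int i * (\<sigma> + 1)) + real i * \<theta>" by (rule high_attained[of \<phi> "j"])
  show ?thesis
  proof (cases "Suc i < n")
    case True
    then show ?thesis using high_ge[OF True, of \<phi> "j + \<sigma> + 1"] i(2) by (simp add: algebra_simps)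
  next
    case False
    then have ni: "int n = int i + 1" "real n = real i + 1" using i by auto
    have e: "j - int i * (\<sigma> + 1) = j + \<sigma> + 1 + int n * (- (\<sigma> + 1))" unfolding ni by (simp add: algebra_simps)
    have "\<phi> (j - int i * (\<sigma> + 1)) = \<phi> (j + \<sigma> + 1) - 2 * pi * (real_of_int \<sigma> + 1)"
      unfolding e marks_shift[OF assms] by (simp add: algebra_simps)
    then have "high \<phi> j + \<theta> \<le> \<phi> (j + \<sigma> + 1)" using i(2) theta_n ni(2) by (simp add: algebra_simps)
    then show ?thesis using high_ge_self[of \<phi> "j + \<sigma> + 1"] by linarith
  qed
qed

text \<open>Raising must not destroy what lowering has achieved. The backward steps of
  \<open>high\<close> commute with the index shift by \<open>\<sigma>\<close>, so the inequality
  passes to every term of the maximum.\<close>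

lemma high_low_step: assumes "\<And>j. \<phi> (j + \<sigma>) \<le> \<phi> j + \<theta>" shows "high \<phi> (j + \<sigma>) \<le> high \<phi> j + \<theta>"
proof -
  obtain i where i: "i < n" "high \<phi> (j + \<sigma>) = \<phi> (j + \<sigma> - int i * (\<sigma> + 1)) + real i * \<theta>" by (rule high_attained[of \<phi> "(j + \<sigma>)"])
  have e: "j + \<sigma> - int i * (\<sigma> + 1) = (j - int i * (\<sigma> + 1)) + \<sigma>" by simp
  have "high \<phi> (j + \<sigma>) \<le> \<phi> (j - int i * (\<sigma> + 1)) + \<theta> + real i * \<theta>"
    unfolding i(2) e using assms[of "j - int i * (\<sigma> + 1)"] by (rule add_right_mono)
  then show ?thesis using high_ge[OF i(1), of \<phi> j] by linarith
qed

lemma high_raised: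
  assumes "marks n \<phi>" "\<phi> j < high \<phi> j" shows "high \<phi> j = high \<phi> (j - \<sigma> - 1) + \<theta>"
proof -
  obtain i where i: "i < n" "high \<phi> j = \<phi> (j - int i * (\<sigma> + 1)) + real i * \<theta>" by (rule high_attained[of \<phi> "j"])
  then obtain i' where i': "i = Suc i'" using assms(2) by (cases i) auto
  have "\<phi> (j - \<sigma> - 1 - int i' * (\<sigma> + 1)) + real i' * \<theta> \<le> high \<phi> (j - \<sigma> - 1)" using i i' by (intro high_ge) auto
  then have "high \<phi> j \<le> high \<phi> (j - \<sigma> - 1) + \<theta>" using i(2) unfolding i' by (simp add: algebra_simps)
  then show ?thesis using high_step[OF assms(1), of "j - \<sigma> - 1"] by simp
qed

text \<open>If an old mark lies strictly inside a gap of the lowered marks, the left end of the gap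
  has really been lowered and is therefore the image of a mark. By monotonicity the image of
  \<open>m\<close> coincides with this end, which is the first alternative of
  \<open>inscribe\<close>.\<close>

lemma low_adm:
  assumes rho: "0 < \<rho>" and adm: "adm (\<rho> *\<^sub>R cis \<theta>) n \<gamma> \<phi>"
  shows "\<exists>\<gamma>'. adm (\<rho> *\<^sub>R cis \<theta>) n \<gamma>' (low \<phi>) \<and> (\<forall>k. \<gamma>' (cis (low \<phi> k)) = \<gamma> (cis (low \<phi> k)))"
proof (rule inscribe[OF rho adm])
  have mk: "marks n \<phi>" by (rule adm_D(4)[OF adm])
  show mk': "marks n (low \<phi>)" by (rule marks_low[OF mk])
  fix m
  obtain l where l: "low \<phi> l \<le> low \<phi> m + \<theta>" "low \<phi> m + \<theta> < low \<phi> (l + 1)" using marks_interval[OF mk'] by blast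
  have "low \<phi> m + \<theta> = low \<phi> l" if i: "low \<phi> l < \<phi> i" "\<phi> i < low \<phi> (l + 1)" for i
  proof -
    have "low \<phi> i < low \<phi> (l + 1)" using i low_le_self[of \<phi> i] by linarith
    then have "i \<le> l" using marks_D(3)[OF mk'] by force
    then have "low \<phi> l < \<phi> l" using i marks_D(2)[OF mk, of i l] by linarith
    then have e: "low \<phi> l = low \<phi> (l - \<sigma>) + \<theta>" by (rule low_lowered[OF mk])
    have "m \<le> l - \<sigma>"
    proof (rule ccontr)
      assume "\<not> m \<le> l - \<sigma>"
      then have "low \<phi> (l + 1) \<le> low \<phi> (m + \<sigma>)" by (intro marks_D(2)[OF mk']) auto
      then show False using low_step[OF mk, of m] l by linarith
    qed
    then show ?thesis using marks_D(2)[OF mk', of m "l - \<sigma>"] e l by linarith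
  qed
  then show "\<exists>l. low \<phi> m + \<theta> = low \<phi> l \<or>
        (low \<phi> l \<le> low \<phi> m + \<theta> \<and> low \<phi> m + \<theta> \<le> low \<phi> (l + 1) \<and> (\<forall>i. \<not> (low \<phi> l < \<phi> i \<and> \<phi> i < low \<phi> (l + 1))))"
    using l by (intro exI[of _ l]) auto
qed

lemma high_adm:
  assumes rho: "0 < \<rho>" and adm: "adm (\<rho> *\<^sub>R cis \<theta>) n \<gamma> \<phi>"
  shows "\<exists>\<gamma>'. adm (\<rho> *\<^sub>R cis \<theta>) n \<gamma>' (high \<phi>) \<and> (\<forall>k. \<gamma>' (cis (high \<phi> k)) = \<gamma> (cis (high \<phi> k)))"
proof (rule inscribe[OF rho adm])
  have mk: "marks n \<phi>" by (rule adm_D(4)[OF adm])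
  show mk': "marks n (high \<phi>)" by (rule marks_high[OF mk])
  fix m
  obtain l where l: "high \<phi> l < high \<phi> m + \<theta>" "high \<phi> m + \<theta> \<le> high \<phi> (l + 1)" using marks_last_less[OF mk'] by blast
  have "high \<phi> m + \<theta> = high \<phi> (l + 1)" if i: "high \<phi> l < \<phi> i" "\<phi> i < high \<phi> (l + 1)" for i
  proof -
    have "high \<phi> l < high \<phi> i" using i high_ge_self[of \<phi> i] by linarith
    then have "l < i" using marks_D(3)[OF mk'] by force
    then have "\<phi> (l + 1) < high \<phi> (l + 1)" using i marks_D(2)[OF mk, of "l + 1" i] by linarith
    then have e: "high \<phi> (l + 1) = high \<phi> (l - \<sigma>) + \<theta>" using high_raised[OF mk, of "l + 1"] by simp
    have "l - \<sigma> \<le> m"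
    proof (rule ccontr)
      assume "\<not> l - \<sigma> \<le> m"
      then have "high \<phi> (m + \<sigma> + 1) \<le> high \<phi> l" by (intro marks_D(2)[OF mk']) auto
      then show False using high_step[OF mk, of m] l by linarith
    qed
    then show ?thesis using marks_D(2)[OF mk', of "l - \<sigma>" m] e l by linarith
  qed
  then show "\<exists>l. high \<phi> m + \<theta> = high \<phi> l \<or>
        (high \<phi> l \<le> high \<phi> m + \<theta> \<and> high \<phi> m + \<theta> \<le> high \<phi> (l + 1) \<and> (\<forall>i. \<not> (high \<phi> l < \<phi> i \<and> \<phi> i < high \<phi> (l + 1))))"
    using l by (cases "\<exists>i. high \<phi> l < \<phi> i \<and> \<phi> i < high \<phi> (l + 1)") (blast, intro exI[of _ l], auto)
qed

end

section \<open>Continuity of gauges and perturbation of the marks\<close>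

lemma adm_lipschitz:
  assumes "adm lam N \<gamma> \<phi>"
  obtains C where "0 \<le> C" "\<And>z z'. \<gamma> z \<le> \<gamma> z' + C * norm (z - z')"
proof -
  note A = adm_D[OF assms]
  define C where "C = \<gamma> 1 + \<gamma> (- 1) + \<gamma> \<i> + \<gamma> (- \<i>)"
  have pos: "0 < \<gamma> 1" "0 < \<gamma> (- 1)" "0 < \<gamma> \<i>" "0 < \<gamma> (- \<i>)" by (auto intro!: A(2))
  have ax: "\<gamma> (t *\<^sub>R u) \<le> \<bar>t\<bar> * (\<gamma> u + \<gamma> (- u))" if "0 < \<gamma> u" "0 < \<gamma> (- u)" for t u
  proof (cases "0 \<le> t")
    case True
    then show ?thesis using A(8)[of t u] that by (simp add: mult_left_mono)
  next
    case False
    have "\<gamma> (t *\<^sub>R u) = \<gamma> ((- t) *\<^sub>R (- u))" by simp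
    also have "\<dots> = - t * \<gamma> (- u)" using False by (intro A(8)) auto
    also have "\<dots> \<le> \<bar>t\<bar> * (\<gamma> u + \<gamma> (- u))" using False that by (simp add: mult_left_mono_neg)
    finally show ?thesis .
  qed
  have bd: "\<gamma> z \<le> C * norm z" for z
  proof -
    have "z = Re z *\<^sub>R 1 + Im z *\<^sub>R \<i>" by (rule complex_eqI) auto
    then have "\<gamma> z \<le> \<gamma> (Re z *\<^sub>R 1) + \<gamma> (Im z *\<^sub>R \<i>)" using A(7) by metis
    also have "\<dots> \<le> \<bar>Re z\<bar> * (\<gamma> 1 + \<gamma> (- 1)) + \<bar>Im z\<bar> * (\<gamma> \<i> + \<gamma> (- \<i>))"
      by (intro add_mono ax pos)
    also have "\<dots> \<le> norm z * (\<gamma> 1 + \<gamma> (- 1)) + norm z * (\<gamma> \<i> + \<gamma> (- \<i>))"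
      using pos by (intro add_mono mult_right_mono abs_Re_le_cmod abs_Im_le_cmod) auto
    finally show ?thesis by (simp add: C_def algebra_simps)
  qed
  have "\<gamma> z \<le> \<gamma> z' + C * norm (z - z')" for z z'
    using A(7)[of z' "z - z'"] bd[of "z - z'"] by simp
  then show ?thesis using that[of C] pos by (simp add: C_def)
qed

lemma adm_lower:
  assumes "adm lam N \<gamma> \<phi>"
  obtains \<mu> where "0 < \<mu>" "\<And>t. \<mu> \<le> \<gamma> (cis t)"
proof -
  obtain C where C: "0 \<le> C" "\<And>z z'. \<gamma> z \<le> \<gamma> z' + C * norm (z - z')" by (rule adm_lipschitz[OF assms]) (rule that, assumption+)
  have "continuous_on (sphere 0 1) \<gamma>"
    unfolding continuous_on_iff
  proof (intro ballI allI impI)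
    fix z :: complex and e :: real assume e: "0 < e"
    have "\<bar>\<gamma> w - \<gamma> z\<bar> < e" if "dist w z < e / (C + 1)" for w
    proof -
      have "\<bar>\<gamma> w - \<gamma> z\<bar> \<le> C * norm (w - z)" using C(2)[of w z] C(2)[of z w] by (simp add: norm_minus_commute abs_le_iff)
      also have "\<dots> \<le> (C + 1) * norm (w - z)" by (simp add: mult_right_mono)
      also have "\<dots> < e" using that C(1) by (simp add: dist_norm field_simps)
      finally show ?thesis .
    qed
    then show "\<exists>d>0. \<forall>x'\<in>sphere 0 1. dist x' z < d \<longrightarrow> dist (\<gamma> x') (\<gamma> z) < e"
      using e C(1) by (intro exI[of _ "e / (C + 1)"]) (auto simp: dist_real_def)
  qed
  then obtain z where z: "z \<in> sphere 0 1" "\<And>w. w \<in> sphere 0 1 \<Longrightarrow> \<gamma> z \<le> \<gamma> w"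
    using continuous_attains_inf[of "sphere (0::complex) 1" \<gamma>] by (auto simp: sphere_eq_empty simp del: mem_sphere_0)
  have "z \<noteq> 0" using z by auto
  then show ?thesis using that[of "\<gamma> z"] adm_D(2)[OF assms] z(2) by auto
qed

lemma periodic_bounded:
  fixes f :: "int \<Rightarrow> real"
  assumes "\<And>k. f (k + int n) = f k" "0 < n" "\<And>k. f k < b"
  obtains B where "B < b" "\<And>k. f k \<le> B"
proof -
  have fin: "finite (f ` {0..<int n})" "f ` {0..<int n} \<noteq> {}" using assms by auto
  have "Max (f ` {0..<int n}) \<in> f ` {0..<int n}" by (rule Max_in[OF fin])
  then have 1: "Max (f ` {0..<int n}) < b" using assms(3) by auto
  have "f k \<le> Max (f ` {0..<int n})" for k
  proof -
    have "f (k mod int n) = f k" by (rule periodic_mod_int(2)) (rule assms(1))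
    moreover have "f (k mod int n) \<in> f ` {0..<int n}" using assms by auto
    ultimately show ?thesis using fin by (metis Max_ge)
  qed
  then show ?thesis using that[OF 1] by blast
qed

lemma sublin_bend:
  assumes "sublin \<gamma>" "0 < b - a" "0 < c - b" "b - a < pi" "c - b < pi" "0 \<le> \<gamma> (cis b)" "\<And>z. 0 \<le> \<gamma> z"
  shows "0 \<le> sin (c - b) * \<gamma> (cis a) + sin (b - a) * \<gamma> (cis c) - sin (c - a) * \<gamma> (cis b)"
proof -
  have s: "0 < sin (c - b)" "0 < sin (b - a)" using assms by (auto intro: sin_gt_zero)
  show ?thesis
  proof (cases "0 \<le> sin (c - a)")
    case True
    have "sin (c - a) *\<^sub>R cis b = sin (c - b) *\<^sub>R cis a + sin (b - a) *\<^sub>R cis c"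
      using cramer[of "cis a" "cis c" "cis b"] unfolding cr_cis .
    then have "sin (c - a) * \<gamma> (cis b) = \<gamma> (sin (c - b) *\<^sub>R cis a + sin (b - a) *\<^sub>R cis c)"
      using assms(1) True unfolding sublin_def by metis
    also have "\<dots> \<le> sin (c - b) * \<gamma> (cis a) + sin (b - a) * \<gamma> (cis c)"
      using assms(1) s unfolding sublin_def by (metis less_imp_le)
    finally show ?thesis by simp
  next
    case False
    have "0 \<le> sin (c - b) * \<gamma> (cis a)" "0 \<le> sin (b - a) * \<gamma> (cis c)" using s assms(7) by auto
    moreover have "sin (c - a) * \<gamma> (cis b) \<le> 0" using False assms(6) by (simp add: mult_nonpos_nonneg)
    ultimately show ?thesis by linarith
  qed
qed

lemma cis_lipschitz: "norm (cis a - cis b) \<le> \<bar>a - b\<bar>"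
proof -
  have "norm (cis a - cis b) = dist (cis a) (cis b)" by (simp add: dist_norm)
  also have "\<dots> = 2 * \<bar>sin ((a - b) / 2)\<bar>" 
  proof -
    have "norm (cis a - cis b) ^ 2 = (2 * \<bar>sin ((a - b) / 2)\<bar>) ^ 2"
    proof -
      have "(norm (cis a - cis b))\<^sup>2 = (cos a - cos b)\<^sup>2 + (sin a - sin b)\<^sup>2" by (simp add: cmod_power2)
      also have "\<dots> = 2 - 2 * cos (a - b)"
        using sin_cos_squared_add[of a] sin_cos_squared_add[of b] by (simp add: cos_diff power2_eq_square algebra_simps)
      also have "cos (a - b) = 1 - 2 * (sin ((a - b) / 2))\<^sup>2"
      proof -
        define h where "h = (a - b) / 2"
        have "a - b = 2 * h" by (simp add: h_def)
        then show ?thesis using cos_double_sin[of h] by (simp add: h_def[symmetric])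
      qed
      finally show ?thesis by (simp add: power_mult_distrib)
    qed
    then show ?thesis unfolding dist_norm by (rule power2_eq_imp_eq) auto
  qed
  also have "\<dots> \<le> 2 * \<bar>(a - b) / 2\<bar>" using abs_sin_x_le_abs_x[of "(a - b) / 2"] by simp
  finally show ?thesis by simp
qed

context karp_sector
begin

lemma lam_q: "(\<rho> *\<^sub>R cis \<theta>) ^ q = (\<rho> ^ q) *\<^sub>R cis x"
proof -
  have "(\<rho> *\<^sub>R cis \<theta>) ^ q = (\<rho> ^ q) *\<^sub>R cis (real q * \<theta>)" by (simp only: scaleR_power Complex.DeMoivre)
  also have "cis (real q * \<theta>) = cis x * cis (2 * pi * real p)" unfolding theta_q by (simp only: cis_mult)
  also have "cis (2 * pi * real p) = 1" by (rule cis_multiple_2pi) auto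
  finally show ?thesis by simp
qed

text \<open>Mixing with equally spaced marks makes all inequalities between the marks strict.\<close>

definition tilt :: "real \<Rightarrow> (int \<Rightarrow> real) \<Rightarrow> int \<Rightarrow> real" where
  "tilt \<epsilon> \<phi> k = (1 - \<epsilon>) * \<phi> k + \<epsilon> * (2 * pi * real_of_int k / real n)"

lemma sigma_theta: "2 * pi * real_of_int \<sigma> / real n < \<theta>" "\<theta> < 2 * pi * (real_of_int \<sigma> + 1) / real n"
proof -
  have "real_of_int \<sigma> / real n = real p / real q" using n_pos by (simp add: \<sigma>_def n_def)
  then have "2 * pi * real_of_int \<sigma> / real n = 2 * pi * real p / real q" by (metis times_divide_eq_right)
  then show "2 * pi * real_of_int \<sigma> / real n < \<theta>" using sector by simp
  have "real s * (real n * \<theta>) = real n * (2 * pi * real r) - real n * (real d * y)"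
    unfolding mult.left_commute[of "real s" "real n"] theta_s by (rule right_diff_distrib)
  also have "\<dots> < real n * (2 * pi * real r)" using n_pos y_pos by simp
  also have "\<dots> = 2 * pi * (real_of_int \<sigma> * real s + real d)"
  proof -
    have "real_of_int (int n * int r) = real_of_int (\<sigma> * int s + int d)" using sigma_s by (intro arg_cong[of _ _ real_of_int]) linarith
    then have "real n * real r = real_of_int \<sigma> * real s + real d" by simp
    moreover have "real n * (2 * pi * real r) = 2 * pi * (real n * real r)" by simp
    ultimately show ?thesis by simp
  qed
  also have "\<dots> \<le> 2 * pi * (real_of_int \<sigma> * real s + real s)" using d_le_s by (intro mult_left_mono add_left_mono) auto
  also have "\<dots> = real s * (2 * pi * (real_of_int \<sigma> + 1))" by (simp add: algebra_simps)
  finally have "real n * \<theta> < 2 * pi * (real_of_int \<sigma> + 1)" using n_pos by (simp only: mult_less_cancel_left_pos of_nat_0_less_iff)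
  then show "\<theta> < 2 * pi * (real_of_int \<sigma> + 1) / real n" using n_pos by (simp add: pos_less_divide_eq mult.commute)
qed

text \<open>The values of \<open>\<gamma>\<close> at the tilted marks satisfy the row inequalities
  up to an error of order \<open>\<epsilon>\<close> and serve as the start of the Perron argument.
  As \<open>\<gamma>\<close> is linear only between the original marks, each row is moved to these
  and back, at the price of two Lipschitz errors.\<close>

theorem perturb:
  assumes rho: "0 < \<rho>" and adm: "adm (\<rho> *\<^sub>R cis \<theta>) n \<gamma> \<phi>"
    and st1: "\<And>j. \<phi> (j + \<sigma>) \<le> \<phi> j + \<theta>" and st2: "\<And>j. \<phi> j + \<theta> \<le> \<phi> (j + \<sigma> + 1)"
  shows "\<exists>K\<ge>0. \<forall>\<epsilon>. 0 < \<epsilon> \<longrightarrow> \<epsilon> \<le> 1 / 2 \<longrightarrow> (\<exists>L G. 0 < L \<and> exp L \<le> 1 / \<rho> + K * \<epsilon> \<and>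
     level_system q d s (\<lambda>i t. tilt \<epsilon> \<phi> (i + \<sigma> * t) - real_of_int t * \<theta>) G x y L)"
proof -
  have mk: "marks n \<phi>" by (rule adm_D(4)[OF adm])
  obtain C where C: "0 \<le> C" "\<And>z z'. \<gamma> z \<le> \<gamma> z' + C * norm (z - z')" by (rule adm_lipschitz[OF adm]) (rule that, assumption+)
  obtain \<mu> where mu: "0 < \<mu>" "\<And>t. \<mu> \<le> \<gamma> (cis t)" by (rule adm_lower[OF adm]) (rule that, assumption+)
  have n3: "3 < n" using s_props(3,4) n_def by linarith
  have per: "\<phi> (k + int n) = \<phi> k + 2 * pi" for k by (rule marks_D(4)[OF mk])
  obtain \<Gamma>0 where G0: "\<Gamma>0 < pi" "\<And>k. \<phi> (k + 1) - \<phi> k \<le> \<Gamma>0"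
  proof (rule periodic_bounded[of "\<lambda>k. \<phi> (k + 1) - \<phi> k" n pi])
    show "\<phi> (k + int n + 1) - \<phi> (k + int n) = \<phi> (k + 1) - \<phi> k" for k
      using per[of k] per[of "k + 1"] by (simp add: algebra_simps)
  qed (use n_pos adm_D(5)[OF adm] in auto)
  define \<Gamma> where "\<Gamma> = max \<Gamma>0 (2 * pi / real n)"
  have "2 * pi / real n < pi" using n3 by (simp add: field_simps)
  then have G: "\<Gamma> < pi" "0 < \<Gamma>" "\<And>k. \<phi> (k + 1) - \<phi> k \<le> \<Gamma>" "2 * pi / real n \<le> \<Gamma>"
    using G0 n_pos by (auto simp: \<Gamma>_def less_max_iff_disj max.coboundedI1)
  obtain \<eta> where eta: "\<And>k. \<bar>\<phi> k - 2 * pi * real_of_int k / real n\<bar> \<le> \<eta>"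
  proof -
    define f where "f = (\<lambda>k. \<bar>\<phi> k - 2 * pi * real_of_int k / real n\<bar>)"
    have fp: "f (k + int n) = f k" for k using n_pos per by (simp add: f_def field_simps)
    have "f k \<le> Max (f ` {0..<int n})" for k
    proof -
      have "f (k mod int n) = f k" by (rule periodic_mod_int(2)) (rule fp)
      moreover have "f (k mod int n) \<in> f ` {0..<int n}" using n_pos by auto
      ultimately show ?thesis by (metis Max_ge finite_atLeastLessThan_int finite_imageI)
    qed
    then show ?thesis by (intro that[of "Max (f ` {0..<int n})"]) (simp add: f_def)
  qed
  have eta0: "0 \<le> \<eta>" using eta[of 0] by linarith
  define D where "D = cos (\<Gamma> / 2)"
  have D: "0 < D" unfolding D_def using G by (intro cos_gt_zero_pi) auto
  \<comment> \<open>The factor \<open>2 * C * \<eta>\<close> accounts for both displacements,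
    \<open>1 / D\<close> bounds the sum \<open>P + S\<close> of the interpolation weights, and
    \<open>1 / \<mu>\<close> turns the absolute error into a multiple of the gauge.\<close>
  define K where "K = 2 * C * \<eta> / D / \<mu>"
  have K: "0 \<le> K" unfolding K_def using C eta0 D mu by auto
  show ?thesis
  proof (rule exI[of _ K], intro conjI K allI impI)
    fix \<epsilon> :: real assume e: "0 < \<epsilon>" "\<epsilon> \<le> 1 / 2"
    define \<psi> where "\<psi> = tilt \<epsilon> \<phi>"
    have psi: "\<psi> k = (1 - \<epsilon>) * \<phi> k + \<epsilon> * (2 * pi * real_of_int k / real n)" for k by (simp add: \<psi>_def tilt_def)
    have dist: "\<bar>\<psi> k - \<phi> k\<bar> \<le> \<epsilon> * \<eta>" for k
    proof -
      have "\<psi> k - \<phi> k = - \<epsilon> * (\<phi> k - 2 * pi * real_of_int k / real n)" by (simp add: psi algebra_simps)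
      then have "\<bar>\<psi> k - \<phi> k\<bar> = \<epsilon> * \<bar>\<phi> k - 2 * pi * real_of_int k / real n\<bar>" using e by (simp add: abs_mult)
      then show ?thesis using eta[of k] e by (simp add: mult_left_mono)
    qed
    have diff: "\<psi> i - \<psi> j = (1 - \<epsilon>) * (\<phi> i - \<phi> j) + \<epsilon> * (2 * pi * real_of_int (i - j) / real n)" for i j
      by (simp add: psi algebra_simps diff_divide_distrib)
    have inc: "\<psi> k < \<psi> (k + 1)" for k
    proof -
      have "0 \<le> (1 - \<epsilon>) * (\<phi> (k + 1) - \<phi> k)" using e marks_D(2)[OF mk, of k "k + 1"] by simp
      moreover have "0 < \<epsilon> * (2 * pi * real_of_int (k + 1 - k) / real n)" using e n_pos by simp
      ultimately show ?thesis using diff[of "k + 1" k] by linarith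
    qed
    have gap: "\<psi> (k + 1) - \<psi> k \<le> \<Gamma>" for k
    proof -
      have "(1 - \<epsilon>) * (\<phi> (k + 1) - \<phi> k) \<le> (1 - \<epsilon>) * \<Gamma>" using e G by (intro mult_left_mono) auto
      moreover have "\<epsilon> * (2 * pi * real_of_int (k + 1 - k) / real n) \<le> \<epsilon> * \<Gamma>" using e G by (intro mult_left_mono) auto
      ultimately show ?thesis using diff[of "k + 1" k] by (simp add: algebra_simps)
    qed
    have lo: "\<psi> (j + \<sigma>) < \<psi> j + \<theta>" for j
    proof -
      have "(1 - \<epsilon>) * (\<phi> (j + \<sigma>) - \<phi> j) \<le> (1 - \<epsilon>) * \<theta>" using e st1[of j] by (intro mult_left_mono) auto
      moreover have "\<epsilon> * (2 * pi * real_of_int (j + \<sigma> - j) / real n) < \<epsilon> * \<theta>" using e sigma_theta by (intro mult_strict_left_mono) auto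
      ultimately show ?thesis using diff[of "j + \<sigma>" j] by (simp add: algebra_simps)
    qed
    have hi: "\<psi> j + \<theta> < \<psi> (j + \<sigma> + 1)" for j
    proof -
      have "(1 - \<epsilon>) * \<theta> \<le> (1 - \<epsilon>) * (\<phi> (j + \<sigma> + 1) - \<phi> j)" using e st2[of j] by (intro mult_left_mono) auto
      moreover have "\<epsilon> * \<theta> < \<epsilon> * (2 * pi * real_of_int (j + \<sigma> + 1 - j) / real n)" using e sigma_theta by (intro mult_strict_left_mono) auto
      ultimately show ?thesis using diff[of "j + \<sigma> + 1" j] by (simp add: algebra_simps)
    qed
    define g0 where "g0 = (\<lambda>k. \<gamma> (cis (\<psi> k)))"
    have perpsi: "\<psi> (k + int n) = \<psi> k + 2 * pi" for k
      using n_pos by (simp add: psi per field_simps)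
    have gap': "\<psi> (k + 1) - \<psi> k < pi" for k using gap[of k] G by linarith
    have gpos: "0 \<le> \<gamma> z" for z using adm_D(2)[OF adm, of z] adm_D(8)[OF adm, of 0 z] by (cases "z = 0") auto
    have "\<exists>L G. 0 < L \<and> exp L \<le> 1 / \<rho> + K * \<epsilon> \<and> level_system q d s (\<lambda>i t. \<psi> (i + \<sigma> * t) - real_of_int t * \<theta>) G x y L"
    proof (rule strict_marks[where ?g0.0=g0, OF perpsi inc gap' lo hi])
      fix k
      have "cis (\<psi> (k + int n)) = cis (\<psi> k)" unfolding perpsi by (simp add: cis_mult[symmetric])
      then show "g0 (k + int n) = g0 k" by (simp add: g0_def)
      show "0 < g0 k" unfolding g0_def by (intro adm_D(2)[OF adm]) simp
      show "0 \<le> sin (\<psi> (k + 1) - \<psi> k) * g0 (k - 1) + sin (\<psi> k - \<psi> (k - 1)) * g0 (k + 1) - sin (\<psi> (k + 1) - \<psi> (k - 1)) * g0 k"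
        unfolding g0_def
        by (rule sublin_bend[OF adm_D(1)[OF adm]])
           (use inc[of k] inc[of "k - 1"] gap'[of k] gap'[of "k - 1"] gpos in \<open>auto intro: less_imp_le\<close>)
      define m where "m = k + \<sigma>"
      define t where "t = \<psi> k + \<theta>"
      have t: "\<psi> m < t" "t < \<psi> (m + 1)" using lo[of k] hi[of k] by (auto simp: m_def t_def)
      have g: "0 < \<psi> (m + 1) - \<psi> m" "\<psi> (m + 1) - \<psi> m < pi" using inc gap' by auto
      define P S where "P = sin (\<psi> (m + 1) - t) / sin (\<psi> (m + 1) - \<psi> m)" and "S = sin (t - \<psi> m) / sin (\<psi> (m + 1) - \<psi> m)"
      have ct: "cis t = P *\<^sub>R cis (\<psi> m) + S *\<^sub>R cis (\<psi> (m + 1))" unfolding P_def S_def by (rule cis_between[OF g])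
      have PS: "0 \<le> P" "0 \<le> S" unfolding P_def S_def using t g by (auto intro!: divide_nonneg_pos sin_ge_zero sin_gt_zero)
      have sum: "(P + S) * D \<le> 1"
      proof -
        define M where "M = (\<psi> m + \<psi> (m + 1)) / 2"
        define h where "h = (\<psi> (m + 1) - \<psi> m) / 2"
        have Mh: "\<psi> m - M = - h" "\<psi> (m + 1) - M = h" by (auto simp: M_def h_def field_simps)
        have "cis (- M) * cis t = P *\<^sub>R cis (\<psi> m - M) + S *\<^sub>R cis (\<psi> (m + 1) - M)"
          unfolding ct by (simp add: distrib_left cis_mult)
        then have "Re (cis (- M) * cis t) = P * cos h + S * cos h" unfolding Mh by simp
        moreover have "Re (cis (- M) * cis t) \<le> 1" by (simp add: cis_mult)
        moreover have "D \<le> cos h" unfolding D_def h_def using gap[of m] g G by (intro cos_monotone_0_pi_le) auto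
        then have "(P + S) * D \<le> (P + S) * cos h" using PS by (intro mult_left_mono) auto
        ultimately show ?thesis by (simp add: distrib_right)
      qed
      have nb: "norm (cis (\<psi> j) - cis (\<phi> j)) \<le> \<epsilon> * \<eta>" "norm (cis (\<phi> j) - cis (\<psi> j)) \<le> \<epsilon> * \<eta>" for j
        using cis_lipschitz[of "\<psi> j" "\<phi> j"] dist[of j] by (auto simp: norm_minus_commute)
      have up: "\<gamma> (cis (\<psi> j)) \<le> \<gamma> (cis (\<phi> j)) + C * (\<epsilon> * \<eta>)" for j
        using C(2)[of "cis (\<psi> j)" "cis (\<phi> j)"] mult_left_mono[OF nb(1)[of j] C(1)] by linarith
      have "P * \<gamma> (cis (\<psi> m)) + S * \<gamma> (cis (\<psi> (m + 1))) \<le>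
          P * (\<gamma> (cis (\<phi> m)) + C * (\<epsilon> * \<eta>)) + S * (\<gamma> (cis (\<phi> (m + 1))) + C * (\<epsilon> * \<eta>))"
        using PS up by (intro add_mono mult_left_mono)
      also have "\<dots> = \<gamma> (P *\<^sub>R cis (\<phi> m) + S *\<^sub>R cis (\<phi> (m + 1))) + (P + S) * (C * (\<epsilon> * \<eta>))"
        using adm_D(6)[OF adm PS, of m] by (simp add: algebra_simps)
      also have "\<dots> \<le> \<gamma> (cis t) + (P + S) * (C * (\<epsilon> * \<eta>)) + (P + S) * (C * (\<epsilon> * \<eta>))"
      proof -
        have "P *\<^sub>R cis (\<phi> m) + S *\<^sub>R cis (\<phi> (m + 1)) - cis t = P *\<^sub>R (cis (\<phi> m) - cis (\<psi> m)) + S *\<^sub>R (cis (\<phi> (m + 1)) - cis (\<psi> (m + 1)))"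
          unfolding ct by (simp add: algebra_simps)
        then have "norm (P *\<^sub>R cis (\<phi> m) + S *\<^sub>R cis (\<phi> (m + 1)) - cis t) \<le> norm (P *\<^sub>R (cis (\<phi> m) - cis (\<psi> m))) + norm (S *\<^sub>R (cis (\<phi> (m + 1)) - cis (\<psi> (m + 1))))"
          by (metis norm_triangle_ineq)
        also have "\<dots> \<le> P * (\<epsilon> * \<eta>) + S * (\<epsilon> * \<eta>)" using nb(2) PS by (auto intro!: add_mono mult_left_mono)
        finally have "C * norm (P *\<^sub>R cis (\<phi> m) + S *\<^sub>R cis (\<phi> (m + 1)) - cis t) \<le> C * (P * (\<epsilon> * \<eta>) + S * (\<epsilon> * \<eta>))"
          using C(1) by (rule mult_left_mono)
        also have "\<dots> = (P + S) * (C * (\<epsilon> * \<eta>))" by (simp add: algebra_simps)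
        finally show ?thesis using C(2)[of "P *\<^sub>R cis (\<phi> m) + S *\<^sub>R cis (\<phi> (m + 1))" "cis t"] by linarith
      qed
      also have "\<gamma> (cis t) \<le> g0 k / \<rho>"
      proof -
        have "\<rho> * \<gamma> (cis t) = \<gamma> (\<rho> *\<^sub>R cis t)" using adm_D(8)[OF adm, of \<rho>] rho by simp
        also have "\<rho> *\<^sub>R cis t = (\<rho> *\<^sub>R cis \<theta>) * cis (\<psi> k)" by (simp add: t_def cis_mult add.commute)
        also have "\<gamma> \<dots> \<le> g0 k" unfolding g0_def by (rule adm_D(3)[OF adm])
        finally show ?thesis using rho by (simp add: field_simps)
      qed
      finally have "P * \<gamma> (cis (\<psi> m)) + S * \<gamma> (cis (\<psi> (m + 1))) \<le> g0 k / \<rho> + 2 * ((P + S) * (C * (\<epsilon> * \<eta>)))" by linarith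
      also have "\<dots> \<le> g0 k / \<rho> + 2 * (1 / D * (C * (\<epsilon> * \<eta>)))"
        using sum D C(1) e eta0 by (intro add_left_mono mult_left_mono mult_right_mono) (auto simp: field_simps)
      also have "2 * (1 / D * (C * (\<epsilon> * \<eta>))) = (K * \<epsilon>) * \<mu>" using mu D by (simp add: K_def field_simps)
      also have "\<dots> \<le> (K * \<epsilon>) * g0 k" using K e mu by (intro mult_left_mono) (auto simp: g0_def)
      finally have "P * \<gamma> (cis (\<psi> m)) + S * \<gamma> (cis (\<psi> (m + 1))) \<le> (1 / \<rho> + K * \<epsilon>) * g0 k" by (simp add: algebra_simps)
      then show "sin_chord (\<psi> (k + \<sigma>)) (\<psi> (k + \<sigma> + 1)) (g0 (k + \<sigma>)) (g0 (k + \<sigma> + 1)) (\<psi> k + \<theta>) \<le> (1 / \<rho> + K * \<epsilon>) * g0 k"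
        unfolding sin_chord_def P_def S_def g0_def m_def t_def by (simp add: add_divide_distrib)
    qed
    then show "\<exists>L G. 0 < L \<and> exp L \<le> 1 / \<rho> + K * \<epsilon> \<and> level_system q d s (\<lambda>i t. tilt \<epsilon> \<phi> (i + \<sigma> * t) - real_of_int t * \<theta>) G x y L"
      unfolding \<psi>_def .
  qed
qed

end

lemma karp_g_strict_mono:
  assumes "0 < sin x" "0 < sin y" "L < L'" "0 < q"
  shows "karp_g q d s x y L' < karp_g q d s x y L"
proof -
  have "(real s / real d) * L \<le> (real s / real d) * L'" using assms(3) by (intro mult_left_mono) auto
  then have 1: "exp (- (real s / real d) * L') \<le> exp (- (real s / real d) * L)" by simp
  have 2: "exp (- (real q * L')) < exp (- (real q * L))" using assms by simp
  show ?thesis unfolding karp_g_def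
    using mult_right_mono[OF 1, of "sin x"] mult_strict_right_mono[OF 2, of "sin y"] assms by linarith
qed

lemma karp_g_mono:
  assumes "0 < sin x" "0 < sin y" "L \<le> L'" "0 < q"
  shows "karp_g q d s x y L' \<le> karp_g q d s x y L"
  using karp_g_strict_mono[OF assms(1,2) _ assms(4), of L L' d s] assms(3) by (cases "L = L'") auto

context karp_sector
begin

lemma sin_xy: "0 < sin x" "0 < sin y" "0 < sin (x + y)"
  using x_pos y_pos x_small xy_small by (auto intro!: sin_gt_zero)

text \<open>Lowering and then raising the marks gives both weak inequalities. Tilted marks yield the
  claim for a slightly larger factor in place of \<open>1 / \<rho>\<close>; \<open>karp_g\<close> is
  antitone and continuous in \<open>L\<close>, so \<open>\<epsilon>\<close> can tend to 0.\<close>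

theorem adm_upper:
  assumes rho: "0 < \<rho>" and adm: "adm (\<rho> *\<^sub>R cis \<theta>) n \<gamma> \<phi>"
  shows "karp_g q d s x y (- ln \<rho>) \<le> 0"
proof -
  obtain \<gamma>1 where g1: "adm (\<rho> *\<^sub>R cis \<theta>) n \<gamma>1 (low \<phi>)" using low_adm[OF rho adm] by blast
  have mk1: "marks n \<phi>" by (rule adm_D(4)[OF adm])
  obtain \<gamma>2 where g2: "adm (\<rho> *\<^sub>R cis \<theta>) n \<gamma>2 (high (low \<phi>))"
    using high_adm[OF rho g1] by blast
  have st1: "high (low \<phi>) (j + \<sigma>) \<le> high (low \<phi>) j + \<theta>" for j
    by (rule high_low_step[of "low \<phi>"]) (rule low_step[OF mk1])
  have st2: "high (low \<phi>) j + \<theta> \<le> high (low \<phi>) (j + \<sigma> + 1)" for j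
    by (rule high_step[OF marks_low[OF mk1]])
  from perturb[OF rho g2 st1 st2]
  obtain K where K: "0 \<le> K" and K': "\<forall>\<epsilon>. 0 < \<epsilon> \<longrightarrow> \<epsilon> \<le> 1 / 2 \<longrightarrow> (\<exists>L G. 0 < L \<and> exp L \<le> 1 / \<rho> + K * \<epsilon> \<and>
     level_system q d s (\<lambda>i t. tilt \<epsilon> (high (low \<phi>)) (i + \<sigma> * t) - real_of_int t * \<theta>) G x y L)"
    by (elim exE conjE)
  have bound: "karp_g q d s x y (ln (1 / \<rho> + K * (1 / real (m + 2)))) \<le> 0" for m
  proof -
    have e: "0 < 1 / real (m + 2)" "1 / real (m + 2) \<le> 1 / 2" by (auto simp: field_simps)
    obtain L G where LG: "0 < L" "exp L \<le> 1 / \<rho> + K * (1 / real (m + 2))"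
      "level_system q d s (\<lambda>i t. tilt (1 / real (m + 2)) (high (low \<phi>)) (i + \<sigma> * t) - real_of_int t * \<theta>) G x y L"
      using K'[rule_format, OF e] by (elim exE conjE)
    have "karp_g q d s x y L \<le> 0" by (rule level_system.g_nonpos[OF LG(3) y_pos xy_small])
    moreover have "L \<le> ln (1 / \<rho> + K * (1 / real (m + 2)))"
      using LG(2) ln_ge_iff[of "1 / \<rho> + K * (1 / real (m + 2))" L] exp_gt_zero[of L] by linarith
    ultimately show ?thesis using karp_g_mono[OF sin_xy(1,2) _ n_pos(2), of L] by (meson order_trans)
  qed
  have "(\<lambda>m. 1 / real (m + 2)) \<longlonglongrightarrow> 0"
    using LIMSEQ_ignore_initial_segment[OF lim_1_over_n, of 2] by simp
  then have "(\<lambda>m. 1 / \<rho> + K * (1 / real (m + 2))) \<longlonglongrightarrow> 1 / \<rho> + K * 0" by (intro tendsto_intros)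
  then have lim: "(\<lambda>m. ln (1 / \<rho> + K * (1 / real (m + 2)))) \<longlonglongrightarrow> ln (1 / \<rho>)" using rho by (intro tendsto_ln) auto
  have "(\<lambda>m. karp_g q d s x y (ln (1 / \<rho> + K * (1 / real (m + 2))))) \<longlonglongrightarrow> karp_g q d s x y (ln (1 / \<rho>))"
    unfolding karp_g_def by (intro tendsto_intros lim)
  then have "karp_g q d s x y (ln (1 / \<rho>)) \<le> 0" by (rule LIMSEQ_le_const2) (use bound in auto)
  then show ?thesis using rho by (simp add: ln_div)
qed

theorem region_upper:
  assumes "0 < \<rho>" "\<rho> *\<^sub>R cis \<theta> \<in> karpelevich_region n"
  shows "karp_g q d s x y (- ln \<rho>) \<le> 0"
proof -
  obtain \<gamma> \<phi> where "adm (\<rho> *\<^sub>R cis \<theta>) n \<gamma> \<phi>"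
    using initial_adm[OF assms(2) lam_q] assms(1) x_pos x_small by auto
  then show ?thesis by (rule adm_upper[OF assms(1)])
qed

end

subsection \<open>The boundary curve is attained\<close>

lemma region_from_rows:
  fixes A :: "nat \<Rightarrow> nat \<Rightarrow> real" and v :: "nat \<Rightarrow> complex"
  assumes A: "\<And>i j. i < N \<Longrightarrow> j < N \<Longrightarrow> 0 \<le> A i j" "\<And>i. i < N \<Longrightarrow> (\<Sum>j<N. A i j) = 1"
    and row: "\<And>i. i < N \<Longrightarrow> lam * v i = (\<Sum>j<N. A i j *\<^sub>R v j)" and k0: "k0 < N" "v k0 \<noteq> 0"
  shows "lam \<in> karpelevich_region N"
proof -
  define M where "M = mat N N (\<lambda>(i, j). A i j)"
  have M: "stochastic_mat N M" unfolding stochastic_mat_def M_def using A by auto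
  have "map_mat complex_of_real M *\<^sub>v vec N v = lam \<cdot>\<^sub>v vec N v"
  proof (rule eq_vecI)
    fix i assume "i < dim_vec (lam \<cdot>\<^sub>v vec N v)"
    then have i: "i < N" by simp
    have "(map_mat complex_of_real M *\<^sub>v vec N v) $ i = (\<Sum>j\<in>{0..<N}. complex_of_real (A i j) * v j)"
      using i by (auto simp: M_def scalar_prod_def intro!: sum.cong)
    also have "\<dots> = lam * v i" using row[OF i] by (simp add: scaleR_conv_of_real atLeast0LessThan)
    finally show "(map_mat complex_of_real M *\<^sub>v vec N v) $ i = (lam \<cdot>\<^sub>v vec N v) $ i" using i by simp
  qed (simp add: M_def)
  moreover have "vec N v \<noteq> 0\<^sub>v N"
  proof
    assume "vec N v = 0\<^sub>v N"
    then have "vec N v $ k0 = 0\<^sub>v N $ k0" by simp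
    then show False using k0 by simp
  qed
  ultimately have "eigenvalue (map_mat complex_of_real M) lam"
    unfolding eigenvalue_def eigenvector_def by (intro exI[of _ "vec N v"]) (auto simp: M_def)
  then show ?thesis using M unfolding karpelevich_region_def by blast
qed

lemma left_eigenvector:
  assumes M: "M \<in> carrier_mat N N"
  shows "eigenvalue M (lam :: complex) \<longleftrightarrow> (\<exists>y. (\<exists>k<N. y k \<noteq> 0) \<and> (\<forall>j<N. (\<Sum>i<N. M $$ (i, j) * y i) = lam * y j))"
proof -
  have "eigenvalue M lam \<longleftrightarrow> eigenvalue (transpose_mat M) lam"
    using M eigenvalue_root_char_poly[of M N] eigenvalue_root_char_poly[of "transpose_mat M" N] by simp
  also have "\<dots> \<longleftrightarrow> (\<exists>y. (\<exists>k<N. y k \<noteq> 0) \<and> (\<forall>j<N. (\<Sum>i<N. M $$ (i, j) * y i) = lam * y j))"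
  proof
    assume "eigenvalue (transpose_mat M) lam"
    then obtain u where u: "u \<in> carrier_vec N" "u \<noteq> 0\<^sub>v N" "transpose_mat M *\<^sub>v u = lam \<cdot>\<^sub>v u"
      using M unfolding eigenvalue_def eigenvector_def by auto
    have "\<exists>k<N. u $ k \<noteq> 0" using u(1,2) by (metis carrier_vecD eq_vecI index_zero_vec(1) index_zero_vec(2))
    moreover have "(\<Sum>i<N. M $$ (i, j) * (u $ i)) = lam * (u $ j)" if "j < N" for j
    proof -
      have "lam * (u $ j) = (transpose_mat M *\<^sub>v u) $ j" using that u(1) unfolding u(3) by simp
      also have "\<dots> = (\<Sum>i\<in>{0..<N}. M $$ (i, j) * (u $ i))"
        using that u(1) M by (auto simp: scalar_prod_def intro!: sum.cong)
      finally show ?thesis by (simp add: atLeast0LessThan)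
    qed
    ultimately show "\<exists>y. (\<exists>k<N. y k \<noteq> 0) \<and> (\<forall>j<N. (\<Sum>i<N. M $$ (i, j) * y i) = lam * y j)"
      by (intro exI[of _ "\<lambda>i. u $ i"]) auto
  next
    assume "\<exists>y. (\<exists>k<N. y k \<noteq> 0) \<and> (\<forall>j<N. (\<Sum>i<N. M $$ (i, j) * y i) = lam * y j)"
    then obtain y k where y: "k < N" "y k \<noteq> 0" "\<And>j. j < N \<Longrightarrow> (\<Sum>i<N. M $$ (i, j) * y i) = lam * y j" by blast
    have "transpose_mat M *\<^sub>v vec N y = lam \<cdot>\<^sub>v vec N y"
    proof (rule eq_vecI)
      fix j assume "j < dim_vec (lam \<cdot>\<^sub>v vec N y)"
      then have j: "j < N" by simp
      have "(transpose_mat M *\<^sub>v vec N y) $ j = (\<Sum>i\<in>{0..<N}. M $$ (i, j) * y i)"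
        using j M by (auto simp: scalar_prod_def intro!: sum.cong)
      then show "(transpose_mat M *\<^sub>v vec N y) $ j = (lam \<cdot>\<^sub>v vec N y) $ j" using y(3)[OF j] j by (simp add: atLeast0LessThan)
    qed (use M in simp)
    moreover have "vec N y \<noteq> 0\<^sub>v N"
    proof
      assume "vec N y = 0\<^sub>v N"
      then have "vec N y $ k = 0\<^sub>v N $ k" by simp
      then show False using y by simp
    qed
    ultimately show "eigenvalue (transpose_mat M) lam"
      unfolding eigenvalue_def eigenvector_def using M by (intro exI[of _ "vec N y"]) auto
  qed
  finally show ?thesis .
qed

text \<open>Since the rows of the matrix sum to 1 and \<open>lam \<noteq> 1\<close>, a left
  eigenvector has entry sum 0. The uniform matrix annihilates it, so mixing this matrix in only
  scales the eigenvalue.\<close>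

lemma region_star:
  assumes reg: "lam \<in> karpelevich_region N" and ne: "lam \<noteq> 1" and t: "0 \<le> t" "t \<le> 1"
  shows "t *\<^sub>R lam \<in> karpelevich_region N"
proof -
  obtain M where M: "stochastic_mat N M" "eigenvalue (map_mat complex_of_real M) lam"
    using reg by (auto simp: karpelevich_region_def)
  have Mc: "M \<in> carrier_mat N N" and Mp: "\<And>i j. i < N \<Longrightarrow> j < N \<Longrightarrow> 0 \<le> M $$ (i, j)"
    and Ms: "\<And>i. i < N \<Longrightarrow> (\<Sum>j<N. M $$ (i, j)) = 1" using M(1) by (auto simp: stochastic_mat_def)
  have Mcc: "map_mat complex_of_real M \<in> carrier_mat N N" using Mc by simp
  obtain y k where y: "k < N" "y k \<noteq> 0" "\<And>j. j < N \<Longrightarrow> (\<Sum>i<N. complex_of_real (M $$ (i, j)) * y i) = lam * y j"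
    using M(2) Mc unfolding left_eigenvector[OF Mcc] by auto
  have N: "0 < N" using y by simp
  have "lam * (\<Sum>j<N. y j) = (\<Sum>j<N. \<Sum>i<N. complex_of_real (M $$ (i, j)) * y i)"
    unfolding sum_distrib_left using y(3) by (intro sum.cong) auto
  also have "\<dots> = (\<Sum>i<N. \<Sum>j<N. complex_of_real (M $$ (i, j)) * y i)" by (rule sum.swap)
  also have "\<dots> = (\<Sum>i<N. y i)"
  proof (rule sum.cong[OF refl])
    fix i assume "i \<in> {..<N}"
    then have "(\<Sum>j<N. complex_of_real (M $$ (i, j))) = complex_of_real 1" using Ms[of i] by (simp flip: of_real_sum)
    then show "(\<Sum>j<N. complex_of_real (M $$ (i, j)) * y i) = y i" by (simp flip: sum_distrib_right)
  qed
  finally have y0: "(\<Sum>j<N. y j) = 0" using ne by auto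
  define B where "B = mat N N (\<lambda>(i, j). t * M $$ (i, j) + (1 - t) / real N)"
  have "stochastic_mat N B"
    unfolding stochastic_mat_def B_def using Mp t Ms N
    by (auto simp: sum.distrib simp flip: sum_distrib_left intro!: add_nonneg_nonneg)
  moreover have "eigenvalue (map_mat complex_of_real B) (t *\<^sub>R lam)"
  proof -
    have Bc: "map_mat complex_of_real B \<in> carrier_mat N N" by (simp add: B_def)
    have "(\<Sum>i<N. map_mat complex_of_real B $$ (i, j) * y i) = (t *\<^sub>R lam) * y j" if j: "j < N" for j
    proof -
      have "(\<Sum>i<N. map_mat complex_of_real B $$ (i, j) * y i)
          = (\<Sum>i<N. t * (complex_of_real (M $$ (i, j)) * y i) + complex_of_real ((1 - t) / real N) * y i)"
        using j by (intro sum.cong) (auto simp: B_def algebra_simps)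
      also have "\<dots> = t * (\<Sum>i<N. complex_of_real (M $$ (i, j)) * y i) + complex_of_real ((1 - t) / real N) * (\<Sum>i<N. y i)"
        by (simp add: sum.distrib sum_distrib_left)
      finally show ?thesis unfolding y0 y(3)[OF j] by (simp add: scaleR_conv_of_real)
    qed
    then show ?thesis unfolding left_eigenvector[OF Bc] using y by blast
  qed
  ultimately show ?thesis unfolding karpelevich_region_def by blast
qed

context karp_sector
begin

text \<open>For \<open>\<alpha> + \<beta> = 1\<close> the vectors \<open>\<mu>^i \<lambda>^j\<close> with \<open>\<lambda>^q = \<beta> + \<alpha> \<mu>\<close> and \<open>\<mu>^d = \<lambda>^z\<close> are eigenvectors of Ito's
  matrix.\<close>

definition ito_alpha where "ito_alpha L = exp (- (real s / real d) * L) * sin x / sin (x + y)"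
definition ito_beta where "ito_beta L = exp (- (real q * L)) * sin y / sin (x + y)"
definition ito_mu where "ito_mu L = exp (- (real z / real d) * L) *\<^sub>R cis (x + y)"

lemma ito_pos: "0 < ito_alpha L" "0 < ito_beta L"
  using sin_xy unfolding ito_alpha_def ito_beta_def by auto

lemma ito_sum: "ito_alpha L + ito_beta L = 1 \<longleftrightarrow> karp_g q d s x y L = 0"
  using sin_xy(3) unfolding ito_alpha_def ito_beta_def karp_g_def by (auto simp: field_simps)

text \<open>\<open>cis x\<close> lies between the directions 1 and \<open>cis (x + y)\<close>, with
  the sine quotients as coordinates; \<open>s / d + z / d = q\<close> splits the modulus between
  \<open>ito_alpha\<close> and \<open>ito_mu\<close>.\<close>

lemma ito_power: "(exp (- L) *\<^sub>R cis \<theta>) ^ q = complex_of_real (ito_beta L) + complex_of_real (ito_alpha L) * ito_mu L"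
proof -
  let ?S = "sin (x + y)"
  have S: "?S \<noteq> 0" using sin_xy(3) by simp
  have e1: "exp (- L) ^ q = exp (- (real q * L))" by (simp flip: exp_of_nat_mult)
  have "cis x = (sin (x + y - x) / sin (x + y - 0)) *\<^sub>R cis 0 + (sin (x - 0) / sin (x + y - 0)) *\<^sub>R cis (x + y)"
    using x_pos y_pos xy_small pi_gt_zero by (intro cis_between) linarith+
  then have c: "cis x = complex_of_real (sin y / ?S) + complex_of_real (sin x / ?S) * cis (x + y)"
    by (simp add: scaleR_conv_of_real)
  have "real s / real d + real z / real d = real q"
    using s_props(1) n_pos by (simp add: n_def field_simps flip: of_nat_add)
  then have e2: "exp (- (real q * L)) = exp (- (real s / real d) * L) * exp (- (real z / real d) * L)"
    unfolding exp_add[symmetric] by (metis distrib_right minus_add_distrib mult_minus_left)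
  have "(exp (- L) *\<^sub>R cis \<theta>) ^ q = exp (- (real q * L)) *\<^sub>R cis x" unfolding lam_q e1 ..
  also have "\<dots> = complex_of_real (ito_beta L) + complex_of_real (exp (- (real q * L)) * sin x / ?S) * cis (x + y)"
    unfolding c ito_beta_def by (simp add: scaleR_conv_of_real algebra_simps)
  also have "complex_of_real (exp (- (real q * L)) * sin x / ?S) = complex_of_real (ito_alpha L) * complex_of_real (exp (- (real z / real d) * L))"
    unfolding e2 ito_alpha_def by simp
  finally show ?thesis unfolding ito_mu_def by (simp add: scaleR_conv_of_real mult_ac)
qed

lemma ito_mu_power: "ito_mu L ^ d = (exp (- L) *\<^sub>R cis \<theta>) ^ z"
proof -
  have e1: "exp (- (real z / real d) * L) ^ d = exp (- L) ^ z"
    using n_pos by (simp flip: exp_of_nat_mult)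
  have "real d * (x + y) = real z * \<theta> + 2 * pi * real_of_int (int r - int p * int d)"
  proof -
    have "real n - real s = real z" using s_props(1) by simp
    have "real d * (x + y) = real d * (real q * \<theta>) - 2 * pi * (real p * real d) + (2 * pi * real r - real s * \<theta>)"
      unfolding distrib_left[of "real d" x y] using theta_s by (simp add: x_def algebra_simps)
    also have "real d * (real q * \<theta>) = real n * \<theta>" by (simp add: n_def)
    finally have "real d * (x + y) = (real n - real s) * \<theta> + 2 * pi * (real r - real p * real d)" by (simp add: algebra_simps)
    then show ?thesis unfolding \<open>real n - real s = real z\<close> by simp
  qed
  then have "cis (real d * (x + y)) = cis (real z * \<theta>) * cis (2 * pi * real_of_int (int r - int p * int d))" by (simp only: cis_mult)
  also have "cis (2 * pi * real_of_int (int r - int p * int d)) = 1" by (rule cis_multiple_2pi) auto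
  finally have c: "cis (real d * (x + y)) = cis (real z * \<theta>)" by simp
  show ?thesis unfolding ito_mu_def scaleR_power Complex.DeMoivre e1 c ..
qed

theorem region_lower:
  assumes g: "karp_g q d s x y L = 0"
  shows "exp (- L) *\<^sub>R cis \<theta> \<in> karpelevich_region n"
proof -
  define lam where "lam = exp (- L) *\<^sub>R cis \<theta>"
  define \<alpha> \<beta> \<mu> where "\<alpha> = ito_alpha L" and "\<beta> = ito_beta L" and "\<mu> = ito_mu L"
  have ab: "0 < \<alpha>" "0 < \<beta>" "\<alpha> + \<beta> = 1" using ito_pos ito_sum g by (auto simp: \<alpha>_def \<beta>_def)
  have lq: "lam ^ q = complex_of_real \<beta> + complex_of_real \<alpha> * \<mu>" unfolding lam_def \<alpha>_def \<beta>_def \<mu>_def by (rule ito_power)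
  have mz: "\<mu> ^ d = lam ^ z" unfolding lam_def \<mu>_def by (rule ito_mu_power)
  define v where "v = (\<lambda>k. \<mu> ^ (k div q) * lam ^ (k mod q))"
  \<comment> \<open>The states form \<open>d\<close> blocks of length \<open>q\<close>. At the end
    of a block the chain returns to its start with probability \<open>\<beta>\<close> and enters the
    next block with probability \<open>\<alpha>\<close>. After the last block the required entry is
    \<open>\<mu> ^ d = lam ^ z\<close>, which is the entry \<open>z\<close> of the first
    block.\<close>
  define T where "T = (\<lambda>k. if k + 1 < n then k + 1 else z)"
  define A where "A = (\<lambda>k l. if Suc k mod q \<noteq> 0 then (if l = k + 1 then 1 else 0)
      else (if l = k + 1 - q then \<beta> else 0) + (if l = T k then \<alpha> else 0))"
  have zn: "z < n" using s_props(1) n_pos by linarith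
  have nz: "Suc k < n" if "k < n" "Suc k mod q \<noteq> 0" for k
  proof (rule ccontr)
    assume "\<not> Suc k < n"
    then have "Suc k = q * d" using that(1) by (simp add: n_def)
    then show False using that(2) by simp
  qed
  have sumA: "(\<Sum>l<n. A k l *\<^sub>R w l) = (if Suc k mod q \<noteq> 0 then w (k + 1) else \<beta> *\<^sub>R w (k + 1 - q) + \<alpha> *\<^sub>R w (T k))"
    if k: "k < n" for k and w :: "nat \<Rightarrow> 'b :: real_vector"
  proof (cases "Suc k mod q \<noteq> 0")
    case True
    have "(\<Sum>l<n. A k l *\<^sub>R w l) = (\<Sum>l<n. if l = k + 1 then w (k + 1) else 0)"
      using True by (intro sum.cong) (auto simp: A_def)
    then show ?thesis using nz[OF k True] True by simp
  next
    case False
    have m: "k + 1 - q < n" "T k < n" using k zn n_pos by (auto simp: T_def)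
    have "(\<Sum>l<n. A k l *\<^sub>R w l) = (\<Sum>l<n. (if l = k + 1 - q then \<beta> *\<^sub>R w (k + 1 - q) else 0) + (if l = T k then \<alpha> *\<^sub>R w (T k) else 0))"
      using False by (intro sum.cong) (auto simp: A_def scaleR_add_left)
    then show ?thesis using m False by (simp add: sum.distrib)
  qed
  show "exp (- L) *\<^sub>R cis \<theta> \<in> karpelevich_region n"
    unfolding lam_def[symmetric]
  proof (rule region_from_rows[of n A lam v 0])
    show "0 \<le> A i j" for i j using ab by (auto simp: A_def)
    show "(\<Sum>j<n. A i j) = 1" if "i < n" for i
      using sumA[OF that, of "\<lambda>_. 1::real"] ab by (auto simp: add.commute split: if_splits)
    show "lam * v i = (\<Sum>j<n. A i j *\<^sub>R v j)" if i: "i < n" for i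
    proof (cases "Suc i mod q = 0")
      case False
      then have "Suc i mod q = Suc (i mod q)" "Suc i div q = i div q" by (auto simp: mod_Suc div_Suc split: if_splits)
      then show ?thesis unfolding sumA[OF i] using False by (simp add: v_def)
    next
      case True
      then have m: "Suc (i mod q) = q" by (auto simp: mod_Suc split: if_splits)
      obtain a where a: "Suc i = a * q" using True by (metis mod_0_imp_dvd dvd_div_mult_self)
      then have "0 < a" by (cases a) auto
      then obtain b where b: "a = Suc b" by (cases a) auto
      have ii: "i = b * q + (q - 1)" using a b n_pos by simp
      have "q * (i div q) + i mod q = i" by (rule mult_div_mod_eq)
      then have "q * (i div q) = q * b" using ii m mult.commute[of b q] by linarith
      then have d1: "i div q = b" "i mod q = q - 1" using n_pos m by auto
      have "lam * v i = \<mu> ^ b * lam ^ q" using n_pos by (simp add: v_def d1 mult.left_commute power_eq_if)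
      also have "\<dots> = \<beta> *\<^sub>R \<mu> ^ b + \<alpha> *\<^sub>R \<mu> ^ Suc b" unfolding lq by (simp add: scaleR_conv_of_real algebra_simps)
      also have "\<mu> ^ b = v (i + 1 - q)"
      proof -
        have "i + 1 - q = b * q" using ii n_pos by simp
        then show ?thesis using n_pos by (simp add: v_def)
      qed
      also have "\<mu> ^ Suc b = v (T i)"
      proof (cases "i + 1 < n")
        case True
        have "i + 1 = Suc b * q" using a b by simp
        then have "v (i + 1) = \<mu> ^ Suc b" using n_pos by (simp only: v_def) simp
        then show ?thesis using True by (simp add: T_def)
      next
        case False
        then have "Suc i = n" using i by linarith
        then have "a * q = d * q" using a n_def by (metis mult.commute)
        then have "a = d" using n_pos(2) by (metis mult_cancel2 less_irrefl)
        then have "Suc b = d" using b by simp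
        then show ?thesis using False mz z_less by (simp add: T_def v_def)
      qed
      finally show ?thesis unfolding sumA[OF i] using True by simp
    qed
    show "v 0 \<noteq> 0" by (simp add: v_def)
  qed (rule n_pos)
qed

lemma karp_g_zero_pos: "0 < karp_g q d s x y 0"
proof -
  have "sin (x + y) < sin x + sin y" using x_pos y_pos xy_small by (intro sin_add_less) auto
  then show ?thesis by (simp add: karp_g_def)
qed

lemma L_pos: "karp_g q d s x y L \<le> 0 \<Longrightarrow> 0 < L"
  using karp_g_mono[OF sin_xy(1,2) _ n_pos(2), of L 0 d s] karp_g_zero_pos by force

text \<open>On the same ray, at least as far from 0, lies a point of the curve; that point is in the
  region, which is star-shaped.\<close>

lemma region_inside:
  assumes g: "karp_g q d s x y L \<le> 0"
  shows "exp (- L) *\<^sub>R cis \<theta> \<in> karpelevich_region n"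
proof -
  have L: "0 < L" by (rule L_pos[OF g])
  have "\<exists>L0. 0 \<le> L0 \<and> L0 \<le> L \<and> karp_g q d s x y L0 = 0"
  proof -
    have "continuous_on {0..L} (karp_g q d s x y)" unfolding karp_g_def[abs_def] by (intro continuous_intros)
    then show ?thesis using IVT2'[of "karp_g q d s x y" L 0 0] g karp_g_zero_pos L by auto
  qed
  then obtain L0 where L0: "0 \<le> L0" "L0 \<le> L" "karp_g q d s x y L0 = 0" by blast
  have "0 < L0" by (rule L_pos) (use L0 in simp)
  have "exp (- L0) *\<^sub>R cis \<theta> \<noteq> 1"
  proof
    assume "exp (- L0) *\<^sub>R cis \<theta> = 1"
    then have "norm (exp (- L0) *\<^sub>R cis \<theta>) = 1" by simp
    then show False using \<open>0 < L0\<close> by simp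
  qed
  then have "exp (L0 - L) *\<^sub>R (exp (- L0) *\<^sub>R cis \<theta>) \<in> karpelevich_region n"
    by (rule region_star[OF region_lower[OF L0(3)]]) (use L0 in auto)
  then show ?thesis by (simp flip: exp_add)
qed

end

subsection \<open>The arc and its parametrisation\<close>

lemma polar_Arg2pi: "z \<noteq> 0 \<Longrightarrow> z = exp (- (- ln (norm z))) *\<^sub>R cis (Arg2pi z)"
  using Arg2pi_eq[of z] by (simp add: cis_conv_exp scaleR_conv_of_real)

lemma Arg2pi_polar:
  assumes "0 < \<rho>" "0 \<le> \<theta>" "\<theta> < 2 * pi"
  shows "Arg2pi (\<rho> *\<^sub>R cis \<theta>) = \<theta>" "norm (\<rho> *\<^sub>R cis \<theta>) = \<rho>" "\<rho> *\<^sub>R cis \<theta> \<noteq> 0"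
proof -
  show "Arg2pi (\<rho> *\<^sub>R cis \<theta>) = \<theta>"
    by (rule Arg2pi_unique[of \<rho>]) (use assms in \<open>auto simp: cis_conv_exp scaleR_conv_of_real\<close>)
qed (use assms in auto)

text \<open>The quadratic opens upwards and is negative at 1, so it has one root on each side of
  1.\<close>

lemma convex_root_unique:
  fixes A B C :: real
  assumes A: "0 < A" and neg: "A + B + C < 0" and a: "a < 1" "A * a\<^sup>2 + B * a + C = 0" and b: "b < 1" "A * b\<^sup>2 + B * b + C = 0"
  shows "a = b"
proof (rule ccontr)
  have no: False if "a < b" "b < 1" "A * a\<^sup>2 + B * a + C = 0" "A * b\<^sup>2 + B * b + C = 0" for a b
  proof -
    have "(b - a) * (A * (a + b) + B) = 0" using that by (simp add: algebra_simps power2_eq_square)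
    then have B: "B = - A * (a + b)" using that by simp
    have "A + B + C = (A + B + C) - (A * b\<^sup>2 + B * b + C)" using that by simp
    also have "\<dots> = A * (1 - b) * (1 - a)" unfolding B by (simp add: algebra_simps power2_eq_square)
    finally show False using A neg that by (smt (verit) mult_pos_pos)
  qed
  assume "a \<noteq> b"
  then show False using no[of a b] no[of b a] a b by linarith
qed

context karp_params
begin

definition "in_sector \<theta> \<longleftrightarrow> 2 * pi * real p / real q < \<theta> \<and> \<theta> < 2 * pi * real r / real s"
text \<open>The coordinates of \<open>karp_sector\<close> as functions on all angles, for arguments
  of continuity and differentiation along the arc.\<close>

definition "sector_x \<theta> = real q * \<theta> - 2 * pi * real p"
definition "sector_y \<theta> = (2 * pi * real r - real s * \<theta>) / real d"
definition "sector_g w = karp_g q d s (sector_x (Arg2pi w)) (sector_y (Arg2pi w)) (- ln (norm w))"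

lemma sector_locale:
  assumes "in_sector \<theta>"
  shows "karp_sector q d z n s p r \<theta>" "karp_sector.x q p \<theta> = sector_x \<theta>" "karp_sector.y d s r \<theta> = sector_y \<theta>"
proof -
  show 1: "karp_sector q d z n s p r \<theta>"
    by (intro karp_sector.intro karp_params_axioms karp_sector_axioms.intro) (use assms in \<open>auto simp: in_sector_def\<close>)
  show "karp_sector.x q p \<theta> = sector_x \<theta>" "karp_sector.y d s r \<theta> = sector_y \<theta>"
    unfolding karp_sector.x_def[OF 1] karp_sector.y_def[OF 1] sector_x_def sector_y_def by auto
qed

lemma p_r_bounds: "0 < p" "r \<le> s"
proof -
  show "0 < p" using p by simp
  have "p + 1 \<le> q" using p q2 by auto
  have "r * q = p * s + 1" by (rule rq)
  also have "\<dots> \<le> p * s + s" using n_pos by simp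
  also have "\<dots> = (p + 1) * s" by simp
  also have "\<dots> \<le> q * s" using \<open>p + 1 \<le> q\<close> by (rule mult_le_mono1)
  finally show "r \<le> s" using n_pos by (simp add: mult.commute)
qed

lemma in_sector_range: assumes "in_sector \<theta>" shows "0 < \<theta>" "\<theta> < 2 * pi"
proof -
  have "0 < 2 * pi * real p / real q" using p_r_bounds n_pos by simp
  then show "0 < \<theta>" using assms by (auto simp: in_sector_def)
  have "2 * pi * real r / real s \<le> 2 * pi" using p_r_bounds n_pos by (simp add: field_simps)
  then show "\<theta> < 2 * pi" using assms by (auto simp: in_sector_def)
qed

lemma sector_g_region:
  assumes w: "w \<noteq> 0" "in_sector (Arg2pi w)"
  shows "w \<in> karpelevich_region n \<longleftrightarrow> sector_g w \<le> 0"
proof -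
  interpret karp_sector q d z n s p r "Arg2pi w" by (rule sector_locale(1)[OF w(2)])
  have G: "sector_g w = karp_g q d s x y (- ln (norm w))" unfolding sector_g_def using sector_locale(2,3)[OF w(2)] by simp
  have pol: "w = exp (- (- ln (norm w))) *\<^sub>R cis (Arg2pi w)" by (rule polar_Arg2pi[OF w(1)])
  have pol': "w = norm w *\<^sub>R cis (Arg2pi w)" using pol w by simp
  show ?thesis
  proof
    assume "w \<in> karpelevich_region n"
    then have "norm w *\<^sub>R cis (Arg2pi w) \<in> karpelevich_region n" using pol' by simp
    then show "sector_g w \<le> 0" unfolding G using region_upper[of "norm w"] w by simp
  next
    assume "sector_g w \<le> 0"
    then show "w \<in> karpelevich_region n" using region_inside[of "- ln (norm w)"] pol unfolding G by simp
  qed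
qed

lemma Arg2pi_cont: assumes "w \<noteq> 0" "in_sector (Arg2pi w)" shows "isCont Arg2pi w"
proof (rule continuous_at_Arg2pi)
  show "w \<notin> \<real>\<^sub>\<ge>\<^sub>0"
  proof
    assume "w \<in> \<real>\<^sub>\<ge>\<^sub>0"
    then have "Arg2pi w = 0" by (simp add: Arg2pi_eq_0 complex_nonneg_Reals_iff complex_is_Real_iff)
    then show False using in_sector_range(1)[OF assms(2)] by simp
  qed
qed

lemma sector_nhds:
  assumes w: "w \<noteq> 0" "in_sector (Arg2pi w)"
  shows "eventually (\<lambda>v. v \<noteq> 0 \<and> in_sector (Arg2pi v)) (nhds w)"
proof -
  have A: "(Arg2pi \<longlongrightarrow> Arg2pi w) (nhds w)" using Arg2pi_cont[OF w] by (simp add: continuous_at tendsto_nhds_iff isCont_def)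
  have "eventually (\<lambda>v. v \<noteq> 0) (nhds w)" using w(1) by (rule t1_space_nhds)
  moreover have "eventually (\<lambda>v. 2 * pi * real p / real q < Arg2pi v) (nhds w)" "eventually (\<lambda>v. Arg2pi v < 2 * pi * real r / real s) (nhds w)"
    using w(2) unfolding in_sector_def by (auto intro!: order_tendstoD[OF A])
  ultimately show ?thesis unfolding in_sector_def by (intro eventually_conj)
qed

lemma sector_g_cont: assumes w: "w \<noteq> 0" "in_sector (Arg2pi w)" shows "(sector_g \<longlongrightarrow> sector_g w) (nhds w)"
proof -
  have "isCont sector_g w"
    unfolding sector_g_def[abs_def] karp_g_def sector_x_def sector_y_def
    by (intro continuous_intros Arg2pi_cont[OF w]) (use w n_pos in auto)
  then show ?thesis by (simp add: isCont_def tendsto_nhds_iff)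
qed

text \<open>Near a point of the sector the region is described by \<open>sector_g \<le> 0\<close>
  with \<open>sector_g\<close> continuous, so frontier points are zeros. Conversely
  \<open>sector_g\<close> increases strictly outwards along rays, so a zero cannot be an interior
  point.\<close>

lemma arc_iff: "w \<in> karpelevich_arc n p q r s \<longleftrightarrow> w \<noteq> 0 \<and> in_sector (Arg2pi w) \<and> sector_g w = 0"
proof (cases "w \<noteq> 0 \<and> in_sector (Arg2pi w)")
  case False
  then show ?thesis by (auto simp: karpelevich_arc_def in_sector_def)
next
  case True
  then have w: "w \<noteq> 0" "in_sector (Arg2pi w)" by auto
  interpret karp_sector q d z n s p r "Arg2pi w" by (rule sector_locale(1)[OF w(2)])
  have arc: "w \<in> karpelevich_arc n p q r s \<longleftrightarrow> w \<in> frontier (karpelevich_region n)"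
    using w by (auto simp: karpelevich_arc_def in_sector_def)
  have ev: "eventually (\<lambda>v. v \<in> karpelevich_region n \<longleftrightarrow> sector_g v \<le> 0) (nhds w)"
    using sector_nhds[OF w] by eventually_elim (use sector_g_region in auto)
  have "w \<in> frontier (karpelevich_region n) \<longleftrightarrow> sector_g w = 0"
  proof
    assume fr: "w \<in> frontier (karpelevich_region n)"
    show "sector_g w = 0"
    proof (rule ccontr)
      assume "sector_g w \<noteq> 0"
      then consider "0 < sector_g w" | "sector_g w < 0" by linarith
      then show False
      proof cases
        case 1
        have "eventually (\<lambda>v. 0 < sector_g v) (nhds w)" using sector_g_cont[OF w] 1 by (rule order_tendstoD)
        with ev have "eventually (\<lambda>v. v \<in> - karpelevich_region n) (nhds w)" by eventually_elim auto
        then have "w \<in> interior (- karpelevich_region n)" by (simp add: eventually_nhds interior_def) blast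
        then show False using fr by (simp add: frontier_def interior_closure)
      next
        case 2
        have "eventually (\<lambda>v. sector_g v < 0) (nhds w)" using sector_g_cont[OF w] 2 by (rule order_tendstoD)
        with ev have "eventually (\<lambda>v. v \<in> karpelevich_region n) (nhds w)" by eventually_elim auto
        then have "w \<in> interior (karpelevich_region n)" by (simp add: eventually_nhds interior_def) blast
        then show False using fr by (simp add: frontier_def)
      qed
    qed
  next
    assume G0: "sector_g w = 0"
    have "w \<in> karpelevich_region n" using sector_g_region[OF w] G0 by simp
    moreover have "w \<notin> interior (karpelevich_region n)"
    proof
      assume "w \<in> interior (karpelevich_region n)"
      then obtain e where e: "0 < e" "ball w e \<subseteq> karpelevich_region n" unfolding mem_interior by blast
      define t where "t = e / (2 * norm w)"
      have t0: "0 < t" using e w by (simp add: t_def)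
      have "dist w ((1 + t) *\<^sub>R w) = t * norm w" using t0 by (simp add: dist_norm scaleR_add_left)
      also have "\<dots> = e / 2" using w by (simp add: t_def)
      finally have "(1 + t) *\<^sub>R w \<in> ball w e" using e by simp
      then have t: "0 < t" "(1 + t) *\<^sub>R w \<in> karpelevich_region n" using t0 e by auto
      have pol: "w = norm w *\<^sub>R cis (Arg2pi w)" using polar_Arg2pi[OF w(1)] w by simp
      have "(1 + t) *\<^sub>R w = ((1 + t) * norm w) *\<^sub>R cis (Arg2pi w)" by (subst pol) simp
      then have "karp_g q d s x y (- ln ((1 + t) * norm w)) \<le> 0" using region_upper[of "(1 + t) * norm w"] t w by simp
      moreover have "karp_g q d s x y (- ln (norm w)) < karp_g q d s x y (- ln ((1 + t) * norm w))"
        by (rule karp_g_strict_mono) (use sin_xy n_pos t w in \<open>auto simp: ln_mult\<close>)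
      moreover have "karp_g q d s x y (- ln (norm w)) = 0" using G0 unfolding sector_g_def using sector_locale(2,3)[OF w(2)] by simp
      ultimately show False by linarith
    qed
    ultimately show "w \<in> frontier (karpelevich_region n)"
      using closure_subset by (auto simp: frontier_def)
  qed
  then show ?thesis using arc w by simp
qed

section \<open>One boundary root for each parameter\<close>

lemma farey_less: "2 * pi * real p / real q < 2 * pi * real r / real s"
proof -
  have "real p * real s < real r * real q" using rq by (metis less_add_one of_nat_less_iff of_nat_mult)
  then show ?thesis using n_pos by (simp add: field_simps)
qed

lemma sector_xy_sum: "real s * sector_x \<theta> + real n * sector_y \<theta> = 2 * pi"
proof -
  have "real n * sector_y \<theta> = real q * (2 * pi * real r - real s * \<theta>)" using n_pos by (simp add: sector_y_def n_def)
  then have "real s * sector_x \<theta> + real n * sector_y \<theta> = 2 * pi * (real (r * q) - real p * real s)"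
    by (simp add: sector_x_def algebra_simps)
  then show ?thesis unfolding rq by simp
qed

text \<open>Eliminating \<open>L\<close> from \<open>ito_alpha L = \<alpha>\<close> and
  \<open>ito_beta L = 1 - \<alpha>\<close> and taking logarithms leaves the condition that this
  quantity is \<open>n * ln \<alpha> - s * ln (1 - \<alpha>)\<close>.\<close>

definition "ito_ratio \<theta> = real n * ln (sin (sector_x \<theta>)) - real s * ln (sin (sector_y \<theta>)) - real z * ln (sin (sector_x \<theta> + sector_y \<theta>))"

text \<open>In terms of the cotangents \<open>X\<close>, \<open>Y\<close>, \<open>Z\<close> of the
  three angles the derivative is \<open>(n^2 X + s^2 Y - z^2 Z) / d\<close>. As
  \<open>Z (X + Y) = X Y - 1\<close> and \<open>z = n - s\<close>, its product with
  \<open>d (X + Y)\<close> is \<open>(n X + s Y)^2 + z^2\<close>, and \<open>X + Y\<close> is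
  positive.\<close>

lemma ito_ratio_strict_mono:
  assumes "in_sector \<theta>1" "in_sector \<theta>2" "\<theta>1 < \<theta>2"
  shows "ito_ratio \<theta>1 < ito_ratio \<theta>2"
proof (rule DERIV_pos_imp_increasing[OF assms(3)])
  fix \<theta> assume th: "\<theta>1 \<le> \<theta>" "\<theta> \<le> \<theta>2"
  have sec: "in_sector \<theta>" using th assms by (auto simp: in_sector_def)
  interpret karp_sector q d z n s p r \<theta> by (rule sector_locale(1)[OF sec])
  note S = sin_xy[unfolded sector_locale(2,3)[OF sec]]
  define X Y where "X = cos (sector_x \<theta>) / sin (sector_x \<theta>)" and "Y = cos (sector_y \<theta>) / sin (sector_y \<theta>)"
  define Z where "Z = cos (sector_x \<theta> + sector_y \<theta>) / sin (sector_x \<theta> + sector_y \<theta>)"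
  have XY: "X + Y = sin (sector_x \<theta> + sector_y \<theta>) / (sin (sector_x \<theta>) * sin (sector_y \<theta>))"
    unfolding X_def Y_def using S by (simp add: sin_add field_simps)
  then have XYp: "0 < X + Y" using S by simp
  have "Z * (X + Y) = cos (sector_x \<theta> + sector_y \<theta>) / (sin (sector_x \<theta>) * sin (sector_y \<theta>))" unfolding XY Z_def using S by simp
  also have "\<dots> = X * Y - 1" unfolding X_def Y_def cos_add using S by (simp add: field_simps)
  finally have ZXY: "Z * (X + Y) = X * Y - 1" .
  have dx: "(sector_x has_real_derivative real q) (at \<theta>)" and dy: "(sector_y has_real_derivative - (real s / real d)) (at \<theta>)"
    unfolding sector_x_def[abs_def] sector_y_def[abs_def] using n_pos by (auto intro!: derivative_eq_intros)
  have "(ito_ratio has_real_derivative real n * (X * real q) - real s * (Y * - (real s / real d)) - real z * (Z * (real q + - (real s / real d)))) (at \<theta>)"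
    unfolding ito_ratio_def[abs_def] X_def Y_def Z_def
    using S by (auto intro!: derivative_eq_intros dx dy simp: divide_inverse mult_ac)
  moreover have "0 < real n * (X * real q) - real s * (Y * - (real s / real d)) - real z * (Z * (real q + - (real s / real d)))"
  proof -
    have q: "real q = real n / real d" using n_pos by (simp add: n_def)
    have "real s + real z = real n" by (metis of_nat_add s_props(1))
    then have zz: "real z = real n - real s" by simp
    have e: "real q + - (real s / real d) = real z / real d" unfolding q zz by (simp add: diff_divide_distrib)
    have "real n * (X * real q) - real s * (Y * - (real s / real d)) - real z * (Z * (real q + - (real s / real d)))
      = ((real n)\<^sup>2 * X + (real s)\<^sup>2 * Y - (real z)\<^sup>2 * Z) / real d"
      unfolding e unfolding q using n_pos by (simp add: field_simps power2_eq_square)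
    moreover have "((real n)\<^sup>2 * X + (real s)\<^sup>2 * Y - (real z)\<^sup>2 * Z) * (X + Y) = (real n * X + real s * Y)\<^sup>2 + (real z)\<^sup>2"
    proof -
      have "((real n)\<^sup>2 * X + (real s)\<^sup>2 * Y - (real z)\<^sup>2 * Z) * (X + Y)
         = ((real n)\<^sup>2 * X + (real s)\<^sup>2 * Y) * (X + Y) - (real z)\<^sup>2 * (Z * (X + Y))" by (simp add: algebra_simps)
      also have "\<dots> = (real n * X + real s * Y)\<^sup>2 + (real z)\<^sup>2"
        unfolding ZXY zz by (simp add: power2_eq_square algebra_simps)
      finally show ?thesis .
    qed
    moreover have "0 < (real n * X + real s * Y)\<^sup>2 + (real z)\<^sup>2" using z by (intro add_nonneg_pos) auto
    ultimately have "0 < ((real n)\<^sup>2 * X + (real s)\<^sup>2 * Y - (real z)\<^sup>2 * Z) * (X + Y)" by simp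
    then have "0 < (real n)\<^sup>2 * X + (real s)\<^sup>2 * Y - (real z)\<^sup>2 * Z" using XYp by (simp add: zero_less_mult_iff)
    then show ?thesis using n_pos \<open>real n * (X * real q) - _ - _ = _\<close> by simp
  qed
  ultimately show "\<exists>y. (ito_ratio has_real_derivative y) (at \<theta>) \<and> 0 < y" by blast
qed

text \<open>Taking norms avoids the choice of a \<open>d\<close>-th root: with
  \<open>u = w ^ q - 1\<close> the polynomial equation becomes
  \<open>norm (u + \<alpha>) = \<alpha> * m\<close>. The parameter \<open>ito_alpha L\<close> of the
  same point satisfies this equation too. Squared, it is a quadratic that is negative at 1, and both
  parameters lie below 1, so they agree.\<close>

lemma root_params:
  assumes sec: "in_sector \<theta>" and \<alpha>: "0 < \<alpha>" "\<alpha> < 1"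
    and L: "karp_g q d s (sector_x \<theta>) (sector_y \<theta>) L = 0"
    and root: "((exp (- L) *\<^sub>R cis \<theta>) ^ q - (1 - complex_of_real \<alpha>)) ^ d - complex_of_real \<alpha> ^ d * (exp (- L) *\<^sub>R cis \<theta>) ^ z = 0"
  shows "exp (- (real s / real d) * L) * sin (sector_x \<theta>) / sin (sector_x \<theta> + sector_y \<theta>) = \<alpha>"
    "exp (- (real q * L)) * sin (sector_y \<theta>) / sin (sector_x \<theta> + sector_y \<theta>) = 1 - \<alpha>"
proof -
  interpret karp_sector q d z n s p r \<theta> by (rule sector_locale(1)[OF sec])
  have L': "karp_g q d s x y L = 0" using L sector_locale(2,3)[OF sec] by simp
  have Lp: "0 < L" by (rule L_pos) (use L' in simp)
  define w u where "w = exp (- L) *\<^sub>R cis \<theta>" and "u = w ^ q - 1"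
  define m where "m = exp (- (real z / real d) * L)"
  have mu: "norm (ito_mu L) = m" by (simp add: ito_mu_def m_def)
  have "norm (ito_mu L ^ d) = norm (w ^ z)" unfolding ito_mu_power w_def ..
  then have md: "m ^ d = norm w ^ z" unfolding norm_power mu .
  have m1: "0 < m" "m < 1" using Lp n_pos z by (auto simp: m_def)
  have wq: "norm (w ^ q) = exp (- (real q * L))" unfolding w_def lam_q by (simp flip: exp_of_nat_mult)
  have zq: "real z / real d < real q"
  proof -
    have "real z < real q" using z_less by simp
    also have "real q \<le> real q * real d" using n_pos by simp
    finally show ?thesis using n_pos by (simp add: field_simps)
  qed
  have wm: "norm (w ^ q) < m" unfolding wq m_def using mult_strict_right_mono[OF zq Lp] by simp
  have sq: "(1 - m\<^sup>2) * a\<^sup>2 + 2 * Re u * a + (norm u)\<^sup>2 = 0" if "norm (u + complex_of_real a) = a * m" for a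
  proof -
    have "(norm (u + complex_of_real a))\<^sup>2 = (norm u)\<^sup>2 + 2 * Re u * a + a\<^sup>2"
      unfolding cmod_power2 by (simp add: power2_eq_square algebra_simps)
    then show ?thesis unfolding that by (simp add: power_mult_distrib algebra_simps)
  qed
  have 1: "norm (u + complex_of_real \<alpha>) = \<alpha> * m"
  proof -
    have "(u + complex_of_real \<alpha>) ^ d = complex_of_real \<alpha> ^ d * w ^ z" using root by (simp add: u_def w_def algebra_simps)
    then have "norm (u + complex_of_real \<alpha>) ^ d = (\<alpha> * m) ^ d"
      using \<alpha> md by (metis norm_power norm_mult norm_of_real abs_of_pos power_mult_distrib)
    then show ?thesis by (rule power_eq_imp_eq_base) (use \<alpha> m1 n_pos in auto)
  qed
  have ab: "ito_alpha L + ito_beta L = 1" using L' ito_sum by simp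
  have 2: "norm (u + complex_of_real (ito_alpha L)) = ito_alpha L * m"
  proof -
    have "u + complex_of_real (ito_alpha L) = complex_of_real (ito_alpha L + ito_beta L) - 1 + complex_of_real (ito_alpha L) * ito_mu L"
      using ito_power[of L] by (simp add: u_def w_def)
    then have "norm (u + complex_of_real (ito_alpha L)) = norm (complex_of_real (ito_alpha L)) * norm (ito_mu L)"
      unfolding ab by (simp add: norm_mult)
    then show ?thesis using ito_pos(1)[of L] mu by simp
  qed
  have "ito_alpha L = \<alpha>"
  proof (rule convex_root_unique[of "1 - m\<^sup>2" "2 * Re u" "(norm u)\<^sup>2"])
    show "0 < 1 - m\<^sup>2" using m1 power_strict_mono[of m 1 2] by simp
    have "1 - m\<^sup>2 + 2 * Re u + (norm u)\<^sup>2 = (norm (w ^ q))\<^sup>2 - m\<^sup>2"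
      unfolding u_def cmod_power2 by (simp add: power2_eq_square algebra_simps)
    moreover have "(norm (w ^ q))\<^sup>2 < m\<^sup>2" using wm by (intro power_strict_mono) auto
    ultimately show "1 - m\<^sup>2 + 2 * Re u + (norm u)\<^sup>2 < 0" by simp
    show "ito_alpha L < 1" using ab ito_pos(2)[of L] by simp
  qed (use sq[OF 1] sq[OF 2] \<alpha> in auto)
  then show "exp (- (real s / real d) * L) * sin (sector_x \<theta>) / sin (sector_x \<theta> + sector_y \<theta>) = \<alpha>"
    "exp (- (real q * L)) * sin (sector_y \<theta>) / sin (sector_x \<theta> + sector_y \<theta>) = 1 - \<alpha>"
    using ab unfolding ito_alpha_def ito_beta_def sector_locale(2,3)[OF sec] by auto
qed

text \<open>The \<open>n\<close>-th power turns the exponential into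
  \<open>exp (- (q * L)) ^ s\<close>, and hypothesis \<open>b\<close> eliminates it.\<close>

lemma power_relation:
  fixes L X Y W :: real
  assumes "0 < X" "0 < Y" "0 < W" "0 < \<alpha>" "\<alpha> < 1"
    and b: "exp (- (real q * L)) * Y / W = 1 - \<alpha>"
  shows "exp (- (real s / real d) * L) * X / W = \<alpha> \<longleftrightarrow> (1 - \<alpha>) ^ s * X ^ n = \<alpha> ^ n * Y ^ s * W ^ z"
proof -
  define e where "e = exp (- (real s / real d) * L)"
  have en: "e ^ n = exp (- (real q * L)) ^ s"
    unfolding e_def using n_pos by (simp add: n_def flip: exp_of_nat_mult)
  have eb: "exp (- (real q * L)) = (1 - \<alpha>) * W / Y" using b assms by (simp add: field_simps)
  have n: "n = s + z" using s_props(1) by simp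
  have "e * X / W = \<alpha> \<longleftrightarrow> (e * X / W) ^ n = \<alpha> ^ n"
  proof
    assume "(e * X / W) ^ n = \<alpha> ^ n"
    then show "e * X / W = \<alpha>" by (rule power_eq_imp_eq_base) (use assms n_pos in \<open>auto simp: e_def\<close>)
  qed simp
  also have "(e * X / W) ^ n = ((1 - \<alpha>) * W / Y) ^ s * X ^ n / W ^ n"
    unfolding eb[symmetric] en[symmetric] by (simp add: power_mult_distrib power_divide)
  also have "\<dots> = (1 - \<alpha>) ^ s * X ^ n / (Y ^ s * W ^ z)"
  proof -
    have "W ^ n = W ^ s * W ^ z" by (simp add: n power_add)
    then show ?thesis unfolding power_mult_distrib power_divide using assms by simp
  qed
  also have "(1 - \<alpha>) ^ s * X ^ n / (Y ^ s * W ^ z) = \<alpha> ^ n \<longleftrightarrow> (1 - \<alpha>) ^ s * X ^ n = \<alpha> ^ n * Y ^ s * W ^ z"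
    using assms by (simp add: field_simps)
  finally show ?thesis unfolding e_def .
qed

theorem ito_root_unique:
  assumes \<alpha>: "0 < \<alpha>" "\<alpha> < 1"
  shows "\<exists>!w. w \<noteq> 0 \<and> (w ^ q - (1 - complex_of_real \<alpha>)) ^ d - complex_of_real \<alpha> ^ d * w ^ z = 0 \<and> w \<in> karpelevich_arc n p q r s"
proof (rule ex_ex1I)
  define a b where "a = 2 * pi * real p / real q" and "b = 2 * pi * real r / real s"
  \<comment> \<open>The zeros of \<open>P\<close> are the angles at which
    \<open>power_relation\<close> holds. \<open>sin x\<close> vanishes at the left end of the sector
    and \<open>sin y\<close> at the right end, so \<open>P\<close> changes sign.\<close>
  define P where "P = (\<lambda>\<theta>. (1 - \<alpha>) ^ s * sin (sector_x \<theta>) ^ n - \<alpha> ^ n * sin (sector_y \<theta>) ^ s * sin (sector_x \<theta> + sector_y \<theta>) ^ z)"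
  have ab: "a < b" unfolding a_def b_def by (rule farey_less)
  have xa: "sector_x a = 0" using n_pos by (simp add: sector_x_def a_def)
  have ya: "sector_y a = 2 * pi / real n" using sector_xy_sum[of a] n_pos xa by (simp add: field_simps)
  have yb: "sector_y b = 0" using n_pos by (simp add: sector_y_def b_def)
  have xb: "sector_x b = 2 * pi / real s" using sector_xy_sum[of b] n_pos yb by (simp add: field_simps)
  have ns: "3 \<le> s" "3 \<le> n" using s_props by (auto simp: n_def)
  have sa: "0 < sin (2 * pi / real n)" "0 < sin (2 * pi / real s)"
    using ns by (auto intro!: sin_gt_zero simp: field_simps)
  have Pa: "P a < 0" unfolding P_def xa ya using sa \<alpha> n_pos by (simp add: power_0_left)
  have Pb: "0 < P b" unfolding P_def xb yb using sa \<alpha> n_pos by (simp add: power_0_left)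
  have "continuous_on {a..b} P" unfolding P_def sector_x_def sector_y_def by (intro continuous_intros) (use n_pos in auto)
  then obtain \<theta> where th: "a \<le> \<theta>" "\<theta> \<le> b" "P \<theta> = 0" using IVT'[of P a 0 b] Pa Pb ab by auto
  have sec: "in_sector \<theta>" using th Pa Pb unfolding in_sector_def a_def[symmetric] b_def[symmetric]
    by (metis order_le_less less_irrefl)
  interpret karp_sector q d z n s p r \<theta> by (rule sector_locale(1)[OF sec])
  note xy = sector_locale(2,3)[OF sec]
  note S = sin_xy[unfolded xy]
  define L where "L = - (ln ((1 - \<alpha>) * sin (x + y) / sin y) / real q)"
  have "exp (- (real q * L)) = (1 - \<alpha>) * sin (x + y) / sin y"
    unfolding L_def using n_pos \<alpha> sin_xy by simp
  then have be: "exp (- (real q * L)) * sin y / sin (x + y) = 1 - \<alpha>" using sin_xy by simp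
  have al: "exp (- (real s / real d) * L) * sin x / sin (x + y) = \<alpha>"
    unfolding power_relation[OF sin_xy \<alpha> be] using th(3) unfolding P_def xy by simp
  have g0: "karp_g q d s x y L = 0" using be al ito_sum[of L] unfolding ito_alpha_def ito_beta_def by simp
  define w where "w = exp (- L) *\<^sub>R cis \<theta>"
  have W: "Arg2pi w = \<theta>" "norm w = exp (- L)" "w \<noteq> 0"
    unfolding w_def using in_sector_range[OF sec] by (auto intro!: Arg2pi_polar)
  have "w \<in> karpelevich_arc n p q r s" unfolding arc_iff using W sec g0 by (simp add: sector_g_def xy)
  moreover have "(w ^ q - (1 - complex_of_real \<alpha>)) ^ d = (complex_of_real \<alpha> * ito_mu L) ^ d"
  proof -
    have "w ^ q = complex_of_real (1 - \<alpha>) + complex_of_real \<alpha> * ito_mu L"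
      using ito_power[of L] unfolding w_def unfolding ito_alpha_def ito_beta_def be al .
    then show ?thesis by simp
  qed
  then have "(w ^ q - (1 - complex_of_real \<alpha>)) ^ d - complex_of_real \<alpha> ^ d * w ^ z = 0"
    unfolding power_mult_distrib ito_mu_power w_def by simp
  ultimately show "\<exists>w. w \<noteq> 0 \<and> (w ^ q - (1 - complex_of_real \<alpha>)) ^ d - complex_of_real \<alpha> ^ d * w ^ z = 0 \<and> w \<in> karpelevich_arc n p q r s"
    using W(3) by blast
next
  fix w1 w2
  let ?R = "\<lambda>w. w \<noteq> 0 \<and> (w ^ q - (1 - complex_of_real \<alpha>)) ^ d - complex_of_real \<alpha> ^ d * w ^ z = 0 \<and> w \<in> karpelevich_arc n p q r s"
  have data: "in_sector (Arg2pi w)" "ito_ratio (Arg2pi w) = real n * ln \<alpha> - real s * ln (1 - \<alpha>)"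
    "norm w ^ q * sin (sector_y (Arg2pi w)) / sin (sector_x (Arg2pi w) + sector_y (Arg2pi w)) = 1 - \<alpha>" if R: "?R w" for w
  proof -
    define \<theta> L where "\<theta> = Arg2pi w" and "L = - ln (norm w)"
    have w0: "w \<noteq> 0" and sec: "in_sector \<theta>" and G: "sector_g w = 0" using R by (auto simp: arc_iff \<theta>_def)
    show "in_sector (Arg2pi w)" using sec by (simp add: \<theta>_def)
    have pol: "exp (- L) *\<^sub>R cis \<theta> = w" using polar_Arg2pi[OF w0] by (simp add: L_def \<theta>_def)
    interpret karp_sector q d z n s p r \<theta> by (rule sector_locale(1)[OF sec])
    note S = sin_xy[unfolded sector_locale(2,3)[OF sec]]
    have g0: "karp_g q d s (sector_x \<theta>) (sector_y \<theta>) L = 0" using G by (simp add: sector_g_def \<theta>_def L_def)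
    have R': "((exp (- L) *\<^sub>R cis \<theta>) ^ q - (1 - complex_of_real \<alpha>)) ^ d - complex_of_real \<alpha> ^ d * (exp (- L) *\<^sub>R cis \<theta>) ^ z = 0"
      unfolding pol using R by simp
    note rp = root_params[OF sec \<alpha> g0 R']
    have e: "exp (- (real q * L)) = norm w ^ q" using w0 by (simp add: L_def exp_of_nat_mult)
    show "norm w ^ q * sin (sector_y (Arg2pi w)) / sin (sector_x (Arg2pi w) + sector_y (Arg2pi w)) = 1 - \<alpha>"
      using rp(2) unfolding e \<theta>_def .
    have "(1 - \<alpha>) ^ s * sin (sector_x \<theta>) ^ n = \<alpha> ^ n * sin (sector_y \<theta>) ^ s * sin (sector_x \<theta> + sector_y \<theta>) ^ z"
      using power_relation[OF S \<alpha> rp(2)] rp(1) by simp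
    then have "ln ((1 - \<alpha>) ^ s * sin (sector_x \<theta>) ^ n) = ln (\<alpha> ^ n * sin (sector_y \<theta>) ^ s * sin (sector_x \<theta> + sector_y \<theta>) ^ z)" by simp
    then show "ito_ratio (Arg2pi w) = real n * ln \<alpha> - real s * ln (1 - \<alpha>)"
      using S \<alpha> unfolding ito_ratio_def \<theta>_def[symmetric] by (simp add: ln_mult ln_realpow)
  qed
  assume R: "?R w1" "?R w2"
  have th: "Arg2pi w1 = Arg2pi w2"
    using data(1,2)[OF R(1)] data(1,2)[OF R(2)] ito_ratio_strict_mono[of "Arg2pi w1" "Arg2pi w2"] ito_ratio_strict_mono[of "Arg2pi w2" "Arg2pi w1"]
    by (cases "Arg2pi w1" "Arg2pi w2" rule: linorder_cases) auto
  interpret karp_sector q d z n s p r "Arg2pi w1" by (rule sector_locale(1)[OF data(1)[OF R(1)]])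
  note S = sin_xy[unfolded sector_locale(2,3)[OF data(1)[OF R(1)]]]
  have "norm w1 ^ q * sin (sector_y (Arg2pi w2)) / sin (sector_x (Arg2pi w2) + sector_y (Arg2pi w2)) = norm w2 ^ q * sin (sector_y (Arg2pi w2)) / sin (sector_x (Arg2pi w2) + sector_y (Arg2pi w2))"
    using data(3)[OF R(1)] data(3)[OF R(2)] unfolding th by simp
  then have "norm w1 ^ q = norm w2 ^ q" using S unfolding th by simp
  then have "norm w1 = norm w2" by (rule power_eq_imp_eq_base) (use n_pos in auto)
  then show "w1 = w2" using th polar_Arg2pi[of w1] polar_Arg2pi[of w2] R by simp
qed

end

subsection \<open>Rigidity on the curve\<close>

lemma cut_N_mono:
  assumes "0 < sin x" "K \<le> K'"
  shows "cut_N x K \<le> cut_N x K'"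
  using assms unfolding cut_N_def by (simp add: divide_right_mono arctan_le_iff)

lemma cut_N_tendsto:
  assumes "(f \<longlongrightarrow> K) F" "sin x \<noteq> 0"
  shows "((\<lambda>m. cut_N x (f m)) \<longlongrightarrow> cut_N x K) F"
  unfolding cut_N_def using assms by (intro tendsto_intros)

lemma saw_H_tendsto:
  assumes "(f \<longlongrightarrow> w) F" "\<bar>w\<bar> < pi / 2"
  shows "((\<lambda>m. saw_H T (f m)) \<longlongrightarrow> saw_H T w) F"
  by (rule isCont_tendsto_compose[OF DERIV_isCont[OF saw_H_deriv[OF assms(2)]] assms(1)])

locale karp_curve = karp_sector +
  fixes L :: real
  assumes curve: "karp_g q d s x y L = 0"
begin

lemma L0: "0 < L" using curve by (intro L_pos) simp

definition "Nc = cut_N x (real q * L)"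
definition "Tc = tan (y - Nc)"

lemma Nc_props: "- (x / 2) < Nc" "Nc + x < pi / 2" "\<bar>Nc\<bar> < pi / 2"
  using cut_N_props[OF x_pos x_small(2), of "real q * L"] L0 n_pos unfolding Nc_def by auto

text \<open>On the curve the climbing inequality for the optimal slope holds with equality; the
  rigidity statements below are drawn from this.\<close>

lemma curve_saw:
  assumes "\<bar>y - Nc\<bar> < pi / 2"
  shows "Tc * real d * y - real s * L = real d * saw_H Tc Nc"
proof -
  have "karp_V q d s x y L = 0"
    using karp_V_iff(2)[OF x_pos x_small(2) _ n_pos(3), of q L y s] assms curve L0 n_pos unfolding Nc_def by simp
  then show ?thesis unfolding Tc_def saw_H_tan[OF assms] karp_V_def Nc_def[symmetric] by (simp add: algebra_simps)
qed

lemma Tc_bounds: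
  assumes y3: "y - Nc \<le> pi / 3"
  shows "0 < tan Nc + Tc" "Tc \<le> sqrt 3"
proof -
  have yN: "\<bar>y - Nc\<bar> < pi / 2" using y3 y_pos Nc_props by linarith
  show "Tc \<le> sqrt 3"
  proof (cases "y - Nc = pi / 3")
    case True
    show ?thesis unfolding Tc_def True tan_60 ..
  next
    case False
    have "tan (y - Nc) < tan (pi / 3)" by (rule tan_mono_abs) (use yN y3 False in auto)
    then show ?thesis by (simp add: Tc_def tan_60)
  qed
  have "tan (Nc - y) < tan Nc" by (rule tan_mono_abs) (use yN y_pos Nc_props in linarith)+
  then show "0 < tan Nc + Tc" using tan_minus[of "y - Nc"] by (simp add: Tc_def)
qed

text \<open>For the tilted marks the exponents \<open>LL m\<close> stay at least \<open>L\<close> by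
  \<open>g_nonpos\<close> and tend to \<open>L\<close>. In the limit \<open>c_lower\<close> and
  \<open>curve_saw\<close> bound the distance from the image to the next mark, times a constant,
  from below by \<open>saw_H Tc Nc\<close>. This is positive because the minimum of
  \<open>saw_H Tc\<close> lies at \<open>Nc - y\<close>, not at \<open>Nc\<close>.\<close>

theorem upper_strict:
  assumes adm: "adm (exp (- L) *\<^sub>R cis \<theta>) n \<gamma> \<phi>"
    and st1: "\<And>j. \<phi> (j + \<sigma>) \<le> \<phi> j + \<theta>" and st2: "\<And>j. \<phi> j + \<theta> \<le> \<phi> (j + \<sigma> + 1)"
  shows "y - Nc \<le> pi / 3" "\<phi> j + \<theta> < \<phi> (j + \<sigma> + 1)"
proof -
  obtain K where K: "0 \<le> K" and K': "\<forall>\<epsilon>. 0 < \<epsilon> \<longrightarrow> \<epsilon> \<le> 1 / 2 \<longrightarrow> (\<exists>L' G. 0 < L' \<and> exp L' \<le> 1 / exp (- L) + K * \<epsilon> \<and>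
     level_system q d s (\<lambda>i t. tilt \<epsilon> \<phi> (i + \<sigma> * t) - real_of_int t * \<theta>) G x y L')"
    using perturb[OF exp_gt_zero adm st1 st2] by (elim exE conjE)
  define \<epsilon> where "\<epsilon> = (\<lambda>m. 1 / real (m + 2))"
  have eps: "0 < \<epsilon> m" "\<epsilon> m \<le> 1 / 2" for m by (auto simp: \<epsilon>_def field_simps)
  have e0: "\<epsilon> \<longlonglongrightarrow> 0" unfolding \<epsilon>_def using LIMSEQ_ignore_initial_segment[OF lim_1_over_n, of 2] by simp
  have "\<forall>m. \<exists>L' G. 0 < L' \<and> exp L' \<le> exp L + K * \<epsilon> m \<and>
     level_system q d s (\<lambda>i t. tilt (\<epsilon> m) \<phi> (i + \<sigma> * t) - real_of_int t * \<theta>) G x y L'"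
  proof
    fix m
    have "1 / exp (- L) = exp L" by (simp add: exp_minus inverse_eq_divide)
    then show "\<exists>L' G. 0 < L' \<and> exp L' \<le> exp L + K * \<epsilon> m \<and>
      level_system q d s (\<lambda>i t. tilt (\<epsilon> m) \<phi> (i + \<sigma> * t) - real_of_int t * \<theta>) G x y L'"
      using K'[rule_format, OF eps(1)[of m] eps(2)[of m]] by simp
  qed
  from choice[OF this] obtain LL where "\<forall>m. \<exists>G. 0 < LL m \<and> exp (LL m) \<le> exp L + K * \<epsilon> m \<and>
     level_system q d s (\<lambda>i t. tilt (\<epsilon> m) \<phi> (i + \<sigma> * t) - real_of_int t * \<theta>) G x y (LL m)" by (elim exE)
  from choice[OF this] obtain GG where LG': "\<forall>m. 0 < LL m \<and> exp (LL m) \<le> exp L + K * \<epsilon> m \<and>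
     level_system q d s (\<lambda>i t. tilt (\<epsilon> m) \<phi> (i + \<sigma> * t) - real_of_int t * \<theta>) (GG m) x y (LL m)" by (elim exE)
  note LG = LG'[rule_format, THEN conjunct1] LG'[rule_format, THEN conjunct2, THEN conjunct1] LG'[rule_format, THEN conjunct2, THEN conjunct2]
  note LG3 = LG(3)
  have ge: "L \<le> LL m" for m
  proof (rule ccontr)
    assume "\<not> L \<le> LL m"
    then have "karp_g q d s x y L < karp_g q d s x y (LL m)" by (intro karp_g_strict_mono sin_xy n_pos) auto
    moreover have "karp_g q d s x y (LL m) \<le> 0" by (rule level_system.g_nonpos[OF LG3 y_pos xy_small])
    ultimately show False using curve by simp
  qed
  have "(\<lambda>m. ln (exp L + K * \<epsilon> m)) \<longlonglongrightarrow> ln (exp L + K * 0)"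
    by (intro tendsto_intros e0) (simp add: add_pos_nonneg)
  moreover have "LL m \<le> ln (exp L + K * \<epsilon> m)" for m
    using LG(2)[of m] ln_ge_iff[of "exp L + K * \<epsilon> m" "LL m"] exp_gt_zero[of "LL m"] by linarith
  ultimately have LLlim: "LL \<longlonglongrightarrow> L"
    by (intro tendsto_sandwich[of "\<lambda>_. L" LL _ "\<lambda>m. ln (exp L + K * \<epsilon> m)"]) (auto simp: ge)
  define NN where "NN m = cut_N x (real q * LL m)" for m
  have NNlim: "NN \<longlonglongrightarrow> Nc" unfolding NN_def Nc_def
    by (intro cut_N_tendsto tendsto_intros LLlim) (use sin_xy in simp)
  have NNge: "Nc \<le> NN m" for m unfolding NN_def Nc_def by (intro cut_N_mono sin_xy mult_left_mono ge) simp
  have NNeq: "level_system.N q x (LL m) = NN m" for m unfolding level_system.N_def[OF LG3] NN_def ..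
  have "y - NN m < pi / 3" for m using level_system.V_nonneg(1)[OF LG3 y_pos xy_small, of m] unfolding NNeq .
  moreover have "(\<lambda>m. y - NN m) \<longlonglongrightarrow> y - Nc" by (intro tendsto_intros NNlim)
  ultimately show y3: "y - Nc \<le> pi / 3" by (intro LIMSEQ_le_const2[of "\<lambda>m. y - NN m"]) (auto intro: less_imp_le)
  have yN: "\<bar>y - Nc\<bar> < pi / 2" using y3 y_pos Nc_props by linarith
  note tN = Tc_bounds(1)[OF y3] and T3 = Tc_bounds(2)[OF y3]
  have tNN: "0 < tan (NN m) + Tc" for m
  proof -
    have "\<bar>NN m\<bar> < pi / 2" using level_system.N_props(3)[OF LG3, of m] unfolding NNeq .
    then have "tan Nc \<le> tan (NN m)" using tan_mono_abs[OF Nc_props(3), of "NN m"] NNge[of m] by (cases "Nc = NN m") auto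
    then show ?thesis using tN by linarith
  qed
  have low: "Tc * real d * y - real s * LL m - (real d - 1) * saw_H Tc (NN m)
     \<le> (tilt (\<epsilon> m) \<phi> (j + \<sigma> + 1) - \<theta> - tilt (\<epsilon> m) \<phi> j) * (tan (NN m + x) + Tc)" for m
    using level_system.c_lower[OF LG3[of m] tNN[of m, folded NNeq] T3, of j 0] unfolding NNeq by (simp add: algebra_simps)
  have tl: "(\<lambda>m. tilt (\<epsilon> m) \<phi> k) \<longlonglongrightarrow> (1 - 0) * \<phi> k + 0 * (2 * pi * real_of_int k / real n)" for k
    unfolding tilt_def by (intro tendsto_intros e0)
  have "(\<lambda>m. Tc * real d * y - real s * LL m - (real d - 1) * saw_H Tc (NN m)) \<longlonglongrightarrow>
     Tc * real d * y - real s * L - (real d - 1) * saw_H Tc Nc"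
    by (intro tendsto_intros LLlim saw_H_tendsto NNlim Nc_props)
  moreover have "(\<lambda>m. (tilt (\<epsilon> m) \<phi> (j + \<sigma> + 1) - \<theta> - tilt (\<epsilon> m) \<phi> j) * (tan (NN m + x) + Tc)) \<longlonglongrightarrow>
     (\<phi> (j + \<sigma> + 1) - \<theta> - \<phi> j) * (tan (Nc + x) + Tc)"
  proof -
    have "cos (Nc + x) > 0" by (rule cos_pos_abs) (use Nc_props x_pos in linarith)
    then have "cos (Nc + x) \<noteq> 0" by simp
    then have "(\<lambda>m. tan (NN m + x)) \<longlonglongrightarrow> tan (Nc + x)"
      by (intro isCont_tendsto_compose[OF isCont_tan] tendsto_add[OF NNlim tendsto_const])
    moreover have "(\<lambda>m. tilt (\<epsilon> m) \<phi> k) \<longlonglongrightarrow> \<phi> k" for k using tl[of k] by simp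
    ultimately show ?thesis by (intro tendsto_intros NNlim)
  qed
  ultimately have "Tc * real d * y - real s * L - (real d - 1) * saw_H Tc Nc \<le> (\<phi> (j + \<sigma> + 1) - \<theta> - \<phi> j) * (tan (Nc + x) + Tc)"
    by (rule LIMSEQ_le) (use low in auto)
  then have "saw_H Tc Nc \<le> (\<phi> (j + \<sigma> + 1) - \<theta> - \<phi> j) * (tan (Nc + x) + Tc)"
    unfolding curve_saw[OF yN] by (simp add: algebra_simps)
  moreover have "0 < saw_H Tc Nc"
  proof -
    have "arctan Tc = y - Nc" unfolding Tc_def by (rule arctan_tan) (use yN in linarith)+
    then have "Nc \<noteq> - arctan Tc" using y_pos by simp
    then show ?thesis using saw_H_zero[OF Nc_props(3), of Tc] saw_H_nonneg[OF Nc_props(3), of Tc] by force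
  qed
  ultimately have "\<phi> (j + \<sigma> + 1) - \<theta> - \<phi> j \<noteq> 0" by auto
  then show "\<phi> j + \<theta> < \<phi> (j + \<sigma> + 1)" using st2[of j] by simp
qed

end

locale strict_levels = karp_curve +
  fixes \<phi> :: "int \<Rightarrow> real"
  assumes mk: "marks n \<phi>" and inc: "\<And>k. \<phi> k < \<phi> (k + 1)" and gap: "\<And>k. \<phi> (k + 1) - \<phi> k < pi"
    and lo: "\<And>j. \<phi> (j + \<sigma>) \<le> \<phi> j + \<theta>" and hi: "\<And>j. \<phi> j + \<theta> < \<phi> (j + \<sigma> + 1)"
begin

definition row :: "(int \<Rightarrow> real) \<Rightarrow> int \<Rightarrow> real" where
  "row w k = sin_chord (\<phi> (k + \<sigma>)) (\<phi> (k + \<sigma> + 1)) (w (k + \<sigma>)) (w (k + \<sigma> + 1)) (\<phi> k + \<theta>)"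

definition "P k = sin (\<phi> (k + \<sigma> + 1) - (\<phi> k + \<theta>)) / sin (\<phi> (k + \<sigma> + 1) - \<phi> (k + \<sigma>))"
definition "Q k = sin (\<phi> k + \<theta> - \<phi> (k + \<sigma>)) / sin (\<phi> (k + \<sigma> + 1) - \<phi> (k + \<sigma>))"

lemma row_eq: "row w k = P k * w (k + \<sigma>) + Q k * w (k + \<sigma> + 1)"
  unfolding row_def sin_chord_def P_def Q_def by (simp add: add_divide_distrib)

lemma sin_gap: "0 < sin (\<phi> (k + 1) - \<phi> k)" using inc[of k] gap[of k] by (intro sin_gt_zero) auto

lemma PQ: "0 < P k" "0 \<le> Q k" "\<phi> (k + \<sigma>) < \<phi> k + \<theta> \<Longrightarrow> 0 < Q k"
  unfolding P_def Q_def using sin_gap[of "k + \<sigma>"] lo[of k] hi[of k] gap[of "k + \<sigma>"]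
  by (auto intro!: divide_pos_pos divide_nonneg_pos sin_gt_zero sin_ge_zero)

lemma PQ_per: "P (k + int n) = P k" "Q (k + int n) = Q k"
proof -
  have e: "k + int n + \<sigma> = (k + \<sigma>) + int n" "(k + \<sigma>) + int n + 1 = (k + \<sigma> + 1) + int n" by simp_all
  show "P (k + int n) = P k" "Q (k + int n) = Q k"
    unfolding P_def Q_def e marks_D(4)[OF mk] by (simp_all add: algebra_simps)
qed

definition super :: "(int \<Rightarrow> real) \<Rightarrow> bool" where
  "super w \<longleftrightarrow> (\<forall>k. w (k + int n) = w k \<and> 0 < w k \<and> row w k \<le> exp L * w k)"

definition strict_at :: "int \<Rightarrow> bool" where
  "strict_at k \<longleftrightarrow> (\<exists>w. super w \<and> row w k < exp L * w k)"

lemma row_per: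
  assumes "\<And>k. w (k + int n) = w k" shows "row w (k + int n) = row w k"
proof -
  have e: "k + int n + \<sigma> = (k + \<sigma>) + int n" "(k + \<sigma>) + int n + 1 = (k + \<sigma> + 1) + int n" by simp_all
  show ?thesis unfolding row_eq PQ_per e assms ..
qed

lemma super_row: assumes "super w" shows "super (row w)"
  unfolding super_def
proof (intro allI conjI)
  fix k
  have w: "w (k + int n) = w k" "0 < w k" "row w k \<le> exp L * w k" for k using assms by (auto simp: super_def)
  show "row w (k + int n) = row w k" by (rule row_per) (rule w)
  show "0 < row w k" unfolding row_eq using PQ[of k] w(2) by (intro add_pos_nonneg mult_pos_pos mult_nonneg_nonneg less_imp_le[OF w(2)])
  have "row (row w) k \<le> P k * (exp L * w (k + \<sigma>)) + Q k * (exp L * w (k + \<sigma> + 1))"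
    unfolding row_eq[of "row w"] using PQ[of k] w(3) by (intro add_mono mult_left_mono) auto
  then show "row (row w) k \<le> exp L * row w k" unfolding row_eq[of w k] by (simp add: algebra_simps)
qed

text \<open>Passing from \<open>w\<close> to \<open>row w\<close> keeps a supersolution, and
  strictness at an index that enters row \<open>k\<close> with positive weight becomes strictness at
  \<open>k\<close>.\<close>

lemma strict_back:
  assumes "strict_at (k + \<sigma>) \<or> strict_at (k + \<sigma> + 1) \<and> \<phi> (k + \<sigma>) < \<phi> k + \<theta>"
  shows "strict_at k"
proof -
  obtain w where w: "super w" "row w (k + \<sigma>) < exp L * w (k + \<sigma>) \<or> row w (k + \<sigma> + 1) < exp L * w (k + \<sigma> + 1) \<and> 0 < Q k"
    using assms PQ(3)[of k] unfolding strict_at_def by blast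
  have le: "row w j \<le> exp L * w j" for j using w(1) by (auto simp: super_def)
  have "row (row w) k < P k * (exp L * w (k + \<sigma>)) + Q k * (exp L * w (k + \<sigma> + 1))"
    unfolding row_eq[of "row w"] using w(2)
  proof
    assume "row w (k + \<sigma>) < exp L * w (k + \<sigma>)"
    then show "P k * row w (k + \<sigma>) + Q k * row w (k + \<sigma> + 1) < P k * (exp L * w (k + \<sigma>)) + Q k * (exp L * w (k + \<sigma> + 1))"
      using PQ[of k] le by (intro add_less_le_mono mult_strict_left_mono mult_left_mono) auto
  next
    assume "row w (k + \<sigma> + 1) < exp L * w (k + \<sigma> + 1) \<and> 0 < Q k"
    then show "P k * row w (k + \<sigma>) + Q k * row w (k + \<sigma> + 1) < P k * (exp L * w (k + \<sigma>)) + Q k * (exp L * w (k + \<sigma> + 1))"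
      using PQ[of k] le by (intro add_le_less_mono mult_strict_left_mono mult_left_mono) auto
  qed
  then have "row (row w) k < exp L * row w k" unfolding row_eq[of w k] by (simp add: algebra_simps)
  then show ?thesis using super_row[OF w(1)] unfolding strict_at_def by blast
qed

lemma strict_per: "strict_at (k + int n) = strict_at k"
proof -
  have "row w (k + int n) < exp L * w (k + int n) \<longleftrightarrow> row w k < exp L * w k" if "super w" for w
    using row_per[of w k] that unfolding super_def by auto
  then show ?thesis unfolding strict_at_def by blast
qed

lemma strict_shift: "strict_at (k + int n * j) = strict_at k"
  by (rule periodic_mod_int(1)) (rule strict_per)

lemma level_index: "i + \<sigma> * (t + int q) = i + \<sigma> * t + int n * int p"
  using sigma_q by (simp add: algebra_simps)

text \<open>\<open>q\<close> steps without a drop would turn by \<open>q * \<theta>\<close>, but the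
  index then moves by \<open>p * n\<close>, that is, by the angle
  \<open>2 * pi * p = q * \<theta> - x\<close>.\<close>

lemma drop_exists:
  obtains e where "t \<le> e" "e < t + int q" "\<phi> (i + \<sigma> * e + \<sigma>) < \<phi> (i + \<sigma> * e) + \<theta>"
proof -
  have "\<exists>e. t \<le> e \<and> e < t + int q \<and> \<phi> (i + \<sigma> * e + \<sigma>) < \<phi> (i + \<sigma> * e) + \<theta>"
  proof (rule ccontr)
    assume c: "\<not> ?thesis"
    have "m \<le> q \<Longrightarrow> \<phi> (i + \<sigma> * (t + int m)) = \<phi> (i + \<sigma> * t) + real m * \<theta>" for m
    proof (induction m)
      case (Suc m)
      then have "\<phi> (i + \<sigma> * (t + int m) + \<sigma>) = \<phi> (i + \<sigma> * (t + int m)) + \<theta>"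
        using c[simplified, rule_format, of "t + int m"] lo[of "i + \<sigma> * (t + int m)"] by linarith
      moreover have "i + \<sigma> * (t + int m) + \<sigma> = i + \<sigma> * (t + int (Suc m))" by (simp add: algebra_simps)
      ultimately show ?case using Suc by (simp add: algebra_simps)
    qed simp
    from this[of q] show False
      unfolding level_index marks_shift[OF mk] using theta_q x_pos by simp
  qed
  then show ?thesis using that by blast
qed

text \<open>The weight \<open>P\<close> is always positive, so strictness moves backwards along a
  level and, by periodicity, to all of the level. A drop makes \<open>Q\<close> positive and links
  level \<open>i\<close> to level \<open>i + 1\<close>; periodicity in the index then reaches
  everything.\<close>

lemma strict_everywhere:
  assumes "strict_at k0" shows "strict_at k"
proof -
  have down: "strict_at (i + \<sigma> * t) \<Longrightarrow> strict_at (i + \<sigma> * (t - int m))" for i t m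
  proof (induction m)
    case (Suc m)
    have "i + \<sigma> * (t - int (Suc m)) + \<sigma> = i + \<sigma> * (t - int m)" by (simp add: algebra_simps)
    then show ?case by (intro strict_back) (use Suc in \<open>simp only: simp_thms\<close>)
  qed simp
  have level: "strict_at (i + \<sigma> * t')" if "strict_at (i + \<sigma> * t)" for i t t'
  proof -
    have "i + \<sigma> * (t' + int q * m) = i + \<sigma> * t' + int n * (int p * m)" for m
      using sigma_q by (simp add: algebra_simps)
    then have "strict_at (i + \<sigma> * t') = strict_at (i + \<sigma> * (t' - int q * (abs (t' - t))))"
      using strict_shift[of "i + \<sigma> * t'" "int p * (- abs (t' - t))"] by (metis diff_conv_add_uminus mult_minus_right)
    moreover have "t' - int q * (abs (t' - t)) \<le> t"
    proof -
      have "abs (t' - t) \<le> int q * abs (t' - t)" using n_pos by (simp add: mult_le_cancel_right1)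
      then show ?thesis by linarith
    qed
    ultimately show ?thesis using down[OF that, of "nat (t - (t' - int q * (abs (t' - t))))"] by simp
  qed
  have pred: "strict_at i" if "strict_at (i + 1)" for i
  proof -
    obtain e where e: "\<phi> (i + \<sigma> * e + \<sigma>) < \<phi> (i + \<sigma> * e) + \<theta>" by (rule drop_exists[of 0 i])
    have "strict_at (i + 1 + \<sigma> * (e + 1))" using level[of "i + 1" 0 "e + 1"] that by simp
    moreover have "i + 1 + \<sigma> * (e + 1) = i + \<sigma> * e + \<sigma> + 1" by (simp add: algebra_simps)
    ultimately have "strict_at (i + \<sigma> * e)" using strict_back[of "i + \<sigma> * e"] e by simp
    then show ?thesis using level[of i e 0] by simp
  qed
  have all: "strict_at (k0 - int m)" for m
  proof (induction m)
    case (Suc m)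
    then show ?case using pred[of "k0 - int (Suc m)"] by simp
  qed (use assms in simp)
  have "abs (k - k0) \<le> int n * abs (k - k0)" using n_pos by (simp add: mult_le_cancel_right1)
  then have "k - int n * abs (k - k0) \<le> k0" by linarith
  then have "strict_at (k + int n * (- abs (k - k0)))"
    using all[of "nat (k0 - (k - int n * abs (k - k0)))"] by simp
  then show ?thesis unfolding strict_shift .
qed

text \<open>A strict supersolution everywhere would make the same marks admissible for a larger modulus.\<close>

lemma no_strict: "\<not> strict_at k"
proof
  assume "strict_at k"
  then have "\<forall>k. \<exists>w. super w \<and> row w k < exp L * w k" using strict_everywhere unfolding strict_at_def by blast
  from choice[OF this] obtain W where W: "\<And>k. super (W k)" "\<And>k. row (W k) k < exp L * W k k" by blast
  have Wd: "W j (k + int n) = W j k" "0 < W j k" "row (W j) k \<le> exp L * W j k" for j k using W(1)[of j] by (auto simp: super_def)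
  define w where "w k = (\<Sum>j\<in>{0..<int n}. W j k)" for k
  have wp: "w (k + int n) = w k" "0 < w k" for k
    using Wd n_pos by (auto simp: w_def intro!: sum_pos)
  have rw: "row w k = (\<Sum>j\<in>{0..<int n}. row (W j) k)" for k
    unfolding row_eq w_def by (simp add: sum_distrib_left sum.distrib)
  have strict: "row w k < exp L * w k" for k
  proof -
    have "row w (k mod int n) < exp L * w (k mod int n)"
      unfolding rw unfolding w_def sum_distrib_left
      by (rule sum_strict_mono_ex1) (use W(2) Wd(3) n_pos in \<open>auto intro!: bexI[of _ "k mod int n"]\<close>)
    moreover have "w (k mod int n) = w k" by (rule periodic_mod_int(2)) (rule wp)
    moreover have "row w (k mod int n) = row w k" by (rule periodic_mod_int(2)) (rule row_per, rule wp)
    ultimately show ?thesis by simp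
  qed
  obtain B where B: "B < exp L" "\<And>k. row w k / w k \<le> B"
    by (rule periodic_bounded[of "\<lambda>k. row w k / w k" n "exp L"])
       (use strict wp n_pos row_per[of w] in \<open>auto simp: pos_divide_less_eq\<close>)
  \<comment> \<open>The entry \<open>exp L / 2\<close> guarantees a positive denominator. As
    \<open>1 / \<rho>\<close> is still below \<open>exp L\<close>, the same marks carry an invariant
    polygon for a point beyond the curve.\<close>
  define \<rho> where "\<rho> = 1 / max B (exp L / 2)"
  have mx: "0 < max B (exp L / 2)" "max B (exp L / 2) < exp L" using B(1) by (auto simp: less_max_iff_disj)
  have rho: "0 < \<rho>" "\<rho> * row w k \<le> w k" for k
  proof -
    show "0 < \<rho>" using mx by (simp add: \<rho>_def)
    have "row w k \<le> max B (exp L / 2) * w k" using B(2)[of k] wp(2)[of k] by (smt (verit) mult_right_mono pos_divide_le_eq)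
    then show "\<rho> * row w k \<le> w k" using mx by (simp add: \<rho>_def field_simps)
  qed
  have "polygon (\<rho> *\<^sub>R cis \<theta>) n \<phi> w q (\<rho> ^ q) x"
  proof
    fix k
    have "cone_rep \<phi> w ((\<rho> * P k) *\<^sub>R cis (\<phi> (k + \<sigma>)) + (\<rho> * Q k) *\<^sub>R cis (\<phi> (k + \<sigma> + 1))) (\<rho> * P k * w (k + \<sigma>) + \<rho> * Q k * w (k + \<sigma> + 1))"
      using PQ[of k] rho(1) by (intro cone_rep_add cone_rep_basis) auto
    moreover have "\<rho> * P k * w (k + \<sigma>) + \<rho> * Q k * w (k + \<sigma> + 1) = \<rho> * row w k" unfolding row_eq by (simp add: algebra_simps)
    moreover have "(\<rho> * P k) *\<^sub>R cis (\<phi> (k + \<sigma>)) + (\<rho> * Q k) *\<^sub>R cis (\<phi> (k + \<sigma> + 1)) = \<rho> *\<^sub>R cis \<theta> * cis (\<phi> k)"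
    proof -
      have "cis (\<phi> k + \<theta>) = P k *\<^sub>R cis (\<phi> (k + \<sigma>)) + Q k *\<^sub>R cis (\<phi> (k + \<sigma> + 1))"
        unfolding P_def Q_def by (rule cis_between) (use inc[of "k + \<sigma>"] gap[of "k + \<sigma>"] in auto)
      then have "\<rho> *\<^sub>R cis \<theta> * cis (\<phi> k) = \<rho> *\<^sub>R (P k *\<^sub>R cis (\<phi> (k + \<sigma>)) + Q k *\<^sub>R cis (\<phi> (k + \<sigma> + 1)))"
        by (simp add: cis_mult add.commute)
      then show ?thesis by (simp add: scaleR_add_right)
    qed
    ultimately have "cone_rep \<phi> w (\<rho> *\<^sub>R cis \<theta> * cis (\<phi> k)) (\<rho> * row w k)" by simp
    then show "cone_rep \<phi> w (\<rho> *\<^sub>R cis \<theta> * cis (\<phi> k)) (w k)" by (rule cone_rep.weaken) (rule rho)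
  qed (use mk wp lam_q rho x_pos x_small in auto)
  then have "adm (\<rho> *\<^sub>R cis \<theta>) n (polygon.gauge \<phi> w) \<phi>" by (rule polygon.gauge_adm)
  then have "karp_g q d s x y (- ln \<rho>) \<le> 0" by (rule adm_upper[OF rho(1)])
  moreover have "- ln \<rho> < L"
  proof -
    have "- ln \<rho> = ln (max B (exp L / 2))" using mx by (simp add: \<rho>_def ln_div)
    also have "\<dots> < ln (exp L)" using mx by (subst ln_less_cancel_iff) auto
    finally show ?thesis by simp
  qed
  ultimately show False using karp_g_strict_mono[OF sin_xy(1,2), of "- ln \<rho>" L q d s] curve n_pos by linarith
qed

text \<open>At the marks themselves the gauge values form a supersolution, since
  \<open>\<gamma>\<close> is linear between consecutive marks; \<open>no_strict\<close> excludes a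
  strict row. Thus the eigenvector equation holds without perturbation.\<close>

theorem rows_tight:
  assumes adm: "adm (exp (- L) *\<^sub>R cis \<theta>) n \<gamma> \<phi>"
  defines "w \<equiv> \<lambda>k. \<gamma> (cis (\<phi> k))"
  shows "row w k = exp L * w k"
proof -
  have per: "w (k + int n) = w k" for k
    unfolding w_def marks_D(4)[OF mk] by (simp add: cis_mult[symmetric])
  have pos: "0 < w k" for k unfolding w_def by (intro adm_D(2)[OF adm]) simp
  have le: "row w k \<le> exp L * w k" for k
  proof -
    have "cis (\<phi> k + \<theta>) = P k *\<^sub>R cis (\<phi> (k + \<sigma>)) + Q k *\<^sub>R cis (\<phi> (k + \<sigma> + 1))"
      unfolding P_def Q_def by (rule cis_between) (use inc[of "k + \<sigma>"] gap[of "k + \<sigma>"] in auto)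
    then have "row w k = \<gamma> (cis (\<phi> k + \<theta>))"
      unfolding row_eq w_def using adm_D(6)[OF adm less_imp_le[OF PQ(1)[of k]] PQ(2)[of k], of "k + \<sigma>"] by simp
    moreover have "exp (- L) * \<gamma> (cis (\<phi> k + \<theta>)) \<le> w k"
    proof -
      have "exp (- L) * \<gamma> (cis (\<phi> k + \<theta>)) = \<gamma> (exp (- L) *\<^sub>R cis (\<phi> k + \<theta>))" using adm_D(8)[OF adm, of "exp (- L)"] by simp
      also have "exp (- L) *\<^sub>R cis (\<phi> k + \<theta>) = (exp (- L) *\<^sub>R cis \<theta>) * cis (\<phi> k)" by (simp add: cis_mult add.commute)
      also have "\<gamma> \<dots> \<le> w k" unfolding w_def by (rule adm_D(3)[OF adm])
      finally show ?thesis .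
    qed
    ultimately show ?thesis by (simp add: exp_minus field_simps)
  qed
  have "super w" using per pos le by (simp add: super_def)
  then show ?thesis using no_strict[of k] le[of k] unfolding strict_at_def by fastforce
qed

end

section \<open>The sinusoid that equality forces at a mark\<close>

lemma cos_three_term:
  fixes a b v \<Psi> :: real
  shows "sin (b - v) * cos (\<Psi> - a) + sin (v - a) * cos (\<Psi> - b) = sin (b - a) * cos (\<Psi> - v)"
proof -
  have "sin (\<Psi> + pi / 2 - t) = cos (\<Psi> - t)" for t
    using sin_add[of "\<Psi> - t" "pi / 2"] by (simp add: algebra_simps)
  then show ?thesis using sin_three_term[of b v "\<Psi> + pi / 2" a] by simp
qed

lemma sin_chord_cos:
  assumes "sin (b - a) \<noteq> 0" "sin (b - v) \<noteq> 0"
    and "sin_chord a b ga (R * cos (\<Psi> - b)) v = R * cos (\<Psi> - v)"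
  shows "ga = R * cos (\<Psi> - a)"
proof -
  have "sin (b - v) * ga + sin (v - a) * (R * cos (\<Psi> - b)) = R * (sin (b - a) * cos (\<Psi> - v))"
    using assms(1,3) unfolding sin_chord_def by (simp add: field_simps)
  also have "\<dots> = R * (sin (b - v) * cos (\<Psi> - a) + sin (v - a) * cos (\<Psi> - b))"
    using cos_three_term[of b v \<Psi> a] by simp
  finally have "sin (b - v) * ga = sin (b - v) * (R * cos (\<Psi> - a))" by (simp add: distrib_left mult.left_commute)
  then show ?thesis using assms(2) by simp
qed

context strict_levels
begin

text \<open>Equality in \<open>climb_bound\<close> makes all deficits and hence all slacks vanish. A
  genuine drop has \<open>alpha > 0\<close>, so its target sits at the best position,
  \<open>c - sm = arctan Tc = y - Nc\<close>, and this fixes the phase of the sinusoid through the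
  two vertices.\<close>

lemma tight_levels:
  assumes y3: "y - Nc \<le> pi / 3"
    and w: "\<And>k. w (k + int n) = w k" "\<And>k. 0 < w k"
    and conv: "\<And>k. 0 \<le> sin (\<phi> (k + 1) - \<phi> k) * w (k - 1) + sin (\<phi> k - \<phi> (k - 1)) * w (k + 1) - sin (\<phi> (k + 1) - \<phi> (k - 1)) * w k"
    and rows: "\<And>k. row w k = exp L * w k"
    and drop: "\<phi> (\<sigma> * e + \<sigma>) < \<phi> (\<sigma> * e) + \<theta>"
  defines "c \<equiv> \<phi> (\<sigma> * e + \<sigma> + 1) - \<theta> - \<phi> (\<sigma> * e)"
  shows "y \<le> c" "\<bar>c - (y - Nc)\<bar> < pi / 2" "w (\<sigma> * e + \<sigma> + 1) * cos (c - (y - Nc)) = exp L * w (\<sigma> * e) * cos (y - Nc)"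
proof -
  define S where "S = (\<lambda>i t. \<phi> (i + \<sigma> * t) - real_of_int t * \<theta>)"
  define G where "G = (\<lambda>i t. ln (w (i + \<sigma> * t)) - real_of_int t * L)"
  interpret level_system q d s S G x y L
    unfolding S_def G_def
    by (rule eigen_levels[OF _ inc gap lo hi w conv rows[unfolded row_def] L0]) (rule marks_D(4)[OF mk])
  have N: "N = Nc" unfolding N_def Nc_def ..
  have yN: "\<bar>y - Nc\<bar> < pi / 2" using y3 y_pos Nc_props by linarith
  have T: "0 < tan N + Tc" "Tc \<le> sqrt 3" unfolding N using Tc_bounds[OF y3] by auto
  have "(\<Sum>i<d. deficit Tc (int i)) \<le> 0"
    using climb_bound[OF T] curve_saw[OF yN] unfolding N by linarith
  then have "(\<Sum>i<d. deficit Tc (int i)) = 0" using deficit_nonneg[OF T] by (intro antisym sum_nonneg) auto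
  then have "deficit Tc 0 = 0" using deficit_nonneg[OF T] n_pos by (subst (asm) sum_nonneg_eq_0_iff) force+
  then have s0: "slack Tc 0 e = 0" by (rule slack_zero[OF T])
  have ce: "S (0 + 1) (e + 1) - S 0 e = c" by (simp add: S_def c_def algebra_simps)
  have ae: "S 0 e - S 0 (e + 1) > 0" using drop by (simp add: S_def algebra_simps)
  have "0 < alpha Tc 0 e"
    using alpha_lower[OF T, of 0 e] mult_pos_pos[OF T(1) ae] by linarith
  then have "saw_H (- Tc) (c - sm 0 e) = 0"
    using s0 unfolding slack_def[OF T] target_gap[OF T] ce by simp
  then have "c - sm 0 e = - arctan (- Tc)" using w_bound[OF T, of 0 e] unfolding ce by (intro saw_H_zero)
  moreover have "arctan Tc = y - Nc" unfolding Tc_def by (rule arctan_tan) (use yN in linarith)+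
  ultimately have sm: "sm 0 e = c - (y - Nc)" by (simp add: arctan_minus)
  show "y \<le> c" using saw_facts(1)[OF T, of 0 e] unfolding sm N by linarith
  show b: "\<bar>c - (y - Nc)\<bar> < pi / 2" using sm_bound[of 0 e] unfolding sm .
  have i: "\<sigma> * (e + 1) = \<sigma> * e + \<sigma>" "1 + \<sigma> * (e + 1) = \<sigma> * e + \<sigma> + 1" by (simp_all add: algebra_simps)
  have "exp (G (0 + 1) (e + 1) - G 0 e) = cos (y - Nc) / cos (c - (y - Nc))"
    using up_ratio[of 0 e] unfolding ce sm by simp
  moreover have "exp (G (0 + 1) (e + 1) - G 0 e) = w (\<sigma> * e + \<sigma> + 1) / (exp L * w (\<sigma> * e))"
  proof -
    have "G (0 + 1) (e + 1) - G 0 e = ln (w (\<sigma> * e + \<sigma> + 1)) - ln (w (\<sigma> * e)) - L"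
      unfolding G_def using i by (simp add: algebra_simps)
    also have "exp \<dots> = w (\<sigma> * e + \<sigma> + 1) / w (\<sigma> * e) / exp L" using w(2) by (simp add: exp_diff)
    finally show ?thesis by simp
  qed
  ultimately show "w (\<sigma> * e + \<sigma> + 1) * cos (c - (y - Nc)) = exp L * w (\<sigma> * e) * cos (y - Nc)"
    using cos_pos_abs[OF b] w(2)[of "\<sigma> * e"] by (simp add: field_simps)
qed

text \<open>Going back from mark 0 in steps of \<open>\<sigma>\<close>, a step without a drop is a
  pure rotation by \<open>\<theta>\<close> that scales the gauge by \<open>exp L\<close>. At the
  first genuine drop, after \<open>j\<close> such steps, \<open>tight_levels\<close> supplies the
  sinusoid. Rotated forward again, it expresses the gauge at mark 0 through the mark
  \<open>1 - j * \<sigma>\<close> alone.\<close>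

theorem last_drop:
  assumes y3: "y - Nc \<le> pi / 3" and adm: "adm (exp (- L) *\<^sub>R cis \<theta>) n \<gamma> \<phi>"
  obtains j where "j < q"
    "\<gamma> (cis (\<phi> 0)) * cos (y - Nc) = exp (real j * L) * \<gamma> (cis (\<phi> (1 - int j * \<sigma>))) * cos (\<phi> (1 - int j * \<sigma>) + real j * \<theta> - \<phi> 0 - (y - Nc))"
    "\<phi> 0 + y < \<phi> (1 - int j * \<sigma>) + real j * \<theta>" "\<phi> (1 - int j * \<sigma>) + real j * \<theta> < \<phi> 0 + pi"
proof -
  define w where "w = (\<lambda>k. \<gamma> (cis (\<phi> k)))"
  have w: "w (k + int n) = w k" "0 < w k" for k
    unfolding w_def marks_D(4)[OF mk] using adm_D(2)[OF adm, of "cis (\<phi> k)"] by (simp_all add: cis_mult[symmetric])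
  have nn: "0 \<le> \<gamma> z" for z using adm_D(2)[OF adm, of z] adm_D(8)[OF adm, of 0 z] by (cases "z = 0") auto
  have conv: "0 \<le> sin (\<phi> (k + 1) - \<phi> k) * w (k - 1) + sin (\<phi> k - \<phi> (k - 1)) * w (k + 1) - sin (\<phi> (k + 1) - \<phi> (k - 1)) * w k" for k
    unfolding w_def by (rule sublin_bend[OF adm_D(1)[OF adm]])
      (use inc[of k] inc[of "k - 1"] gap[of k] gap[of "k - 1"] nn in \<open>auto intro: less_imp_le\<close>)
  have rows: "row w k = exp L * w k" for k unfolding w_def by (rule rows_tight[OF adm])
  have flat: "w (k + \<sigma>) = exp L * w k" if "\<phi> (k + \<sigma>) = \<phi> k + \<theta>" for k
  proof -
    have "P k = 1" "Q k = 0" using that sin_gap[of "k + \<sigma>"] unfolding P_def Q_def by auto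
    then show ?thesis using rows[of k] unfolding row_eq by simp
  qed
  define D where "D j \<longleftrightarrow> \<phi> (\<sigma> * (- int j - 1) + \<sigma>) < \<phi> (\<sigma> * (- int j - 1)) + \<theta>" for j :: nat
  obtain e where e: "- int q \<le> e" "e < 0" "\<phi> (0 + \<sigma> * e + \<sigma>) < \<phi> (0 + \<sigma> * e) + \<theta>"
    by (rule drop_exists[of "- int q" 0]) auto
  have D: "D (nat (- e - 1))" "nat (- e - 1) < q" using e n_pos by (auto simp: D_def)
  define j where "j = (LEAST j. D j)"
  have Dj: "D j" unfolding j_def by (rule LeastI) (rule D)
  have jq: "j < q" using Least_le[of D, OF D(1)] D(2) unfolding j_def by simp
  have before: "i \<le> j \<Longrightarrow> \<phi> (- int i * \<sigma>) = \<phi> 0 - real i * \<theta> \<and> w 0 = exp (real i * L) * w (- int i * \<sigma>)" for i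
  proof (induction i)
    case (Suc i)
    have "\<not> D i" using Suc.prems not_less_Least[of i D] unfolding j_def by simp
    then have "\<phi> (\<sigma> * (- int i - 1) + \<sigma>) = \<phi> (\<sigma> * (- int i - 1)) + \<theta>" using lo[of "\<sigma> * (- int i - 1)"] unfolding D_def by linarith
    moreover have i: "\<sigma> * (- int i - 1) + \<sigma> = - int i * \<sigma>" "\<sigma> * (- int i - 1) = - int (Suc i) * \<sigma>" by (simp_all add: algebra_simps)
    ultimately have "\<phi> (- int i * \<sigma>) = \<phi> (- int (Suc i) * \<sigma>) + \<theta>" "w (- int i * \<sigma>) = exp L * w (- int (Suc i) * \<sigma>)"
      using flat[of "\<sigma> * (- int i - 1)"] by (simp_all only:)
    then show ?case using Suc by (simp add: algebra_simps exp_add)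
  qed simp
  define k where "k = \<sigma> * (- int j - 1)"
  have i: "k + \<sigma> = - int j * \<sigma>" "k + \<sigma> + 1 = 1 - int j * \<sigma>" by (simp_all add: k_def algebra_simps)
  define c where "c = \<phi> (k + \<sigma> + 1) - \<theta> - \<phi> k"
  note TL = tight_levels[OF y3 w conv rows Dj[unfolded D_def], folded k_def, folded c_def]
  define \<Psi> where "\<Psi> = \<phi> (k + \<sigma> + 1) - (y - Nc)"
  have yN: "\<bar>y - Nc\<bar> < pi / 2" using y3 y_pos Nc_props by linarith
  note cy = cos_pos_abs[OF yN]
  have a: "0 < \<phi> k + \<theta> - \<phi> (k + \<sigma>)" using Dj unfolding D_def k_def by simp
  have "w (k + \<sigma>) = w (k + \<sigma> + 1) / cos (y - Nc) * cos (\<Psi> - \<phi> (k + \<sigma>))"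
  proof (rule sin_chord_cos)
    show "sin (\<phi> (k + \<sigma> + 1) - \<phi> (k + \<sigma>)) \<noteq> 0" "sin (\<phi> (k + \<sigma> + 1) - (\<phi> k + \<theta>)) \<noteq> 0"
      using a hi[of k] gap[of "k + \<sigma>"] inc[of "k + \<sigma>"] sin_gt_zero by (auto simp: less_imp_neq[symmetric])
    have 1: "\<Psi> - \<phi> (k + \<sigma> + 1) = - (y - Nc)" "\<Psi> - (\<phi> k + \<theta>) = c - (y - Nc)" by (auto simp: \<Psi>_def c_def)
    have "w (k + \<sigma> + 1) / cos (y - Nc) * cos (\<Psi> - \<phi> (k + \<sigma> + 1)) = w (k + \<sigma> + 1)"
      unfolding 1 cos_minus using cy by simp
    moreover have "w (k + \<sigma> + 1) / cos (y - Nc) * cos (\<Psi> - (\<phi> k + \<theta>)) = exp L * w k"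
      unfolding 1 using TL(3) cy by (simp add: field_simps)
    ultimately show "sin_chord (\<phi> (k + \<sigma>)) (\<phi> (k + \<sigma> + 1)) (w (k + \<sigma>)) (w (k + \<sigma> + 1) / cos (y - Nc) * cos (\<Psi> - \<phi> (k + \<sigma> + 1))) (\<phi> k + \<theta>)
      = w (k + \<sigma> + 1) / cos (y - Nc) * cos (\<Psi> - (\<phi> k + \<theta>))"
      using rows[of k] unfolding row_def by simp
  qed
  then have wk: "w (k + \<sigma>) * cos (y - Nc) = w (k + \<sigma> + 1) * cos (\<Psi> - \<phi> (k + \<sigma>))" using cy by (simp add: field_simps)
  have b: "\<phi> (k + \<sigma>) = \<phi> 0 - real j * \<theta>" "w 0 = exp (real j * L) * w (k + \<sigma>)" using before[of j] unfolding i by auto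
  show ?thesis
  proof (rule that[OF jq])
    have "w 0 * cos (y - Nc) = exp (real j * L) * (w (k + \<sigma>) * cos (y - Nc))" unfolding b(2) by simp
    also have "\<dots> = exp (real j * L) * w (1 - int j * \<sigma>) * cos (\<Psi> - \<phi> (k + \<sigma>))" unfolding wk unfolding i(2) by simp
    also have "\<Psi> - \<phi> (k + \<sigma>) = \<phi> (1 - int j * \<sigma>) + real j * \<theta> - \<phi> 0 - (y - Nc)" unfolding \<Psi>_def b(1) i(2) by simp
    finally show "\<gamma> (cis (\<phi> 0)) * cos (y - Nc) = exp (real j * L) * \<gamma> (cis (\<phi> (1 - int j * \<sigma>))) * cos (\<phi> (1 - int j * \<sigma>) + real j * \<theta> - \<phi> 0 - (y - Nc))"
      unfolding w_def .
    show "\<phi> 0 + y < \<phi> (1 - int j * \<sigma>) + real j * \<theta>"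
      using TL(1) a b(1) unfolding c_def unfolding i(2) by linarith
    show "\<phi> (1 - int j * \<sigma>) + real j * \<theta> < \<phi> 0 + pi"
      using gap[of "k + \<sigma>"] b(1) unfolding i(2) by linarith
  qed
qed

end

subsection \<open>Inserting a mark\<close>

text \<open>The marks \<open>b\<close> merged with the new marks \<open>\<tau> + 2 \<pi> l\<close>, indexed so that each \<open>ins b \<tau> k\<close> is continuous in \<open>\<tau>\<close>.\<close>

definition ins :: "(int \<Rightarrow> real) \<Rightarrow> real \<Rightarrow> int \<Rightarrow> real" where
  "ins b \<tau> k = (INF l. max (b (k - l)) (\<tau> + 2 * pi * real_of_int l))"

lemma ins_min:
  assumes "marks M b"
  obtains l where "\<And>l'. max (b (k - l)) (\<tau> + 2 * pi * real_of_int l) \<le> max (b (k - l')) (\<tau> + 2 * pi * real_of_int l')"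
proof -
  \<comment> \<open>When \<open>l\<close> grows by \<open>M\<close>, the difference of the two
    arguments of the maximum grows by \<open>2 * pi * (M + 1)\<close>. Divided by \<open>N\<close>
    it is again a sequence of marks, so its change of sign can be located; the minimum sits on one
    of the two sides of it.\<close>
  define N where "N = real M + 1"
  have M0: "0 < M" and mono: "\<And>i j. i \<le> j \<Longrightarrow> b i \<le> b j" and per: "\<And>k. b (k + int M) = b k + 2 * pi"
    using marks_D[OF assms] by auto
  have "marks M (\<lambda>l. (\<tau> + 2 * pi * real_of_int l - b (k - l)) / N)"
    unfolding marks_def
  proof (intro conjI allI monoI M0)
    fix i j :: int assume ij: "i \<le> j"
    then have "b (k - j) \<le> b (k - i)" by (intro mono) simp
    moreover have "2 * pi * real_of_int i \<le> 2 * pi * real_of_int j" using ij by simp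
    ultimately show "(\<tau> + 2 * pi * real_of_int i - b (k - i)) / N \<le> (\<tau> + 2 * pi * real_of_int j - b (k - j)) / N"
      by (intro divide_right_mono) (linarith, simp add: N_def)
  next
    fix l
    have "b (k - l) = b (k - (l + int M)) + 2 * pi" using per[of "k - (l + int M)"] by simp
    then show "(\<tau> + 2 * pi * real_of_int (l + int M) - b (k - (l + int M))) / N = (\<tau> + 2 * pi * real_of_int l - b (k - l)) / N + 2 * pi"
      by (simp add: N_def field_simps)
  qed
  from marks_last_less[OF this, of 0] obtain l where
    l: "(\<tau> + 2 * pi * real_of_int l - b (k - l)) / N < 0" "0 \<le> (\<tau> + 2 * pi * real_of_int (l + 1) - b (k - (l + 1))) / N" by auto
  have l: "\<tau> + 2 * pi * real_of_int l < b (k - l)" "b (k - (l + 1)) \<le> \<tau> + 2 * pi * real_of_int (l + 1)"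
    using l by (auto simp: N_def divide_less_0_iff zero_le_divide_iff)
  have lower: "min (b (k - l)) (\<tau> + 2 * pi * real_of_int (l + 1)) \<le> max (b (k - l')) (\<tau> + 2 * pi * real_of_int l')" for l'
  proof (cases "l' \<le> l")
    case True
    then have "b (k - l) \<le> b (k - l')" by (intro mono) simp
    then show ?thesis by simp
  next
    case False
    then have "2 * pi * real_of_int (l + 1) \<le> 2 * pi * real_of_int l'" by (intro mult_left_mono) auto
    then show ?thesis by (auto simp: min_le_iff_disj le_max_iff_disj)
  qed
  show ?thesis
  proof (cases "b (k - l) \<le> \<tau> + 2 * pi * real_of_int (l + 1)")
    case True
    show ?thesis by (rule that[of l]) (use lower True l in auto)
  next
    case False
    show ?thesis by (rule that[of "l + 1"]) (use lower False l in auto)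
  qed
qed

lemma ins_cases:
  assumes "marks M b"
  obtains l where "ins b \<tau> k = max (b (k - l)) (\<tau> + 2 * pi * real_of_int l)"
    "\<And>l'. ins b \<tau> k \<le> max (b (k - l')) (\<tau> + 2 * pi * real_of_int l')"
proof -
  obtain l where l: "\<And>l'. max (b (k - l)) (\<tau> + 2 * pi * real_of_int l) \<le> max (b (k - l')) (\<tau> + 2 * pi * real_of_int l')"
    by (rule ins_min[OF assms, of k \<tau>]) (rule that, assumption)
  then have "ins b \<tau> k = max (b (k - l)) (\<tau> + 2 * pi * real_of_int l)"
    unfolding ins_def by (intro cInf_eq_minimum) auto
  then show ?thesis using l by (intro that[of l]) auto
qed

lemma ins_le: "marks M b \<Longrightarrow> ins b \<tau> k \<le> max (b (k - l)) (\<tau> + 2 * pi * real_of_int l)"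
  by (rule ins_cases[of M b \<tau> k]) auto

lemma ins_shift:
  assumes "marks M b" shows "ins b (\<tau> + 2 * pi) k = ins b \<tau> (k + 1)"
proof (rule antisym)
  obtain l where "ins b \<tau> (k + 1) = max (b (k + 1 - l)) (\<tau> + 2 * pi * real_of_int l)" by (rule ins_cases[OF assms, of \<tau> "k + 1"]) auto
  moreover have "ins b (\<tau> + 2 * pi) k \<le> max (b (k - (l - 1))) (\<tau> + 2 * pi + 2 * pi * real_of_int (l - 1))" by (rule ins_le[OF assms])
  moreover have "k - (l - 1) = k + 1 - l" "\<tau> + 2 * pi + 2 * pi * real_of_int (l - 1) = \<tau> + 2 * pi * real_of_int l" by (simp_all add: algebra_simps)
  ultimately show "ins b (\<tau> + 2 * pi) k \<le> ins b \<tau> (k + 1)" by simp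
next
  obtain l where "ins b (\<tau> + 2 * pi) k = max (b (k - l)) (\<tau> + 2 * pi + 2 * pi * real_of_int l)" by (rule ins_cases[OF assms, of "\<tau> + 2 * pi" k]) auto
  moreover have "ins b \<tau> (k + 1) \<le> max (b (k + 1 - (l + 1))) (\<tau> + 2 * pi * real_of_int (l + 1))" by (rule ins_le[OF assms])
  moreover have "k + 1 - (l + 1) = k - l" "\<tau> + 2 * pi + 2 * pi * real_of_int l = \<tau> + 2 * pi * real_of_int (l + 1)" by (simp_all add: algebra_simps)
  ultimately show "ins b \<tau> (k + 1) \<le> ins b (\<tau> + 2 * pi) k" by simp
qed

lemma marks_ins:
  assumes "marks M b" shows "marks (M + 1) (ins b \<tau>)"
  unfolding marks_def
proof (intro conjI allI monoI)
  have mono: "\<And>i j. i \<le> j \<Longrightarrow> b i \<le> b j" and per: "\<And>k. b (k + int M) = b k + 2 * pi"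
    using marks_D[OF assms] by auto
  fix i j :: int assume ij: "i \<le> j"
  obtain l where "ins b \<tau> j = max (b (j - l)) (\<tau> + 2 * pi * real_of_int l)" by (rule ins_cases[OF assms, of \<tau> j]) auto
  moreover have "ins b \<tau> i \<le> max (b (i - l)) (\<tau> + 2 * pi * real_of_int l)" by (rule ins_le[OF assms])
  moreover have "b (i - l) \<le> b (j - l)" using ij by (intro mono) simp
  ultimately show "ins b \<tau> i \<le> ins b \<tau> j" by simp
next
  fix k
  have per: "b (k + int (M + 1) - l) = b (k - (l - 1)) + 2 * pi" for l
    using marks_D(4)[OF assms, of "k - (l - 1)"] by (simp add: algebra_simps)
  have e: "max (b (k + int (M + 1) - l)) (\<tau> + 2 * pi * real_of_int l)
      = max (b (k - (l - 1))) (\<tau> + 2 * pi * real_of_int (l - 1)) + 2 * pi" for l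
    unfolding per by (auto simp: max_def algebra_simps)
  show "ins b \<tau> (k + int (M + 1)) = ins b \<tau> k + 2 * pi"
  proof (rule antisym)
    obtain l where "ins b \<tau> k = max (b (k - l)) (\<tau> + 2 * pi * real_of_int l)" by (rule ins_cases[OF assms, of \<tau> k]) auto
    then show "ins b \<tau> (k + int (M + 1)) \<le> ins b \<tau> k + 2 * pi"
      using ins_le[OF assms, of \<tau> "k + int (M + 1)" "l + 1", unfolded e] by simp
  next
    obtain l where "ins b \<tau> (k + int (M + 1)) = max (b (k + int (M + 1) - l)) (\<tau> + 2 * pi * real_of_int l)" by (rule ins_cases[OF assms, of \<tau> "k + int (M + 1)"]) auto
    then show "ins b \<tau> k + 2 * pi \<le> ins b \<tau> (k + int (M + 1))"
      unfolding e using ins_le[OF assms, of \<tau> k "l - 1"] by simp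
  qed
qed simp

lemma ins_lipschitz:
  assumes "marks M b" shows "\<bar>ins b \<tau> k - ins b \<tau>' k\<bar> \<le> \<bar>\<tau> - \<tau>'\<bar>"
proof -
  have "ins b \<tau> k \<le> ins b \<tau>' k + \<bar>\<tau> - \<tau>'\<bar>" for \<tau> \<tau>'
  proof -
    obtain l where "ins b \<tau>' k = max (b (k - l)) (\<tau>' + 2 * pi * real_of_int l)" by (rule ins_cases[OF assms, of \<tau>' k]) auto
    moreover have "ins b \<tau> k \<le> max (b (k - l)) (\<tau> + 2 * pi * real_of_int l)" by (rule ins_le[OF assms])
    ultimately show ?thesis by linarith
  qed
  from this[of \<tau> \<tau>'] this[of \<tau>' \<tau>] show ?thesis by linarith
qed

lemma ins_between:
  assumes "marks M b"
  obtains l where "b l \<le> ins b \<tau> k" "ins b \<tau> (k + 1) \<le> b (l + 1)"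
proof -
  obtain l where l: "b l \<le> ins b \<tau> k" "ins b \<tau> k < b (l + 1)" by (rule marks_interval[OF assms])
  obtain m where m: "ins b \<tau> k = max (b (k - m)) (\<tau> + 2 * pi * real_of_int m)" by (rule ins_cases[OF assms, of \<tau> k]) auto
  then have "b (k - m) < b (l + 1)" using l(2) by simp
  then have "k - m < l + 1" by (rule marks_D(3)[OF assms])
  then have "b (k + 1 - m) \<le> b (l + 1)" by (intro marks_D(2)[OF assms]) simp
  then have "ins b \<tau> (k + 1) \<le> b (l + 1)" using ins_le[OF assms, of \<tau> "k + 1" m] m l(2) by linarith
  then show ?thesis using l(1) that by blast
qed

lemma adm_ins:
  assumes adm: "adm lam M \<gamma> b"
  shows "adm lam (M + 1) \<gamma> (ins b \<tau>)"
proof -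
  have mk: "marks M b" by (rule adm_D(4)[OF adm])
  have mki: "marks (M + 1) (ins b \<tau>)" by (rule marks_ins[OF mk])
  have "ins b \<tau> (k + 1) - ins b \<tau> k < pi" for k
  proof -
    obtain l where "b l \<le> ins b \<tau> k" "ins b \<tau> (k + 1) \<le> b (l + 1)" by (rule ins_between[OF mk])
    then show ?thesis using adm_D(5)[OF adm, of l] by linarith
  qed
  moreover have "\<gamma> (a *\<^sub>R cis (ins b \<tau> k) + c *\<^sub>R cis (ins b \<tau> (k + 1))) = a * \<gamma> (cis (ins b \<tau> k)) + c * \<gamma> (cis (ins b \<tau> (k + 1)))"
    if "0 \<le> a" "0 \<le> c" for a c k
  proof -
    obtain l where l: "b l \<le> ins b \<tau> k" "ins b \<tau> (k + 1) \<le> b (l + 1)" by (rule ins_between[OF mk])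
    show ?thesis by (rule adm_linear[OF adm l(1) _ l(2) that]) (rule marks_D(2)[OF mki], simp)
  qed
  ultimately show ?thesis using adm mki unfolding adm_def by blast
qed

text \<open>All copies of the inserted mark have indices in one residue class modulo
  \<open>M + 1\<close>. Outside this class an index must carry an old mark, which is how the lemma
  is applied.\<close>

lemma ins_index:
  assumes mk: "marks M b" and new: "\<And>l i. \<tau> + 2 * pi * real_of_int l \<noteq> b i"
    and "ins b \<tau> k = \<tau> + 2 * pi * real_of_int l" "ins b \<tau> k' = \<tau> + 2 * pi * real_of_int l'"
  shows "k' - k = int (M + 1) * (l' - l)"
proof -
  have loc: "b (k - l - int M * l) < \<tau> \<and> \<tau> < b (k - l - int M * l + 1)" if "ins b \<tau> k = \<tau> + 2 * pi * real_of_int l" for k l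
  proof -
    have sh: "b (j - int M * l) = b j - 2 * pi * real_of_int l" for j
      using marks_shift[OF mk, of j "- l"] by simp
    obtain m where m: "ins b \<tau> k = max (b (k - m)) (\<tau> + 2 * pi * real_of_int m)" by (rule ins_cases[OF mk, of \<tau> k]) auto
    then have "2 * pi * real_of_int m = 2 * pi * real_of_int l" using that new[of l "k - m"] by (auto simp: max_def split: if_splits)
    then have "m = l" by simp
    then have 1: "b (k - l) < \<tau> + 2 * pi * real_of_int l" using m that new[of l "k - l"] by (auto simp: max_def split: if_splits)
    have "\<tau> + 2 * pi * real_of_int l \<le> max (b (k - (l - 1))) (\<tau> + 2 * pi * real_of_int (l - 1))"
      using ins_le[OF mk, of \<tau> k "l - 1"] that by simp
    moreover have "2 * pi * real_of_int (l - 1) < 2 * pi * real_of_int l" by simp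
    ultimately have "\<tau> + 2 * pi * real_of_int l \<le> b (k - (l - 1))" by linarith
    then have 2: "\<tau> + 2 * pi * real_of_int l < b (k - l + 1)" using new[of l "k - l + 1"] by (simp add: algebra_simps)
    have e: "k - l - int M * l + 1 = k - l + 1 - int M * l" by simp
    show ?thesis using 1 2 unfolding e sh by linarith
  qed
  have "b (k - l - int M * l) < b (k' - l' - int M * l' + 1)" "b (k' - l' - int M * l') < b (k - l - int M * l + 1)"
    using loc[OF assms(3)] loc[OF assms(4)] by linarith+
  then have "k - l - int M * l = k' - l' - int M * l'" using marks_D(3)[OF mk] by (metis add1_zle_eq order_antisym zle_add1_eq_le)
  then show ?thesis by (simp add: algebra_simps)
qed

lemma ins_value:
  assumes "marks M b"
  obtains l where "ins b \<tau> k = b l" | l where "ins b \<tau> k = \<tau> + 2 * pi * real_of_int l"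
proof -
  obtain l where "ins b \<tau> k = max (b (k - l)) (\<tau> + 2 * pi * real_of_int l)" by (rule ins_cases[OF assms, of \<tau> k]) auto
  then show ?thesis using that by (auto simp: max_def split: if_splits)
qed

context karp_sector
begin

lemma low_shift:
  assumes "\<And>k. \<phi>' k = \<phi> (k + m)" shows "low \<phi>' j = low \<phi> (j + m)"
  unfolding low_def assms by (simp add: algebra_simps)

lemma low_lipschitz:
  assumes "\<And>k. \<bar>\<phi> k - \<phi>' k\<bar> \<le> C" shows "\<bar>low \<phi> j - low \<phi>' j\<bar> \<le> C"
proof -
  have "low \<phi> j \<le> low \<phi>' j + C" if "\<And>k. \<bar>\<phi> k - \<phi>' k\<bar> \<le> C" for \<phi> \<phi>'
  proof -
    obtain i where i: "i < q" "low \<phi>' j = \<phi>' (j - int i * \<sigma>) + real i * \<theta>" by (rule low_attained[of \<phi>' j])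
    show ?thesis using low_le[OF i(1), of \<phi> j] i(2) that[of "j - int i * \<sigma>"] by linarith
  qed
  from this[of \<phi> \<phi>'] this[of \<phi>' \<phi>] show ?thesis using assms by (simp add: abs_minus_commute abs_le_iff)
qed

text \<open>The lowered mark 0 depends continuously on \<open>\<tau>\<close>. A full turn of
  \<open>\<tau>\<close> shifts the indices by 1, so \<open>n\<close> turns move this mark by
  \<open>2 * pi\<close>, and the intermediate value theorem reaches every angle.\<close>

lemma low_ins_onto:
  assumes mk: "marks (n - 1) b"
  obtains \<tau> where "low (ins b \<tau>) 0 = t"
proof -
  define f where "f \<tau> = low (ins b \<tau>) 0" for \<tau>
  have lip: "\<bar>f \<tau> - f \<tau>'\<bar> \<le> \<bar>\<tau> - \<tau>'\<bar>" for \<tau> \<tau>'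
    unfolding f_def by (rule low_lipschitz) (rule ins_lipschitz[OF mk])
  have cont: "continuous_on UNIV f"
    unfolding continuous_on_iff using lip by (metis UNIV_I dist_real_def le_less_trans)
  have n: "n - 1 + 1 = n" using n_pos by simp
  have mki: "marks n (ins b \<tau>)" for \<tau> using marks_ins[OF mk, of \<tau>] unfolding n .
  have shift: "ins b (\<tau> + 2 * pi * real m) k = ins b \<tau> (k + int m)" for m \<tau> k
  proof (induction m arbitrary: k)
    case (Suc m)
    have "\<tau> + 2 * pi * real (Suc m) = \<tau> + 2 * pi * real m + 2 * pi" by (simp add: algebra_simps)
    then have "ins b (\<tau> + 2 * pi * real (Suc m)) k = ins b (\<tau> + 2 * pi * real m) (k + 1)" by (simp only: ins_shift[OF mk])
    also have "\<dots> = ins b \<tau> (k + 1 + int m)" by (rule Suc.IH)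
    finally show ?case by (simp add: add_ac)
  qed simp
  have fs: "f (\<tau> + 2 * pi * real (n * m)) = f \<tau> + 2 * pi * real m" for m \<tau>
  proof -
    have "f (\<tau> + 2 * pi * real (n * m)) = low (ins b \<tau>) (0 + int (n * m))"
      unfolding f_def by (rule low_shift) (rule shift)
    also have "\<dots> = low (ins b \<tau>) 0 + 2 * pi * real m"
      using marks_shift[OF marks_low[OF mki[of \<tau>]], of 0 "int m"] by simp
    finally show ?thesis by (simp add: f_def)
  qed
  define m where "m = nat \<lceil>\<bar>t - f 0\<bar>\<rceil>"
  have m: "\<bar>t - f 0\<bar> \<le> 2 * pi * real m"
  proof -
    have "\<bar>t - f 0\<bar> \<le> real m" unfolding m_def by linarith
    also have "\<dots> \<le> 2 * pi * real m" using pi_gt3 by (simp add: mult_le_cancel_right1)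
    finally show ?thesis .
  qed
  define a c where "a = - (2 * pi * real (n * m))" and "c = 2 * pi * real (n * m)"
  have "f a = f 0 - 2 * pi * real m" using fs[of a m] by (simp add: a_def)
  moreover have "f c = f 0 + 2 * pi * real m" using fs[of 0 m] by (simp add: c_def)
  ultimately have "f a \<le> t" "t \<le> f c" using m by linarith+
  moreover have "a \<le> c" by (simp add: a_def c_def)
  ultimately have "\<exists>\<tau>\<ge>a. \<tau> \<le> c \<and> f \<tau> = t" by (intro IVT') (auto intro: continuous_on_subset[OF cont])
  then show ?thesis using that unfolding f_def by blast
qed

end

section \<open>Excluding kinks of the gauge\<close>

lemma cis_three_term: "sin (w - u) *\<^sub>R cis v = sin (w - v) *\<^sub>R cis u + sin (v - u) *\<^sub>R cis w"
  using cramer[of "cis u" "cis w" "cis v"] unfolding cr_cis by simp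

lemma sublin_three:
  assumes "sublin \<gamma>" "u \<le> v" "v \<le> w" "w - u \<le> pi"
  shows "sin (w - u) * \<gamma> (cis v) \<le> sin (w - v) * \<gamma> (cis u) + sin (v - u) * \<gamma> (cis w)"
proof -
  have s: "0 \<le> sin (w - u)" "0 \<le> sin (w - v)" "0 \<le> sin (v - u)" using assms by (auto intro!: sin_ge_zero)
  have h: "0 \<le> c \<Longrightarrow> \<gamma> (c *\<^sub>R z) = c * \<gamma> z" "\<gamma> (z + z') \<le> \<gamma> z + \<gamma> z'" for c z z' using assms(1) by (auto simp: sublin_def)
  have "sin (w - u) * \<gamma> (cis v) = \<gamma> (sin (w - v) *\<^sub>R cis u + sin (v - u) *\<^sub>R cis w)"
    unfolding cis_three_term[symmetric] using h(1)[OF s(1)] by simp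
  also have "\<dots> \<le> \<gamma> (sin (w - v) *\<^sub>R cis u) + \<gamma> (sin (v - u) *\<^sub>R cis w)" by (rule h(2))
  finally show ?thesis using h(1)[OF s(2)] h(1)[OF s(3)] by simp
qed

lemma adm_three:
  assumes "adm lam N \<gamma> \<phi>" "\<phi> l \<le> u" "u \<le> v" "v \<le> w" "w \<le> \<phi> (l + 1)"
  shows "sin (w - u) * \<gamma> (cis v) = sin (w - v) * \<gamma> (cis u) + sin (v - u) * \<gamma> (cis w)"
proof -
  have "w - u < pi" using assms adm_D(5)[OF assms(1), of l] by linarith
  then have s: "0 \<le> sin (w - u)" "0 \<le> sin (w - v)" "0 \<le> sin (v - u)" using assms by (auto intro!: sin_ge_zero)
  have "sin (w - u) * \<gamma> (cis v) = \<gamma> (sin (w - v) *\<^sub>R cis u + sin (v - u) *\<^sub>R cis w)"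
    unfolding cis_three_term[symmetric] using adm_D(8)[OF assms(1) s(1)] by simp
  then show ?thesis using adm_linear[OF assms(1,2) _ assms(5) s(2,3)] assms(3,4) by simp
qed

lemma cos_match:
  fixes R R' :: real
  assumes "u < v" "v - u < pi" "R * cos (\<Psi> - u) = R' * cos (\<Psi>' - u)" "R * cos (\<Psi> - v) = R' * cos (\<Psi>' - v)"
  shows "R * cos (\<Psi> - t) = R' * cos (\<Psi>' - t)"
proof -
  have s: "0 < sin (v - u)" using assms by (intro sin_gt_zero) auto
  have "sin (v - u) * (R * cos (\<Psi> - t)) = sin (v - t) * (R * cos (\<Psi> - u)) + sin (t - u) * (R * cos (\<Psi> - v))" for R \<Psi>
    using arg_cong[OF cos_three_term[of v t \<Psi> u], of "\<lambda>a. R * a"] by (simp add: algebra_simps)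
  from this[of R \<Psi>] this[of R' \<Psi>'] have "sin (v - u) * (R * cos (\<Psi> - t)) = sin (v - u) * (R' * cos (\<Psi>' - t))"
    using assms(3,4) by simp
  then show ?thesis using s by simp
qed

lemma adm_match:
  assumes adm: "adm lam N \<gamma> \<phi>" and uv: "\<phi> l \<le> u" "u < v" "v \<le> \<phi> (l + 1)"
    and h: "\<gamma> (cis u) = R * cos (\<Psi> - u)" "\<gamma> (cis v) = R * cos (\<Psi> - v)"
    and t: "\<phi> l \<le> t" "t \<le> \<phi> (l + 1)"
  shows "\<gamma> (cis t) = R * cos (\<Psi> - t)"
proof -
  have pi: "\<phi> (l + 1) - \<phi> l < pi" by (rule adm_D(5)[OF adm])
  have s: "0 < sin (v - u)" using uv pi by (intro sin_gt_zero) auto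
  have H: "sin (c - a) * (R * cos (\<Psi> - b)) = sin (c - b) * (R * cos (\<Psi> - a)) + sin (b - a) * (R * cos (\<Psi> - c))" for a b c
    using arg_cong[OF cos_three_term[of c b \<Psi> a], of "\<lambda>a. R * a"] by (simp add: algebra_simps)
  consider "t < u" | "u \<le> t" "t \<le> v" | "v < t" by linarith
  then have "sin (v - u) * \<gamma> (cis t) = sin (v - u) * (R * cos (\<Psi> - t))"
  proof cases
    case 1
    then have "sin (v - t) * \<gamma> (cis u) = sin (v - u) * \<gamma> (cis t) + sin (u - t) * \<gamma> (cis v)"
      using adm_three[OF adm t(1), of u v] uv by simp
    then show ?thesis using H[of v t u] unfolding h by linarith
  next
    case 2
    then have "sin (v - u) * \<gamma> (cis t) = sin (v - t) * \<gamma> (cis u) + sin (t - u) * \<gamma> (cis v)"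
      using adm_three[OF adm uv(1), of t v] uv by simp
    then show ?thesis using H[of v u t] unfolding h by linarith
  next
    case 3
    then have "sin (t - u) * \<gamma> (cis v) = sin (t - v) * \<gamma> (cis u) + sin (v - u) * \<gamma> (cis t)"
      using adm_three[OF adm uv(1), of v t] uv t by simp
    then show ?thesis using H[of t u v] unfolding h by linarith
  qed
  then show ?thesis using s by simp
qed

lemma same_key:
  fixes K :: "real \<Rightarrow> 'a::countable"
  assumes "a < c" "countable E"
  obtains s t where "a < s" "s < t" "t < c" "s \<notin> E" "t \<notin> E" "K s = K t"
proof -
  have "uncountable ({a<..<c} - E)"
    using uncountable_minus_countable[OF _ assms(2)] uncountable_open_interval[of a c] assms(1) by blast
  then have "\<not> inj_on K ({a<..<c} - E)" using countable_image_inj_on[of K] by (meson countableI_type)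
  then obtain s t where st: "s \<in> {a<..<c} - E" "t \<in> {a<..<c} - E" "K s = K t" "s \<noteq> t" by (auto simp: inj_on_def)
  show ?thesis
  proof (cases "s < t")
    case True then show ?thesis using that[of s t] st by auto
  next
    case False then show ?thesis using that[of t s] st by auto
  qed
qed

context karp_curve
begin

text \<open>A generic angle \<open>\<phi>\<close> is a moved copy of the inserted mark. The value of the gauge there is then read off the
  sinusoid attached to a moved copy \<open>\<Psi>\<close> of an old mark, hence off countably many data.\<close>

lemma key_exists:
  assumes adm: "adm (exp (- L) *\<^sub>R cis \<theta>) (n - 1) \<gamma> b"
    and gen: "\<And>l i. i < q \<Longrightarrow> \<phi> \<noteq> b l + real i * \<theta>"
  shows "y - Nc \<le> pi / 3" "\<exists>m i j. let \<Psi> = b m + real i * \<theta> + real j * \<theta>; R = exp (real j * L) * \<gamma> (cis (b m + real i * \<theta>)) in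
    \<gamma> (cis \<phi>) * cos (y - Nc) = R * cos (\<Psi> - \<phi> - (y - Nc)) \<and> \<phi> + y < \<Psi> \<and> \<Psi> < \<phi> + pi \<and> \<gamma> (cis \<Psi>) \<le> R"
proof -
  have mkb: "marks (n - 1) b" by (rule adm_D(4)[OF adm])
  obtain \<tau> where tau: "low (ins b \<tau>) 0 = \<phi>" by (rule low_ins_onto[OF mkb])
  have n: "n - 1 + 1 = n" using n_pos by simp
  have adm0: "adm (exp (- L) *\<^sub>R cis \<theta>) n \<gamma> (ins b \<tau>)" using adm_ins[OF adm, of \<tau>] unfolding n .
  have mk0: "marks n (ins b \<tau>)" by (rule adm_D(4)[OF adm0])
  define \<phi>1 where "\<phi>1 = low (ins b \<tau>)"
  obtain \<gamma>1 where adm1: "adm (exp (- L) *\<^sub>R cis \<theta>) n \<gamma>1 \<phi>1" and g1: "\<And>k. \<gamma>1 (cis (\<phi>1 k)) = \<gamma> (cis (\<phi>1 k))"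
    using low_adm[OF exp_gt_zero adm0] unfolding \<phi>1_def by blast
  have mk1: "marks n \<phi>1" by (rule adm_D(4)[OF adm1])
  have lo: "\<phi>1 (j + \<sigma>) \<le> \<phi>1 j + \<theta>" for j unfolding \<phi>1_def by (rule low_step[OF mk0])
  obtain \<gamma>2 where adm2: "adm (exp (- L) *\<^sub>R cis \<theta>) n \<gamma>2 (high \<phi>1)"
    using high_adm[OF exp_gt_zero adm1] by blast
  note US = upper_strict[OF adm2 high_low_step[of \<phi>1, OF lo] high_step[OF mk1]]
  show y3: "y - Nc \<le> pi / 3" by (rule US(1))
  \<comment> \<open>A mark that is really raised would be the image of another one, giving equality
    where \<open>upper_strict\<close> has a strict inequality. Hence the lowered marks already
    satisfy both conditions.\<close>
  have hi_eq: "high \<phi>1 j = \<phi>1 j" for j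
  proof (rule ccontr)
    assume "high \<phi>1 j \<noteq> \<phi>1 j"
    then have "\<phi>1 j < high \<phi>1 j" using high_ge_self[of \<phi>1 j] by simp
    then have "high \<phi>1 j = high \<phi>1 (j - \<sigma> - 1) + \<theta>" by (rule high_raised[OF mk1])
    then show False using US(2)[of "j - \<sigma> - 1"] by simp
  qed
  have hi: "\<phi>1 j + \<theta> < \<phi>1 (j + \<sigma> + 1)" for j using US(2)[of j] unfolding hi_eq .
  have inc: "\<phi>1 k < \<phi>1 (k + 1)" for k using lo[of "k - \<sigma>"] hi[of "k - \<sigma>"] by simp
  interpret strict_levels q d z n s p r \<theta> L \<phi>1
    by unfold_locales (rule mk1 inc adm_D(5)[OF adm1] lo hi)+
  obtain j where j: "j < q"
    "\<gamma>1 (cis (\<phi>1 0)) * cos (y - Nc) = exp (real j * L) * \<gamma>1 (cis (\<phi>1 (1 - int j * \<sigma>))) * cos (\<phi>1 (1 - int j * \<sigma>) + real j * \<theta> - \<phi>1 0 - (y - Nc))"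
    "\<phi>1 0 + y < \<phi>1 (1 - int j * \<sigma>) + real j * \<theta>" "\<phi>1 (1 - int j * \<sigma>) + real j * \<theta> < \<phi>1 0 + pi"
    by (rule last_drop[OF y3 adm1])
  have p0: "\<phi>1 0 = \<phi>" unfolding \<phi>1_def by (rule tau)
  obtain i0 where i0: "i0 < q" "\<phi> = ins b \<tau> (0 - int i0 * \<sigma>) + real i0 * \<theta>"
    using low_attained[of "ins b \<tau>" 0] tau by metis
  obtain l0 where l0: "ins b \<tau> (0 - int i0 * \<sigma>) = \<tau> + 2 * pi * real_of_int l0"
    by (rule ins_value[OF mkb, of \<tau> "0 - int i0 * \<sigma>"]) (use i0 gen[OF i0(1)] in auto)
  have new: "\<tau> + 2 * pi * real_of_int l \<noteq> b m" for l m
  proof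
    assume "\<tau> + 2 * pi * real_of_int l = b m"
    then have "\<tau> + 2 * pi * real_of_int l0 = b (m + int (n - 1) * (l0 - l))"
      unfolding marks_shift[OF mkb] by (simp add: algebra_simps)
    then show False using gen[OF i0(1), of "m + int (n - 1) * (l0 - l)"] i0(2) l0 by simp
  qed
  obtain i where i: "i < q" "\<phi>1 (1 - int j * \<sigma>) = ins b \<tau> (1 - int j * \<sigma> - int i * \<sigma>) + real i * \<theta>"
    unfolding \<phi>1_def by (rule low_attained[of "ins b \<tau>" "1 - int j * \<sigma>"])
  obtain m where m: "ins b \<tau> (1 - int j * \<sigma> - int i * \<sigma>) = b m"
  proof (rule ins_value[OF mkb, of \<tau> "1 - int j * \<sigma> - int i * \<sigma>"])
    fix l assume l: "ins b \<tau> (1 - int j * \<sigma> - int i * \<sigma>) = \<tau> + 2 * pi * real_of_int l"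
    have "1 - int j * \<sigma> - int i * \<sigma> - (0 - int i0 * \<sigma>) = int n * (l - l0)"
      using ins_index[OF mkb new l0 l] unfolding n .
    \<comment> \<open>The inserted mark has its indices in the class of
      \<open>- i0 * \<sigma>\<close> modulo \<open>n\<close>. Both \<open>\<sigma>\<close> and
      \<open>n\<close> are multiples of \<open>d \<ge> 2\<close>, so an index that is 1 modulo
      \<open>d\<close> cannot belong to this class.\<close>
    then have "1 = int d * (int q * (l - l0) + int p * (int j + int i - int i0))"
      unfolding \<sigma>_def n_def by (simp add: algebra_simps)
    then have "int d dvd 1" by (metis dvd_triv_left)
    then have False using d2 by simp
    then show thesis ..
  qed (rule that)
  have pm: "\<phi>1 (1 - int j * \<sigma>) = b m + real i * \<theta>" using i(2) m by simp
  have up: "\<gamma> ((exp (- L) *\<^sub>R cis \<theta>) ^ j * u) \<le> \<gamma> u" for u j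
  proof (induction j)
    case (Suc j)
    have "\<gamma> ((exp (- L) *\<^sub>R cis \<theta>) ^ Suc j * u) \<le> \<gamma> ((exp (- L) *\<^sub>R cis \<theta>) ^ j * u)"
      using adm_D(3)[OF adm, of "(exp (- L) *\<^sub>R cis \<theta>) ^ j * u"] by (simp add: mult.assoc)
    then show ?case using Suc by linarith
  qed simp
  have e: "(exp (- L) *\<^sub>R cis \<theta>) ^ j * cis t = exp (- (real j * L)) *\<^sub>R cis (t + real j * \<theta>)" for t
    by (simp add: scaleR_power Complex.DeMoivre cis_mult exp_of_nat_mult[symmetric] add.commute)
  have "exp (- (real j * L)) * \<gamma> (cis (b m + real i * \<theta> + real j * \<theta>)) \<le> \<gamma> (cis (b m + real i * \<theta>))"
    using up[of j "cis (b m + real i * \<theta>)"] unfolding e using adm_D(8)[OF adm, of "exp (- (real j * L))"] by simp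
  then have "\<gamma> (cis (b m + real i * \<theta> + real j * \<theta>)) \<le> exp (real j * L) * \<gamma> (cis (b m + real i * \<theta>))"
    by (simp add: exp_minus field_simps)
  then show "\<exists>m i j. let \<Psi> = b m + real i * \<theta> + real j * \<theta>; R = exp (real j * L) * \<gamma> (cis (b m + real i * \<theta>)) in
    \<gamma> (cis \<phi>) * cos (y - Nc) = R * cos (\<Psi> - \<phi> - (y - Nc)) \<and> \<phi> + y < \<Psi> \<and> \<Psi> < \<phi> + pi \<and> \<gamma> (cis \<Psi>) \<le> R"
    using j(2-4) unfolding g1 unfolding p0 pm Let_def by blast
qed

text \<open>Two angles \<open>s < t\<close> less than \<open>y\<close> before
  \<open>b (l + 1)\<close> share a sinusoid \<open>h\<close>, which then equals the gauge on the
  whole gap. Its reference angle \<open>\<Psi> > s + y\<close> lies beyond \<open>b (l + 1)\<close>,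
  and \<open>\<gamma> (cis \<Psi>) \<le> h \<Psi>\<close> there. Convexity gives
  \<open>\<gamma> \<ge> h\<close> when the piece from \<open>s\<close> to \<open>t\<close> is
  prolonged and \<open>\<gamma> \<le> h\<close> on the chord from \<open>t\<close> to
  \<open>\<Psi>\<close>, so the gauge follows \<open>h\<close> past the mark.\<close>

lemma flat_end:
  assumes adm: "adm (exp (- L) *\<^sub>R cis \<theta>) (n - 1) \<gamma> b" and ne: "b l < b (l + 1)"
  obtains R \<Psi> v where "b (l + 1) < v" "\<And>t. b l \<le> t \<Longrightarrow> t \<le> v \<Longrightarrow> \<gamma> (cis t) = R * cos (\<Psi> - t)"
proof -
  define E where "E = (\<lambda>(m, i). b m + real i * \<theta>) ` (UNIV :: (int \<times> nat) set)"
  define good where "good \<phi> \<Psi> R \<longleftrightarrow> \<gamma> (cis \<phi>) * cos (y - Nc) = R * cos (\<Psi> - \<phi> - (y - Nc)) \<and> \<phi> + y < \<Psi> \<and> \<Psi> < \<phi> + pi \<and> \<gamma> (cis \<Psi>) \<le> R"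
    for \<phi> \<Psi> R
  define key where "key \<phi> k = (case k of (m, i, j) \<Rightarrow> good \<phi> (b m + real i * \<theta> + real j * \<theta>) (exp (real j * L) * \<gamma> (cis (b m + real i * \<theta>))))"
    for \<phi> and k :: "int \<times> nat \<times> nat"
  define K where "K \<phi> = (SOME k. key \<phi> k)" for \<phi>
  have K: "key \<phi> (K \<phi>)" if "\<phi> \<notin> E" for \<phi>
  proof -
    have "\<phi> \<noteq> b l + real i * \<theta>" for l i using that by (auto simp: E_def)
    then obtain m i j where "key \<phi> (m, i, j)"
      using key_exists(2)[OF adm, of \<phi>] unfolding Let_def key_def good_def by auto
    then show ?thesis unfolding K_def by (rule someI)
  qed
  have "countable E" unfolding E_def by (intro countable_image) auto
  then obtain s t where st: "max (b l) (b (l + 1) - y) < s" "s < t" "t < b (l + 1)" "s \<notin> E" "t \<notin> E" "K s = K t"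
    by (rule same_key[of "max (b l) (b (l + 1) - y)" "b (l + 1)" E K, rotated])
      (blast, use ne y_pos in simp)
  have "\<exists>\<Psi> R. good s \<Psi> R \<and> good t \<Psi> R"
    using K[OF st(4)] K[OF st(5)] unfolding st(6) key_def by (auto split: prod.splits)
  then obtain \<Psi> R where g: "good s \<Psi> R" "good t \<Psi> R" by blast
  have y3: "y - Nc \<le> pi / 3" by (rule key_exists(1)[OF adm, of s]) (use st(4) in \<open>auto simp: E_def\<close>)
  have cy: "0 < cos (y - Nc)" by (rule cos_pos_abs) (use y3 y_pos Nc_props in linarith)
  define h where "h t = R / cos (y - Nc) * cos (\<Psi> - (y - Nc) - t)" for t
  have hs: "\<gamma> (cis s) = h s" "\<gamma> (cis t) = h t"
    using g cy unfolding good_def h_def by (simp_all add: field_simps)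
  have "\<Psi> - (y - Nc) - \<Psi> = - (y - Nc)" by simp
  then have hP: "h \<Psi> = R" using cy unfolding h_def by (simp only: cos_minus) simp
  have in_l: "\<gamma> (cis u) = h u" if "b l \<le> u" "u \<le> b (l + 1)" for u
    unfolding h_def by (rule adm_match[OF adm _ st(2) _ hs[unfolded h_def] that]) (use st in auto)
  have H: "sin (c - a) * h b = sin (c - b) * h a + sin (b - a) * h c" for a b c
    using arg_cong[OF cos_three_term[of c b "\<Psi> - (y - Nc)" a], of "\<lambda>u. R / cos (y - Nc) * u"]
    unfolding h_def by (simp add: algebra_simps)
  have PP: "b (l + 1) < \<Psi>" "\<Psi> - s < pi" "\<gamma> (cis \<Psi>) \<le> h \<Psi>" using g st(1) unfolding good_def hP by auto
  have above: "h u \<le> \<gamma> (cis u)" if "t \<le> u" "u \<le> \<Psi>" for u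
  proof -
    have "sin (u - s) * \<gamma> (cis t) \<le> sin (u - t) * \<gamma> (cis s) + sin (t - s) * \<gamma> (cis u)"
      by (rule sublin_three[OF adm_D(1)[OF adm]]) (use st that PP in auto)
    then have "sin (t - s) * h u \<le> sin (t - s) * \<gamma> (cis u)" using H[of u s t] unfolding hs by linarith
    moreover have "0 < sin (t - s)" using st that PP by (intro sin_gt_zero) auto
    ultimately show ?thesis by simp
  qed
  have tP: "t < \<Psi>" using st PP by linarith
  have eqP: "\<gamma> (cis \<Psi>) = h \<Psi>" using above[of \<Psi>] tP PP(3) by simp
  have below: "\<gamma> (cis u) \<le> h u" if "t \<le> u" "u \<le> \<Psi>" for u
  proof -
    have "sin (\<Psi> - t) * \<gamma> (cis u) \<le> sin (\<Psi> - u) * \<gamma> (cis t) + sin (u - t) * \<gamma> (cis \<Psi>)"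
      by (rule sublin_three[OF adm_D(1)[OF adm]]) (use st that PP in auto)
    then have "sin (\<Psi> - t) * \<gamma> (cis u) \<le> sin (\<Psi> - t) * h u" using H[of \<Psi> t u] unfolding hs eqP by linarith
    moreover have "0 < sin (\<Psi> - t)" using st tP PP by (intro sin_gt_zero) auto
    ultimately show ?thesis by simp
  qed
  show ?thesis
  proof (rule that[OF PP(1)])
    fix u assume u: "b l \<le> u" "u \<le> \<Psi>"
    show "\<gamma> (cis u) = R / cos (y - Nc) * cos (\<Psi> - (y - Nc) - u)"
    proof (cases "u \<le> b (l + 1)")
      case True then show ?thesis using in_l[of u] u unfolding h_def by simp
    next
      case False
      then have "t \<le> u" using st by linarith
      then show ?thesis using above[of u] below[of u] u unfolding h_def by simp
    qed
  qed
qed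

theorem no_adm: "\<not> adm (exp (- L) *\<^sub>R cis \<theta>) (n - 1) \<gamma> b"
proof
  assume adm: "adm (exp (- L) *\<^sub>R cis \<theta>) (n - 1) \<gamma> b"
  have mkb: "marks (n - 1) b" by (rule adm_D(4)[OF adm])
  have mono: "b i \<le> b (i + 1)" for i by (rule marks_D(2)[OF mkb]) simp
  obtain l0 where l0: "b l0 \<le> b 0" "b 0 < b (l0 + 1)" by (rule marks_interval[OF mkb])
  then have "b l0 < b (l0 + 1)" by simp
  then obtain R \<Psi> v0 where v0: "b (l0 + 1) < v0" and h0: "\<And>t. b l0 \<le> t \<Longrightarrow> t \<le> v0 \<Longrightarrow> \<gamma> (cis t) = R * cos (\<Psi> - t)"
    by (rule flat_end[OF adm, of l0]) (rule that, assumption+)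
  \<comment> \<open>Each flat piece reaches past its last mark and so overlaps the next one in an
    interval of positive length. Two sinusoids that agree there are equal, and coinciding marks need
    no step. After \<open>n - 1\<close> further marks the sinusoid covers two opposite angles, where
    its values have opposite signs.\<close>
  have ext: "\<exists>v. b (l0 + 1 + int m) < v \<and> (\<forall>t. b l0 \<le> t \<and> t \<le> v \<longrightarrow> \<gamma> (cis t) = R * cos (\<Psi> - t))" for m
  proof (induction m)
    case 0
    show ?case using v0 h0 by (intro exI[of _ v0]) auto
  next
    case (Suc m)
    define l where "l = l0 + 1 + int m"
    have ll: "l0 + 1 + int (Suc m) = l + 1" by (simp add: l_def)
    obtain v where v: "b l < v" "\<And>t. b l0 \<le> t \<Longrightarrow> t \<le> v \<Longrightarrow> \<gamma> (cis t) = R * cos (\<Psi> - t)"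
      using Suc unfolding l_def by blast
    have l0l: "b l0 \<le> b l" by (rule marks_D(2)[OF mkb]) (simp add: l_def)
    show ?case unfolding ll
    proof (cases "b l < b (l + 1)")
      case False
      then have "b (l + 1) = b l" using mono[of l] by simp
      then show "\<exists>v. b (l + 1) < v \<and> (\<forall>t. b l0 \<le> t \<and> t \<le> v \<longrightarrow> \<gamma> (cis t) = R * cos (\<Psi> - t))" using v by auto
    next
      case True
      then obtain R' \<Psi>' v' where v': "b (l + 1) < v'" "\<And>t. b l \<le> t \<Longrightarrow> t \<le> v' \<Longrightarrow> \<gamma> (cis t) = R' * cos (\<Psi>' - t)"
        by (rule flat_end[OF adm, of l]) (rule that, assumption+)
      define m1 where "m1 = min v (b (l + 1))"
      have m1: "b l < m1" "m1 \<le> v" "m1 \<le> b (l + 1)" using v True by (auto simp: m1_def)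
      have same: "R' * cos (\<Psi>' - t) = R * cos (\<Psi> - t)" for t
      proof (rule cos_match[OF m1(1)])
        show "m1 - b l < pi" using m1 adm_D(5)[OF adm, of l] by linarith
        show "R' * cos (\<Psi>' - b l) = R * cos (\<Psi> - b l)" using v(2)[of "b l"] v'(2)[of "b l"] l0l v v' True by simp
        show "R' * cos (\<Psi>' - m1) = R * cos (\<Psi> - m1)" using v(2)[of m1] v'(2)[of m1] l0l m1 v' by simp
      qed
      show "\<exists>v. b (l + 1) < v \<and> (\<forall>t. b l0 \<le> t \<and> t \<le> v \<longrightarrow> \<gamma> (cis t) = R * cos (\<Psi> - t))"
      proof (intro exI[of _ v'] conjI allI impI)
        fix t assume t: "b l0 \<le> t \<and> t \<le> v'"
        show "\<gamma> (cis t) = R * cos (\<Psi> - t)"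
        proof (cases "t \<le> v")
          case False
          then have "b l \<le> t" using v(1) by simp
          then show ?thesis using v'(2)[of t] t same[of t] by simp
        qed (use v(2) t in simp)
      qed (rule v')
    qed
  qed
  obtain v where v: "b (l0 + 1 + int (n - 1)) < v" "\<And>t. b l0 \<le> t \<Longrightarrow> t \<le> v \<Longrightarrow> \<gamma> (cis t) = R * cos (\<Psi> - t)"
    using ext[of "n - 1"] by blast
  have "b (l0 + 1 + int (n - 1)) = b (l0 + 1) + 2 * pi" by (rule marks_D(4)[OF mkb])
  then have "b l0 + pi \<le> v" using v(1) mono[of l0] pi_gt_zero by linarith
  then have "\<gamma> (cis (b l0)) = R * cos (\<Psi> - b l0)" "\<gamma> (cis (b l0 + pi)) = R * cos (\<Psi> - (b l0 + pi))"
    using v(2)[of "b l0"] v(2)[of "b l0 + pi"] pi_gt_zero by auto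
  moreover have "cos (\<Psi> - (b l0 + pi)) = - cos (\<Psi> - b l0)" using cos_minus_pi[of "\<Psi> - b l0"] by (simp add: algebra_simps)
  moreover have "0 < \<gamma> (cis (b l0))" "0 < \<gamma> (cis (b l0 + pi))" by (rule adm_D(2)[OF adm], simp)+
  ultimately show False by simp
qed

end

theorem lemma2p2:
  fixes q d z n s p r :: nat
  assumes "q \<ge> 2" and "d \<ge> 2" and "1 \<le> z" and "z \<le> q - 1" and "coprime q z"
    and "n = q * d" and "s = q * d - z"
    and "p \<in> {1..q - 1}" and "[p * z = 1] (mod q)"
    and "r = (p * s + 1) div q"
  shows "q dvd p * s + 1 \<and>
    karpelevich_arc n p q r s \<subseteq> UNIV - karpelevich_region (n - 1) \<and>
    (\<forall>\<alpha>::real. 0 < \<alpha> \<and> \<alpha> < 1 \<longrightarrow>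
       karpelevich_ito_root p q r d z \<alpha> \<in> karpelevich_arc n p q r s - karpelevich_region (n - 1))"
proof -
  interpret karp_params q d z n s p r by unfold_locales (use assms in auto)
  have outside: "w \<notin> karpelevich_region (n - 1)" if "w \<in> karpelevich_arc n p q r s" for w
  proof
    assume reg: "w \<in> karpelevich_region (n - 1)"
    have w: "w \<noteq> 0" "in_sector (Arg2pi w)" "sector_g w = 0" using that unfolding arc_iff by auto
    define L where "L = - ln (norm w)"
    interpret karp_sector q d z n s p r "Arg2pi w" by (rule sector_locale(1)[OF w(2)])
    interpret karp_curve q d z n s p r "Arg2pi w" L
      by unfold_locales (use w(3) sector_locale(2,3)[OF w(2)] in \<open>simp add: sector_g_def L_def\<close>)
    have pol: "w = exp (- L) *\<^sub>R cis (Arg2pi w)" unfolding L_def by (rule polar_Arg2pi[OF w(1)])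
    have "w ^ q = exp (- L) ^ q *\<^sub>R cis x" by (subst pol) (rule lam_q)
    then obtain \<gamma> b where "adm w (n - 1) \<gamma> b"
      using initial_adm[OF reg, of q "exp (- L) ^ q" x] x_pos x_small by auto
    then show False using no_adm pol by metis
  qed
  have "karpelevich_ito_root p q r d z \<alpha> \<in> karpelevich_arc n p q r s" if "0 < \<alpha>" "\<alpha> < 1" for \<alpha> :: real
    using theI'[OF ito_root_unique[OF that]] unfolding karpelevich_ito_root_def n_def s_def by blast
  then show ?thesis using q_dvd outside by blast
qed

end
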